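(* For a real-valued function $u_0$ on $\mathbb{R}^d$ let $u^*(x)=\sup_{t>0}(|u_0|*K_t)(x)$ be its heat flow maximal function, where $K_t(x)=(4\pi t)^{-d/2}e^{-|x|^2/4t}$. The following hold. (i) Let $d=1$, $1<p\le\infty$ and $u_0\in W^{1,p}(\mathbb{R})$. Then $u^*\in W^{1,p}(\mathbb{R})$ and $\|(u^* )'\|_p\le\|u_0'\|_p$. (ii) Let $d=1$ and $u_0\in W^{1,1}(\mathbb{R})$. Then $u^*\in L^\infty(\mathbb{R})$ and $u^*$ has a weak derivative $(u^* )'$ that satisfies $\|(u^* )'\|_1\le\|u_0'\|_1$. (iii) Let $d=1$ and let $u_0$ be of bounded variation on $\mathbb{R}$. Then $u^*$ is of bounded variation on $\mathbb{R}$ and $V(u^* )\le V(u_0)$. (iv) Let $d>1$ and $u_0\in W^{1,p}(\mathbb{R}^d)$, for $p=2$ or $p=\infty$. Then $u^*\in W^{1,p}(\mathbb{R}^d)$ and $\|\nabla u^*\|_p\le\|\nabla u_0\|_p$.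
   Context: Functions are real-valued. $|\cdot|$ is the Euclidean norm on $\mathbb{R}^d$, and $\|\nabla u\|_p$ denotes the $L^p(\mathbb{R}^d)$-norm of the function $x\mapsto|\nabla u(x)|$, with $\nabla u$ the weak gradient. $(f*g)(x)=\int_{\mathbb{R}^d}f(x-y)g(y)\,dy$. $W^{1,p}$ is the usual Sobolev space of $L^p$ functions with weak first derivatives in $L^p$. $V(f)=\sup\sum_{i=1}^{N-1}|f(x_{i+1})-f(x_i)|$ (supremum over all finite partitions $x_1<x_2<\dots<x_N$ of points of $\mathbb{R}$) is the total variation of $f:\mathbb{R}\to\mathbb{R}$; $f$ is of bounded variation if $V(f)<\infty$. *)

theory Defs
  imports "HOL-Analysis.Analysis" "HOL-Probability.Essential_Supremum"
begin

section \<open>Lebesgue spaces\<close>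

definition Lp_norm :: "ennreal \<Rightarrow> ('a::euclidean_space \<Rightarrow> real) \<Rightarrow> ennreal" where
  "Lp_norm p f =
    (if p = \<infinity> then esssup lebesgue (\<lambda>x. ennreal \<bar>f x\<bar>)
     else let I = (\<integral>\<^sup>+x. ennreal (\<bar>f x\<bar> powr enn2real p) \<partial>lebesgue)
          in if I = \<infinity> then \<infinity> else ennreal (enn2real I powr (1 / enn2real p)))"

definition Lp_space :: "ennreal \<Rightarrow> ('a::euclidean_space \<Rightarrow> real) set" where
  "Lp_space p = {f \<in> borel_measurable lebesgue. Lp_norm p f < \<infinity>}"


section \<open>Weak gradients and Sobolev spaces\<close>

primrec C_k :: "nat \<Rightarrow> ('a::euclidean_space \<Rightarrow> real) \<Rightarrow> bool" where
  "C_k 0 f \<longleftrightarrow> continuous_on UNIV f"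
| "C_k (Suc k) f \<longleftrightarrow>
    (\<forall>x. f differentiable (at x)) \<and> (\<forall>i\<in>Basis. C_k k (\<lambda>x. frechet_derivative f (at x) i))"

definition test_functions :: "('a::euclidean_space \<Rightarrow> real) set" where
  "test_functions = {\<phi>. (\<forall>k. C_k k \<phi>) \<and> compact (closure {x. \<phi> x \<noteq> 0})}"

definition locally_integrable :: "('a::euclidean_space \<Rightarrow> 'b::euclidean_space) \<Rightarrow> bool" where
  "locally_integrable f \<longleftrightarrow> (\<forall>K. compact K \<longrightarrow> f absolutely_integrable_on K)"

definition has_weak_gradient :: "('a::euclidean_space \<Rightarrow> real) \<Rightarrow> ('a \<Rightarrow> 'a) \<Rightarrow> bool" where
  "has_weak_gradient u g \<longleftrightarrow> locally_integrable u \<and> locally_integrable g \<and>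
    (\<forall>\<phi>\<in>test_functions. \<forall>i\<in>Basis.
      (\<integral>x. u x * frechet_derivative \<phi> (at x) i \<partial>lebesgue) = - (\<integral>x. (g x \<bullet> i) * \<phi> x \<partial>lebesgue))"

text \<open>The weak gradient is determined only up to null sets, hence a choice of representative; it
  is meaningful only if some weak gradient exists. On \<^typ>\<open>real\<close> it is the weak derivative.\<close>

definition weak_gradient :: "('a::euclidean_space \<Rightarrow> real) \<Rightarrow> 'a \<Rightarrow> 'a" where
  "weak_gradient u = (SOME g. has_weak_gradient u g)"

definition Sobolev_W1 :: "ennreal \<Rightarrow> ('a::euclidean_space \<Rightarrow> real) set" where
  "Sobolev_W1 p = {u \<in> Lp_space p.
    \<exists>g. has_weak_gradient u g \<and> (\<forall>i\<in>Basis. (\<lambda>x. g x \<bullet> i) \<in> Lp_space p)}"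


section \<open>Total variation on the line\<close>

definition total_variation :: "(real \<Rightarrow> real) \<Rightarrow> ennreal" where
  "total_variation f =
    (SUP xs\<in>{xs. sorted_wrt (<) xs}. ennreal (\<Sum>i<length xs - 1. \<bar>f (xs ! (i + 1)) - f (xs ! i)\<bar>))"

definition bounded_variation :: "(real \<Rightarrow> real) \<Rightarrow> bool" where
  "bounded_variation f \<longleftrightarrow> total_variation f < \<infinity>"


section \<open>The heat flow maximal function\<close>

definition heat_kernel :: "real \<Rightarrow> 'a::euclidean_space \<Rightarrow> real" where
  "heat_kernel t x = (4 * pi * t) powr (- real DIM('a) / 2) * exp (- (norm x)\<^sup>2 / (4 * t))"

text \<open>For nonnegative functions only: the integrand is truncated at zero.\<close>

definition nn_convolution ::
    "('a::euclidean_space \<Rightarrow> real) \<Rightarrow> ('a \<Rightarrow> real) \<Rightarrow> 'a \<Rightarrow> ennreal" where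
  "nn_convolution f g x = (\<integral>\<^sup>+y. ennreal (f (x - y) * g y) \<partial>lebesgue)"

text \<open>The supremum may be infinite on a null set (e.g. for suitable
  unbounded functions in $W^{1,2}$ of the plane), so it takes values in the extended half-line.\<close>

definition heat_maximal :: "('a::euclidean_space \<Rightarrow> real) \<Rightarrow> 'a \<Rightarrow> ennreal" where
  "heat_maximal u x = (SUP t\<in>{0<..}. nn_convolution (\<lambda>y. \<bar>u y\<bar>) (heat_kernel t) x)"

end

theory Submission
  imports Defs "HOL-Probability.Distributions"
begin

text \<open>Let \<open>P\<^sub>t\<close> be the heat semigroup, so that the maximal function of \<open>f = \<bar>u\<^sub>0\<bar>\<close> is
  \<open>sup\<^bsub>t > 0\<^esub> P\<^sub>t f\<close>. On the line, consider for \<open>l \<ge> 0\<close> the supremum over all partitions of the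
  sums of \<open>(\<bar>f y - f x\<bar> - l (y - x))\<^sub>+\<close>. It does not increase under \<open>P\<^sub>t\<close>, which averages
  translates, and not from \<open>P\<^sub>s f\<close> to \<open>sup\<^bsub>t \<ge> s\<^esub> P\<^sub>t f\<close>: by the maximum principle this supremum has,
  relative to affine functions, no strict local maximum above \<open>P\<^sub>s f\<close>. The bounds for all \<open>l\<close>
  together bound every \<open>L\<^sup>p\<close> norm of the derivative by that of the datum; \<open>l = 0\<close> is the total
  variation.

  In any dimension, a Lipschitz bound survives convolution and suprema. For \<open>p = 2\<close>,
  \<open>V = sup\<^bsub>n \<ge> 1\<^esub> P\<^bsub>ns\<^esub> f\<close> lies above \<open>F = P\<^sub>s f\<close> and satisfies \<open>V \<le> P\<^sub>s V\<close> where \<open>V \<noteq> F\<close>. Hence the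
  Dirichlet energy of \<open>V\<close> at scale \<open>s\<close>, built from squared differences weighted by the kernel, is at
  most that of \<open>F\<close>, and \<open>V\<close> increases to the maximal function along \<open>s = 2\<^sup>-\<^sup>k\<close>.

  In all cases a weak gradient of the limit arises from a sequence of approximate gradients by weak
  compactness, in the form of convex combinations that converge almost everywhere.\<close>

section \<open>The heat kernel\<close>

text \<open>The maximal function is a supremum over uncountably many times, may be infinite on a
  null set, and offers no derivative to work with. Hence derivatives are replaced by differences:
  truncated variation on the line, averaged squared differences for p = 2. Affine functions are
  stationary for the heat flow, so subtracting \<open>l * x\<close> is compatible with the maximum
  principle; and the functions (t - l)_+ generate t^p by superposition, so one argument serves all
  finite exponents on the line. For p = 2 the times are discretised with the same step
  \<open>s\<close> that defines the energy: only then is every later value exactly one averaging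
  step away from an earlier one. Times near 0 are reached as limits, because at positive times the
  flow is bounded and continuous, as the maximum principle requires. Finiteness and square
  integrability of the maximal function come from a weak type inequality, deduced from Hopf's lemma.
  For p = 1 there is no reflexivity: compactness rests on uniform integrability, which the bounds at
  large \<open>l\<close> supply.\<close>

lemma distr_lborel_reflect: "distr lborel borel (\<lambda>y. c - y) = (lborel :: 'a::euclidean_space measure)"
  by (subst lborel_affine[of "-1" c], auto simp: density_1)

lemma distr_lborel_translate: "distr lborel borel (\<lambda>y. y + c) = (lborel :: 'a::euclidean_space measure)"
  using lborel_distr_plus[of c] by (simp add: add.commute[of _ c] cong: distr_cong)

lemma nn_integral_lborel_reflect:
  fixes f :: "'a::euclidean_space \<Rightarrow> ennreal"
  assumes [measurable]: "f \<in> borel_measurable borel"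
  shows "(\<integral>\<^sup>+y. f (c - y) \<partial>lborel) = (\<integral>\<^sup>+y. f y \<partial>lborel)"
  by (subst (2) distr_lborel_reflect[symmetric, of c]) (simp add: nn_integral_distr)

lemma nn_integral_lborel_translate:
  fixes f :: "'a::euclidean_space \<Rightarrow> ennreal"
  assumes [measurable]: "f \<in> borel_measurable borel"
  shows "(\<integral>\<^sup>+y. f (y + c) \<partial>lborel) = (\<integral>\<^sup>+y. f y \<partial>lborel)"
  by (subst (2) distr_lborel_translate[symmetric, of c]) (simp add: nn_integral_distr)

lemma integral_lborel_translate:
  fixes f :: "'a::euclidean_space \<Rightarrow> 'b::{banach, second_countable_topology}"
  assumes [measurable]: "f \<in> borel_measurable borel"
  shows "(\<integral>y. f (y + c) \<partial>lborel) = (\<integral>y. f y \<partial>lborel)"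
  by (subst (2) distr_lborel_translate[symmetric, of c]) (simp add: integral_distr)

lemma AE_lborel_reflect:
  fixes P :: "'a::euclidean_space \<Rightarrow> bool"
  assumes "AE x in lborel. P x"
  shows "AE y in lborel. P (c - y)"
proof -
  obtain N where N: "N \<in> null_sets lborel" "{x. \<not> P x} \<subseteq> N"
    using assms by (auto simp: eventually_ae_filter)
  have "AE x in distr lborel borel (\<lambda>y. c - y). x \<notin> N"
    using N(1) by (simp add: distr_lborel_reflect AE_not_in)
  then have "AE y in lborel. c - y \<notin> N"
    using N(1) by (subst (asm) AE_distr_iff) auto
  then show ?thesis by (rule eventually_mono) (use N(2) in auto)
qed

lemma AE_lborel_translate:
  fixes P :: "'a::euclidean_space \<Rightarrow> bool"
  assumes "AE x in lborel. P x"
  shows "AE y in lborel. P (y + c)"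
  using AE_lborel_reflect[OF AE_lborel_reflect[OF assms, of 0], of "-c"] by (simp add: add.commute)

lemma
  fixes f :: "'a::euclidean_space \<Rightarrow> real \<Rightarrow> real"
  assumes f: "\<And>b. b \<in> Basis \<Longrightarrow> integrable lborel (f b)"
  shows integrable_lborel_prod: "integrable lborel (\<lambda>x::'a. \<Prod>b\<in>Basis. f b (x \<bullet> b))"
    and integral_lborel_prod: "(\<integral>x. (\<Prod>b\<in>Basis. f b ((x::'a) \<bullet> b)) \<partial>lborel) = (\<Prod>b\<in>Basis. (\<integral>x. f b x \<partial>lborel))"
proof -
  interpret finite_product_sigma_finite "\<lambda>_. lborel :: real measure" "Basis :: 'a set"
    by standard simp
  have m[measurable]: "\<And>b. b \<in> Basis \<Longrightarrow> f b \<in> borel_measurable borel"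
    using f borel_measurable_integrable by force
  have "integrable (\<Pi>\<^sub>M b\<in>Basis. lborel) (\<lambda>x. \<Prod>b\<in>Basis. f b (x b))"
    by (rule product_integrable_prod) (auto intro: f)
  then show "integrable lborel (\<lambda>x::'a. \<Prod>b\<in>Basis. f b (x \<bullet> b))"
    by (subst lborel_eq, subst integrable_distr_eq) (auto cong: prod.cong)
  show "(\<integral>x. (\<Prod>b\<in>Basis. f b ((x::'a) \<bullet> b)) \<partial>lborel) = (\<Prod>b\<in>Basis. (\<integral>x. f b x \<partial>lborel))"
    by (subst lborel_eq, subst integral_distr) (auto cong: prod.cong intro!: product_integral_prod f)
qed

text \<open>The kernel at time t has variance 2 t, whence \<open>sqrt (2 * t)\<close>.\<close>

lemma heat_kernel_real: "0 < t \<Longrightarrow> heat_kernel t (x::real) = normal_density 0 (sqrt (2 * t)) x"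
  unfolding heat_kernel_def normal_density_def
  using powr_minus_divide[of "4 * pi * t" "1/2"] by (simp add: powr_half_sqrt)

text \<open>Reduces total mass, semigroup law and moments in dimension d to facts about the normal
  distribution on the line.\<close>

lemma heat_kernel_prod:
  fixes x :: "'a::euclidean_space"
  assumes t: "0 < t"
  shows "heat_kernel t x = (\<Prod>b\<in>Basis. heat_kernel t (x \<bullet> b))"
proof -
  have "(\<Prod>b\<in>(Basis::'a set). heat_kernel t (x \<bullet> b)) =
      ((4 * pi * t) powr (- 1 / 2)) ^ DIM('a) * (\<Prod>b\<in>Basis. exp (- (x \<bullet> b)\<^sup>2 / (4 * t)))"
    by (simp add: heat_kernel_def prod.distrib)
  also have "((4 * pi * t) powr (- 1 / 2)) ^ DIM('a) = (4 * pi * t) powr (- real DIM('a) / 2)"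
    using t by (simp add: powr_realpow[symmetric] powr_powr)
  also have "(\<Prod>b\<in>Basis. exp (- (x \<bullet> b)\<^sup>2 / (4 * t))) = exp (- (norm x)\<^sup>2 / (4 * t))"
    by (subst exp_sum[symmetric])
      (simp_all add: norm_eq_sqrt_inner euclidean_inner[of x x] sum_nonneg power2_eq_square
        sum_divide_distrib[symmetric] sum_negf)
  finally show ?thesis by (simp add: heat_kernel_def)
qed

lemma heat_kernel_pos: "0 < t \<Longrightarrow> 0 < heat_kernel t x"
  by (simp add: heat_kernel_def)

lemma heat_kernel_nonneg [simp]: "0 \<le> heat_kernel t x"
  by (simp add: heat_kernel_def)

lemma heat_kernel_minus [simp]: "heat_kernel t (- x) = heat_kernel t x"
  by (simp add: heat_kernel_def)

lemma borel_measurable_heat_kernel [measurable]: "heat_kernel t \<in> borel_measurable borel"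
  unfolding heat_kernel_def by measurable

lemma nn_integral_heat_kernel:
  assumes t: "0 < t"
  shows "(\<integral>\<^sup>+x. heat_kernel t (x::'a::euclidean_space) \<partial>lborel) = 1"
proof -
  have 1: "(\<integral>\<^sup>+x. heat_kernel t (x::real) \<partial>lborel) = 1"
    using t by (simp add: heat_kernel_real nn_integral_eq_integral)
  have "(\<integral>\<^sup>+x. heat_kernel t (x::'a) \<partial>lborel) = (\<integral>\<^sup>+x. (\<Prod>b\<in>Basis. ennreal (heat_kernel t ((x::'a) \<bullet> b))) \<partial>lborel)"
    using t by (simp add: heat_kernel_prod[of t "_::'a"] prod_ennreal)
  also have "\<dots> = 1"
    by (subst nn_integral_lborel_prod) (simp_all add: 1)
  finally show ?thesis .
qed

lemma heat_kernel_convolution: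
  fixes x :: "'a::euclidean_space"
  assumes s: "0 < s" and t: "0 < t"
  shows "(\<integral>\<^sup>+y. heat_kernel s (x - y) * heat_kernel t y \<partial>lborel) = heat_kernel (s + t) x"
proof -
  have 1: "(\<integral>\<^sup>+y. ennreal (heat_kernel s (z - y) * heat_kernel t y) \<partial>lborel) = heat_kernel (s + t) z" for z :: real
    using fun_cong[OF conv_normal_density_zero_mean[of "sqrt (2 * s)" "sqrt (2 * t)"], of z] s t
    by (simp add: heat_kernel_real)
  have "(\<integral>\<^sup>+y. heat_kernel s (x - y) * heat_kernel t y \<partial>lborel)
    = (\<integral>\<^sup>+y. (\<Prod>b\<in>Basis. ennreal (heat_kernel s (x \<bullet> b - y \<bullet> b) * heat_kernel t (y \<bullet> b))) \<partial>lborel)"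
    using s t by (simp add: heat_kernel_prod[of _ "_::'a"] prod_ennreal prod.distrib inner_diff_left)
  also have "\<dots> = (\<Prod>b\<in>Basis. ennreal (heat_kernel (s + t) (x \<bullet> b)))"
    by (subst nn_integral_lborel_prod[where f="\<lambda>b y. ennreal (heat_kernel s (x \<bullet> b - y) * heat_kernel t y)"])
      (simp_all add: 1)
  also have "\<dots> = heat_kernel (s + t) x"
    using s t by (simp add: heat_kernel_prod[of _ x] prod_ennreal)
  finally show ?thesis .
qed

section \<open>The heat kernel as a probability measure\<close>

definition heat_measure :: "real \<Rightarrow> 'a::euclidean_space measure" where
  "heat_measure t = density lborel (\<lambda>x. ennreal (heat_kernel t x))"

lemma sets_heat_measure [simp, measurable_cong]: "sets (heat_measure t) = sets borel"
  by (simp add: heat_measure_def)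

lemma space_heat_measure [simp]: "space (heat_measure t) = UNIV"
  by (simp add: heat_measure_def)

lemma prob_space_heat_measure: "0 < t \<Longrightarrow> prob_space (heat_measure t)"
  by (rule prob_spaceI) (simp add: heat_measure_def emeasure_density nn_integral_heat_kernel)

lemma nn_integral_heat_measure:
  fixes f :: "'a::euclidean_space \<Rightarrow> ennreal"
  shows "f \<in> borel_measurable borel \<Longrightarrow>
    (\<integral>\<^sup>+x. f x \<partial>heat_measure t) = (\<integral>\<^sup>+x. heat_kernel t x * f x \<partial>lborel)"
  by (simp add: heat_measure_def nn_integral_density)

lemma nn_integral_heat_measure_uminus:
  fixes f :: "'a::euclidean_space \<Rightarrow> ennreal"
  assumes [measurable]: "f \<in> borel_measurable borel"
  shows "(\<integral>\<^sup>+x. f (- x) \<partial>heat_measure t) = (\<integral>\<^sup>+x. f x \<partial>heat_measure t)"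
  using nn_integral_lborel_reflect[of "\<lambda>x. ennreal (heat_kernel t x) * f x" 0]
  by (simp add: nn_integral_heat_measure)

lemma distr_heat_measure_uminus: "distr (heat_measure t) borel uminus = heat_measure t"
proof (rule measure_eqI)
  fix A :: "'a set" assume "A \<in> sets (distr (heat_measure t) borel uminus)"
  then have A[measurable]: "A \<in> sets borel" by simp
  have "emeasure (distr (heat_measure t) borel uminus) A = (\<integral>\<^sup>+x. indicator A (- x) \<partial>heat_measure t)"
    using nn_integral_distr[of uminus "heat_measure t" borel "indicator A"] by simp
  also have "\<dots> = emeasure (heat_measure t) A"
    by (subst nn_integral_heat_measure_uminus) auto
  finally show "emeasure (distr (heat_measure t) borel uminus) A = emeasure (heat_measure t) A" .
qed simp

lemma integral_heat_measure_uminus: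
  fixes f :: "'a::euclidean_space \<Rightarrow> 'b::{banach, second_countable_topology}"
  assumes [measurable]: "f \<in> borel_measurable borel"
  shows "(\<integral>y. f (- y) \<partial>heat_measure t) = (\<integral>y. f y \<partial>heat_measure t)"
  by (subst (2) distr_heat_measure_uminus[symmetric]) (simp add: integral_distr)

lemma AE_heat_measure: "0 < t \<Longrightarrow> (AE x in heat_measure t. P x) \<longleftrightarrow> (AE x in lborel. P x)"
  unfolding heat_measure_def by (subst AE_density) (auto simp: heat_kernel_pos)

lemma
  fixes f :: "'a::euclidean_space \<Rightarrow> 'b::{banach, second_countable_topology}"
  assumes "f \<in> borel_measurable borel"
  shows integrable_heat_measure: "integrable (heat_measure t) f \<longleftrightarrow> integrable lborel (\<lambda>x. heat_kernel t x *\<^sub>R f x)"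
    and integral_heat_measure: "(\<integral>x. f x \<partial>heat_measure t) = (\<integral>x. heat_kernel t x *\<^sub>R f x \<partial>lborel)"
  using assms unfolding heat_measure_def
  by (simp_all add: integrable_density integral_density)

lemma has_bochner_integral_heat_measure:
  fixes f :: "'a::euclidean_space \<Rightarrow> 'b::{banach, second_countable_topology}"
  assumes "f \<in> borel_measurable borel"
  shows "has_bochner_integral (heat_measure t) f c \<longleftrightarrow>
    has_bochner_integral lborel (\<lambda>x. heat_kernel t x *\<^sub>R f x) c"
  using assms by (simp add: has_bochner_integral_iff integrable_heat_measure integral_heat_measure)

section \<open>Moments of the Gaussian measure\<close>

lemma has_bochner_integral_heat_measure_prod:
  fixes f :: "'a::euclidean_space \<Rightarrow> real \<Rightarrow> real"
  assumes t: "0 < t" and f: "\<And>b. b \<in> Basis \<Longrightarrow> has_bochner_integral (heat_measure t) (f b) (c b)"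
  shows "has_bochner_integral (heat_measure t) (\<lambda>x::'a. \<Prod>b\<in>Basis. f b (x \<bullet> b)) (\<Prod>b\<in>Basis. c b)"
proof -
  have m[measurable]: "\<And>b. b \<in> Basis \<Longrightarrow> f b \<in> borel_measurable borel"
    using f by (auto dest!: borel_measurable_has_bochner_integral)
  have f': "has_bochner_integral lborel (\<lambda>y. heat_kernel t y * f b y) (c b)" if "b \<in> Basis" for b
    using f[OF that] has_bochner_integral_heat_measure[OF m[OF that], of t "c b"] by simp
  have "has_bochner_integral lborel (\<lambda>x::'a. \<Prod>b\<in>Basis. heat_kernel t (x \<bullet> b) * f b (x \<bullet> b)) (\<Prod>b\<in>Basis. c b)"
    unfolding has_bochner_integral_iff
    using integrable_lborel_prod[of "\<lambda>b y. heat_kernel t y * f b y"]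
      integral_lborel_prod[of "\<lambda>b y. heat_kernel t y * f b y"] f'
    by (auto simp: has_bochner_integral_iff)
  then show ?thesis
    by (subst has_bochner_integral_heat_measure) (simp_all add: heat_kernel_prod[OF t, of "_::'a"] prod.distrib)
qed

text \<open>A normal variable of variance 2 t has the moment (2 t)^k (2 k)! / (2^k k!) of order 2 k;
  the powers of 2 cancel.\<close>

lemma heat_measure_moment_even:
  assumes t: "0 < t"
  shows "has_bochner_integral (heat_measure t) (\<lambda>x::real. x ^ (2 * k)) (fact (2 * k) / fact k * t ^ k)"
proof -
  have "has_bochner_integral lborel (\<lambda>x. heat_kernel t x * x ^ (2 * k)) (fact (2 * k) / fact k * t ^ k)"
    using normal_moment_even[of "sqrt (2 * t)" 0 k] t by (simp add: heat_kernel_real field_simps power_divide)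
  then show ?thesis
    by (subst has_bochner_integral_heat_measure) simp_all
qed

lemma heat_measure_moment_odd:
  assumes t: "0 < t"
  shows "has_bochner_integral (heat_measure t) (\<lambda>x::real. x ^ (2 * k + 1)) 0"
proof -
  have "has_bochner_integral lborel (\<lambda>x. heat_kernel t x * x ^ (2 * k + 1)) 0"
    using normal_moment_odd[of "sqrt (2 * t)" 0 k] t by (simp add: heat_kernel_real)
  then show ?thesis
    by (subst has_bochner_integral_heat_measure) simp_all
qed

lemma heat_measure_moment_coordinate:
  fixes b :: "'a::euclidean_space"
  assumes t: "0 < t" and b: "b \<in> Basis"
    and f: "has_bochner_integral (heat_measure t) f (c::real)"
  shows "has_bochner_integral (heat_measure t) (\<lambda>x. f (x \<bullet> b)) c"
proof -
  \<comment> \<open>The remaining coordinates contribute the factor 1, whose integral is the moment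
    of order 0.\<close>
  have "has_bochner_integral (heat_measure t) (\<lambda>x::'a. \<Prod>i\<in>Basis. (if i = b then f (x \<bullet> i) else 1))
      (\<Prod>i\<in>(Basis::'a set). (if i = b then c else 1))"
    using has_bochner_integral_heat_measure_prod[of t "\<lambda>i. if i = b then f else (\<lambda>_. 1)"
       "\<lambda>i. if i = b then c else 1", OF t] heat_measure_moment_even[OF t, of 0] f
    by (simp add: if_distrib[of "\<lambda>f. f _"] cong: if_cong)
  then show ?thesis using b by (simp add: prod.delta)
qed

lemma heat_measure_moment2:
  fixes b c :: "'a::euclidean_space"
  assumes t: "0 < t" and b: "b \<in> Basis" "c \<in> Basis"
  shows "has_bochner_integral (heat_measure t) (\<lambda>x. (x \<bullet> b) * (x \<bullet> c)) (if b = c then 2 * t else 0)"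
proof (cases "b = c")
  case True
  with heat_measure_moment_coordinate[OF t b(1) heat_measure_moment_even[OF t, of 1]]
  show ?thesis by (simp add: power2_eq_square)
next
  case False
  have "has_bochner_integral (heat_measure t)
      (\<lambda>x::'a. \<Prod>i\<in>Basis. (if i = b then (x \<bullet> i) else if i = c then x \<bullet> i else 1))
      (\<Prod>i\<in>(Basis::'a set). (if i = b then 0 else if i = c then 0 else 1))"
    using has_bochner_integral_heat_measure_prod[of t "\<lambda>i. if i = b then (\<lambda>x. x) else if i = c then (\<lambda>x. x) else (\<lambda>_. 1)"
       "\<lambda>i. if i = b then 0 else if i = c then 0 else 1", OF t] heat_measure_moment_even[OF t, of 0]
       heat_measure_moment_odd[OF t, of 0]
    by (simp add: if_distrib[of "\<lambda>f. f _"] cong: if_cong)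
  moreover have "(\<Prod>i\<in>Basis. (if i = b then (x \<bullet> i) else if i = c then x \<bullet> i else 1)) = (x \<bullet> b) * (x \<bullet> c)" for x :: 'a
  proof -
    have "(\<Prod>i\<in>Basis. (if i = b then (x \<bullet> i) else if i = c then x \<bullet> i else 1))
      = (\<Prod>i\<in>Basis. (if i = b then (x \<bullet> i) else 1) * (if i = c then x \<bullet> i else 1))"
      using False by (intro prod.cong) auto
    then show ?thesis using b by (simp add: prod.distrib prod.delta)
  qed
  moreover have "(\<Prod>i\<in>(Basis::'a set). (if i = b then 0 else if i = c then 0 else 1::real)) = 0"
    using b by (auto simp: prod_zero_iff)
  ultimately show ?thesis using False by simp
qed

text \<open>The covariance is 2 t times the identity. This is the origin of the factor
  \<open>2 * s\<close> in \<open>heat_grad\<close> and in all energy bounds.\<close>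

lemma heat_measure_inner_inner:
  fixes u v :: "'a::euclidean_space"
  assumes t: "0 < t"
  shows "has_bochner_integral (heat_measure t) (\<lambda>x. (x \<bullet> u) * (x \<bullet> v)) (2 * t * (u \<bullet> v))"
proof -
  have "has_bochner_integral (heat_measure t)
      (\<lambda>x::'a. \<Sum>b\<in>Basis. \<Sum>c\<in>Basis. ((x \<bullet> b) * (x \<bullet> c)) * ((u \<bullet> b) * (v \<bullet> c)))
      (\<Sum>b\<in>Basis. \<Sum>c\<in>Basis. (if b = c then 2 * t else 0) * ((u \<bullet> b) * (v \<bullet> c)))"
    by (intro has_bochner_integral_sum has_bochner_integral_mult_left heat_measure_moment2[OF t])
  also have "(\<lambda>x::'a. \<Sum>b\<in>Basis. \<Sum>c\<in>Basis. ((x \<bullet> b) * (x \<bullet> c)) * ((u \<bullet> b) * (v \<bullet> c)))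
    = (\<lambda>x. (x \<bullet> u) * (x \<bullet> v))"
    by (rule ext, subst (3) euclidean_inner, subst (3) euclidean_inner) (simp add: sum_product mult_ac)
  also have "(\<Sum>b\<in>(Basis::'a set). \<Sum>c\<in>Basis. (if b = c then 2 * t else 0) * ((u \<bullet> b) * (v \<bullet> c))) = 2 * t * (u \<bullet> v)"
  proof -
    have "(\<Sum>c\<in>Basis. (if b = c then 2 * t else 0) * ((u \<bullet> b) * (v \<bullet> c))) = 2 * t * ((u \<bullet> b) * (v \<bullet> b))"
      if b: "b \<in> Basis" for b :: 'a
    proof -
      have "(\<Sum>c\<in>Basis. (if b = c then 2 * t else 0) * ((u \<bullet> b) * (v \<bullet> c)))
        = (\<Sum>c\<in>Basis. if b = c then 2 * t * ((u \<bullet> b) * (v \<bullet> c)) else 0)"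
        by (intro sum.cong) auto
      then show ?thesis using b by simp
    qed
    then show ?thesis
      by (simp add: euclidean_inner[of u v] sum_distrib_left)
  qed
  finally show ?thesis .
qed

text \<open>One coordinate has fourth moment 12 t^2. Cauchy-Schwarz bounds the fourth power of the
  norm by d times the sum of the fourth powers of the d coordinates, which gives d^2.\<close>

lemma heat_measure_norm4:
  assumes t: "0 < t"
  obtains C where "0 \<le> C" "C = 12 * (real DIM('a))\<^sup>2"
    "integrable (heat_measure t) (\<lambda>x::'a::euclidean_space. norm x ^ 4)"
    "(\<integral>x. norm (x::'a) ^ 4 \<partial>heat_measure t) \<le> C * t\<^sup>2"
proof -
  have 4: "has_bochner_integral (heat_measure t) (\<lambda>x::'a. real DIM('a) * (\<Sum>b\<in>Basis. (x \<bullet> b) ^ 4))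
      (real DIM('a) * (\<Sum>b\<in>(Basis::'a set). 12 * t\<^sup>2))"
    using heat_measure_moment_coordinate[OF t _ heat_measure_moment_even[OF t, of 2], where 'a='a]
    by (intro has_bochner_integral_mult_right has_bochner_integral_sum) (auto simp: fact_numeral)
  have le: "norm x ^ 4 \<le> real DIM('a) * (\<Sum>b\<in>Basis. (x \<bullet> b) ^ 4)" for x :: 'a
  proof -
    have "norm x ^ 4 = (\<Sum>b\<in>Basis. (x \<bullet> b)\<^sup>2 * 1)\<^sup>2"
    proof -
      have "(norm x)\<^sup>2 = (\<Sum>b\<in>Basis. (x \<bullet> b)\<^sup>2)"
        by (subst power2_norm_eq_inner, subst euclidean_inner) (simp add: power2_eq_square)
      then show ?thesis using power_mult[of "norm x" 2 2] by simp
    qed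
    also have "\<dots> \<le> (\<Sum>b\<in>Basis. ((x \<bullet> b)\<^sup>2)\<^sup>2) * (\<Sum>b\<in>(Basis::'a set). 1\<^sup>2)"
      by (rule Cauchy_Schwarz_ineq_sum)
    finally show ?thesis by (simp add: mult.commute flip: power_mult)
  qed
  have int: "integrable (heat_measure t) (\<lambda>x::'a. norm x ^ 4)"
    by (rule Bochner_Integration.integrable_bound[OF integrable.intros[OF 4]])
      (auto intro!: AE_I2 order_trans[OF le] )
  moreover have "(\<integral>x. norm (x::'a) ^ 4 \<partial>heat_measure t) \<le> 12 * (real DIM('a))\<^sup>2 * t\<^sup>2"
    using integral_mono[OF int integrable.intros[OF 4] le]
    unfolding has_bochner_integral_integral_eq[OF 4] by (simp add: power2_eq_square mult_ac)
  ultimately show ?thesis by (intro that[of "12 * (real DIM('a))\<^sup>2"]) auto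
qed

section \<open>The heat semigroup\<close>

text \<open>Written as an average over shifts, so that Jensen's inequality and the translation of
  partitions apply directly. Values in \<open>ennreal\<close> spare integrability questions before
  the maximal function is known to be finite.\<close>

definition heat :: "real \<Rightarrow> ('a::euclidean_space \<Rightarrow> ennreal) \<Rightarrow> 'a \<Rightarrow> ennreal" where
  "heat t f x = (\<integral>\<^sup>+y. f (x - y) \<partial>heat_measure t)"

lemma heat_maximal_eq:
  "u \<in> borel_measurable borel \<Longrightarrow>
    heat_maximal u x = (SUP t\<in>{0<..}. heat t (\<lambda>y. ennreal \<bar>u y\<bar>) x)"
  unfolding heat_maximal_def nn_convolution_def heat_def nn_integral_completion
  by (intro SUP_cong refl, subst nn_integral_heat_measure) (simp_all add: ennreal_mult'' mult.commute)

lemma heat_eq: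
  fixes f :: "'a::euclidean_space \<Rightarrow> ennreal"
  assumes [measurable]: "f \<in> borel_measurable borel"
  shows "heat t f x = (\<integral>\<^sup>+y. heat_kernel t (x - y) * f y \<partial>lborel)"
  using nn_integral_lborel_reflect[of "\<lambda>y. ennreal (heat_kernel t (x - y)) * f y" x]
  by (simp add: heat_def nn_integral_heat_measure)

lemma heat_eq_plus:
  assumes [measurable]: "f \<in> borel_measurable borel"
  shows "heat t f x = (\<integral>\<^sup>+y. f (x + y) \<partial>heat_measure t)"
  using nn_integral_heat_measure_uminus[of "\<lambda>y. f (x - y)" t] by (simp add: heat_def)

lemma sigma_finite_heat_measure: "sigma_finite_measure (heat_measure t)"
  unfolding heat_measure_def
  by (subst sigma_finite_measure.sigma_finite_iff_density_finite'[OF sigma_finite_lborel]) auto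

lemma borel_measurable_heat [measurable]:
  assumes [measurable]: "f \<in> borel_measurable borel"
  shows "heat t f \<in> borel_measurable borel"
proof -
  interpret sigma_finite_measure "heat_measure t :: 'a measure" by (rule sigma_finite_heat_measure)
  show ?thesis unfolding heat_def[abs_def] by measurable
qed

lemma heat_heat:
  assumes [measurable]: "f \<in> borel_measurable borel" and s: "0 < s" and t: "0 < t"
  shows "heat s (heat t f) x = heat (s + t) f x"
proof -
  have "heat s (heat t f) x = (\<integral>\<^sup>+y. heat_kernel s (x - y) * (\<integral>\<^sup>+z. heat_kernel t (y - z) * f z \<partial>lborel) \<partial>lborel)"
    by (simp add: heat_eq)
  also have "\<dots> = (\<integral>\<^sup>+y. \<integral>\<^sup>+z. heat_kernel s (x - y) * heat_kernel t (y - z) * f z \<partial>lborel \<partial>lborel)"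
    by (simp add: nn_integral_cmult[symmetric] ennreal_mult' mult.assoc)
  also have "\<dots> = (\<integral>\<^sup>+z. \<integral>\<^sup>+y. heat_kernel s (x - y) * heat_kernel t (y - z) * f z \<partial>lborel \<partial>lborel)"
    by (rule lborel_pair.Fubini') measurable
  also have "\<dots> = (\<integral>\<^sup>+z. (\<integral>\<^sup>+y. ennreal (heat_kernel s (x - y) * heat_kernel t (y - z)) \<partial>lborel) * f z \<partial>lborel)"
    by (simp add: nn_integral_multc)
  also have "\<dots> = (\<integral>\<^sup>+z. heat_kernel (s + t) (x - z) * f z \<partial>lborel)"
  proof (intro nn_integral_cong arg_cong2[where f="(*)"] refl)
    fix z
    show "(\<integral>\<^sup>+y. ennreal (heat_kernel s (x - y) * heat_kernel t (y - z)) \<partial>lborel) = heat_kernel (s + t) (x - z)"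
      using nn_integral_lborel_translate[of "\<lambda>y. ennreal (heat_kernel s (x - y) * heat_kernel t (y - z))" z]
        heat_kernel_convolution[OF s t, of "x - z"] by (simp add: diff_diff_eq add.commute)
  qed
  finally show ?thesis by (simp add: heat_eq)
qed

lemma nn_integral_heat:
  assumes [measurable]: "f \<in> borel_measurable borel" and t: "0 < t"
  shows "(\<integral>\<^sup>+x. heat t f x \<partial>lborel) = (\<integral>\<^sup>+x. f x \<partial>lborel)"
proof -
  interpret prob_space "heat_measure t :: 'a measure" by (rule prob_space_heat_measure[OF t])
  interpret pair_sigma_finite lborel "heat_measure t :: 'a measure" ..
  have "(\<integral>\<^sup>+x. heat t f x \<partial>lborel) = (\<integral>\<^sup>+y. \<integral>\<^sup>+x. f (x - y) \<partial>lborel \<partial>heat_measure t)"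
    unfolding heat_def by (rule Fubini'[symmetric]) measurable
  also have "\<dots> = (\<integral>\<^sup>+y. \<integral>\<^sup>+x. f x \<partial>lborel \<partial>(heat_measure t :: 'a measure))"
    using nn_integral_lborel_translate[of f "- _"] by simp
  also have "\<dots> = (\<integral>\<^sup>+x. f x \<partial>lborel)" using emeasure_space_1 by simp
  finally show ?thesis .
qed

lemma heat_mono: "(\<And>x. f x \<le> g x) \<Longrightarrow> heat t f x \<le> heat t g x"
  unfolding heat_def by (intro nn_integral_mono)

text \<open>A reflected and translated null set is null, also for \<open>heat_measure\<close>. An
  inequality off a null set thus becomes one at every point, and the maximal function does not
  depend on the representative of the datum.\<close>

lemma heat_AE_mono:
  assumes "AE x in lborel. f x \<le> g x" "0 < t"
  shows "heat t f x \<le> heat t g x"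
  unfolding heat_def
  by (rule nn_integral_mono_AE) (use AE_lborel_reflect[OF assms(1), of x] AE_heat_measure[OF assms(2)] in blast)

lemma heat_AE_cong:
  assumes "AE x in lborel. f x = g x" "0 < t"
  shows "heat t f x = heat t g x"
  unfolding heat_def
  by (rule nn_integral_cong_AE) (use AE_lborel_reflect[OF assms(1), of x] AE_heat_measure[OF assms(2)] in blast)

lemma heat_const:
  assumes "0 < t"
  shows "heat t (\<lambda>_. c) (x::'a::euclidean_space) = c"
proof -
  interpret prob_space "heat_measure t :: 'a measure" by (rule prob_space_heat_measure[OF assms])
  show ?thesis using emeasure_space_1 by (simp add: heat_def)
qed

lemma heat_add:
  "f \<in> borel_measurable borel \<Longrightarrow> g \<in> borel_measurable borel \<Longrightarrow>
    heat t (\<lambda>x. f x + g x) x = heat t f x + heat t g x"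
  unfolding heat_def by (subst nn_integral_add) auto

section \<open>Test functions\<close>

text \<open>The denominators are what differentiating \<open>exp (- (1 / t))\<close> produces: with
  them the family is closed under derivatives, up to linear combinations.\<close>

definition flat :: "nat \<Rightarrow> real \<Rightarrow> real" where
  "flat n t = (if 0 < t then exp (- (1 / t)) / t ^ n else 0)"

lemma flat_nonneg: "0 \<le> flat n t"
  by (simp add: flat_def)

lemma flat_0_le_1: "flat 0 t \<le> 1"
  by (simp add: flat_def)

lemma flat_eq_0: "t \<le> 0 \<Longrightarrow> flat n t = 0"
  by (simp add: flat_def)

lemma flat_tendsto_0: "(flat n \<longlongrightarrow> 0) (at 0)"
proof (rule filterlim_split_at)
  show "(flat n \<longlongrightarrow> 0) (at_left 0)"
    by (rule tendsto_eventually) (auto simp: flat_def eventually_at_left_field intro: exI[of _ "-1"])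
  have "((\<lambda>t. inverse t ^ n / exp (inverse t)) \<longlongrightarrow> 0) (at_right (0::real))"
    by (rule filterlim_compose[OF tendsto_power_div_exp_0 filterlim_inverse_at_top_right])
  then show "(flat n \<longlongrightarrow> 0) (at_right 0)"
    by (rule Lim_transform_eventually)
      (auto simp: flat_def eventually_at_right_field exp_minus field_simps intro!: exI[of _ 1])
qed

lemma flat_deriv: "(flat n has_real_derivative flat (n + 2) t - real n * flat (n + 1) t) (at t)"
proof -
  consider "t < 0" | "t = 0" | "0 < t" by linarith
  then show ?thesis
  proof cases
    case 1
    have "((\<lambda>_. 0) has_real_derivative 0) (at t)" by simp
    then have "(flat n has_real_derivative 0) (at t)"
      by (rule has_field_derivative_transform_within_open[of _ _ _ "{..<0}"])
        (use 1 in \<open>auto simp: flat_def\<close>)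
    with 1 show ?thesis by (simp add: flat_def)
  next
    case 2
    \<comment> \<open>The difference quotient at 0 is \<open>flat (n + 1)\<close> itself.\<close>
    have "((\<lambda>h. (flat n (0 + h) - flat n 0) / h) \<longlongrightarrow> 0) (at 0)"
      by (rule Lim_transform_eventually[OF flat_tendsto_0[of "n + 1"]])
        (auto simp: flat_def eventually_at_filter)
    then show ?thesis using 2 by (simp add: DERIV_def flat_def)
  next
    case 3
    have "((\<lambda>t. exp (- (1 / t)) / t ^ n) has_real_derivative
        flat (n + 2) t - real n * flat (n + 1) t) (at t)"
    proof (cases n)
      case 0
      show ?thesis using 3 unfolding 0
        by (auto intro!: derivative_eq_intros simp: flat_def power2_eq_square)
    next
      case (Suc m)
      have e: "((\<lambda>t. exp (- (1 / t))) has_real_derivative exp (- (1 / t)) * (1 / t\<^sup>2)) (at t)"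
        using 3 by (auto intro!: derivative_eq_intros simp: power2_eq_square)
      have d: "((\<lambda>t. t ^ Suc m) has_real_derivative real (Suc m) * t ^ m) (at t)"
        using DERIV_pow[of "Suc m" t] by simp
      show ?thesis unfolding Suc
        by (rule DERIV_cong[OF DERIV_divide[OF e d]])
          (use 3 in \<open>auto simp: flat_def power2_eq_square field_simps\<close>)
    qed
    then show ?thesis
      by (rule has_field_derivative_transform_within_open[of _ _ _ "{0<..}"])
        (use 3 in \<open>auto simp: flat_def\<close>)
  qed
qed

text \<open>An algebra of functions that is closed under partial derivatives, hence consists of
  functions with derivatives of all orders.\<close>

inductive smooth_fun :: "('a::euclidean_space \<Rightarrow> real) \<Rightarrow> bool" where
  const: "smooth_fun (\<lambda>_. c)"
| add: "smooth_fun f \<Longrightarrow> smooth_fun g \<Longrightarrow> smooth_fun (\<lambda>x. f x + g x)"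
| mult: "smooth_fun f \<Longrightarrow> smooth_fun g \<Longrightarrow> smooth_fun (\<lambda>x. f x * g x)"
| flat: "smooth_fun (\<lambda>x. flat n (c + x \<bullet> a))"

lemma smooth_fun_prod:
  "finite A \<Longrightarrow> (\<And>i. i \<in> A \<Longrightarrow> smooth_fun (f i)) \<Longrightarrow> smooth_fun (\<lambda>x. \<Prod>i\<in>A. f i x)"
  by (induction A rule: finite_induct) (auto intro: smooth_fun.intros)

lemma smooth_fun_shift:
  assumes "smooth_fun f"
  shows "smooth_fun (\<lambda>x. f (x - h))"
  using assms
proof induction
  case (flat n c a)
  have "(\<lambda>x. flat n (c + (x - h) \<bullet> a)) = (\<lambda>x. flat n ((c - h \<bullet> a) + x \<bullet> a))"
    by (simp add: inner_diff_left algebra_simps)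
  then show ?case using smooth_fun.flat by metis
qed (auto intro: smooth_fun.intros)

lemma smooth_fun_derivative:
  assumes "smooth_fun f"
  shows "\<exists>f'. (\<forall>x. (f has_derivative f' x) (at x)) \<and> (\<forall>i. smooth_fun (\<lambda>x. f' x i))"
  using assms
proof induction
  case (const c)
  show ?case by (intro exI[of _ "\<lambda>_ _. 0"]) (auto intro: smooth_fun.const)
next
  case (add f g)
  then obtain f' g' where "\<forall>x. (f has_derivative f' x) (at x)" "\<forall>i. smooth_fun (\<lambda>x. f' x i)"
    "\<forall>x. (g has_derivative g' x) (at x)" "\<forall>i. smooth_fun (\<lambda>x. g' x i)" by blast
  then show ?case
    by (intro exI[of _ "\<lambda>x h. f' x h + g' x h"]) (auto intro: smooth_fun.add has_derivative_add)
next
  case (mult f g)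
  then obtain f' g' where "\<forall>x. (f has_derivative f' x) (at x)" "\<forall>i. smooth_fun (\<lambda>x. f' x i)"
    "\<forall>x. (g has_derivative g' x) (at x)" "\<forall>i. smooth_fun (\<lambda>x. g' x i)" by blast
  with mult.hyps show ?case
    by (intro exI[of _ "\<lambda>x h. f x * g' x h + f' x h * g x"])
      (auto intro!: smooth_fun.add smooth_fun.mult has_derivative_mult)
next
  case (flat n c a)
  let ?f' = "\<lambda>x h. (flat (n + 2) (c + x \<bullet> a) + (- real n) * flat (n + 1) (c + x \<bullet> a)) * (h \<bullet> a)"
  have "((\<lambda>x. flat n (c + x \<bullet> a)) has_derivative ?f' x) (at x)" for x
  proof -
    have "((\<lambda>x. c + x \<bullet> a) has_derivative (\<lambda>h. h \<bullet> a)) (at x)"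
      by (auto intro!: derivative_eq_intros)
    from has_derivative_compose[OF this flat_deriv[unfolded has_field_derivative_def]]
    show ?thesis by simp
  qed
  moreover have "smooth_fun (\<lambda>x. ?f' x i)" for i
    by (intro smooth_fun.intros)
  ultimately show ?case by (intro exI[of _ ?f'] conjI allI)
qed

lemma C_k_smooth_fun: "smooth_fun f \<Longrightarrow> C_k k f"
proof (induction k arbitrary: f)
  case 0
  then show ?case
    using smooth_fun_derivative has_derivative_continuous continuous_at_imp_continuous_on
    by (metis C_k.simps(1))
next
  case (Suc k)
  obtain f' where f': "\<And>x. (f has_derivative f' x) (at x)" "\<And>i. smooth_fun (\<lambda>x. f' x i)"
    using smooth_fun_derivative[OF Suc.prems] by blast
  have "frechet_derivative f (at x) = f' x" for x
    using frechet_derivative_at[OF f'(1)] by simp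
  then show ?case using Suc.IH f' by (auto simp: differentiable_def)
qed

lemma smooth_fun_test_function:
  assumes "smooth_fun f" "\<And>x. x \<notin> cball 0 R \<Longrightarrow> f x = 0"
  shows "f \<in> test_functions"
proof -
  have "{x. f x \<noteq> 0} \<subseteq> cball 0 R" using assms(2) by blast
  then have "bounded {x. f x \<noteq> 0}" by (rule bounded_subset[OF bounded_cball])
  then show ?thesis using assms(1) by (simp add: test_functions_def C_k_smooth_fun)
qed

lemma test_function_facts:
  fixes \<phi> :: "'a::euclidean_space \<Rightarrow> real"
  assumes "\<phi> \<in> test_functions"
  obtains R B where "0 < R" "0 \<le> B" "\<And>x. (\<phi> has_derivative frechet_derivative \<phi> (at x)) (at x)"
    "\<And>x h. \<bar>frechet_derivative \<phi> (at x) h\<bar> \<le> B * norm h" "\<And>x. \<bar>\<phi> x\<bar> \<le> B"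
    "\<And>x y. \<bar>\<phi> x - \<phi> y\<bar> \<le> B * norm (x - y)"
    "\<And>x. norm x > R \<Longrightarrow> \<phi> x = 0" "\<And>x h. norm x > R \<Longrightarrow> frechet_derivative \<phi> (at x) h = 0"
    "continuous_on UNIV \<phi>" "\<And>h. continuous_on UNIV (\<lambda>x. frechet_derivative \<phi> (at x) h)"
proof -
  define D where "D x = frechet_derivative \<phi> (at x)" for x
  have C: "C_k k \<phi>" for k
    using assms by (auto simp: test_functions_def)
  have K: "compact (closure {x. \<phi> x \<noteq> 0})"
    using assms by (auto simp: test_functions_def)
  have d: "(\<phi> has_derivative D x) (at x)" for x
    using C[of "Suc 0"] by (simp add: D_def frechet_derivative_works)
  have lin: "linear (D x)" for x using d has_derivative_linear by blast
  \<comment> \<open>\<open>C_k\<close> gives continuity of the partial derivatives along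
    \<open>Basis\<close> only; all other directions follow by linearity.\<close>
  have Di: "D x h = (\<Sum>i\<in>Basis. (h \<bullet> i) * D x i)" for x h
    by (subst (1) euclidean_representation[of h, symmetric])
      (simp only: linear_sum[OF lin] linear_scale[OF lin] real_scaleR_def)
  have contD: "continuous_on UNIV (\<lambda>x. D x i)" if "i \<in> Basis" for i
    using C[of "Suc 0"] that by (simp add: D_def)
  have contDh: "continuous_on UNIV (\<lambda>x. D x h)" for h
    by (subst Di) (intro continuous_intros contD)
  have cont: "continuous_on UNIV \<phi>" using C[of 0] by simp
  obtain R where R: "0 < R" "closure {x. \<phi> x \<noteq> 0} \<subseteq> ball 0 R"
    using bounded_subset_ballD[OF compact_imp_bounded[OF K], of 0] by blast
  have z: "\<phi> x = 0" if "norm x > R" for x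
    using that R closure_subset[of "{x. \<phi> x \<noteq> 0}"] by fastforce
  have zD: "D x h = 0" if "norm x > R" for x h
  proof -
    have "open (- cball 0 R :: 'a set)" by auto
    have "((\<lambda>_. 0) has_derivative (\<lambda>_. 0)) (at x)" by simp
    then have "(\<phi> has_derivative (\<lambda>_. 0)) (at x)"
      by (rule has_derivative_transform_within_open[of _ _ _ _ "- cball 0 R"]) (use that z in auto)
    from has_derivative_unique[OF this d] show ?thesis by metis
  qed
  have "compact (cball 0 R :: 'a set)" by simp
  then have bd: "\<exists>B\<ge>0. \<forall>x. \<bar>f x\<bar> \<le> B" if "continuous_on UNIV f" "\<And>x. norm x > R \<Longrightarrow> f x = 0" for f :: "'a \<Rightarrow> real"
  proof -
    have "compact (f ` cball 0 R)"
      using that(1) by (intro compact_continuous_image) (auto intro: continuous_on_subset)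
    then obtain B where B: "\<And>x. x \<in> cball 0 R \<Longrightarrow> \<bar>f x\<bar> \<le> B"
      using compact_imp_bounded bounded_iff by (metis imageI real_norm_def)
    moreover have "0 \<le> B" using B[of 0] R by (simp add: order_trans[OF abs_ge_zero])
    ultimately show ?thesis using that(2) by (intro exI[of _ B]) (metis abs_zero linorder_not_less mem_cball_0)
  qed
  have "\<forall>i. \<exists>B. i \<in> Basis \<longrightarrow> 0 \<le> B \<and> (\<forall>x. \<bar>D x i\<bar> \<le> B)"
    using bd[OF contD] zD by blast
  then obtain Bi where Bi: "\<And>i. i \<in> Basis \<Longrightarrow> 0 \<le> Bi i" "\<And>i x. i \<in> Basis \<Longrightarrow> \<bar>D x i\<bar> \<le> Bi i" by metis
  obtain B0 where B0: "0 \<le> B0" "\<And>x. \<bar>\<phi> x\<bar> \<le> B0" using bd[OF cont] z by blast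
  define B where "B = B0 + (\<Sum>i\<in>Basis. Bi i)"
  have S0: "0 \<le> (\<Sum>i\<in>Basis. Bi i)" using Bi by (intro sum_nonneg) auto
  have DB: "\<bar>D x h\<bar> \<le> B * norm h" for x h
  proof -
    have "\<bar>D x h\<bar> \<le> (\<Sum>i\<in>Basis. \<bar>h \<bullet> i\<bar> * \<bar>D x i\<bar>)"
      by (subst Di) (rule order_trans[OF sum_abs], simp add: abs_mult)
    also have "\<dots> \<le> (\<Sum>i\<in>Basis. norm h * Bi i)"
      by (intro sum_mono mult_mono Bi) (auto simp: Basis_le_norm)
    also have "\<dots> \<le> B * norm h"
      using B0(1) by (simp add: B_def algebra_simps sum_distrib_left)
    finally show ?thesis .
  qed
  have lip: "\<bar>\<phi> x - \<phi> y\<bar> \<le> B * norm (x - y)" for x y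
  proof -
    have "norm (\<phi> x - \<phi> y) \<le> B * norm (x - y)"
    proof (rule differentiable_bound[of UNIV \<phi> D B x y])
      show "onorm (D z) \<le> B" for z
        using DB B0(1) S0 by (intro onorm_bound) (auto simp: B_def)
    qed (use d in auto)
    then show ?thesis by simp
  qed
  show ?thesis
  proof (rule that[of R B])
    show "\<bar>\<phi> x\<bar> \<le> B" for x using B0(2)[of x] S0 by (simp add: B_def)
  qed (use R B0 S0 d DB lip z zD cont contDh in \<open>auto simp: B_def D_def\<close>)
qed

text \<open>The dilation \<open>Suc n\<close> drives each factor to 1 inside the box, while outside
  some factor is 0. These bumps and their translates are the only test functions constructed
  explicitly.\<close>

definition box_bump :: "nat \<Rightarrow> 'a::euclidean_space \<Rightarrow> 'a \<Rightarrow> 'a \<Rightarrow> real" where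
  "box_bump n A B x = (\<Prod>b\<in>Basis. flat 0 (real (Suc n) * ((x - A) \<bullet> b)) * flat 0 (real (Suc n) * ((B - x) \<bullet> b)))"

lemma box_bump_bounds: "0 \<le> box_bump n A B x" "box_bump n A B x \<le> indicator (box A B) x"
proof -
  show "0 \<le> box_bump n A B x"
    unfolding box_bump_def by (intro prod_nonneg ballI mult_nonneg_nonneg flat_nonneg)
  show "box_bump n A B x \<le> indicator (box A B) x"
  proof (cases "x \<in> box A B")
    case True
    have "box_bump n A B x \<le> (\<Prod>b\<in>(Basis::'a set). 1)"
      unfolding box_bump_def
      by (intro prod_mono conjI mult_nonneg_nonneg flat_nonneg mult_le_one flat_0_le_1)
    then show ?thesis using True by simp
  next
    case False
    then obtain b where "b \<in> Basis" "x \<bullet> b \<le> A \<bullet> b \<or> B \<bullet> b \<le> x \<bullet> b"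
      by (auto simp: mem_box not_less)
    then have "\<exists>b\<in>Basis. flat 0 (real (Suc n) * ((x - A) \<bullet> b)) * flat 0 (real (Suc n) * ((B - x) \<bullet> b)) = 0"
      by (intro bexI[of _ b])
        (auto simp: inner_diff_left intro!: flat_eq_0 mult_nonneg_nonpos simp del: of_nat_Suc)
    then have "box_bump n A B x = 0" unfolding box_bump_def by (simp add: prod_zero)
    then show ?thesis by simp
  qed
qed

lemma box_bump_test_function:
  fixes A B h :: "'a::euclidean_space"
  shows "(\<lambda>x. box_bump n A B (x - h)) \<in> test_functions"
proof -
  have s: "smooth_fun (box_bump n A B)"
  proof -
    have "smooth_fun (\<lambda>x. flat 0 (real (Suc n) * ((x - A) \<bullet> b)))" for b
      using smooth_fun.flat[of 0 "- (real (Suc n) * (A \<bullet> b))" "real (Suc n) *\<^sub>R b"]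
      by (simp add: inner_diff_left algebra_simps)
    moreover have "smooth_fun (\<lambda>x. flat 0 (real (Suc n) * ((B - x) \<bullet> b)))" for b
      using smooth_fun.flat[of 0 "real (Suc n) * (B \<bullet> b)" "- real (Suc n) *\<^sub>R b"]
      by (simp add: inner_diff_left algebra_simps)
    ultimately show ?thesis unfolding box_bump_def[abs_def]
      by (intro smooth_fun_prod smooth_fun.mult) auto
  qed
  have "bounded ((+) h ` box A B)" by (intro bounded_translation) simp
  then obtain R where R: "(+) h ` box A B \<subseteq> cball 0 R"
    by (meson bounded_subset_ballD ball_subset_cball order_trans)
  show ?thesis
  proof (rule smooth_fun_test_function[OF smooth_fun_shift[OF s]])
    fix x assume "x \<notin> cball (0::'a) R"
    then have "x \<notin> (+) h ` box A B" using R by blast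
    then have "x - h \<notin> box A B" by (metis add_diff_cancel_left' diff_add_cancel image_eqI add.commute)
    then show "box_bump n A B (x - h) = 0"
      using box_bump_bounds[of n A B "x - h"] by simp
  qed
qed

lemma box_bump_tendsto: "(\<lambda>n. box_bump n A B x) \<longlonglongrightarrow> indicator (box A B) x"
proof (cases "x \<in> box A B")
  case True
  have f: "(\<lambda>n. flat 0 (real (Suc n) * c)) \<longlonglongrightarrow> 1" if "c > 0" for c
  proof -
    have "(\<lambda>n. exp (- (inverse c * inverse (real (Suc n))))) \<longlonglongrightarrow> exp (- (inverse c * 0))"
      by (intro tendsto_intros LIMSEQ_inverse_real_of_nat)
    then show ?thesis using that by (simp add: flat_def divide_inverse mult_pos_pos mult.commute del: of_nat_Suc)
  qed
  have "(\<lambda>n. box_bump n A B x) \<longlonglongrightarrow> (\<Prod>b\<in>(Basis::'a set). 1 * 1)"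
    unfolding box_bump_def
    by (intro tendsto_prod tendsto_mult f) (use True in \<open>auto simp: mem_box inner_diff_left\<close>)
  then show ?thesis using True by simp
next
  case False
  then have "box_bump n A B x = 0" for n using box_bump_bounds[of n A B x] by simp
  then show ?thesis using False by simp
qed

section \<open>Weak gradients of Borel functions\<close>

lemma norm_integral_le_nn_integral:
  fixes f :: "'a \<Rightarrow> 'b::{banach, second_countable_topology}"
  shows "ennreal (norm (\<integral>x. f x \<partial>M)) \<le> (\<integral>\<^sup>+x. norm (f x) \<partial>M)"
  by (cases "integrable M f") (auto simp: integral_norm_bound_ennreal not_integrable_integral_eq)

lemma sets_cball [measurable]: "cball x r \<in> sets (borel :: 'a::euclidean_space measure)"
  by (intro borel_closed closed_cball)

text \<open>The Borel counterpart of \<open>locally_integrable\<close>: every compact set lies in a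
  ball about 0, and Borel measurability keeps Fubini's theorem and translations available.\<close>

definition loc_int :: "('a::euclidean_space \<Rightarrow> 'b::euclidean_space) \<Rightarrow> bool" where
  "loc_int f \<longleftrightarrow> f \<in> borel_measurable borel \<and> (\<forall>R. set_integrable lborel (cball 0 R) f)"

lemma loc_int_measurable: "loc_int f \<Longrightarrow> f \<in> borel_measurable borel"
  by (simp add: loc_int_def)

lemma loc_int_mult:
  fixes f :: "'a::euclidean_space \<Rightarrow> real"
  assumes f: "loc_int f" and m: "\<phi> \<in> borel_measurable borel"
    and b: "\<And>x. \<bar>\<phi> x\<bar> \<le> B" "\<And>x. norm x > R \<Longrightarrow> \<phi> x = 0"
  shows "integrable lborel (\<lambda>x. f x * \<phi> x)"
proof (rule Bochner_Integration.integrable_bound)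
  show "integrable lborel (\<lambda>x. B * (indicator (cball 0 R) x *\<^sub>R f x))"
    using f by (auto simp: loc_int_def set_integrable_def)
  show "(\<lambda>x. f x * \<phi> x) \<in> borel_measurable lborel"
    using f m by (auto simp: loc_int_def)
  show "AE x in lborel. norm (f x * \<phi> x) \<le> norm (B * (indicator (cball 0 R) x *\<^sub>R f x))"
  proof (intro AE_I2)
    fix x
    have "0 \<le> B" using b(1)[of 0] by linarith
    then show "norm (f x * \<phi> x) \<le> norm (B * (indicator (cball 0 R) x *\<^sub>R f x))"
      using b[of x] by (cases "norm x > R") (auto simp: abs_mult mult.commute intro: mult_right_mono split: split_indicator)
  qed
qed

text \<open>The bumps converge boundedly to indicators of boxes. So the measures with the positive
  and the negative part of \<open>w\<close> as densities agree on boxes, an intersection-stable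
  generator of the Borel sets, and hence coincide.\<close>

lemma fundamental_lemma_variations:
  fixes w :: "'a::euclidean_space \<Rightarrow> real"
  assumes w: "loc_int w" and 0: "\<And>n A B. (\<integral>x. w x * box_bump n A B x \<partial>lborel) = 0"
  shows "AE x in lborel. w x = 0"
proof -
  have [measurable]: "w \<in> borel_measurable borel" using w by (rule loc_int_measurable)
  have mb[measurable]: "box_bump n A B \<in> borel_measurable borel" for n and A B :: 'a
    using box_bump_test_function[of n A B 0] test_function_facts by (metis (no_types, lifting) borel_measurable_continuous_onI diff_zero ext)
  have R: "\<exists>R. box A B \<subseteq> cball 0 R" for A B :: 'a
    by (meson bounded_box bounded_subset_ballD ball_subset_cball order_trans)
  have int: "integrable lborel (\<lambda>x. w x * indicator (box A B) x)" for A B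
  proof -
    obtain R where "box A B \<subseteq> cball 0 R" using R by blast
    then show ?thesis
      by (intro loc_int_mult[OF w, of _ 1 R]) (auto split: split_indicator)
  qed
  have box0: "(\<integral>x. w x * indicator (box A B) x \<partial>lborel) = 0" for A B
  proof (rule LIMSEQ_unique)
    show "(\<lambda>n. \<integral>x. w x * box_bump n A B x \<partial>lborel) \<longlonglongrightarrow> (\<integral>x. w x * indicator (box A B) x \<partial>lborel)"
    proof (rule integral_dominated_convergence[where w="\<lambda>x. norm (w x * indicator (box A B) x)"])
      show "integrable lborel (\<lambda>x. norm (w x * indicator (box A B) x))" using int by (rule integrable_norm)
      show "AE x in lborel. (\<lambda>n. w x * box_bump n A B x) \<longlonglongrightarrow> w x * indicator (box A B) x"
        by (intro AE_I2 tendsto_intros box_bump_tendsto)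
      show "AE x in lborel. norm (w x * box_bump n A B x) \<le> norm (w x * indicator (box A B) x)" for n
        using box_bump_bounds[of n A B] by (intro AE_I2) (auto simp: abs_mult intro!: mult_left_mono)
    qed auto
  qed (simp add: 0)
  let ?P = "density lborel (\<lambda>x. ennreal (w x))" and ?N = "density lborel (\<lambda>x. ennreal (- w x))"
  have nn: "(\<integral>\<^sup>+x. ennreal (w x) * indicator (box A B) x \<partial>lborel) = (\<integral>\<^sup>+x. ennreal (- w x) * indicator (box A B) x \<partial>lborel)"
    "(\<integral>\<^sup>+x. ennreal (w x) * indicator (box A B) x \<partial>lborel) \<noteq> \<infinity>" for A B
  proof -
    let ?w = "\<lambda>x. w x * indicator (box A B) x"
    have e: "(\<integral>\<^sup>+x. ennreal (w x) * indicator (box A B) x \<partial>lborel) = (\<integral>\<^sup>+x. ennreal (?w x) \<partial>lborel)"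
      "(\<integral>\<^sup>+x. ennreal (- w x) * indicator (box A B) x \<partial>lborel) = (\<integral>\<^sup>+x. ennreal (- ?w x) \<partial>lborel)"
      by (intro nn_integral_cong; simp split: split_indicator)+
    have f: "(\<integral>\<^sup>+x. ennreal (?w x) \<partial>lborel) \<noteq> \<infinity>" "(\<integral>\<^sup>+x. ennreal (- ?w x) \<partial>lborel) \<noteq> \<infinity>"
      using int[of A B] unfolding real_integrable_def by auto
    have "enn2real (\<integral>\<^sup>+x. ennreal (?w x) \<partial>lborel) = enn2real (\<integral>\<^sup>+x. ennreal (- ?w x) \<partial>lborel)"
      using box0[of A B] unfolding real_lebesgue_integral_def[OF int] by simp
    then have "(\<integral>\<^sup>+x. ennreal (?w x) \<partial>lborel) = (\<integral>\<^sup>+x. ennreal (- ?w x) \<partial>lborel)"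
      using f by (metis (no_types) ennreal_enn2real top.not_eq_extremum infinity_ennreal_def)
    then show "(\<integral>\<^sup>+x. ennreal (w x) * indicator (box A B) x \<partial>lborel) = (\<integral>\<^sup>+x. ennreal (- w x) * indicator (box A B) x \<partial>lborel)"
      "(\<integral>\<^sup>+x. ennreal (w x) * indicator (box A B) x \<partial>lborel) \<noteq> \<infinity>" using f e by auto
  qed
  have "?P = ?N"
  proof (rule measure_eqI_generator_eq)
    let ?E = "range (\<lambda>(a, b). box a b::'a set)"
    show "Int_stable ?E" by (auto simp: Int_stable_def box_Int_box)
    show "?E \<subseteq> Pow UNIV" "sets ?P = sigma_sets UNIV ?E" "sets ?N = sigma_sets UNIV ?E"
      by (simp_all add: borel_eq_box)
    let ?A = "\<lambda>n::nat. box (- (real n *\<^sub>R One)) (real n *\<^sub>R One) :: 'a set"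
    show "range ?A \<subseteq> ?E" "(\<Union>i. ?A i) = UNIV"
      unfolding UN_box_eq_UNIV by auto
    show "emeasure ?P (?A i) \<noteq> \<infinity>" for i using nn(2) by (simp add: emeasure_density)
    show "emeasure ?P X = emeasure ?N X" if "X \<in> ?E" for X
      using that nn(1) by (auto simp: emeasure_density)
  qed
  \<comment> \<open>\<open>ennreal\<close> truncates at 0, so one of the two sides vanishes at each
    point.\<close>
  then have "AE x in lborel. ennreal (w x) = ennreal (- w x)"
    by (intro sigma_finite_measure.density_unique[OF sigma_finite_lborel]) auto
  then show ?thesis
  proof (rule eventually_mono)
    fix x assume "ennreal (w x) = ennreal (- w x)"
    then show "w x = 0"
      by (metis ennreal_eq_0_iff ennreal_neg linorder_linear neg_le_0_iff_le order_antisym)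
  qed
qed

text \<open>All analysis is carried out with this Borel version of \<open>has_weak_gradient\<close>;
  the notions of the theorem reappear only when the datum is replaced by a representative and when
  the result is transferred back.\<close>

definition weak_grad :: "('a::euclidean_space \<Rightarrow> real) \<Rightarrow> ('a \<Rightarrow> 'a) \<Rightarrow> bool" where
  "weak_grad u g \<longleftrightarrow> loc_int u \<and> loc_int g \<and>
    (\<forall>\<phi>\<in>test_functions. \<forall>i\<in>Basis.
      (\<integral>x. u x * frechet_derivative \<phi> (at x) i \<partial>lborel) = - (\<integral>x. (g x \<bullet> i) * \<phi> x \<partial>lborel))"

lemma loc_int_set_integrable: "loc_int f \<Longrightarrow> bounded S \<Longrightarrow> S \<in> sets borel \<Longrightarrow> set_integrable lborel S f"
  by (metis ball_subset_cball bounded_subset_ballD order_trans set_integrable_subset sets_lborel loc_int_def)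

lemma loc_int_nn_integral:
  assumes "loc_int f"
  shows "(\<integral>\<^sup>+x. norm (f x) * indicator (cball 0 R) x \<partial>lborel) < \<infinity>"
proof -
  have "integrable lborel (\<lambda>x. indicator (cball 0 R) x *\<^sub>R f x)"
    using assms by (auto simp: loc_int_def set_integrable_def)
  then have "(\<integral>\<^sup>+x. norm (indicator (cball 0 R) x *\<^sub>R f x) \<partial>lborel) < \<infinity>"
    by (simp add: integrable_iff_bounded)
  also have "(\<integral>\<^sup>+x. norm (indicator (cball 0 R) x *\<^sub>R f x) \<partial>lborel)
      = (\<integral>\<^sup>+x. norm (f x) * indicator (cball 0 R) x \<partial>lborel)"
    by (intro nn_integral_cong) (auto split: split_indicator)
  finally show ?thesis .
qed

lemma loc_intI:
  assumes [measurable]: "f \<in> borel_measurable borel"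
    and fin: "\<And>R. (\<integral>\<^sup>+x. norm (f x) * indicator (cball 0 R) x \<partial>lborel) < \<infinity>"
  shows "loc_int f"
proof -
  have "integrable lborel (\<lambda>x. indicator (cball 0 R) x *\<^sub>R f x)" for R
  proof -
    have "(\<integral>\<^sup>+x. norm (indicator (cball 0 R) x *\<^sub>R f x) \<partial>lborel)
      = (\<integral>\<^sup>+x. norm (f x) * indicator (cball 0 R) x \<partial>lborel)"
      by (intro nn_integral_cong) (auto split: split_indicator)
    then show ?thesis using fin[of R] by (simp add: integrable_iff_bounded)
  qed
  then show ?thesis by (auto simp: loc_int_def set_integrable_def)
qed

lemma loc_int_diff: "loc_int f \<Longrightarrow> loc_int g \<Longrightarrow> loc_int (\<lambda>x. f x - g x)"
  by (auto simp: loc_int_def intro: set_integral_diff)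

lemma loc_int_inner: "loc_int f \<Longrightarrow> loc_int (\<lambda>x. f x \<bullet> h)"
proof -
  assume f: "loc_int f"
  have "integrable lborel (\<lambda>x. (indicator (cball 0 R) x *\<^sub>R f x) \<bullet> h)" for R
    using f by (intro integrable_inner_left) (auto simp: loc_int_def set_integrable_def)
  then show ?thesis using f by (auto simp: loc_int_def set_integrable_def)
qed

lemma loc_int_translate:
  assumes f: "loc_int f"
  shows "loc_int (\<lambda>x. f (x + h))"
proof (rule loc_intI)
  have [measurable]: "f \<in> borel_measurable borel" using f by (rule loc_int_measurable)
  show "(\<lambda>x. f (x + h)) \<in> borel_measurable borel" by simp
  fix R
  have "(\<integral>\<^sup>+x. norm (f (x + h)) * indicator (cball 0 R) x \<partial>lborel)
      \<le> (\<integral>\<^sup>+x. norm (f (x + h)) * indicator (cball 0 (R + norm h)) (x + h) \<partial>lborel)"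
    by (intro nn_integral_mono) (auto split: split_indicator intro: norm_triangle_le)
  also have "\<dots> = (\<integral>\<^sup>+x. norm (f x) * indicator (cball 0 (R + norm h)) x \<partial>lborel)"
    by (rule nn_integral_lborel_translate[where f="\<lambda>x. norm (f x) * indicator (cball 0 (R + norm h)) x"]) measurable
  also have "\<dots> < \<infinity>" by (rule loc_int_nn_integral[OF f])
  finally show "(\<integral>\<^sup>+x. norm (f (x + h)) * indicator (cball 0 R) x \<partial>lborel) < \<infinity>" .
qed

lemma borel_measurable_test_function:
  "\<phi> \<in> test_functions \<Longrightarrow> \<phi> \<in> borel_measurable borel"
  by (metis borel_measurable_continuous_onI test_function_facts)

lemma borel_measurable_test_function_derivative:
  "\<phi> \<in> test_functions \<Longrightarrow> (\<lambda>x. frechet_derivative \<phi> (at x) h) \<in> borel_measurable borel"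
  by (metis borel_measurable_continuous_onI test_function_facts)

lemma test_function_derivative_sum:
  assumes "\<phi> \<in> test_functions"
  shows "frechet_derivative \<phi> (at x) h = (\<Sum>i\<in>Basis. (h \<bullet> i) * frechet_derivative \<phi> (at x) i)"
proof -
  have lin: "linear (frechet_derivative \<phi> (at x))"
    using test_function_facts[OF assms] has_derivative_linear by metis
  show ?thesis
    by (subst (1) euclidean_representation[of h, symmetric])
      (simp only: linear_sum[OF lin] linear_scale[OF lin] real_scaleR_def)
qed

lemma loc_int_test_function:
  assumes "loc_int u" "\<phi> \<in> test_functions"
  shows "integrable lborel (\<lambda>x. u x * \<phi> x)" "integrable lborel (\<lambda>x. u x * frechet_derivative \<phi> (at x) h)"
proof -
  obtain R B where *: "\<And>x h. \<bar>frechet_derivative \<phi> (at x) h\<bar> \<le> B * norm h" "\<And>x. \<bar>\<phi> x\<bar> \<le> B"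
    "\<And>x. norm x > R \<Longrightarrow> \<phi> x = 0" "\<And>x h. norm x > R \<Longrightarrow> frechet_derivative \<phi> (at x) h = 0"
    using test_function_facts[OF assms(2)] by metis
  show "integrable lborel (\<lambda>x. u x * \<phi> x)"
    by (rule loc_int_mult[OF assms(1) _ *(2,3)]) (auto intro: borel_measurable_test_function assms)
  show "integrable lborel (\<lambda>x. u x * frechet_derivative \<phi> (at x) h)"
    by (rule loc_int_mult[OF assms(1) _ *(1,4)]) (auto intro: borel_measurable_test_function_derivative assms)
qed

lemma weak_grad_direction:
  assumes wg: "weak_grad u g" and \<phi>: "\<phi> \<in> test_functions"
  shows "(\<integral>x. u x * frechet_derivative \<phi> (at x) h \<partial>lborel) = - (\<integral>x. (g x \<bullet> h) * \<phi> x \<partial>lborel)"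
proof -
  have u: "loc_int u" and g: "loc_int g" using wg by (auto simp: weak_grad_def)
  have "(\<integral>x. u x * frechet_derivative \<phi> (at x) h \<partial>lborel)
    = (\<integral>x. (\<Sum>i\<in>Basis. (h \<bullet> i) * (u x * frechet_derivative \<phi> (at x) i)) \<partial>lborel)"
    by (subst test_function_derivative_sum[OF \<phi>, of _ h]) (simp add: sum_distrib_left mult_ac)
  also have "\<dots> = (\<Sum>i\<in>Basis. (h \<bullet> i) * (\<integral>x. u x * frechet_derivative \<phi> (at x) i \<partial>lborel))"
    by (subst Bochner_Integration.integral_sum) (auto intro!: integrable_mult_right loc_int_test_function u \<phi>)
  also have "\<dots> = (\<Sum>i\<in>Basis. (h \<bullet> i) * - (\<integral>x. (g x \<bullet> i) * \<phi> x \<partial>lborel))"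
    using wg \<phi> by (auto simp: weak_grad_def intro!: sum.cong)
  also have "\<dots> = - (\<integral>x. (\<Sum>i\<in>Basis. (h \<bullet> i) * ((g x \<bullet> i) * \<phi> x)) \<partial>lborel)"
    by (subst Bochner_Integration.integral_sum)
      (auto intro!: integrable_mult_right loc_int_test_function loc_int_inner g \<phi> simp: sum_negf)
  also have "(\<lambda>x. \<Sum>i\<in>Basis. (h \<bullet> i) * ((g x \<bullet> i) * \<phi> x)) = (\<lambda>x. (g x \<bullet> h) * \<phi> x)"
    by (rule ext, subst (3) euclidean_inner) (simp add: sum_distrib_left sum_distrib_right mult_ac)
  finally show ?thesis .
qed

text \<open>The integral over [0, 1] in the form of an expectation, so that Jensen's inequality
  applies to mean values along a segment.\<close>

definition unit_measure :: "real measure" where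
  "unit_measure = density lborel (\<lambda>x. ennreal (indicator {0..1} x))"

lemma sets_unit_measure [simp, measurable_cong]: "sets unit_measure = sets borel"
  by (simp add: unit_measure_def)

lemma space_unit_measure [simp]: "space unit_measure = UNIV"
  by (simp add: unit_measure_def)

lemma prob_space_unit_measure: "prob_space unit_measure"
  by (rule prob_spaceI) (simp add: unit_measure_def emeasure_density ennreal_indicator)

lemma AE_unit_measure: "AE \<tau> in unit_measure. \<tau> \<in> {0..1}"
  unfolding unit_measure_def by (subst AE_density) (auto simp: indicator_def intro!: AE_I2)

lemma integral_unit_measure_derivative:
  fixes F f :: "real \<Rightarrow> real"
  assumes "\<And>\<tau>. (F has_real_derivative f \<tau>) (at \<tau>)" "\<And>\<tau>. isCont f \<tau>"
  shows "(\<integral>\<tau>. f \<tau> \<partial>unit_measure) = F 1 - F 0"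
proof -
  have [measurable]: "f \<in> borel_measurable borel"
    using assms(2) by (intro borel_measurable_continuous_onI continuous_at_imp_continuous_on) auto
  have "(\<integral>\<tau>. f \<tau> \<partial>unit_measure) = (\<integral>\<tau>. f \<tau> * indicator {0..1} \<tau> \<partial>lborel)"
    unfolding unit_measure_def by (subst integral_density) (auto simp: mult.commute)
  also have "\<dots> = F 1 - F 0"
    by (rule integral_FTC_Icc_real) (use assms in auto)
  finally show ?thesis .
qed

text \<open>Tested against \<^term>\<open>\<psi>\<close>, the difference of \<^term>\<open>u\<close> moves to
  \<^term>\<open>\<psi>\<close>, where it is the integral of a directional derivative.\<close>

lemma weak_grad_difference:
  fixes u :: "'a::euclidean_space \<Rightarrow> real"
  assumes wg: "weak_grad u g"
  shows "AE x in lborel. u (x + h) - u x = (\<integral>\<tau>. g (x + \<tau> *\<^sub>R h) \<bullet> h \<partial>unit_measure)"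
proof -
  interpret U: prob_space unit_measure by (rule prob_space_unit_measure)
  interpret P: pair_sigma_finite lborel unit_measure ..
  have u: "loc_int u" and g: "loc_int g" using wg by (auto simp: weak_grad_def)
  have [measurable]: "u \<in> borel_measurable borel" "g \<in> borel_measurable borel"
    using u g by (auto dest: loc_int_measurable)
  define W where "W x = (\<integral>\<tau>. g (x + \<tau> *\<^sub>R h) \<bullet> h \<partial>unit_measure)" for x
  have Wm[measurable]: "W \<in> borel_measurable borel"
    unfolding W_def[abs_def] by measurable
  \<comment> \<open>Moving a point by at most \<open>h\<close> enlarges the ball by
    \<open>norm h\<close>; this makes the mean along the segment locally integrable, and with it the
    right-hand side of the claim.\<close>
  have gh: "(\<integral>\<^sup>+x. norm (g (x + \<tau> *\<^sub>R h) \<bullet> h) * indicator (cball 0 R) x \<partial>lborel)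
      \<le> (\<integral>\<^sup>+x. norm (g x \<bullet> h) * indicator (cball 0 (R + norm h)) x \<partial>lborel)" if "\<tau> \<in> {0..1}" for \<tau> R
  proof -
    have "norm (x + \<tau> *\<^sub>R h) \<le> R + norm h" if "norm x \<le> R" for x
    proof -
      have "norm (\<tau> *\<^sub>R h) \<le> 1 * norm h" using \<open>\<tau> \<in> {0..1}\<close> by (simp add: mult_left_le_one_le)
      then show ?thesis using that by (intro norm_triangle_le) auto
    qed
    then have "(\<integral>\<^sup>+x. norm (g (x + \<tau> *\<^sub>R h) \<bullet> h) * indicator (cball 0 R) x \<partial>lborel)
      \<le> (\<integral>\<^sup>+x. norm (g (x + \<tau> *\<^sub>R h) \<bullet> h) * indicator (cball 0 (R + norm h)) (x + \<tau> *\<^sub>R h) \<partial>lborel)"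
      by (intro nn_integral_mono) (auto split: split_indicator)
    also have "\<dots> = (\<integral>\<^sup>+x. norm (g x \<bullet> h) * indicator (cball 0 (R + norm h)) x \<partial>lborel)"
      by (rule nn_integral_lborel_translate[where f="\<lambda>x. norm (g x \<bullet> h) * indicator (cball 0 (R + norm h)) x"]) measurable
    finally show ?thesis .
  qed
  have fin2: "(\<integral>\<^sup>+x. \<integral>\<^sup>+\<tau>. norm (g (x + \<tau> *\<^sub>R h) \<bullet> h) * indicator (cball 0 R) x \<partial>unit_measure \<partial>lborel) < \<infinity>" for R
  proof -
    have "(\<integral>\<^sup>+x. \<integral>\<^sup>+\<tau>. norm (g (x + \<tau> *\<^sub>R h) \<bullet> h) * indicator (cball 0 R) x \<partial>unit_measure \<partial>lborel)
      = (\<integral>\<^sup>+\<tau>. \<integral>\<^sup>+x. norm (g (x + \<tau> *\<^sub>R h) \<bullet> h) * indicator (cball 0 R) x \<partial>lborel \<partial>unit_measure)"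
      by (rule P.Fubini'[symmetric]) measurable
    also have "\<dots> \<le> (\<integral>\<^sup>+\<tau>. \<integral>\<^sup>+x. norm (g x \<bullet> h) * indicator (cball 0 (R + norm h)) x \<partial>lborel \<partial>unit_measure)"
      by (rule nn_integral_mono_AE) (use AE_unit_measure gh in \<open>auto elim: eventually_mono\<close>)
    also have "\<dots> = (\<integral>\<^sup>+x. norm (g x \<bullet> h) * indicator (cball 0 (R + norm h)) x \<partial>lborel)"
      using U.emeasure_space_1 by simp
    also have "\<dots> < \<infinity>" by (rule loc_int_nn_integral[OF loc_int_inner[OF g]])
    finally show ?thesis .
  qed
  have W: "loc_int W"
  proof (rule loc_intI)
    fix R
    have "norm (W x) * indicator (cball 0 R) x
      \<le> (\<integral>\<^sup>+\<tau>. norm (g (x + \<tau> *\<^sub>R h) \<bullet> h) * indicator (cball 0 R) x \<partial>unit_measure)" for x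
      using norm_integral_le_nn_integral[of unit_measure "\<lambda>\<tau>. g (x + \<tau> *\<^sub>R h) \<bullet> h"] unfolding W_def
      by (simp split: split_indicator)
    then have "(\<integral>\<^sup>+x. norm (W x) * indicator (cball 0 R) x \<partial>lborel)
        \<le> (\<integral>\<^sup>+x. \<integral>\<^sup>+\<tau>. norm (g (x + \<tau> *\<^sub>R h) \<bullet> h) * indicator (cball 0 R) x \<partial>unit_measure \<partial>lborel)"
      by (intro nn_integral_mono) auto
    then show "(\<integral>\<^sup>+x. norm (W x) * indicator (cball 0 R) x \<partial>lborel) < \<infinity>"
      using fin2[of R] by (rule order.strict_trans1)
  qed simp
  have uh: "loc_int (\<lambda>x. u (x + h) - u x)"
    by (intro loc_int_diff loc_int_translate u)
  have key: "(\<integral>x. (u (x + h) - u x) * box_bump n A B x \<partial>lborel) = (\<integral>x. W x * box_bump n A B x \<partial>lborel)" for n A B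
  proof -
    define \<psi> where "\<psi> = box_bump n A B"
    have \<psi>s: "(\<lambda>x. \<psi> (x - z)) \<in> test_functions" for z
      unfolding \<psi>_def by (rule box_bump_test_function)
    have \<psi>: "\<psi> \<in> test_functions" using \<psi>s[of 0] by simp
    have [measurable]: "\<psi> \<in> borel_measurable borel" using \<psi> by (rule borel_measurable_test_function)
    define D where "D x = frechet_derivative \<psi> (at x)" for x
    obtain R C where R: "0 < R" "0 \<le> C" and D: "\<And>x. (\<psi> has_derivative D x) (at x)"
      "\<And>x h. \<bar>D x h\<bar> \<le> C * norm h" "\<And>x. \<bar>\<psi> x\<bar> \<le> C"
      "\<And>x. norm x > R \<Longrightarrow> \<psi> x = 0" "\<And>x h. norm x > R \<Longrightarrow> D x h = 0"
      and cD: "\<And>h. continuous_on UNIV (\<lambda>x. D x h)"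
      using test_function_facts[OF \<psi>] unfolding D_def by metis
    have [measurable]: "(\<lambda>x. D x h) \<in> borel_measurable borel"
      using cD by (rule borel_measurable_continuous_onI)
    have Dshift: "frechet_derivative (\<lambda>x. \<psi> (x - z)) (at x) = D (x - z)" for x z
    proof -
      have "((\<lambda>x. x - z) has_derivative (\<lambda>h. h)) (at x)"
        by (auto intro!: derivative_eq_intros)
      from has_derivative_compose[OF this D(1)]
      have "((\<lambda>x. \<psi> (x - z)) has_derivative D (x - z)) (at x)" .
      from frechet_derivative_at[OF this] show ?thesis by simp
    qed
    have diff: "\<psi> (x - h) - \<psi> x = (\<integral>\<tau>. - D (x - \<tau> *\<^sub>R h) h \<partial>unit_measure)" for x
    proof -
      have "((\<lambda>\<tau>. \<psi> (x - \<tau> *\<^sub>R h)) has_real_derivative - D (x - \<tau> *\<^sub>R h) h) (at \<tau>)" for \<tau>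
      proof -
        have lin: "linear (D (x - \<tau> *\<^sub>R h))" using D(1) has_derivative_linear by blast
        have "((\<lambda>\<tau>. \<psi> (x - \<tau> *\<^sub>R h)) has_derivative (\<lambda>s. D (x - \<tau> *\<^sub>R h) (- (s *\<^sub>R h)))) (at \<tau>)"
          by (rule has_derivative_compose[OF _ D(1)]) (auto intro!: derivative_eq_intros)
        moreover have "(\<lambda>s. D (x - \<tau> *\<^sub>R h) (- (s *\<^sub>R h))) = (*) (- D (x - \<tau> *\<^sub>R h) h)"
          using linear_scale[OF lin] linear_neg[OF lin] by (auto simp: fun_eq_iff)
        ultimately show ?thesis by (simp add: has_field_derivative_def)
      qed
      moreover have "isCont (\<lambda>\<tau>. - D (x - \<tau> *\<^sub>R h) h) \<tau>" for \<tau>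
      proof -
        have "continuous_on UNIV (\<lambda>\<tau>. - D (x - \<tau> *\<^sub>R h) h)"
          by (intro continuous_intros continuous_on_compose2[OF cD[of h]]) auto
        then show ?thesis by (simp add: continuous_on_eq_continuous_at)
      qed
      ultimately show ?thesis
        using integral_unit_measure_derivative[of "\<lambda>\<tau>. \<psi> (x - \<tau> *\<^sub>R h)" "\<lambda>\<tau>. - D (x - \<tau> *\<^sub>R h) h"] by simp
    qed
    have far: "norm (x - \<tau> *\<^sub>R h) > R" if "norm x > R + norm h" "\<tau> \<in> {0..1}" for x \<tau>
    proof -
      have "norm (\<tau> *\<^sub>R h) \<le> 1 * norm h" using that(2) by (simp add: mult_left_le_one_le)
      then show ?thesis using norm_triangle_ineq2[of x "\<tau> *\<^sub>R h"] that(1) by linarith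
    qed
    have pm1: "(\<lambda>(x, \<tau>). u x * - D (x - \<tau> *\<^sub>R h) h) \<in> borel_measurable (lborel \<Otimes>\<^sub>M unit_measure)"
    proof -
      have "(\<lambda>p. u (fst p) * - (\<lambda>x. D x h) (fst p - snd p *\<^sub>R h)) \<in> borel_measurable (lborel \<Otimes>\<^sub>M unit_measure)"
        by measurable
      then show ?thesis by (simp add: case_prod_beta')
    qed
    have pi1: "integrable (lborel \<Otimes>\<^sub>M unit_measure) (\<lambda>(x, \<tau>). u x * - D (x - \<tau> *\<^sub>R h) h)"
    proof -
      have "(\<integral>\<^sup>+x. \<integral>\<^sup>+\<tau>. norm (u x * - D (x - \<tau> *\<^sub>R h) h) \<partial>unit_measure \<partial>lborel)
        \<le> (\<integral>\<^sup>+x. \<integral>\<^sup>+\<tau>. (C * norm h) * (norm (u x) * indicator (cball 0 (R + norm h)) x) \<partial>unit_measure \<partial>lborel)"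
      proof (rule nn_integral_mono, rule nn_integral_mono_AE, rule eventually_mono[OF AE_unit_measure])
        fix x \<tau> assume \<tau>: "\<tau> \<in> {0..1::real}"
        have "norm (u x * - D (x - \<tau> *\<^sub>R h) h) \<le> (C * norm h) * (norm (u x) * indicator (cball 0 (R + norm h)) x)"
        proof (cases "norm x > R + norm h")
          case True
          then show ?thesis using D(5)[OF far[OF True \<tau>]] by simp
        next
          case False
          then have "norm (u x) * \<bar>D (x - \<tau> *\<^sub>R h) h\<bar> \<le> norm (u x) * (C * norm h)"
            by (intro mult_left_mono D(2)) auto
          with False show ?thesis by (simp add: abs_mult mult_ac)
        qed
        then show "ennreal (norm (u x * - D (x - \<tau> *\<^sub>R h) h)) \<le> (C * norm h) * (norm (u x) * indicator (cball 0 (R + norm h)) x)"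
          by (rule ennreal_leI)
      qed
      also have "\<dots> = (C * norm h) * (\<integral>\<^sup>+x. norm (u x) * indicator (cball 0 (R + norm h)) x \<partial>lborel)"
        using U.emeasure_space_1 R by (simp add: nn_integral_cmult ennreal_mult)
      also have "\<dots> < \<infinity>"
        using loc_int_nn_integral[OF u, of "R + norm h"] by (simp add: ennreal_mult_less_top)
      finally show ?thesis
        using pm1 by (simp add: integrable_iff_bounded U.nn_integral_fst[symmetric] case_prod_beta')
    qed
    have pm2: "(\<lambda>(x, \<tau>). (g (x + \<tau> *\<^sub>R h) \<bullet> h) * \<psi> x) \<in> borel_measurable (lborel \<Otimes>\<^sub>M unit_measure)"
      by measurable
    have pi2: "integrable (lborel \<Otimes>\<^sub>M unit_measure) (\<lambda>(x, \<tau>). (g (x + \<tau> *\<^sub>R h) \<bullet> h) * \<psi> x)"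
    proof -
      have "(\<integral>\<^sup>+x. \<integral>\<^sup>+\<tau>. norm ((g (x + \<tau> *\<^sub>R h) \<bullet> h) * \<psi> x) \<partial>unit_measure \<partial>lborel)
        \<le> (\<integral>\<^sup>+x. \<integral>\<^sup>+\<tau>. C * (norm (g (x + \<tau> *\<^sub>R h) \<bullet> h) * indicator (cball 0 R) x) \<partial>unit_measure \<partial>lborel)"
      proof (intro nn_integral_mono)
        fix x \<tau>
        have "norm ((g (x + \<tau> *\<^sub>R h) \<bullet> h) * \<psi> x) \<le> C * (norm (g (x + \<tau> *\<^sub>R h) \<bullet> h) * indicator (cball 0 R) x)"
        proof (cases "norm x > R")
          case True
          then show ?thesis using D(4) by simp
        next
          case False
          have "norm (g (x + \<tau> *\<^sub>R h) \<bullet> h) * \<bar>\<psi> x\<bar> \<le> norm (g (x + \<tau> *\<^sub>R h) \<bullet> h) * C"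
            by (intro mult_left_mono D(3)) auto
          with False show ?thesis by (simp add: abs_mult mult_ac)
        qed
        then show "ennreal (norm ((g (x + \<tau> *\<^sub>R h) \<bullet> h) * \<psi> x))
            \<le> C * (norm (g (x + \<tau> *\<^sub>R h) \<bullet> h) * indicator (cball 0 R) x)"
          by (rule ennreal_leI)
      qed
      also have "\<dots> = C * (\<integral>\<^sup>+x. \<integral>\<^sup>+\<tau>. norm (g (x + \<tau> *\<^sub>R h) \<bullet> h) * indicator (cball 0 R) x \<partial>unit_measure \<partial>lborel)"
        using R by (simp add: nn_integral_cmult ennreal_mult)
      also have "\<dots> < \<infinity>" using fin2[of R] by (simp add: ennreal_mult_less_top)
      finally show ?thesis
        using pm2 by (simp add: integrable_iff_bounded U.nn_integral_fst[symmetric] case_prod_beta')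
    qed
    have i1: "integrable lborel (\<lambda>x. u (x + h) * \<psi> x)" "integrable lborel (\<lambda>x. u x * \<psi> x)"
      "integrable lborel (\<lambda>x. u x * \<psi> (x - h))"
      by (intro loc_int_test_function loc_int_translate u \<psi> \<psi>s)+
    have "(\<integral>x. (u (x + h) - u x) * \<psi> x \<partial>lborel) = (\<integral>x. u (x + h) * \<psi> x \<partial>lborel) - (\<integral>x. u x * \<psi> x \<partial>lborel)"
      using i1 by (simp add: left_diff_distrib)
    also have "(\<integral>x. u (x + h) * \<psi> x \<partial>lborel) = (\<integral>x. u x * \<psi> (x - h) \<partial>lborel)"
      using integral_lborel_translate[of "\<lambda>x. u x * \<psi> (x - h)" h] by simp
    also have "\<dots> - (\<integral>x. u x * \<psi> x \<partial>lborel) = (\<integral>x. u x * (\<psi> (x - h) - \<psi> x) \<partial>lborel)"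
      using i1 by (simp add: right_diff_distrib)
    also have "\<dots> = (\<integral>x. (\<integral>\<tau>. u x * - D (x - \<tau> *\<^sub>R h) h \<partial>unit_measure) \<partial>lborel)"
      by (simp add: diff)
    also have "\<dots> = (\<integral>\<tau>. (\<integral>x. u x * - D (x - \<tau> *\<^sub>R h) h \<partial>lborel) \<partial>unit_measure)"
      using P.Fubini_integral[OF pi1] by simp
    also have "\<dots> = (\<integral>\<tau>. (\<integral>x. (g (x + \<tau> *\<^sub>R h) \<bullet> h) * \<psi> x \<partial>lborel) \<partial>unit_measure)"
    proof (rule Bochner_Integration.integral_cong[OF refl])
      fix \<tau> :: real
      have "(\<integral>x. u x * - D (x - \<tau> *\<^sub>R h) h \<partial>lborel) = (\<integral>x. (g x \<bullet> h) * \<psi> (x - \<tau> *\<^sub>R h) \<partial>lborel)"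
        using weak_grad_direction[OF wg \<psi>s[of "\<tau> *\<^sub>R h"], of h] by (simp add: Dshift)
      also have "\<dots> = (\<integral>x. (g (x + \<tau> *\<^sub>R h) \<bullet> h) * \<psi> x \<partial>lborel)"
        using integral_lborel_translate[of "\<lambda>x. (g x \<bullet> h) * \<psi> (x - \<tau> *\<^sub>R h)" "\<tau> *\<^sub>R h"] by simp
      finally show "(\<integral>x. u x * - D (x - \<tau> *\<^sub>R h) h \<partial>lborel) = (\<integral>x. (g (x + \<tau> *\<^sub>R h) \<bullet> h) * \<psi> x \<partial>lborel)" .
    qed
    also have "\<dots> = (\<integral>x. (\<integral>\<tau>. (g (x + \<tau> *\<^sub>R h) \<bullet> h) * \<psi> x \<partial>unit_measure) \<partial>lborel)"
      using P.Fubini_integral[OF pi2] by simp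
    also have "\<dots> = (\<integral>x. W x * \<psi> x \<partial>lborel)" by (simp add: W_def)
    finally show ?thesis by (simp add: \<psi>_def)
  qed
  have "AE x in lborel. u (x + h) - u x - W x = 0"
  proof (rule fundamental_lemma_variations)
    show "loc_int (\<lambda>x. u (x + h) - u x - W x)" by (rule loc_int_diff[OF uh W])
    fix n and A B :: 'a
    have "(\<lambda>x. box_bump n A B x) \<in> test_functions" using box_bump_test_function[of n A B 0] by simp
    then show "(\<integral>x. (u (x + h) - u x - W x) * box_bump n A B x \<partial>lborel) = 0"
      using key[of n A B] loc_int_test_function(1)[OF uh] loc_int_test_function(1)[OF W]
      by (simp add: left_diff_distrib[of _ "W _"])
  qed
  then show ?thesis by (simp add: W_def)
qed

lemma weak_grad_unique:
  fixes u :: "'a::euclidean_space \<Rightarrow> real"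
  assumes "weak_grad u g" "weak_grad u g'"
  shows "AE x in lborel. g x = g' x"
proof -
  have "AE x in lborel. g x \<bullet> i - g' x \<bullet> i = 0" if i: "i \<in> Basis" for i
  proof (rule fundamental_lemma_variations)
    show "loc_int (\<lambda>x. g x \<bullet> i - g' x \<bullet> i)"
      using assms by (auto simp: weak_grad_def intro!: loc_int_diff loc_int_inner)
    fix n and A B :: 'a
    have t: "(\<lambda>x. box_bump n A B x) \<in> test_functions" using box_bump_test_function[of n A B 0] by simp
    then have "(\<integral>x. (g x \<bullet> i) * box_bump n A B x \<partial>lborel) = (\<integral>x. (g' x \<bullet> i) * box_bump n A B x \<partial>lborel)"
      using assms i by (auto simp: weak_grad_def dest!: bspec)
    moreover have "integrable lborel (\<lambda>x. (g x \<bullet> i) * box_bump n A B x)" "integrable lborel (\<lambda>x. (g' x \<bullet> i) * box_bump n A B x)"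
      using assms t by (auto simp: weak_grad_def intro!: loc_int_test_function loc_int_inner)
    ultimately show "(\<integral>x. (g x \<bullet> i - g' x \<bullet> i) * box_bump n A B x \<partial>lborel) = 0"
      by (simp add: left_diff_distrib)
  qed
  then have "AE x in lborel. \<forall>i\<in>Basis. g x \<bullet> i - g' x \<bullet> i = 0" by (intro AE_finite_allI) auto
  then show ?thesis by (rule eventually_mono) (auto intro: euclidean_eqI)
qed

section \<open>Passage between Lebesgue and Borel measurable functions\<close>

lemma lebesgue_measurable_ex_borel:
  fixes f :: "'a::euclidean_space \<Rightarrow> 'b::euclidean_space"
  assumes "f \<in> borel_measurable lebesgue"
  obtains f' where "f' \<in> borel_measurable borel" "AE x in lborel. f x = f' x"
proof -
  have "\<exists>f'\<in>borel_measurable lborel. AE x in lborel. f x \<bullet> i = f' x" for i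
    by (rule completion_ex_borel_measurable_real) (use assms in measurable)
  then obtain F where F: "\<And>i. F i \<in> borel_measurable lborel" "\<And>i. AE x in lborel. f x \<bullet> i = F i x" by metis
  have [measurable]: "F i \<in> borel_measurable borel" for i using F(1)[of i] by simp
  show ?thesis
  proof
    show "(\<lambda>x. \<Sum>i\<in>Basis. F i x *\<^sub>R i) \<in> borel_measurable borel" by measurable
    have "AE x in lborel. \<forall>i\<in>Basis. f x \<bullet> i = F i x" using F(2) by (intro AE_finite_allI) auto
    then show "AE x in lborel. f x = (\<Sum>i\<in>Basis. F i x *\<^sub>R i)"
    proof (rule eventually_mono)
      fix x assume "\<forall>i\<in>Basis. f x \<bullet> i = F i x"
      then show "f x = (\<Sum>i\<in>Basis. F i x *\<^sub>R i)"
        by (subst euclidean_representation[of "f x", symmetric]) (auto intro: sum.cong)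
    qed
  qed
qed

text \<open>Integrability on compact sets yields measurability of the truncations to balls, and
  \<open>f\<close> is their pointwise limit.\<close>

lemma locally_integrable_measurable:
  fixes f :: "'a::euclidean_space \<Rightarrow> 'b::euclidean_space"
  assumes "locally_integrable f"
  shows "f \<in> borel_measurable lebesgue"
proof (rule borel_measurable_LIMSEQ_metric)
  fix n :: nat
  show "(\<lambda>x. indicator (cball 0 (real n)) x *\<^sub>R f x) \<in> borel_measurable lebesgue"
    using assms unfolding locally_integrable_def set_integrable_def
    by (blast intro: borel_measurable_integrable compact_cball)
next
  fix x :: 'a
  obtain N :: nat where "norm x \<le> real N" using real_arch_simple by blast
  then have "\<forall>\<^sub>F n in sequentially. indicator (cball 0 (real n)) x *\<^sub>R f x = f x"
    by (auto simp: eventually_sequentially intro!: exI[of _ N] split: split_indicator)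
  then show "(\<lambda>n. indicator (cball 0 (real n)) x *\<^sub>R f x) \<longlonglongrightarrow> f x"
    by (rule tendsto_eventually)
qed

lemma integral_lebesgue_cong:
  fixes f g :: "'a::euclidean_space \<Rightarrow> real"
  assumes "AE x in lborel. f x = g x" "g \<in> borel_measurable borel" "f \<in> borel_measurable lebesgue"
  shows "(\<integral>x. f x \<partial>lebesgue) = (\<integral>x. g x \<partial>lborel)"
proof -
  have "(\<integral>x. f x \<partial>lebesgue) = (\<integral>x. g x \<partial>lebesgue)"
    using assms by (intro integral_cong_AE) (auto intro: AE_completion measurable_completion)
  then show ?thesis using assms(2) by (simp add: integral_completion)
qed

lemma locally_integrable_loc_int:
  assumes "locally_integrable f" "f' \<in> borel_measurable borel" "AE x in lborel. f x = f' x"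
  shows "loc_int f'"
  unfolding loc_int_def
proof (intro conjI allI)
  fix R
  have i: "integrable lebesgue (\<lambda>x. indicator (cball 0 R) x *\<^sub>R f x)"
    using assms by (auto simp: locally_integrable_def set_integrable_def)
  have ae: "AE x in lebesgue. indicator (cball 0 R) x *\<^sub>R f x = indicator (cball 0 R) x *\<^sub>R f' x"
    using AE_completion[OF assms(3)] by (rule eventually_mono) simp
  have m: "(\<lambda>x. indicator (cball 0 R) x *\<^sub>R f' x) \<in> borel_measurable lborel"
    using assms(2) by simp
  have "integrable lebesgue (\<lambda>x. indicator (cball 0 R) x *\<^sub>R f' x)"
    using integrable_cong_AE[OF borel_measurable_integrable[OF i] measurable_completion[OF m] ae] i by blast
  then show "set_integrable lborel (cball 0 R) f'"
    using integrable_completion[OF m] by (simp add: set_integrable_def)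
qed (rule assms)

lemma loc_int_locally_integrable:
  assumes f: "loc_int f"
  shows "locally_integrable f"
  unfolding locally_integrable_def
proof (intro allI impI)
  fix K :: "'a set" assume K: "compact K"
  have "set_integrable lborel K f"
    using K by (intro loc_int_set_integrable[OF f] compact_imp_bounded borel_compact)
  moreover have "(\<lambda>x. indicator K x *\<^sub>R f x) \<in> borel_measurable lborel"
    using loc_int_measurable[OF f] borel_compact[OF K] by simp
  ultimately show "f absolutely_integrable_on K"
    using integrable_completion[of "\<lambda>x. indicator K x *\<^sub>R f x" lborel] by (simp add: set_integrable_def)
qed

lemma weak_grad_has_weak_gradient:
  assumes wg: "weak_grad u g"
  shows "has_weak_gradient u g"
proof -
  have u: "loc_int u" and g: "loc_int g" using wg by (auto simp: weak_grad_def)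
  note [measurable] = loc_int_measurable[OF u] loc_int_measurable[OF g]
  have "(\<integral>x. u x * frechet_derivative \<phi> (at x) i \<partial>lebesgue) = - (\<integral>x. (g x \<bullet> i) * \<phi> x \<partial>lebesgue)"
    if \<phi>: "\<phi> \<in> test_functions" and i: "i \<in> Basis" for \<phi> i
  proof -
    note [measurable] = borel_measurable_test_function[OF \<phi>] borel_measurable_test_function_derivative[OF \<phi>]
    show ?thesis using wg \<phi> i by (simp add: integral_completion weak_grad_def)
  qed
  then show ?thesis
    using u g by (simp add: has_weak_gradient_def loc_int_locally_integrable)
qed

text \<open>The Borel representative of \<open>u\<close> stays free, because two different gradients
  have to be attached to one and the same representative before uniqueness can compare them.\<close>

lemma has_weak_gradient_borel:
  fixes u :: "'a::euclidean_space \<Rightarrow> real"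
  assumes h: "has_weak_gradient u g"
  obtains g' where "g' \<in> borel_measurable borel" "AE x in lborel. g x = g' x"
    "\<And>u'. u' \<in> borel_measurable borel \<Longrightarrow> AE x in lborel. u x = u' x \<Longrightarrow> weak_grad u' g'"
proof -
  have l: "locally_integrable u" "locally_integrable g" using h by (auto simp: has_weak_gradient_def)
  note m = locally_integrable_measurable[OF l(1)] locally_integrable_measurable[OF l(2)]
  obtain g' where g': "g' \<in> borel_measurable borel" "AE x in lborel. g x = g' x"
    using lebesgue_measurable_ex_borel[OF m(2)] by blast
  show ?thesis
  proof (rule that[OF g'])
    fix u' assume u': "u' \<in> borel_measurable borel" "AE x in lborel. u x = u' x"
    show "weak_grad u' g'"
      unfolding weak_grad_def
    proof (intro conjI ballI)
      fix \<phi> :: "'a \<Rightarrow> real" and i assume \<phi>: "\<phi> \<in> test_functions" and i: "i \<in> (Basis :: 'a set)"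
      note bm = borel_measurable_test_function[OF \<phi>] borel_measurable_test_function_derivative[OF \<phi>, of i]
      have lm: "\<phi> \<in> borel_measurable lebesgue" "(\<lambda>x. frechet_derivative \<phi> (at x) i) \<in> borel_measurable lebesgue"
        using bm by (auto intro: measurable_completion)
      have "(\<integral>x. u x * frechet_derivative \<phi> (at x) i \<partial>lebesgue) = (\<integral>x. u' x * frechet_derivative \<phi> (at x) i \<partial>lborel)"
        by (rule integral_lebesgue_cong)
          (use u' bm m lm in \<open>auto elim: eventually_mono\<close>)
      moreover have "(\<integral>x. (g x \<bullet> i) * \<phi> x \<partial>lebesgue) = (\<integral>x. (g' x \<bullet> i) * \<phi> x \<partial>lborel)"
        by (rule integral_lebesgue_cong)
          (use g' bm m lm in \<open>auto elim: eventually_mono\<close>)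
      ultimately show "(\<integral>x. u' x * frechet_derivative \<phi> (at x) i \<partial>lborel) = - (\<integral>x. (g' x \<bullet> i) * \<phi> x \<partial>lborel)"
        using h \<phi> i by (simp add: has_weak_gradient_def)
    qed (use locally_integrable_loc_int l u' g' in auto)
  qed
qed

section \<open>Convex combinations converging almost everywhere\<close>

text \<open>Dyadic convex combinations of members with index at least \<open>k\<close>. Iterated
  midpoints are enough: the convexity inequalities in use are midpoint inequalities, and the Cauchy
  argument averages only two functions at a time.\<close>

inductive midconv :: "(nat \<Rightarrow> 'a \<Rightarrow> 'b::real_vector) \<Rightarrow> nat \<Rightarrow> ('a \<Rightarrow> 'b) \<Rightarrow> bool" for G k where
  base: "k \<le> n \<Longrightarrow> midconv G k (G n)"
| mid: "midconv G k f \<Longrightarrow> midconv G k g \<Longrightarrow> midconv G k (\<lambda>x. (1 / 2) *\<^sub>R (f x + g x))"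

lemma midconv_antimono:
  assumes "midconv G n f" "k \<le> n"
  shows "midconv G k f"
  using assms by induction (auto intro: midconv.intros)

lemma midconv_measurable:
  fixes G :: "nat \<Rightarrow> 'a \<Rightarrow> 'b::euclidean_space"
  assumes "midconv G k f" "\<And>n. G n \<in> borel_measurable M"
  shows "f \<in> borel_measurable M"
  using assms by induction auto

lemma midconv_nn_integral_le:
  fixes G :: "nat \<Rightarrow> 'a \<Rightarrow> 'b::euclidean_space" and \<Phi> :: "'b \<Rightarrow> ennreal"
  assumes f: "midconv G k f"
    and G[measurable]: "\<And>n. G n \<in> borel_measurable M" and [measurable]: "\<Phi> \<in> borel_measurable borel"
    and conv: "\<And>a b. \<Phi> ((1 / 2) *\<^sub>R (a + b)) \<le> (\<Phi> a + \<Phi> b) / 2"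
    and le: "\<And>n. k \<le> n \<Longrightarrow> (\<integral>\<^sup>+x. \<Phi> (G n x) \<partial>M) \<le> c"
  shows "(\<integral>\<^sup>+x. \<Phi> (f x) \<partial>M) \<le> c"
  using f
proof induction
  case (mid f g)
  note [measurable] = midconv_measurable[OF mid(1) G] midconv_measurable[OF mid(2) G]
  have "(\<integral>\<^sup>+x. \<Phi> ((1 / 2) *\<^sub>R (f x + g x)) \<partial>M) \<le> (\<integral>\<^sup>+x. (\<Phi> (f x) + \<Phi> (g x)) / 2 \<partial>M)"
    by (intro nn_integral_mono conv)
  also have "\<dots> = ((\<integral>\<^sup>+x. \<Phi> (f x) \<partial>M) + (\<integral>\<^sup>+x. \<Phi> (g x) \<partial>M)) / 2"
    by (simp add: nn_integral_divide nn_integral_add)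
  also have "\<dots> \<le> (c + c) / 2"
    by (intro divide_right_mono_ennreal add_mono mid.IH)
  also have "\<dots> = c"
    using ennreal_times_divide[of c 2 2] by (simp flip: mult_2 add: mult.commute)
  finally show ?case .
qed (rule le)

text \<open>Since \<open>ennreal\<close> truncates negative numbers,
  \<open>ennreal (norm a - K)\<close> is the excess of the norm over \<open>K\<close>, a convex
  function. Its integral measures uniform integrability and is stable under midpoints.\<close>

lemma norm_excess_midpoint:
  fixes a b :: "'b::real_normed_vector"
  shows "ennreal (norm ((1 / 2) *\<^sub>R (a + b)) - K) \<le> (ennreal (norm a - K) + ennreal (norm b - K)) / 2"
proof -
  have "norm ((1 / 2) *\<^sub>R (a + b)) - K \<le> (max 0 (norm a - K) + max 0 (norm b - K)) / 2"
    using norm_triangle_ineq[of a b] by simp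
  then have "ennreal (norm ((1 / 2) *\<^sub>R (a + b)) - K) \<le> ennreal ((max 0 (norm a - K) + max 0 (norm b - K)) / 2)"
    by (rule ennreal_leI)
  also have "\<dots> = (ennreal (norm a - K) + ennreal (norm b - K)) / 2"
    by (subst divide_ennreal[symmetric, of _ 2, simplified]) (simp_all add: ennreal_max_0)
  finally show ?thesis .
qed

lemma ennreal_le_add_excess:
  assumes "0 \<le> K"
  shows "ennreal a \<le> ennreal K + ennreal (a - K)"
proof (cases "K \<le> a")
  case True
  then have "ennreal K + ennreal (a - K) = ennreal a"
    using assms by (subst ennreal_plus[symmetric]) auto
  then show ?thesis by simp
next
  case False
  then have "ennreal a \<le> ennreal K" by (intro ennreal_leI) simp
  then show ?thesis by (rule add_increasing2[rotated]) simp
qed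

text \<open>Almost minimisers of the integral of \<open>bracket\<close> among the convex combinations of the tails
  form a Cauchy sequence: \<open>bracket\<close> has linear growth and is uniformly convex on bounded sets.\<close>

definition bracket :: "'b::real_inner \<Rightarrow> real" where
  "bracket a = sqrt (1 + (norm a)\<^sup>2)"

definition bracket_gap :: "'b::real_inner \<Rightarrow> 'b \<Rightarrow> real" where
  "bracket_gap a b = bracket a + bracket b - 2 * bracket ((1 / 2) *\<^sub>R (a + b))"

lemma bracket_bounds: "1 \<le> bracket a" "bracket a \<le> 1 + norm a" "0 \<le> bracket a"
proof -
  show "1 \<le> bracket a" by (simp add: bracket_def)
  then show "0 \<le> bracket a" by linarith
  show "bracket a \<le> 1 + norm a"
    unfolding bracket_def by (intro real_le_lsqrt) (auto simp: power2_eq_square algebra_simps)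
qed

lemma borel_measurable_bracket [measurable]: "bracket \<in> borel_measurable borel"
  unfolding bracket_def by measurable

text \<open>\<open>bracket a\<close> is the length of the vector (1, a). Multiplying by the two
  conjugate factors removes the square roots and leaves the Gram determinant of (1, a) and (1, b),
  which by Cauchy-Schwarz is at least the squared distance of a and b.\<close>

lemma bracket_gap_product:
  "(norm (a - b))\<^sup>2 \<le> bracket_gap a b * ((bracket a * bracket b + 1 + a \<bullet> b) * (bracket a + bracket b + 2 * bracket ((1 / 2) *\<^sub>R (a + b)))) / 2"
proof -
  let ?m = "2 * bracket ((1 / 2) *\<^sub>R (a + b))" and ?S = "bracket a + bracket b"
  have sq: "(bracket c)\<^sup>2 = 1 + c \<bullet> c" for c :: 'a
    by (simp add: bracket_def power2_norm_eq_inner)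
  have m2: "?m\<^sup>2 = 4 + (a + b) \<bullet> (a + b)"
    by (simp add: power_mult_distrib sq)
  have S2: "?S\<^sup>2 = 2 + a \<bullet> a + b \<bullet> b + 2 * (bracket a * bracket b)"
    by (simp add: power2_sum sq)
  have d: "?S\<^sup>2 - ?m\<^sup>2 = 2 * (bracket a * bracket b - (1 + a \<bullet> b))"
    unfolding m2 S2 by (simp add: inner_add_left inner_add_right inner_commute)
  have "(bracket a * bracket b - (1 + a \<bullet> b)) * (bracket a * bracket b + 1 + a \<bullet> b)
    = (bracket a)\<^sup>2 * (bracket b)\<^sup>2 - (1 + a \<bullet> b)\<^sup>2"
    by (simp add: power2_eq_square algebra_simps)
  also have "\<dots> = (norm (a - b))\<^sup>2 + ((a \<bullet> a) * (b \<bullet> b) - (a \<bullet> b)\<^sup>2)"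
    unfolding sq power2_norm_eq_inner
    by (simp add: inner_diff_left inner_diff_right inner_commute power2_eq_square algebra_simps)
  also have "\<dots> \<ge> (norm (a - b))\<^sup>2" using Cauchy_Schwarz_ineq[of a b] by simp
  finally have "(norm (a - b))\<^sup>2 \<le> (?S\<^sup>2 - ?m\<^sup>2) / 2 * (bracket a * bracket b + 1 + a \<bullet> b)"
  proof -
    have "(?S\<^sup>2 - ?m\<^sup>2) / 2 = bracket a * bracket b - (1 + a \<bullet> b)" unfolding d by simp
    then show "(norm (a - b))\<^sup>2 \<le> (bracket a * bracket b - (1 + a \<bullet> b)) * (bracket a * bracket b + 1 + a \<bullet> b)
      \<Longrightarrow> ?thesis" by (simp only:)
  qed
  also have "?S\<^sup>2 - ?m\<^sup>2 = bracket_gap a b * (?S + ?m)"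
    by (simp add: bracket_gap_def power2_eq_square algebra_simps)
  finally show ?thesis by (simp add: mult_ac)
qed

lemma bracket_product_ge: "1 + \<bar>a \<bullet> b\<bar> \<le> bracket a * bracket b"
proof (rule power2_le_imp_le)
  have sq: "(bracket c)\<^sup>2 = 1 + c \<bullet> c" for c :: 'a
    by (simp add: bracket_def power2_norm_eq_inner)
  have "2 * \<bar>a \<bullet> b\<bar> \<le> a \<bullet> a + b \<bullet> b"
    using inner_ge_zero[of "a - b"] inner_ge_zero[of "a + b"]
    by (simp add: inner_diff_left inner_diff_right inner_add_left inner_add_right inner_commute abs_le_iff)
  then show "(1 + \<bar>a \<bullet> b\<bar>)\<^sup>2 \<le> (bracket a * bracket b)\<^sup>2"
    using Cauchy_Schwarz_ineq[of a b]
    unfolding power_mult_distrib sq by (simp add: power2_eq_square algebra_simps)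
qed (simp add: bracket_bounds)

lemma bracket_gap_nonneg: "0 \<le> bracket_gap a b"
proof -
  have "0 < (bracket a * bracket b + 1 + a \<bullet> b) * (bracket a + bracket b + 2 * bracket ((1 / 2) *\<^sub>R (a + b)))"
    using bracket_product_ge[of a b] bracket_bounds(1)[of a] bracket_bounds(1)[of b] bracket_bounds(1)[of "(1 / 2) *\<^sub>R (a + b)"]
    by (intro mult_pos_pos) linarith+
  moreover have "0 \<le> bracket_gap a b * ((bracket a * bracket b + 1 + a \<bullet> b) * (bracket a + bracket b + 2 * bracket ((1 / 2) *\<^sub>R (a + b))))"
    using bracket_gap_product[of a b] zero_le_power2[of "norm (a - b)"] by linarith
  ultimately show ?thesis by (simp add: zero_le_mult_iff)
qed

text \<open>Uniform convexity on the ball of radius \<open>M\<close>: the conjugate factors are at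
  most 2 (1 + M)^2 and 4 (1 + M), and half their product is the constant.\<close>

lemma bracket_gap_ge:
  assumes "norm a \<le> M" "norm b \<le> M"
  shows "(norm (a - b))\<^sup>2 \<le> 4 * (1 + M) ^ 3 * bracket_gap a b"
proof -
  have M: "0 \<le> M" using assms norm_ge_zero order_trans by blast
  have b1: "bracket a \<le> 1 + M" "bracket b \<le> 1 + M" using bracket_bounds(2) assms by (meson add_left_mono order_trans)+
  have "norm ((1 / 2) *\<^sub>R (a + b)) \<le> M" using norm_triangle_ineq[of a b] assms by simp
  then have b2: "bracket ((1 / 2) *\<^sub>R (a + b)) \<le> 1 + M" using bracket_bounds(2) by (meson add_left_mono order_trans)
  have bb: "bracket a * bracket b \<le> (1 + M) * (1 + M)"
    using b1 M by (intro mult_mono) (auto simp: bracket_bounds)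
  have "(bracket a * bracket b + 1 + a \<bullet> b) * (bracket a + bracket b + 2 * bracket ((1 / 2) *\<^sub>R (a + b)))
      \<le> (2 * ((1 + M) * (1 + M))) * (4 * (1 + M))"
    using bb b1 b2 bracket_product_ge[of a b] M
    by (intro mult_mono) (auto simp: bracket_bounds add_nonneg_nonneg)
  then have "bracket_gap a b * ((bracket a * bracket b + 1 + a \<bullet> b) * (bracket a + bracket b + 2 * bracket ((1 / 2) *\<^sub>R (a + b)))) / 2
      \<le> bracket_gap a b * ((2 * ((1 + M) * (1 + M))) * (4 * (1 + M))) / 2"
    using bracket_gap_nonneg[of a b] by (intro divide_right_mono mult_left_mono) auto
  with bracket_gap_product[of a b]
  have "(norm (a - b))\<^sup>2 \<le> bracket_gap a b * ((2 * ((1 + M) * (1 + M))) * (4 * (1 + M))) / 2" by linarith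
  also have "\<dots> = 4 * (1 + M) ^ 3 * bracket_gap a b" by (simp add: power3_eq_cube algebra_simps)
  finally show ?thesis .
qed

text \<open>If a norm exceeds 2 K, it is at most twice its excess over \<open>K\<close>, and the
  larger of the two norms pays for both: hence the factor 4. Otherwise uniform convexity on the ball
  of radius 2 K applies, weighted by \<open>e\<close> to pass from the square to the first
  power.\<close>

lemma norm_diff_le_gap:
  fixes a b :: "'b::real_inner"
  assumes K: "0 \<le> K" and e: "0 < e"
  shows "norm (a - b) \<le> 4 * max 0 (norm a - K) + 4 * max 0 (norm b - K) + e + 4 * (1 + 2 * K) ^ 3 / e * bracket_gap a b"
proof -
  have g: "0 \<le> 4 * (1 + 2 * K) ^ 3 / e * bracket_gap a b"
    using K e bracket_gap_nonneg[of a b] by simp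
  show ?thesis
  proof (cases "norm a \<le> 2 * K \<and> norm b \<le> 2 * K")
    case True
    let ?n = "norm (a - b)"
    have "?n \<le> e + ?n\<^sup>2 / e"
    proof (cases "?n \<le> e")
      case True
      have "0 \<le> ?n\<^sup>2 / e" using e by simp
      with True show ?thesis by linarith
    next
      case False
      then have "?n * e \<le> ?n * ?n" by (intro mult_left_mono) auto
      then have "?n \<le> ?n\<^sup>2 / e" using e by (simp add: field_simps power2_eq_square)
      then show ?thesis using e by linarith
    qed
    also have "?n\<^sup>2 / e \<le> (4 * (1 + 2 * K) ^ 3 * bracket_gap a b) / e"
      using bracket_gap_ge[of a "2 * K" b] True e by (intro divide_right_mono) auto
    finally have "?n \<le> e + 4 * (1 + 2 * K) ^ 3 / e * bracket_gap a b" by simp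
    then show ?thesis by (rule order_trans) simp
  next
    case False
    have "norm (a - b) \<le> norm a + norm b" by (rule norm_triangle_ineq4)
    then show ?thesis using False e g by (auto simp: max_def)
  qed
qed

text \<open>This takes the place of the Dunford-Pettis theorem. The infima of \<open>J\<close> over
  the tails increase and are bounded, hence converge. The midpoint of two almost minimisers still
  competes in the earlier tail, so their convexity gap is small, and with it their distance in
  mean.\<close>

lemma (in prob_space) ui_midconv_limit:
  fixes G :: "nat \<Rightarrow> 'a \<Rightarrow> 'b::euclidean_space"
  assumes G[measurable]: "\<And>n. G n \<in> borel_measurable M"
    and ui: "\<And>e. 0 < e \<Longrightarrow> \<exists>K\<ge>0. \<forall>n. (\<integral>\<^sup>+x. ennreal (norm (G n x) - K) \<partial>M) \<le> ennreal e"
  obtains \<gamma> g where "\<And>k. midconv G k (\<gamma> k)" "g \<in> borel_measurable M"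
    "AE x in M. (\<lambda>k. \<gamma> k x) \<longlonglongrightarrow> g x"
    "\<And>k. (\<integral>\<^sup>+x. norm (\<gamma> k x - g x) \<partial>M) \<le> ennreal ((1 / 2) ^ k)"
proof -
  have meas: "f \<in> borel_measurable M" if "midconv G k f" for k f
    using midconv_measurable[OF that G] .
  have ui_mid: "\<exists>K\<ge>0. \<forall>f k. midconv G k f \<longrightarrow> (\<integral>\<^sup>+x. ennreal (norm (f x) - K) \<partial>M) \<le> ennreal e" if e: "0 < e" for e
  proof -
    obtain K where K: "0 \<le> K" "\<And>n. (\<integral>\<^sup>+x. ennreal (norm (G n x) - K) \<partial>M) \<le> ennreal e"
      using ui[OF e] by blast
    have "(\<integral>\<^sup>+x. ennreal (norm (f x) - K) \<partial>M) \<le> ennreal e" if "midconv G k f" for f k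
      by (rule midconv_nn_integral_le[OF that G, where \<Phi>="\<lambda>a. ennreal (norm a - K)"])
        (use K(2) norm_excess_midpoint in auto)
    then show ?thesis using K(1) by blast
  qed
  define J where "J f = (\<integral>x. bracket (f x) \<partial>M)" for f :: "'a \<Rightarrow> 'b"
  obtain K1 where K1: "0 \<le> K1" "\<And>f k. midconv G k f \<Longrightarrow> (\<integral>\<^sup>+x. ennreal (norm (f x) - K1) \<partial>M) \<le> ennreal 1"
    using ui_mid[of 1] by auto
  have brK: "(\<integral>\<^sup>+x. bracket (f x) \<partial>M) \<le> ennreal (2 + K1)" if f: "midconv G k f" for f k
  proof -
    note [measurable] = meas[OF f]
    have "(\<integral>\<^sup>+x. bracket (f x) \<partial>M) \<le> (\<integral>\<^sup>+x. ennreal (1 + K1) + ennreal (norm (f x) - K1) \<partial>M)"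
    proof (intro nn_integral_mono)
      fix x
      have "ennreal (bracket (f x)) \<le> ennreal ((1 + K1) + max 0 (norm (f x) - K1))"
        using bracket_bounds(2)[of "f x"] by (intro ennreal_leI) auto
      then show "ennreal (bracket (f x)) \<le> ennreal (1 + K1) + ennreal (norm (f x) - K1)"
        using K1(1) by (subst (asm) ennreal_plus) (auto simp: ennreal_max_0)
    qed
    also have "\<dots> \<le> ennreal (1 + K1) + ennreal 1"
      using K1(2)[OF f] emeasure_space_1 by (subst nn_integral_add) auto
    also have "\<dots> = ennreal (2 + K1)" using K1(1) by (subst ennreal_plus[symmetric]) auto
    finally show ?thesis .
  qed
  have int: "integrable M (\<lambda>x. bracket (f x))" if f: "midconv G k f" for f k
  proof -
    note [measurable] = meas[OF f]
    have "(\<integral>\<^sup>+x. bracket (f x) \<partial>M) < \<infinity>" using brK[OF f] by (rule order.strict_trans1) simp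
    then show ?thesis by (intro integrableI_nonneg) (auto simp: bracket_bounds)
  qed
  have J0: "0 \<le> J f" for f unfolding J_def by (intro Bochner_Integration.integral_nonneg) (simp add: bracket_bounds)
  have JK: "J f \<le> 2 + K1" if f: "midconv G k f" for f k
  proof -
    have "ennreal (J f) \<le> ennreal (2 + K1)"
      unfolding J_def using brK[OF f] int[OF f] by (subst nn_integral_eq_integral[symmetric]) (auto simp: bracket_bounds)
    then show ?thesis using K1(1) by (subst (asm) ennreal_le_iff) auto
  qed
  define m where "m n = Inf (J ` {f. midconv G n f})" for n
  have bdd: "bdd_below (J ` {f. midconv G n f})" for n using J0 by (auto intro!: bdd_belowI)
  have ne: "J ` {f. midconv G n f} \<noteq> {}" for n using midconv.base[of n n G] by blast
  have m_le: "m n \<le> J f" if "midconv G n f" for n f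
    unfolding m_def using that by (intro cInf_lower bdd) auto
  have m_mono: "m n \<le> m k" if "n \<le> k" for n k
    unfolding m_def by (rule cInf_superset_mono[OF ne bdd]) (use that midconv_antimono in blast)
  have m_bd: "m n \<le> 2 + K1" for n using m_le[OF midconv.base] JK[OF midconv.base] order_trans by blast
  have "incseq m" using m_mono by (simp add: incseq_def)
  then obtain L where "m \<longlonglongrightarrow> L" using incseq_convergent[of m "2 + K1"] m_bd by blast
  then have m_cauchy: "Cauchy m" by (rule LIMSEQ_imp_Cauchy)
  have "\<exists>f. midconv G n f \<and> J f < m n + 1 / Suc n" for n
  proof -
    have "Inf (J ` {f. midconv G n f}) < m n + 1 / Suc n" by (simp add: m_def)
    then obtain y where "y \<in> J ` {f. midconv G n f}" "y < m n + 1 / Suc n"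
      using cInf_lessD[OF ne] by blast
    then show ?thesis by blast
  qed
  then obtain h where h: "\<And>n. midconv G n (h n)" "\<And>n. J (h n) < m n + 1 / Suc n" by metis
  note hm[measurable] = meas[OF h(1)]
  have gap: "(\<integral>\<^sup>+x. bracket_gap (h i x) (h j x) \<partial>M) \<le> ennreal (\<bar>m i - m j\<bar> + 2 / Suc (min i j))" for i j
  proof -
    let ?f = "\<lambda>x. (1 / 2) *\<^sub>R (h i x + h j x)" and ?k = "min i j"
    have hh: "midconv G ?k (h i)" "midconv G ?k (h j)"
      using midconv_antimono[OF h(1)] by auto
    have f: "midconv G ?k ?f" using hh by (rule midconv.mid)
    have gi: "integrable M (\<lambda>x. bracket_gap (h i x) (h j x))"
      unfolding bracket_gap_def using int[OF hh(1)] int[OF hh(2)] int[OF f] by simp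
    have "(\<integral>x. bracket_gap (h i x) (h j x) \<partial>M) = J (h i) + J (h j) - 2 * J ?f"
      unfolding bracket_gap_def J_def using int[OF hh(1)] int[OF hh(2)] int[OF f] by simp
    also have "\<dots> \<le> (m i + 1 / Suc i) + (m j + 1 / Suc j) - 2 * m ?k"
      using h(2)[of i] h(2)[of j] m_le[OF f] by linarith
    also have "\<dots> \<le> \<bar>m i - m j\<bar> + 2 / Suc ?k"
    proof -
      have "1 / real (Suc i) \<le> 1 / Suc ?k" "1 / real (Suc j) \<le> 1 / Suc ?k" by (auto intro!: divide_left_mono)
      then have "1 / real (Suc i) + 1 / real (Suc j) \<le> 2 / Suc ?k" by simp
      moreover have "m i + m j - 2 * m ?k \<le> \<bar>m i - m j\<bar>" by (cases "i \<le> j") (auto simp: min_def)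
      ultimately show ?thesis by linarith
    qed
    finally show ?thesis
      using gi by (subst nn_integral_eq_integral) (auto simp: bracket_gap_nonneg simp del: ennreal_plus intro: ennreal_leI)
  qed
  have cauchy: "\<exists>N. \<forall>i\<ge>N. \<forall>j\<ge>N. (\<integral>\<^sup>+x. norm (h i x - h j x) \<partial>M) \<le> ennreal e" if e: "0 < e" for e
  proof -
    \<comment> \<open>The target \<open>e\<close> is met by four terms of size e / 4: two excesses
      multiplied by 4, the constant, and the gap multiplied by \<open>C\<close>.\<close>
    obtain K where K: "0 \<le> K" "\<And>f k. midconv G k f \<Longrightarrow> (\<integral>\<^sup>+x. ennreal (norm (f x) - K) \<partial>M) \<le> ennreal (e / 16)"
      using ui_mid[of "e / 16"] e by auto
    define C where "C = 4 * (1 + 2 * K) ^ 3 / (e / 4)"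
    have C: "0 < C" using K(1) e by (simp add: C_def)
    obtain N1 where N1: "\<And>i j. N1 \<le> i \<Longrightarrow> N1 \<le> j \<Longrightarrow> \<bar>m i - m j\<bar> < e / (8 * C)"
      using m_cauchy C e unfolding Cauchy_altdef2 Cauchy_iff2
      by (metis CauchyD m_cauchy divide_pos_pos mult_pos_pos real_norm_def zero_less_numeral)
    obtain N2 :: nat where N2: "2 / (e / (8 * C)) < real N2" using reals_Archimedean2 by blast
    show ?thesis
    proof (intro exI[of _ "max N1 N2"] allI impI)
      fix i j assume ij: "max N1 N2 \<le> i" "max N1 N2 \<le> j"
      have g: "\<bar>m i - m j\<bar> + 2 / Suc (min i j) \<le> e / (4 * C)"
      proof -
        have "2 / (e / (8 * C)) < Suc (min i j)" using N2 ij by linarith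
        then have "2 / Suc (min i j) < e / (8 * C)" using e C by (simp add: field_simps)
        moreover have "\<bar>m i - m j\<bar> < e / (8 * C)" using N1 ij by simp
        moreover have "e / (8 * C) + e / (8 * C) = e / (4 * C)" by (simp add: field_simps)
        ultimately show ?thesis by linarith
      qed
      have "(\<integral>\<^sup>+x. norm (h i x - h j x) \<partial>M)
        \<le> (\<integral>\<^sup>+x. 4 * ennreal (norm (h i x) - K) + 4 * ennreal (norm (h j x) - K) + ennreal (e / 4)
            + ennreal C * ennreal (bracket_gap (h i x) (h j x)) \<partial>M)"
      proof (intro nn_integral_mono)
        fix x
        have "ennreal (norm (h i x - h j x)) \<le> ennreal (4 * max 0 (norm (h i x) - K) + 4 * max 0 (norm (h j x) - K) + e / 4
            + C * bracket_gap (h i x) (h j x))"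
          unfolding C_def using K(1) e by (intro ennreal_leI norm_diff_le_gap) auto
        also have "\<dots> = 4 * ennreal (norm (h i x) - K) + 4 * ennreal (norm (h j x) - K) + ennreal (e / 4)
            + ennreal C * ennreal (bracket_gap (h i x) (h j x))"
          using e C bracket_gap_nonneg[of "h i x" "h j x"]
          by (simp add: ennreal_plus ennreal_mult ennreal_max_0 add_nonneg_nonneg)
        finally show "ennreal (norm (h i x - h j x)) \<le> 4 * ennreal (norm (h i x) - K) + 4 * ennreal (norm (h j x) - K) + ennreal (e / 4)
            + ennreal C * ennreal (bracket_gap (h i x) (h j x))" .
      qed
      also have "\<dots> = 4 * (\<integral>\<^sup>+x. ennreal (norm (h i x) - K) \<partial>M) + 4 * (\<integral>\<^sup>+x. ennreal (norm (h j x) - K) \<partial>M)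
          + ennreal (e / 4) + ennreal C * (\<integral>\<^sup>+x. bracket_gap (h i x) (h j x) \<partial>M)"
        unfolding bracket_gap_def using emeasure_space_1 by (simp add: nn_integral_add nn_integral_cmult)
      also have "\<dots> \<le> 4 * ennreal (e / 16) + 4 * ennreal (e / 16) + ennreal (e / 4) + ennreal C * ennreal (e / (4 * C))"
        by (intro add_mono mult_left_mono K(2)[OF h(1)] order_refl order_trans[OF gap ennreal_leI[OF g]]) auto
      also have "\<dots> = ennreal e"
      proof -
        have "4 * ennreal (e / 16) = ennreal (e / 4)"
          using e by (subst ennreal_numeral[symmetric], subst ennreal_mult[symmetric]) auto
        moreover have "ennreal C * ennreal (e / (4 * C)) = ennreal (e / 4)"
          using C e by (subst ennreal_mult[symmetric]) auto
        ultimately show ?thesis using e by (simp add: ennreal_plus[symmetric] del: ennreal_plus)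
      qed
      finally show "(\<integral>\<^sup>+x. norm (h i x - h j x) \<partial>M) \<le> ennreal e" .
    qed
  qed
  have "\<exists>N. \<forall>i\<ge>N. \<forall>j\<ge>N. (\<integral>\<^sup>+x. norm (h i x - h j x) \<partial>M) \<le> ennreal ((1 / 2) ^ l)" for l :: nat
    by (rule cauchy) simp
  then obtain N where N: "\<And>l i j. N l \<le> i \<Longrightarrow> N l \<le> j \<Longrightarrow> (\<integral>\<^sup>+x. norm (h i x - h j x) \<partial>M) \<le> ennreal ((1 / 2) ^ l)"
    by metis
  \<comment> \<open>\<open>r l\<close> exceeds all \<open>N i\<close> with i \<le> l, which makes
    consecutive distances geometrically small; the summand \<open>l\<close> keeps the chosen
    function in the \<open>l\<close>-th tail.\<close>
  define r where "r l = l + (\<Sum>i\<le>l. N i)" for l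
  have r: "N l \<le> r k" "l \<le> r l" if "l \<le> k" for l k
  proof -
    have "N l \<le> (\<Sum>i\<le>k. N i)" using that by (intro member_le_sum) auto
    then show "N l \<le> r k" by (simp add: r_def)
  qed (simp add: r_def)
  define \<gamma> where "\<gamma> l = h (r l)" for l
  have \<gamma>: "midconv G l (\<gamma> l)" for l
    unfolding \<gamma>_def by (rule midconv_antimono[OF h(1) r(2)[OF order_refl]])
  have [measurable]: "\<gamma> l \<in> borel_measurable M" for l using meas[OF \<gamma>] .
  have \<gamma>c: "(\<integral>\<^sup>+x. norm (\<gamma> k x - \<gamma> l x) \<partial>M) \<le> ennreal ((1 / 2) ^ n)" if "n \<le> k" "n \<le> l" for k l n
    unfolding \<gamma>_def using that by (intro N r(1))
  have "(\<integral>\<^sup>+x. (\<Sum>l. ennreal (norm (\<gamma> (Suc l) x - \<gamma> l x))) \<partial>M) = (\<Sum>l. \<integral>\<^sup>+x. norm (\<gamma> (Suc l) x - \<gamma> l x) \<partial>M)"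
    by (rule nn_integral_suminf) measurable
  also have "\<dots> \<le> (\<Sum>l. ennreal ((1 / 2) ^ l))" by (intro suminf_le \<gamma>c) auto
  also have "\<dots> = ennreal (\<Sum>l. (1 / 2) ^ l)"
    by (intro suminf_ennreal2) (auto intro!: summable_geometric)
  also have "\<dots> < \<infinity>" by simp
  finally have "AE x in M. (\<Sum>l. ennreal (norm (\<gamma> (Suc l) x - \<gamma> l x))) \<noteq> \<infinity>"
    by (intro nn_integral_noteq_infinite) auto
  then have conv: "AE x in M. convergent (\<lambda>k. \<gamma> k x)"
  proof (rule eventually_mono)
    fix x assume "(\<Sum>l. ennreal (norm (\<gamma> (Suc l) x - \<gamma> l x))) \<noteq> \<infinity>"
    then have "summable (\<lambda>l. norm (\<gamma> (Suc l) x - \<gamma> l x))"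
      by (intro summable_suminf_not_top) auto
    then have "summable (\<lambda>l. \<gamma> (Suc l) x - \<gamma> l x)" by (rule summable_norm_cancel)
    then have "convergent (\<lambda>n. \<Sum>l<n. \<gamma> (Suc l) x - \<gamma> l x)" by (simp add: summable_iff_convergent)
    then have "convergent (\<lambda>n. \<gamma> n x - \<gamma> 0 x)" using sum_lessThan_telescope[of "\<lambda>l. \<gamma> l x"] by simp
    then have "convergent (\<lambda>n. (\<gamma> n x - \<gamma> 0 x) + \<gamma> 0 x)" by (intro convergent_add convergent_const)
    then show "convergent (\<lambda>n. \<gamma> n x)" by simp
  qed
  define g where "g x = lim (\<lambda>k. \<gamma> k x)" for x
  have gm[measurable]: "g \<in> borel_measurable M" unfolding g_def[abs_def] by measurable
  have lim: "AE x in M. (\<lambda>k. \<gamma> k x) \<longlonglongrightarrow> g x"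
    using conv by (rule eventually_mono) (simp add: g_def convergent_LIMSEQ_iff)
  show ?thesis
  proof (rule that[OF \<gamma> gm lim])
    fix k
    have "(\<integral>\<^sup>+x. norm (\<gamma> k x - g x) \<partial>M) = (\<integral>\<^sup>+x. liminf (\<lambda>l. ennreal (norm (\<gamma> k x - \<gamma> l x))) \<partial>M)"
    proof (rule nn_integral_cong_AE, use lim in \<open>rule eventually_mono\<close>)
      fix x assume "(\<lambda>k. \<gamma> k x) \<longlonglongrightarrow> g x"
      then have "(\<lambda>l. ennreal (norm (\<gamma> k x - \<gamma> l x))) \<longlonglongrightarrow> ennreal (norm (\<gamma> k x - g x))"
        by (intro tendsto_intros)
      then show "ennreal (norm (\<gamma> k x - g x)) = liminf (\<lambda>l. ennreal (norm (\<gamma> k x - \<gamma> l x)))"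
        using lim_imp_Liminf[OF sequentially_bot] by metis
    qed
    also have "\<dots> \<le> liminf (\<lambda>l. \<integral>\<^sup>+x. norm (\<gamma> k x - \<gamma> l x) \<partial>M)"
      by (rule nn_integral_liminf) measurable
    also have "\<dots> \<le> ennreal ((1 / 2) ^ k)"
    proof (rule Liminf_le)
      show "\<forall>\<^sub>F l in sequentially. (\<integral>\<^sup>+x. norm (\<gamma> k x - \<gamma> l x) \<partial>M) \<le> ennreal ((1 / 2) ^ k)"
        using eventually_ge_at_top[of k] by (rule eventually_mono) (intro \<gamma>c, auto)
    qed simp
    finally show "(\<integral>\<^sup>+x. norm (\<gamma> k x - g x) \<partial>M) \<le> ennreal ((1 / 2) ^ k)" .
  qed
qed

section \<open>Existence of weak gradients by compactness\<close>

lemma heat_kernel_lower_bound: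
  assumes "0 < t" "norm x \<le> R"
  shows "(4 * pi * t) powr (- real DIM('a) / 2) * exp (- R\<^sup>2 / (4 * t)) \<le> heat_kernel t (x :: 'a::euclidean_space)"
proof -
  have "(norm x)\<^sup>2 \<le> R\<^sup>2" using assms(2) by (intro power_mono) auto
  then show ?thesis unfolding heat_kernel_def using assms(1)
    by (intro mult_left_mono) (auto intro!: divide_right_mono)
qed

text \<open>The Gaussian density is bounded below on balls. The compactness argument needs a
  probability measure on the whole space, and this bound returns its conclusions to Lebesgue measure
  on balls.\<close>

lemma nn_integral_cball_le_heat_measure:
  fixes R :: real
  assumes t: "0 < t"
  obtains C where "0 < C" "\<And>f :: 'a::euclidean_space \<Rightarrow> ennreal. f \<in> borel_measurable borel \<Longrightarrow>
    (\<integral>\<^sup>+x. f x * indicator (cball 0 R) x \<partial>lborel) \<le> ennreal C * (\<integral>\<^sup>+x. f x \<partial>heat_measure t)"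
proof -
  define c where "c = (4 * pi * t) powr (- real DIM('a) / 2) * exp (- R\<^sup>2 / (4 * t))"
  have c: "0 < c" using t by (simp add: c_def)
  show ?thesis
  proof (rule that[of "1 / c"])
    fix f :: "'a \<Rightarrow> ennreal" assume [measurable]: "f \<in> borel_measurable borel"
    have "(\<integral>\<^sup>+x. f x * indicator (cball 0 R) x \<partial>lborel) \<le> (\<integral>\<^sup>+x. ennreal (1 / c) * (ennreal (heat_kernel t x) * f x) \<partial>lborel)"
    proof (intro nn_integral_mono)
      fix x :: 'a
      show "f x * indicator (cball 0 R) x \<le> ennreal (1 / c) * (ennreal (heat_kernel t x) * f x)"
      proof (cases "norm x \<le> R")
        case True
        have "c \<le> heat_kernel t x"
          unfolding c_def by (rule heat_kernel_lower_bound[OF t True])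
        then have "1 \<le> 1 / c * heat_kernel t x" using c by (simp add: field_simps)
        then have "1 \<le> ennreal (1 / c) * ennreal (heat_kernel t x)"
          using c by (subst ennreal_mult[symmetric]) (auto simp del: ennreal_1 simp flip: ennreal_1 intro: ennreal_leI)
        then have "1 * f x \<le> (ennreal (1 / c) * ennreal (heat_kernel t x)) * f x"
          by (rule mult_right_mono) simp
        then show ?thesis using True by (simp add: mult.assoc)
      qed simp
    qed
    also have "\<dots> = ennreal (1 / c) * (\<integral>\<^sup>+x. f x \<partial>heat_measure t)"
      by (simp add: nn_integral_cmult nn_integral_heat_measure)
    finally show "(\<integral>\<^sup>+x. f x * indicator (cball 0 R) x \<partial>lborel) \<le> ennreal (1 / c) * (\<integral>\<^sup>+x. f x \<partial>heat_measure t)" .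
  qed (use c in simp)
qed

lemma loc_int_heat_measure:
  fixes f :: "'a::euclidean_space \<Rightarrow> 'b::euclidean_space"
  assumes [measurable]: "f \<in> borel_measurable borel" and t: "0 < t"
    and fin: "(\<integral>\<^sup>+x. norm (f x) \<partial>heat_measure t) < \<infinity>"
  shows "loc_int f"
proof (rule loc_intI)
  fix R
  obtain C where C: "\<And>f :: 'a::euclidean_space \<Rightarrow> ennreal. f \<in> borel_measurable borel \<Longrightarrow>
    (\<integral>\<^sup>+x. f x * indicator (cball 0 R) x \<partial>lborel) \<le> ennreal C * (\<integral>\<^sup>+x. f x \<partial>heat_measure t)"
    using nn_integral_cball_le_heat_measure[OF t] by blast
  have "(\<integral>\<^sup>+x. norm (f x) * indicator (cball 0 R) x \<partial>lborel) = (\<integral>\<^sup>+x. ennreal (norm (f x)) * indicator (cball 0 R) x \<partial>lborel)"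
    by (intro nn_integral_cong) (simp split: split_indicator)
  also have "\<dots> \<le> ennreal C * (\<integral>\<^sup>+x. norm (f x) \<partial>heat_measure t)" by (rule C) simp
  also have "\<dots> < \<infinity>" using fin by (simp add: ennreal_mult_less_top)
  finally show "(\<integral>\<^sup>+x. norm (f x) * indicator (cball 0 R) x \<partial>lborel) < \<infinity>" .
qed simp

text \<open>The functions \<open>G n\<close> need not be weak gradients of anything: only their
  pairings with test functions must converge to the distributional derivative of \<open>u\<close>.
  Uniform integrability, unlike boundedness in mean, rules out a limit that is merely a
  measure.\<close>

theorem weak_grad_compactness:
  fixes u :: "'a::euclidean_space \<Rightarrow> real" and G :: "nat \<Rightarrow> 'a \<Rightarrow> 'a"
  assumes u: "loc_int u"
    and G[measurable]: "\<And>n. G n \<in> borel_measurable borel"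
    and ui: "\<And>e. 0 < e \<Longrightarrow> \<exists>K\<ge>0. \<forall>n. (\<integral>\<^sup>+x. ennreal (norm (G n x) - K) \<partial>heat_measure 1) \<le> ennreal e"
    and lim: "\<And>\<phi> i. \<phi> \<in> test_functions \<Longrightarrow> i \<in> Basis \<Longrightarrow>
      (\<lambda>n. \<integral>x. (G n x \<bullet> i) * \<phi> x \<partial>lborel) \<longlonglongrightarrow> - (\<integral>x. u x * frechet_derivative \<phi> (at x) i \<partial>lborel)"
  obtains \<gamma> g where "weak_grad u g" "\<And>k. midconv G k (\<gamma> k)" "AE x in lborel. (\<lambda>k. \<gamma> k x) \<longlonglongrightarrow> g x"
proof -
  interpret prob_space "heat_measure 1 :: 'a measure" by (rule prob_space_heat_measure) simp
  have Gm: "G n \<in> borel_measurable (heat_measure 1)" for n by simp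
  obtain \<gamma> g where \<gamma>: "\<And>k. midconv G k (\<gamma> k)" and g: "g \<in> borel_measurable (heat_measure 1)"
    and ae: "AE x in heat_measure 1. (\<lambda>k. \<gamma> k x) \<longlonglongrightarrow> g x"
    and L1: "\<And>k. (\<integral>\<^sup>+x. norm (\<gamma> k x - g x) \<partial>heat_measure 1) \<le> ennreal ((1 / 2) ^ k)"
    using ui_midconv_limit[OF Gm ui] by blast
  have [measurable]: "g \<in> borel_measurable borel" using g by simp
  have \<gamma>m[measurable]: "\<gamma> k \<in> borel_measurable borel" for k by (rule midconv_measurable[OF \<gamma> G])
  obtain K1 where K1: "0 \<le> K1" "\<And>n. (\<integral>\<^sup>+x. ennreal (norm (G n x) - K1) \<partial>heat_measure 1) \<le> ennreal 1"
    using ui[of 1] by auto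
  have fin: "(\<integral>\<^sup>+x. norm (f x) \<partial>heat_measure 1) < \<infinity>" if f: "midconv G k f" for f k
  proof -
    note [measurable] = midconv_measurable[OF f G]
    have "(\<integral>\<^sup>+x. norm (f x) \<partial>heat_measure 1) \<le> (\<integral>\<^sup>+x. ennreal K1 + ennreal (norm (f x) - K1) \<partial>heat_measure 1)"
      using K1(1) by (intro nn_integral_mono ennreal_le_add_excess)
    also have "\<dots> = ennreal K1 + (\<integral>\<^sup>+x. ennreal (norm (f x) - K1) \<partial>heat_measure 1)"
      using emeasure_space_1 by (subst nn_integral_add) auto
    also have "(\<integral>\<^sup>+x. ennreal (norm (f x) - K1) \<partial>heat_measure 1) \<le> ennreal 1"
    proof (rule midconv_nn_integral_le[OF f, where \<Phi>="\<lambda>a. ennreal (norm a - K1)"])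
      show "(\<integral>\<^sup>+x. ennreal (norm (G n x) - K1) \<partial>heat_measure 1) \<le> ennreal 1" for n by (rule K1(2))
    qed (use norm_excess_midpoint in auto)
    finally have "(\<integral>\<^sup>+x. norm (f x) \<partial>heat_measure 1) \<le> ennreal K1 + ennreal 1" by (simp add: add_left_mono)
    also have "\<dots> < \<infinity>" by simp
    finally show ?thesis .
  qed
  have loc: "loc_int f" if f: "midconv G k f" for f k
    by (rule loc_int_heat_measure[OF midconv_measurable[OF f G] _ fin[OF f]]) simp_all
  have gfin: "(\<integral>\<^sup>+x. norm (g x) \<partial>heat_measure 1) < \<infinity>"
  proof -
    have "(\<integral>\<^sup>+x. norm (g x) \<partial>heat_measure 1) \<le> (\<integral>\<^sup>+x. ennreal (norm (\<gamma> 0 x)) + ennreal (norm (\<gamma> 0 x - g x)) \<partial>heat_measure 1)"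
      by (intro nn_integral_mono) (auto simp flip: ennreal_plus intro!: ennreal_leI norm_triangle_sub simp: norm_minus_commute)
    also have "\<dots> = (\<integral>\<^sup>+x. norm (\<gamma> 0 x) \<partial>heat_measure 1) + (\<integral>\<^sup>+x. norm (\<gamma> 0 x - g x) \<partial>heat_measure 1)"
      by (subst nn_integral_add) auto
    also have "\<dots> < \<infinity>" using fin[OF \<gamma>[of 0]] L1[of 0] by (auto simp: less_top[symmetric] top_unique)
    finally show ?thesis .
  qed
  have gloc: "loc_int g" by (rule loc_int_heat_measure[OF _ _ gfin]) simp_all
  have "weak_grad u g"
    unfolding weak_grad_def
  proof (intro conjI ballI u gloc)
    fix \<phi> :: "'a \<Rightarrow> real" and i :: 'a assume \<phi>: "\<phi> \<in> test_functions" and i: "i \<in> Basis"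
    note [measurable] = borel_measurable_test_function[OF \<phi>]
    define \<Lambda> where "\<Lambda> = - (\<integral>x. u x * frechet_derivative \<phi> (at x) i \<partial>lborel)"
    have I: "integrable lborel (\<lambda>x. (f x \<bullet> i) * \<phi> x)" if "loc_int f" for f :: "'a \<Rightarrow> 'a"
      by (intro loc_int_test_function loc_int_inner that \<phi>)
    \<comment> \<open>The pairing is affine, so a bound valid for a whole tail of \<open>G\<close>
      persists under midpoints.\<close>
    have close: "\<bar>(\<integral>x. (f x \<bullet> i) * \<phi> x \<partial>lborel) - \<Lambda>\<bar> \<le> e"
      if f: "midconv G k f" and e: "\<And>n. k \<le> n \<Longrightarrow> \<bar>(\<integral>x. (G n x \<bullet> i) * \<phi> x \<partial>lborel) - \<Lambda>\<bar> \<le> e" for f k e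
      using f
    proof induction
      case (mid f g)
      have "(\<integral>x. (((1 / 2) *\<^sub>R (f x + g x)) \<bullet> i) * \<phi> x \<partial>lborel)
        = (\<integral>x. (1 / 2) * ((f x \<bullet> i) * \<phi> x + (g x \<bullet> i) * \<phi> x) \<partial>lborel)"
        by (intro Bochner_Integration.integral_cong refl) (simp add: inner_add_left algebra_simps)
      also have "\<dots> = (1 / 2) * ((\<integral>x. (f x \<bullet> i) * \<phi> x \<partial>lborel) + (\<integral>x. (g x \<bullet> i) * \<phi> x \<partial>lborel))"
        using I[OF loc[OF mid(1)]] I[OF loc[OF mid(2)]] by simp
      finally have eq: "(\<integral>x. (((1 / 2) *\<^sub>R (f x + g x)) \<bullet> i) * \<phi> x \<partial>lborel)
        = (1 / 2) * ((\<integral>x. (f x \<bullet> i) * \<phi> x \<partial>lborel) + (\<integral>x. (g x \<bullet> i) * \<phi> x \<partial>lborel))" .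
      have "\<bar>1 / 2 * (A + B) - \<Lambda>\<bar> \<le> e" if "\<bar>A - \<Lambda>\<bar> \<le> e" "\<bar>B - \<Lambda>\<bar> \<le> e" for A B
        using that by (simp add: abs_le_iff field_simps)
      from this[OF mid.IH] show ?case unfolding eq .
    qed (rule e)
    have 1: "(\<lambda>k. \<integral>x. (\<gamma> k x \<bullet> i) * \<phi> x \<partial>lborel) \<longlonglongrightarrow> \<Lambda>"
    proof (rule LIMSEQ_I)
      fix e :: real assume e: "0 < e"
      have "0 < e / 2" using e by simp
      then obtain N where N: "\<And>n. N \<le> n \<Longrightarrow> norm ((\<integral>x. (G n x \<bullet> i) * \<phi> x \<partial>lborel) - \<Lambda>) < e / 2"
        using LIMSEQ_D[OF lim[OF \<phi> i]] unfolding \<Lambda>_def by blast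
      show "\<exists>N. \<forall>k\<ge>N. norm ((\<integral>x. (\<gamma> k x \<bullet> i) * \<phi> x \<partial>lborel) - \<Lambda>) < e"
      proof (intro exI[of _ N] allI impI)
        fix k assume "N \<le> k"
        then have "\<bar>(\<integral>x. (\<gamma> k x \<bullet> i) * \<phi> x \<partial>lborel) - \<Lambda>\<bar> \<le> e / 2"
          by (intro close[OF \<gamma>]) (use N in \<open>auto simp: less_imp_le\<close>)
        then show "norm ((\<integral>x. (\<gamma> k x \<bullet> i) * \<phi> x \<partial>lborel) - \<Lambda>) < e" using e by simp
      qed
    qed
    obtain R B where R: "0 \<le> B" "\<And>x. \<bar>\<phi> x\<bar> \<le> B" "\<And>x. norm x > R \<Longrightarrow> \<phi> x = 0"
      using test_function_facts[OF \<phi>] by metis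
    obtain C where C: "0 < C" "\<And>f :: 'a \<Rightarrow> ennreal. f \<in> borel_measurable borel \<Longrightarrow>
      (\<integral>\<^sup>+x. f x * indicator (cball 0 R) x \<partial>lborel) \<le> ennreal C * (\<integral>\<^sup>+x. f x \<partial>heat_measure 1)"
      using nn_integral_cball_le_heat_measure[of 1 R] by auto
    have diff: "\<bar>(\<integral>x. (\<gamma> k x \<bullet> i) * \<phi> x \<partial>lborel) - (\<integral>x. (g x \<bullet> i) * \<phi> x \<partial>lborel)\<bar> \<le> B * C * (1 / 2) ^ k" for k
    proof -
      have "(\<integral>x. (\<gamma> k x \<bullet> i) * \<phi> x \<partial>lborel) - (\<integral>x. (g x \<bullet> i) * \<phi> x \<partial>lborel) = (\<integral>x. ((\<gamma> k x - g x) \<bullet> i) * \<phi> x \<partial>lborel)"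
        using I[OF loc[OF \<gamma>[of k]]] I[OF gloc] by (simp add: inner_diff_left left_diff_distrib)
      then have "ennreal \<bar>(\<integral>x. (\<gamma> k x \<bullet> i) * \<phi> x \<partial>lborel) - (\<integral>x. (g x \<bullet> i) * \<phi> x \<partial>lborel)\<bar>
          \<le> (\<integral>\<^sup>+x. norm (((\<gamma> k x - g x) \<bullet> i) * \<phi> x) \<partial>lborel)"
        using norm_integral_le_nn_integral[of lborel "\<lambda>x. ((\<gamma> k x - g x) \<bullet> i) * \<phi> x"] by simp
      also have "\<dots> \<le> (\<integral>\<^sup>+x. ennreal B * (ennreal (norm (\<gamma> k x - g x)) * indicator (cball 0 R) x) \<partial>lborel)"
      proof (intro nn_integral_mono)
        fix x
        show "ennreal (norm (((\<gamma> k x - g x) \<bullet> i) * \<phi> x)) \<le> ennreal B * (ennreal (norm (\<gamma> k x - g x)) * indicator (cball 0 R) x)"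
        proof (cases "norm x > R")
          case False
          have "norm (((\<gamma> k x - g x) \<bullet> i) * \<phi> x) \<le> norm (\<gamma> k x - g x) * B"
            unfolding norm_mult using Basis_le_norm[OF i, of "\<gamma> k x - g x"] R(1,2)
            by (intro mult_mono) auto
          then show ?thesis using False R(1)
            by (simp add: ennreal_mult[symmetric] mult.commute ennreal_leI)
        qed (use R(3) in simp)
      qed
      also have "\<dots> \<le> ennreal B * (ennreal C * (\<integral>\<^sup>+x. norm (\<gamma> k x - g x) \<partial>heat_measure 1))"
        by (subst nn_integral_cmult) (auto intro!: mult_left_mono C(2))
      also have "\<dots> \<le> ennreal B * (ennreal C * ennreal ((1 / 2) ^ k))"
        by (intro mult_left_mono L1) auto
      also have "\<dots> = ennreal (B * C * (1 / 2) ^ k)" using R(1) C(1) by (simp add: ennreal_mult mult.assoc)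
      finally show ?thesis using R(1) C(1) by (subst (asm) ennreal_le_iff) auto
    qed
    have "(\<lambda>k. (\<integral>x. (\<gamma> k x \<bullet> i) * \<phi> x \<partial>lborel) - (\<integral>x. (g x \<bullet> i) * \<phi> x \<partial>lborel)) \<longlonglongrightarrow> 0"
    proof (rule Lim_null_comparison)
      show "(\<lambda>k. B * C * (1 / 2) ^ k) \<longlonglongrightarrow> 0" by (intro tendsto_mult_right_zero LIMSEQ_realpow_zero) auto
    qed (use diff in auto)
    then have "(\<lambda>k. \<integral>x. (\<gamma> k x \<bullet> i) * \<phi> x \<partial>lborel) \<longlonglongrightarrow> (\<integral>x. (g x \<bullet> i) * \<phi> x \<partial>lborel)"
      by (rule LIM_zero_cancel)
    then have "(\<integral>x. (g x \<bullet> i) * \<phi> x \<partial>lborel) = \<Lambda>" using 1 LIMSEQ_unique by blast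
    then show "(\<integral>x. u x * frechet_derivative \<phi> (at x) i \<partial>lborel) = - (\<integral>x. (g x \<bullet> i) * \<phi> x \<partial>lborel)"
      by (simp add: \<Lambda>_def)
  qed
  then show ?thesis
    by (rule that[OF _ \<gamma>]) (use ae in \<open>simp add: AE_heat_measure\<close>)
qed

section \<open>The maximal function of the heat semigroup\<close>

lemma ennreal_le_diff_add: "a \<le> (a - b) + (b :: ennreal)"
  by (metis add.commute diff_add_self_ennreal ennreal_minus_eq_0 le_cases linorder_not_le add_0_right add_0 diff_eq_0_iff_ennreal less_imp_le order_refl)

text \<open>The ergodic sums of the n values at times 0, s, ..., (n - 1) s. The recursion puts one
  application of the semigroup around the previous sum, the form in which Hopf's argument uses
  positivity.\<close>

primrec heat_sum :: "real \<Rightarrow> ('a::euclidean_space \<Rightarrow> ennreal) \<Rightarrow> nat \<Rightarrow> 'a \<Rightarrow> ennreal" where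
  "heat_sum s f 0 = (\<lambda>_. 0)"
| "heat_sum s f (Suc n) = (\<lambda>x. f x + heat s (heat_sum s f n) x)"

lemma borel_measurable_heat_sum [measurable]:
  assumes [measurable]: "f \<in> borel_measurable borel"
  shows "heat_sum s f n \<in> borel_measurable borel"
  by (induction n) auto

lemma heat_sum_eq:
  assumes f[measurable]: "f \<in> borel_measurable borel" and s: "0 < s"
  shows "heat_sum s f (Suc n) x = f x + (\<Sum>k<n. heat (real (Suc k) * s) f x)"
proof (induction n arbitrary: x)
  case 0
  then show ?case using heat_const[OF s, of 0 x] by simp
next
  case (Suc n)
  have "heat s (heat_sum s f (Suc n)) x = heat s (\<lambda>x. f x + (\<Sum>k<n. heat (real (Suc k) * s) f x)) x"
    using Suc.IH by presburger
  also have "\<dots> = heat s f x + heat s (\<lambda>x. \<Sum>k<n. heat (real (Suc k) * s) f x) x"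
    by (subst heat_add) auto
  also have "heat s (\<lambda>x. \<Sum>k<n. heat (real (Suc k) * s) f x) x = (\<Sum>k<n. heat s (heat (real (Suc k) * s) f) x)"
    unfolding heat_def[of s "\<lambda>x. \<Sum>k<n. heat (real (Suc k) * s) f x"] heat_def[of s "heat _ f"]
    by (rule nn_integral_sum) measurable
  also have "\<dots> = (\<Sum>k<n. heat (real (Suc (Suc k)) * s) f x)"
    using s by (intro sum.cong refl, subst heat_heat) (auto simp: algebra_simps intro!: add_pos_nonneg)
  finally show ?case
    by (simp only: heat_sum.simps(2)[of s f "Suc n"] sum.lessThan_Suc_shift) (simp add: o_def)
qed

lemma nn_integral_heat_sum:
  assumes [measurable]: "f \<in> borel_measurable borel" and s: "0 < s"
  shows "(\<integral>\<^sup>+x. heat_sum s f n x \<partial>lborel) = of_nat n * (\<integral>\<^sup>+x. f x \<partial>lborel)"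
  using s by (induction n) (simp_all add: nn_integral_add nn_integral_heat distrib_right)

lemma heat_sum_mono:
  assumes "\<And>x. f x \<le> g x"
  shows "heat_sum s f n x \<le> heat_sum s g n x"
proof (induction n arbitrary: x)
  case (Suc n)
  then show ?case by (auto intro!: add_mono assms heat_mono)
qed simp

lemma heat_sum_add_const:
  assumes [measurable]: "f \<in> borel_measurable borel" and s: "0 < s"
  shows "heat_sum s (\<lambda>x. f x + c) n x = heat_sum s f n x + of_nat n * c"
proof (induction n arbitrary: x)
  case (Suc n)
  have "heat s (heat_sum s (\<lambda>x. f x + c) n) x = heat s (\<lambda>x. heat_sum s f n x + of_nat n * c) x"
    using Suc.IH by presburger
  also have "\<dots> = heat s (heat_sum s f n) x + of_nat n * c"
    using s by (subst heat_add) (auto simp: heat_const)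
  finally show ?case by (simp add: algebra_simps)
qed simp

text \<open>Hopf's maximal ergodic lemma: the sequence \<open>G\<close> solves \<open>G = f + P G - \<lambda> 1\<^sub>E\<close> up to
  truncation, and no truncation occurs on \<open>E\<close>.\<close>

lemma hopf_maximal_finite:
  fixes f :: "'a::euclidean_space \<Rightarrow> ennreal" and N :: nat
  assumes f[measurable]: "f \<in> borel_measurable borel" and s: "0 < s" and l: "l < \<infinity>"
  defines "E \<equiv> {x. \<exists>n\<le>N. of_nat n * l < heat_sum s f n x}"
  shows "l * emeasure lborel E \<le> (\<integral>\<^sup>+x. f x \<partial>lborel)"
proof (cases "(\<integral>\<^sup>+x. f x \<partial>lborel) = \<infinity>")
  case False
  have Em[measurable]: "E \<in> sets borel"
  proof -
    have "E = (\<Union>n\<in>{..N}. {x \<in> space borel. of_nat n * l < heat_sum s f n x})" by (auto simp: E_def)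
    also have "\<dots> \<in> sets borel" by (intro sets.finite_UN) auto
    finally show ?thesis .
  qed
  define G where "G = rec_nat (\<lambda>_. 0) (\<lambda>_ g x. f x + heat s g x - l * indicator E x)"
  have G0: "G 0 = (\<lambda>_. 0)" and GS: "G (Suc n) = (\<lambda>x. f x + heat s (G n) x - l * indicator E x)" for n
    by (simp_all add: G_def)
  have Gm[measurable]: "G n \<in> borel_measurable borel" for n
    by (induction n) (auto simp: G0 GS)
  have G_le: "G n x \<le> heat_sum s f n x" for n x
  proof (induction n arbitrary: x)
    case (Suc n)
    have "G (Suc n) x \<le> f x + heat s (G n) x" unfolding GS by (rule diff_le_self_ennreal)
    also have "\<dots> \<le> f x + heat s (heat_sum s f n) x" by (intro add_left_mono heat_mono Suc.IH)
    finally show ?case by simp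
  qed (simp add: G0)
  have G_Suc: "G n x \<le> G (Suc n) x" for n x
  proof (induction n arbitrary: x)
    case (Suc n)
    have "f x + heat s (G n) x - l * indicator E x \<le> f x + heat s (G (Suc n)) x - l * indicator E x"
      by (intro ennreal_minus_mono add_left_mono heat_mono Suc.IH order_refl)
    then show ?case unfolding GS[of "Suc n"] unfolding GS[of n] .
  qed (simp add: G0)
  have G_mono: "G m x \<le> G n x" if "m \<le> n" for m n x
    using lift_Suc_mono_le[of "\<lambda>n. G n x", OF G_Suc that] .
  have sum_le: "heat_sum s f n x \<le> G n x + of_nat n * l" for n x
  proof (induction n arbitrary: x)
    case (Suc n)
    have "heat_sum s f (Suc n) x \<le> f x + heat s (\<lambda>x. G n x + of_nat n * l) x"
      by (simp add: add_left_mono heat_mono Suc.IH)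
    also have "\<dots> = (f x + heat s (G n) x) + of_nat n * l"
      using s by (subst heat_add) (auto simp: heat_const add.assoc)
    also have "f x + heat s (G n) x \<le> G (Suc n) x + l * indicator E x"
      unfolding GS by (rule ennreal_le_diff_add)
    also have "G (Suc n) x + l * indicator E x \<le> G (Suc n) x + l"
      by (intro add_left_mono) (simp split: split_indicator)
    finally show ?case by (simp add: distrib_right add.assoc add_right_mono)
  qed simp
  \<comment> \<open>Of a sum of \<open>Suc m\<close> terms that exceeds \<open>Suc m\<close> times
    \<open>l\<close>, all but the outermost step account for at most \<open>m * l\<close> beyond
    \<open>G m\<close>; so more than \<open>l\<close> is left for
    \<open>f x + heat s (G m) x\<close>.\<close>
  have E_le: "l \<le> f x + heat s (G N) x" if xE: "x \<in> E" for x
  proof -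
    obtain n where n: "n \<le> N" "of_nat n * l < heat_sum s f n x" using xE by (auto simp: E_def)
    then obtain m where m: "n = Suc m" by (cases n) auto
    have "heat_sum s f (Suc m) x \<le> f x + heat s (\<lambda>x. G m x + of_nat m * l) x"
      by (simp add: add_left_mono heat_mono sum_le)
    also have "\<dots> = (f x + heat s (G m) x) + of_nat m * l"
      using s by (subst heat_add) (auto simp: heat_const add.assoc)
    finally have "heat_sum s f n x \<le> (f x + heat s (G m) x) + of_nat m * l" unfolding m .
    moreover have "of_nat n * l = l + of_nat m * l" by (simp add: m distrib_right)
    ultimately have "l + of_nat m * l < (f x + heat s (G m) x) + of_nat m * l"
      using n(2) by (metis order.strict_trans2)
    then have "l \<le> f x + heat s (G m) x"
      by (metis add_right_mono linorder_not_le nle_le)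
    also have "\<dots> \<le> f x + heat s (G N) x"
      using n(1) m by (intro add_left_mono heat_mono G_mono) simp
    finally show ?thesis .
  qed
  have eq: "G (Suc N) x + l * indicator E x = f x + heat s (G N) x" for x
    unfolding GS using E_le[of x] l by (cases "x \<in> E") (auto simp: diff_add_cancel_ennreal)
  \<comment> \<open>Finiteness permits cancelling the integral of \<open>G (Suc N)\<close> at the
    end; this is why the case of infinite integral of \<open>f\<close> is split off.\<close>
  have Gfin: "(\<integral>\<^sup>+x. G n x \<partial>lborel) < \<infinity>" for n
  proof -
    have "(\<integral>\<^sup>+x. G n x \<partial>lborel) \<le> (\<integral>\<^sup>+x. heat_sum s f n x \<partial>lborel)" by (intro nn_integral_mono G_le)
    also have "\<dots> < \<infinity>" using False s ennreal_mult_less_top[of "of_nat n" "\<integral>\<^sup>+x. f x \<partial>lborel"]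
      by (simp add: nn_integral_heat_sum less_top of_nat_less_top)
    finally show ?thesis .
  qed
  have "(\<integral>\<^sup>+x. G (Suc N) x \<partial>lborel) + l * emeasure lborel E = (\<integral>\<^sup>+x. G (Suc N) x + l * indicator E x \<partial>lborel)"
    by (subst nn_integral_add) (auto simp: nn_integral_cmult)
  also have "\<dots> = (\<integral>\<^sup>+x. f x + heat s (G N) x \<partial>lborel)" by (simp only: eq)
  also have "\<dots> = (\<integral>\<^sup>+x. f x \<partial>lborel) + (\<integral>\<^sup>+x. G N x \<partial>lborel)"
    using s by (subst nn_integral_add) (auto simp: nn_integral_heat)
  also have "\<dots> \<le> (\<integral>\<^sup>+x. f x \<partial>lborel) + (\<integral>\<^sup>+x. G (Suc N) x \<partial>lborel)"
    by (intro add_left_mono nn_integral_mono G_Suc)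
  finally have "(\<integral>\<^sup>+x. G (Suc N) x \<partial>lborel) + l * emeasure lborel E
    \<le> (\<integral>\<^sup>+x. G (Suc N) x \<partial>lborel) + (\<integral>\<^sup>+x. f x \<partial>lborel)" by (simp add: add.commute)
  then show ?thesis
    using Gfin[of "Suc N"] by (auto simp: ennreal_add_left_cancel_le)
qed simp

lemma hopf_maximal:
  fixes f :: "'a::euclidean_space \<Rightarrow> ennreal"
  assumes f[measurable]: "f \<in> borel_measurable borel" and s: "0 < s" and l: "l < \<infinity>"
  shows "l * emeasure lborel {x. \<exists>n. of_nat n * l < heat_sum s f n x} \<le> (\<integral>\<^sup>+x. f x \<partial>lborel)"
proof -
  define E where "E N = {x. \<exists>n\<le>N. of_nat n * l < heat_sum s f n x}" for N
  have Em: "E N \<in> sets lborel" for N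
  proof -
    have "E N = (\<Union>n\<in>{..N}. {x \<in> space borel. of_nat n * l < heat_sum s f n x})" by (auto simp: E_def)
    also have "\<dots> \<in> sets borel" by (intro sets.finite_UN) auto
    finally show ?thesis by simp
  qed
  have "incseq E" by (auto simp: incseq_def E_def intro: order_trans)
  then have "emeasure lborel (\<Union>N. E N) = (SUP N. emeasure lborel (E N))"
    using Em by (intro SUP_emeasure_incseq[symmetric]) auto
  moreover have "(\<Union>N. E N) = {x. \<exists>n. of_nat n * l < heat_sum s f n x}" by (auto simp: E_def)
  ultimately have "l * emeasure lborel {x. \<exists>n. of_nat n * l < heat_sum s f n x} = (SUP N. l * emeasure lborel (E N))"
    by (simp add: SUP_mult_left_ennreal)
  also have "\<dots> \<le> (\<integral>\<^sup>+x. f x \<partial>lborel)"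
    unfolding E_def by (intro SUP_least hopf_maximal_finite f s l)
  finally show ?thesis .
qed

text \<open>The Gaussian exponential increases with time, and the normalising factor drops by at
  most 3 to the power d / 2 when time grows by a factor of at most 3.\<close>

lemma heat_kernel_comparison:
  fixes x :: "'a::euclidean_space"
  assumes t: "0 < t" "t \<le> r" "r \<le> 3 * t"
  shows "heat_kernel t x \<le> 3 powr (real DIM('a) / 2) * heat_kernel r x"
proof -
  have "(4 * pi * t) powr (- real DIM('a) / 2) = 3 powr (real DIM('a) / 2) * (4 * pi * (3 * t)) powr (- real DIM('a) / 2)"
  proof -
    have "(4 * pi * (3 * t)) powr (- real DIM('a) / 2) = 3 powr (- real DIM('a) / 2) * (4 * pi * t) powr (- real DIM('a) / 2)"
      using t(1) by (subst powr_mult[symmetric]) (auto simp: mult_ac)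
    moreover have "3 powr (real DIM('a) / 2) * 3 powr (- real DIM('a) / 2) = (1::real)"
      by (subst powr_add[symmetric]) simp
    ultimately show ?thesis by (simp only: mult.assoc[symmetric] mult_1)
  qed
  also have "(4 * pi * (3 * t)) powr (- real DIM('a) / 2) \<le> (4 * pi * r) powr (- real DIM('a) / 2)"
    using t by (intro powr_mono2') auto
  finally have 1: "(4 * pi * t) powr (- real DIM('a) / 2) \<le> 3 powr (real DIM('a) / 2) * (4 * pi * r) powr (- real DIM('a) / 2)"
    by simp
  have 2: "exp (- (norm x)\<^sup>2 / (4 * t)) \<le> exp (- (norm x)\<^sup>2 / (4 * r))"
    using t by (auto intro!: divide_left_mono)
  have "heat_kernel t x \<le> (3 powr (real DIM('a) / 2) * (4 * pi * r) powr (- real DIM('a) / 2)) * exp (- (norm x)\<^sup>2 / (4 * r))"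
    unfolding heat_kernel_def by (intro mult_mono 1 2) auto
  then show ?thesis by (simp add: heat_kernel_def mult.assoc)
qed

text \<open>Turns a single time into an ergodic average: the 2 n times \<open>j * s\<close> with n
  \<le> j < 3 n lie within a factor 3 after \<open>n * s\<close>, so each of them dominates the
  value at \<open>n * s\<close> up to the constant of the kernel comparison.\<close>

lemma heat_le_heat_sum:
  fixes f :: "'a::euclidean_space \<Rightarrow> ennreal"
  assumes f[measurable]: "f \<in> borel_measurable borel" and s: "0 < s" and n: "0 < n"
  shows "of_nat (2 * n) * heat (real n * s) f x \<le> ennreal (3 powr (real DIM('a) / 2)) * heat_sum s f (3 * n) x"
proof -
  let ?C = "ennreal (3 powr (real DIM('a) / 2))"
  have cmp: "heat (real n * s) f x \<le> ?C * heat (real j * s) f x" if "n \<le> j" "j \<le> 3 * n" for j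
  proof -
    have "real j \<le> 3 * real n" using that(2) by linarith
    then have "real j * s \<le> 3 * (real n * s)" using s by (simp add: mult.assoc[symmetric])
    then have "heat_kernel (real n * s) y \<le> 3 powr (real DIM('a) / 2) * heat_kernel (real j * s) y" for y :: 'a
      using that s n by (intro heat_kernel_comparison) auto
    then have "(\<integral>\<^sup>+y. heat_kernel (real n * s) (x - y) * f y \<partial>lborel)
        \<le> (\<integral>\<^sup>+y. ?C * (heat_kernel (real j * s) (x - y) * f y) \<partial>lborel)"
      by (intro nn_integral_mono)
        (auto simp: mult.assoc[symmetric] ennreal_mult[symmetric] intro!: mult_right_mono ennreal_leI)
    also have "\<dots> = ?C * (\<integral>\<^sup>+y. heat_kernel (real j * s) (x - y) * f y \<partial>lborel)"
      by (rule nn_integral_cmult) measurable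
    finally show ?thesis by (simp add: heat_eq)
  qed
  have "of_nat (2 * n) * heat (real n * s) f x = (\<Sum>j\<in>{n..<3 * n}. heat (real n * s) f x)"
    by simp
  also have "\<dots> \<le> (\<Sum>j\<in>{n..<3 * n}. ?C * heat (real j * s) f x)"
    by (intro sum_mono cmp) auto
  also have "\<dots> = ?C * (\<Sum>j\<in>{n..<3 * n}. heat (real j * s) f x)"
    by (rule sum_distrib_left[symmetric])
  \<comment> \<open>\<open>heat_sum_eq\<close> numbers the positive times by \<open>Suc k\<close>,
    hence the reindexing; the summand \<open>f x\<close> at time 0 is only added in the end.\<close>
  also have "(\<Sum>j\<in>{n..<3 * n}. heat (real j * s) f x) \<le> (\<Sum>j\<in>Suc ` {..<3 * n - 1}. heat (real j * s) f x)"
  proof (rule sum_mono2)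
    show "{n..<3 * n} \<subseteq> Suc ` {..<3 * n - 1}"
    proof
      fix j assume "j \<in> {n..<3 * n}"
      then have "j = Suc (j - 1)" "j - 1 < 3 * n - 1" using n by auto
      then show "j \<in> Suc ` {..<3 * n - 1}" by blast
    qed
  qed auto
  also have "\<dots> = (\<Sum>k<3 * n - 1. heat (real (Suc k) * s) f x)"
    by (subst sum.reindex) auto
  also have "\<dots> \<le> heat_sum s f (Suc (3 * n - 1)) x"
    unfolding heat_sum_eq[OF f s] by simp
  also have "Suc (3 * n - 1) = 3 * n" using n by simp
  finally show ?thesis by (simp add: mult_left_mono)
qed

section \<open>From all positive times to dyadic times\<close>

definition heat_sup :: "('a::euclidean_space \<Rightarrow> ennreal) \<Rightarrow> 'a \<Rightarrow> ennreal" where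
  "heat_sup f x = (SUP t\<in>{0<..}. heat t f x)"

text \<open>Positive multiples of one step: countably many, so measurability is preserved, and
  closed under adding the step, which the ergodic sums and the energy argument both exploit.\<close>

definition heat_sup_dyadic :: "nat \<Rightarrow> ('a::euclidean_space \<Rightarrow> ennreal) \<Rightarrow> 'a \<Rightarrow> ennreal" where
  "heat_sup_dyadic k f x = (SUP n. heat (real (Suc n) / 2 ^ k) f x)"

text \<open>Fatou's lemma along pointwise convergent kernels. It requires no finiteness, and lower
  semicontinuity is all that the passage to dyadic times needs.\<close>

lemma heat_lower_semicontinuous:
  fixes f :: "'a::euclidean_space \<Rightarrow> ennreal"
  assumes [measurable]: "f \<in> borel_measurable borel" and t: "0 < t" and lim: "r \<longlonglongrightarrow> t" "X \<longlonglongrightarrow> x"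
  shows "heat t f x \<le> liminf (\<lambda>n. heat (r n) f (X n))"
proof -
  have "heat t f x = (\<integral>\<^sup>+y. liminf (\<lambda>n. ennreal (heat_kernel (r n) (X n - y)) * f y) \<partial>lborel)"
    unfolding heat_eq[OF assms(1)]
  proof (intro nn_integral_cong)
    fix y
    have kl: "(\<lambda>n. heat_kernel (r n) (X n - y)) \<longlonglongrightarrow> heat_kernel t (x - y)"
      unfolding heat_kernel_def using t by (intro tendsto_intros lim) auto
    have "(\<lambda>n. ennreal (heat_kernel (r n) (X n - y)) * f y) \<longlonglongrightarrow> ennreal (heat_kernel t (x - y)) * f y"
    proof (cases "f y")
      case (real c)
      have "(\<lambda>n. ennreal (heat_kernel (r n) (X n - y) * c)) \<longlonglongrightarrow> ennreal (heat_kernel t (x - y) * c)"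
        by (intro tendsto_ennrealI tendsto_mult kl tendsto_const)
      then show ?thesis using real by (simp add: ennreal_mult)
    next
      case top
      have "\<forall>\<^sub>F n in sequentially. 0 < r n" using order_tendstoD(1)[OF lim(1) t] .
      then have "\<forall>\<^sub>F n in sequentially. ennreal (heat_kernel (r n) (X n - y)) * f y = \<infinity>"
      proof (rule eventually_mono)
        fix n assume "0 < r n"
        then have "0 < heat_kernel (r n) (X n - y)" by (rule heat_kernel_pos)
        then show "ennreal (heat_kernel (r n) (X n - y)) * f y = \<infinity>" using top by (simp add: ennreal_mult_top)
      qed
      moreover have "ennreal (heat_kernel t (x - y)) * f y = \<infinity>"
        using heat_kernel_pos[OF t, of "x - y"] top by (auto simp: ennreal_mult_top)
      ultimately show ?thesis by (simp add: tendsto_eventually)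
    qed
    then show "ennreal (heat_kernel t (x - y)) * f y = liminf (\<lambda>n. ennreal (heat_kernel (r n) (X n - y)) * f y)"
      using lim_imp_Liminf[OF sequentially_bot] by metis
  qed
  also have "\<dots> \<le> liminf (\<lambda>n. heat (r n) f (X n))"
    unfolding heat_eq[OF assms(1)] by (rule nn_integral_liminf) measurable
  finally show ?thesis .
qed

lemma heat_sup_dyadic_incseq: "heat_sup_dyadic k f x \<le> heat_sup_dyadic (Suc k) f x"
  unfolding heat_sup_dyadic_def
proof (rule SUP_least)
  fix n :: nat
  have "real (Suc n) / 2 ^ k = real (Suc (2 * n + 1)) / 2 ^ Suc k" by (simp add: field_simps)
  then show "heat (real (Suc n) / 2 ^ k) f x \<le> (SUP n. heat (real (Suc n) / 2 ^ Suc k) f x)"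
    by (simp only:) (rule SUP_upper, simp)
qed

lemma heat_sup_eq_dyadic:
  fixes f :: "'a::euclidean_space \<Rightarrow> ennreal"
  assumes f: "f \<in> borel_measurable borel"
  shows "heat_sup f x = (SUP k. heat_sup_dyadic k f x)"
proof (rule antisym)
  show "heat_sup f x \<le> (SUP k. heat_sup_dyadic k f x)"
    unfolding heat_sup_def
  proof (rule SUP_least)
    fix t :: real assume "t \<in> {0<..}"
    then have t: "0 < t" by simp
    \<comment> \<open>Round \<open>t\<close> up to a multiple of 2^-k, so that it stays positive; 1
      is subtracted because \<open>heat_sup_dyadic\<close> counts by \<open>Suc n\<close>.\<close>
    define n where "n k = nat \<lceil>t * 2 ^ k\<rceil> - 1" for k
    have n: "real (Suc (n k)) = of_int \<lceil>t * 2 ^ k\<rceil>" for k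
    proof -
      have "0 < \<lceil>t * 2 ^ k\<rceil>" using t by simp
      then show ?thesis unfolding n_def by (simp add: of_nat_diff Suc_diff_1 nat_0_iff)
    qed
    have "(\<lambda>k. real (Suc (n k)) / 2 ^ k) \<longlonglongrightarrow> t"
    proof (rule tendsto_sandwich)
      show "\<forall>\<^sub>F k in sequentially. t \<le> real (Suc (n k)) / 2 ^ k"
        unfolding n by (intro always_eventually allI) (simp add: field_simps)
      show "\<forall>\<^sub>F k in sequentially. real (Suc (n k)) / 2 ^ k \<le> t + (1 / 2) ^ k"
      proof (intro always_eventually allI)
        fix k
        have "of_int \<lceil>t * 2 ^ k\<rceil> \<le> t * 2 ^ k + 1" by linarith
        then have "of_int \<lceil>t * 2 ^ k\<rceil> / 2 ^ k \<le> (t * 2 ^ k + 1) / 2 ^ k" by (intro divide_right_mono) auto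
        also have "\<dots> = t + (1 / 2) ^ k" by (simp add: add_divide_distrib power_one_over)
        finally show "real (Suc (n k)) / 2 ^ k \<le> t + (1 / 2) ^ k" unfolding n .
      qed
      have "(\<lambda>k. t + (1 / 2) ^ k) \<longlonglongrightarrow> t + 0" by (intro tendsto_add tendsto_const LIMSEQ_realpow_zero) auto
      then show "(\<lambda>k. t + (1 / 2) ^ k) \<longlonglongrightarrow> t" by simp
    qed auto
    then have "heat t f x \<le> liminf (\<lambda>k. heat (real (Suc (n k)) / 2 ^ k) f x)"
      by (rule heat_lower_semicontinuous[OF f t _ tendsto_const])
    also have "\<dots> \<le> (SUP k. heat_sup_dyadic k f x)"
    proof (rule Liminf_le)
      have "heat (real (Suc (n k)) / 2 ^ k) f x \<le> (SUP k. heat_sup_dyadic k f x)" for k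
        unfolding heat_sup_dyadic_def by (rule SUP_upper2[of k]) (auto intro: SUP_upper)
      then show "\<forall>\<^sub>F k in sequentially. heat (real (Suc (n k)) / 2 ^ k) f x \<le> (SUP k. heat_sup_dyadic k f x)" by simp
    qed simp
    finally show "heat t f x \<le> (SUP k. heat_sup_dyadic k f x)" .
  qed
  show "(SUP k. heat_sup_dyadic k f x) \<le> heat_sup f x"
    unfolding heat_sup_def heat_sup_dyadic_def by (intro SUP_least SUP_upper) auto
qed

lemma borel_measurable_heat_sup_dyadic [measurable]:
  assumes [measurable]: "f \<in> borel_measurable borel"
  shows "heat_sup_dyadic k f \<in> borel_measurable borel"
  unfolding heat_sup_dyadic_def[abs_def] by measurable

lemma borel_measurable_heat_sup [measurable]:
  assumes [measurable]: "f \<in> borel_measurable borel"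
  shows "heat_sup f \<in> borel_measurable borel"
proof -
  have "heat_sup f = (\<lambda>x. SUP k. heat_sup_dyadic k f x)" using heat_sup_eq_dyadic[OF assms] by blast
  then show ?thesis by simp
qed

text \<open>The factor 3 / 2 in \<open>C\<close> is the ratio of the 3 n terms of the sum to the 2 n
  times compared. The level is doubled to discard the part of \<open>f\<close> below
  \<open>l\<close>, which contributes at most \<open>l\<close> per term; the integral over
  \<open>l < f x\<close> that remains is what interpolation requires.\<close>

lemma heat_sup_weak_type:
  fixes f :: "'a::euclidean_space \<Rightarrow> ennreal"
  assumes f[measurable]: "f \<in> borel_measurable borel" and l: "0 < l" "l < \<infinity>"
  defines "C \<equiv> ennreal (3 powr (real DIM('a) / 2) * 3 / 2)"
  shows "l * emeasure lborel {x. C * (2 * l) < heat_sup f x} \<le> (\<integral>\<^sup>+x. f x * indicator {x. l < f x} x \<partial>lborel)"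
proof -
  let ?f1 = "\<lambda>x. f x * indicator {x. l < f x} x"
  let ?C = "3 powr (real DIM('a) / 2)"
  have f1[measurable]: "?f1 \<in> borel_measurable borel" by measurable
  have k: "l * emeasure lborel {x. C * (2 * l) < heat_sup_dyadic k f x} \<le> (\<integral>\<^sup>+x. ?f1 x \<partial>lborel)" for k
  proof -
    define s :: real where "s = 1 / 2 ^ k"
    have s: "0 < s" by (simp add: s_def)
    have "{x. C * (2 * l) < heat_sup_dyadic k f x} \<subseteq> {x. \<exists>n. of_nat n * l < heat_sum s ?f1 n x}"
    proof
      fix x assume "x \<in> {x. C * (2 * l) < heat_sup_dyadic k f x}"
      then obtain m where m: "C * (2 * l) < heat (real (Suc m) * s) f x"
        by (auto simp: heat_sup_dyadic_def less_SUP_iff s_def)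
      let ?n = "Suc m"
      have L: "of_nat (2 * ?n) * (C * (2 * l)) = ennreal ?C * (of_nat (3 * ?n) * l + of_nat (3 * ?n) * l)"
      proof -
        have "of_nat (2 * ?n) * (C * (2 * l)) = (ennreal (real (2 * ?n)) * C * 2) * l"
          by (simp add: ennreal_of_nat_eq_real_of_nat mult_ac)
        also have "ennreal (real (2 * ?n)) * C * 2 = ennreal (real (2 * ?n) * (?C * 3 / 2) * 2)"
          unfolding C_def by (simp only: ennreal_numeral[symmetric] ennreal_mult[symmetric] of_nat_0_le_iff mult_nonneg_nonneg powr_ge_zero zero_le_numeral zero_le_divide_iff simp_thms)
        also have "real (2 * ?n) * (?C * 3 / 2) * 2 = ?C * (real (3 * ?n) + real (3 * ?n))" by (simp add: algebra_simps)
        also have "ennreal \<dots> = ennreal ?C * (of_nat (3 * ?n) + of_nat (3 * ?n))"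
          by (subst ennreal_mult) (auto simp only: ennreal_plus[symmetric] ennreal_of_nat_eq_real_of_nat of_nat_0_le_iff powr_ge_zero add_nonneg_nonneg)
        finally show ?thesis by (simp add: distrib_right mult.assoc)
      qed
      have "of_nat (2 * ?n) * (C * (2 * l)) < of_nat (2 * ?n) * heat (real ?n * s) f x"
        using m by (intro ennreal_mult_strict_left_mono) (auto simp: of_nat_less_top ennreal_mult_less_top add_pos_nonneg)
      also have "\<dots> \<le> ennreal ?C * heat_sum s f (3 * ?n) x"
        by (rule heat_le_heat_sum[OF f s]) simp
      also have "\<dots> \<le> ennreal ?C * heat_sum s (\<lambda>x. ?f1 x + l) (3 * ?n) x"
        by (intro mult_left_mono heat_sum_mono) (auto split: split_indicator simp: add_increasing2)
      also have "heat_sum s (\<lambda>x. ?f1 x + l) (3 * ?n) x = heat_sum s ?f1 (3 * ?n) x + of_nat (3 * ?n) * l"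
        by (rule heat_sum_add_const[OF f1 s])
      finally have lt: "ennreal ?C * (of_nat (3 * ?n) * l + of_nat (3 * ?n) * l)
          < ennreal ?C * (heat_sum s ?f1 (3 * ?n) x + of_nat (3 * ?n) * l)" unfolding L .
      have "of_nat (3 * ?n) * l < heat_sum s ?f1 (3 * ?n) x"
      proof (rule ccontr)
        assume "\<not> ?thesis"
        then have "ennreal ?C * (heat_sum s ?f1 (3 * ?n) x + of_nat (3 * ?n) * l)
            \<le> ennreal ?C * (of_nat (3 * ?n) * l + of_nat (3 * ?n) * l)"
          by (intro mult_left_mono add_right_mono) (auto simp: not_less)
        with lt show False by simp
      qed
      then show "x \<in> {x. \<exists>n. of_nat n * l < heat_sum s ?f1 n x}" by blast
    qed
    then have "emeasure lborel {x. C * (2 * l) < heat_sup_dyadic k f x} \<le> emeasure lborel {x. \<exists>n. of_nat n * l < heat_sum s ?f1 n x}"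
      by (intro emeasure_mono) auto
    then have "l * emeasure lborel {x. C * (2 * l) < heat_sup_dyadic k f x} \<le> l * emeasure lborel {x. \<exists>n. of_nat n * l < heat_sum s ?f1 n x}"
      by (rule mult_left_mono) simp
    also have "\<dots> \<le> (\<integral>\<^sup>+x. ?f1 x \<partial>lborel)" by (rule hopf_maximal[OF f1 s l(2)])
    finally show ?thesis .
  qed
  have "{x. C * (2 * l) < heat_sup f x} = (\<Union>k. {x. C * (2 * l) < heat_sup_dyadic k f x})"
    by (auto simp: heat_sup_eq_dyadic[OF f] less_SUP_iff)
  moreover have "incseq (\<lambda>k. {x. C * (2 * l) < heat_sup_dyadic k f x})"
    by (rule incseq_SucI) (use heat_sup_dyadic_incseq in \<open>auto intro: order.strict_trans2\<close>)
  ultimately have "emeasure lborel {x. C * (2 * l) < heat_sup f x} = (SUP k. emeasure lborel {x. C * (2 * l) < heat_sup_dyadic k f x})"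
    by (subst SUP_emeasure_incseq) auto
  then have "l * emeasure lborel {x. C * (2 * l) < heat_sup f x} = (SUP k. l * emeasure lborel {x. C * (2 * l) < heat_sup_dyadic k f x})"
    by (simp add: SUP_mult_left_ennreal)
  also have "\<dots> \<le> (\<integral>\<^sup>+x. ?f1 x \<partial>lborel)" by (intro SUP_least k)
  finally show ?thesis .
qed

section \<open>Interpolation between the weak bound and boundedness\<close>

lemma nn_integral_powr_Ioo:
  assumes p: "0 < p" and m: "0 \<le> m"
  shows "(\<integral>\<^sup>+l. ennreal (p * l powr (p - 1)) * indicator {0<..<m} l \<partial>lborel) = ennreal (m powr p)"
proof -
  have "((\<lambda>x. x powr (p - 1)) has_integral (m powr (p - 1 + 1) / (p - 1 + 1))) {0..m}"
    using p m by (intro has_integral_powr_from_0) auto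
  then have "((\<lambda>x. p * x powr (p - 1)) has_integral (p * (m powr p / p))) {0..m}"
    using p by (intro has_integral_mult_right) simp
  then have "((\<lambda>x. p * x powr (p - 1)) has_integral (m powr p)) {0..m}" using p by simp
  then have "(\<integral>\<^sup>+x\<in>{0..m}. ennreal (p * x powr (p - 1)) \<partial>lborel) = ennreal (m powr p)"
    using p by (intro nn_integral_has_integral_lebesgue') auto
  moreover have "(\<integral>\<^sup>+x\<in>{0..m}. ennreal (p * x powr (p - 1)) \<partial>lborel)
    = (\<integral>\<^sup>+l. ennreal (p * l powr (p - 1)) * indicator {0<..<m} l \<partial>lborel)"
    by (rule nn_integral_cong_AE, rule AE_mp[OF AE_conjI[OF AE_lborel_singleton[of 0] AE_lborel_singleton[of m]]])
      (auto split: split_indicator intro!: AE_I2)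
  ultimately show ?thesis by simp
qed

text \<open>The weak bound is integrated against p l^(p-1) dl. After Tonelli the inner integral of
  l^(p-2) over (0, f x) remains; it converges because p > 1 and yields the factor p / (p -
  1).\<close>

theorem heat_sup_Lp:
  fixes f :: "'a::euclidean_space \<Rightarrow> real"
  assumes f[measurable]: "f \<in> borel_measurable borel" and p: "1 < p"
    and nn: "\<And>x. 0 \<le> f x" and fin: "(\<integral>\<^sup>+x. ennreal (f x powr p) \<partial>lborel) < \<infinity>"
  shows "AE x in lborel. heat_sup (\<lambda>x. ennreal (f x)) x < \<infinity>"
    and "(\<integral>\<^sup>+x. ennreal (enn2real (heat_sup (\<lambda>x. ennreal (f x)) x) powr p) \<partial>lborel) < \<infinity>"
proof -
  let ?f = "\<lambda>x. ennreal (f x)" and ?c = "3 powr (real DIM('a) / 2) * 3 :: real"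
  let ?M = "heat_sup ?f"
  have c: "0 < ?c" by simp
  have Mm[measurable]: "?M \<in> borel_measurable borel" by measurable
  \<comment> \<open>For finite \<open>M\<close> this is the p-th power of M / c, with c for
    \<open>?c\<close>, by the layer cake formula; for infinite \<open>M\<close> it is infinite. The
    argument is extended-valued because the maximal function is not yet known to be finite.\<close>
  define \<Phi> where "\<Phi> M = (\<integral>\<^sup>+l. ennreal (p * l powr (p - 1)) * (indicator {0<..} l * indicator {z. ennreal (?c * fst z) < snd z} (l, M)) \<partial>lborel)" for M
  have [measurable]: "{z. ennreal (?c * fst z) < (snd z :: ennreal)} \<in> sets (borel \<Otimes>\<^sub>M borel)"
  proof -
    have "{z \<in> space (borel \<Otimes>\<^sub>M borel). ennreal (?c * fst z) < (snd z :: ennreal)} \<in> sets (borel \<Otimes>\<^sub>M borel)"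
      by measurable
    then show ?thesis by (simp add: space_pair_measure)
  qed
  have weak: "ennreal (l powr (p - 1)) * emeasure lborel {x. ennreal (?c * l) < ?M x}
    \<le> (\<integral>\<^sup>+x. ennreal (l powr (p - 2)) * (ennreal (f x) * indicator {l<..} (f x)) \<partial>lborel)" if l: "0 < l" for l
  proof -
    have e: "ennreal (?c / 2) * (2 * ennreal l) = ennreal (?c * l)"
      using l by (simp add: ennreal_mult[symmetric] flip: ennreal_numeral)
    have "ennreal l * emeasure lborel {x. ennreal (?c * l) < ?M x}
        \<le> (\<integral>\<^sup>+x. ?f x * indicator {x. ennreal l < ?f x} x \<partial>lborel)"
      using heat_sup_weak_type[of ?f "ennreal l"] l e by simp
    also have "\<dots> = (\<integral>\<^sup>+x. ennreal (f x) * indicator {l<..} (f x) \<partial>lborel)"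
      using l nn by (intro nn_integral_cong) (auto split: split_indicator simp: ennreal_less_iff)
    finally have "ennreal (l powr (p - 2)) * (ennreal l * emeasure lborel {x. ennreal (?c * l) < ?M x})
      \<le> ennreal (l powr (p - 2)) * (\<integral>\<^sup>+x. ennreal (f x) * indicator {l<..} (f x) \<partial>lborel)"
      by (rule mult_left_mono) simp
    moreover have "l powr (p - 1) = l powr (p - 2) * l"
      using l powr_add[of l "p - 2" 1] by simp
    ultimately show ?thesis
      using l by (simp add: ennreal_mult nn_integral_cmult mult.assoc)
  qed
  have "(\<integral>\<^sup>+x. \<Phi> (?M x) \<partial>lborel)
    = (\<integral>\<^sup>+l. \<integral>\<^sup>+x. ennreal (p * l powr (p - 1)) * (indicator {0<..} l * indicator {z. ennreal (?c * fst z) < snd z} (l, ?M x)) \<partial>lborel \<partial>lborel)"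
    unfolding \<Phi>_def by (rule lborel_pair.Fubini') measurable
  also have "\<dots> = (\<integral>\<^sup>+l. ennreal p * (indicator {0<..} l * (ennreal (l powr (p - 1)) * emeasure lborel {x. ennreal (?c * l) < ?M x})) \<partial>lborel)"
  proof (intro nn_integral_cong)
    fix l :: real
    have "(\<integral>\<^sup>+x. ennreal (p * l powr (p - 1)) * (indicator {0<..} l * indicator {z. ennreal (?c * fst z) < snd z} (l, ?M x)) \<partial>lborel)
      = (\<integral>\<^sup>+x. (ennreal (p * l powr (p - 1)) * indicator {0<..} l) * indicator {x. ennreal (?c * l) < ?M x} x \<partial>lborel)"
      by (intro nn_integral_cong) (auto split: split_indicator)
    also have "\<dots> = (ennreal (p * l powr (p - 1)) * indicator {0<..} l) * emeasure lborel {x. ennreal (?c * l) < ?M x}"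
      by (subst nn_integral_cmult_indicator) auto
    finally show "(\<integral>\<^sup>+x. ennreal (p * l powr (p - 1)) * (indicator {0<..} l * indicator {z. ennreal (?c * fst z) < snd z} (l, ?M x)) \<partial>lborel)
      = ennreal p * (indicator {0<..} l * (ennreal (l powr (p - 1)) * emeasure lborel {x. ennreal (?c * l) < ?M x}))"
      using p by (simp add: ennreal_mult mult_ac)
  qed
  also have "\<dots> \<le> (\<integral>\<^sup>+l. ennreal p * (indicator {0<..} l * (\<integral>\<^sup>+x. ennreal (l powr (p - 2)) * (ennreal (f x) * indicator {l<..} (f x)) \<partial>lborel)) \<partial>lborel)"
  proof (rule nn_integral_mono, rule mult_left_mono)
    fix l :: real
    show "indicator {0<..} l * (ennreal (l powr (p - 1)) * emeasure lborel {x. ennreal (?c * l) < ?M x})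
      \<le> indicator {0<..} l * (\<integral>\<^sup>+x. ennreal (l powr (p - 2)) * (ennreal (f x) * indicator {l<..} (f x)) \<partial>lborel)"
      using weak[of l] by (cases "0 < l") auto
  qed simp
  also have "\<dots> = (\<integral>\<^sup>+l. \<integral>\<^sup>+x. ennreal (p * l powr (p - 2)) * (ennreal (f x) * (indicator {0<..} l * indicator {z. fst z < snd z} (l, f x))) \<partial>lborel \<partial>lborel)"
  proof (intro nn_integral_cong)
    fix l :: real
    have "(\<integral>\<^sup>+x. ennreal (p * l powr (p - 2)) * (ennreal (f x) * (indicator {0<..} l * indicator {z. fst z < snd z} (l, f x))) \<partial>lborel)
      = (\<integral>\<^sup>+x. (ennreal p * indicator {0<..} l) * (ennreal (l powr (p - 2)) * (ennreal (f x) * indicator {l<..} (f x))) \<partial>lborel)"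
      using p by (intro nn_integral_cong) (auto split: split_indicator simp: ennreal_mult mult_ac)
    also have "\<dots> = (ennreal p * indicator {0<..} l) * (\<integral>\<^sup>+x. ennreal (l powr (p - 2)) * (ennreal (f x) * indicator {l<..} (f x)) \<partial>lborel)"
      by (rule nn_integral_cmult) measurable
    finally show "ennreal p * (indicator {0<..} l * (\<integral>\<^sup>+x. ennreal (l powr (p - 2)) * (ennreal (f x) * indicator {l<..} (f x)) \<partial>lborel))
      = (\<integral>\<^sup>+x. ennreal (p * l powr (p - 2)) * (ennreal (f x) * (indicator {0<..} l * indicator {z. fst z < snd z} (l, f x))) \<partial>lborel)"
      by (simp add: mult.assoc)
  qed
  also have "\<dots> = (\<integral>\<^sup>+x. \<integral>\<^sup>+l. ennreal (p * l powr (p - 2)) * (ennreal (f x) * (indicator {0<..} l * indicator {z. fst z < snd z} (l, f x))) \<partial>lborel \<partial>lborel)"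
  proof (rule lborel_pair.Fubini'[symmetric])
    have [measurable]: "{z. fst z < (snd z :: real)} \<in> sets (borel \<Otimes>\<^sub>M borel)"
    proof -
      have "{z \<in> space (borel \<Otimes>\<^sub>M borel). fst z < (snd z :: real)} \<in> sets (borel \<Otimes>\<^sub>M borel)"
        by measurable
      then show ?thesis by (simp add: space_pair_measure)
    qed
    show "(\<lambda>(l, x). ennreal (p * l powr (p - 2)) * (ennreal (f x) * (indicator {0<..} l * indicator {z. fst z < snd z} (l, f x))))
      \<in> borel_measurable (lborel \<Otimes>\<^sub>M lborel)" by measurable
  qed
  also have "\<dots> = (\<integral>\<^sup>+x. ennreal (p / (p - 1)) * ennreal (f x powr p) \<partial>lborel)"
  proof (intro nn_integral_cong)
    fix x
    have "(\<integral>\<^sup>+l. ennreal (p * l powr (p - 2)) * (ennreal (f x) * (indicator {0<..} l * indicator {z. fst z < snd z} (l, f x))) \<partial>lborel)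
      = (\<integral>\<^sup>+l. (ennreal (p / (p - 1)) * ennreal (f x)) * (ennreal ((p - 1) * l powr ((p - 1) - 1)) * indicator {0<..<f x} l) \<partial>lborel)"
    proof (intro nn_integral_cong)
      fix l
      have "ennreal (p * l powr (p - 2)) = ennreal (p / (p - 1)) * ennreal ((p - 1) * l powr ((p - 1) - 1))"
        using p by (simp add: ennreal_mult[symmetric])
      then show "ennreal (p * l powr (p - 2)) * (ennreal (f x) * (indicator {0<..} l * indicator {z. fst z < snd z} (l, f x)))
        = (ennreal (p / (p - 1)) * ennreal (f x)) * (ennreal ((p - 1) * l powr ((p - 1) - 1)) * indicator {0<..<f x} l)"
        by (auto split: split_indicator simp: mult_ac)
    qed
    also have "\<dots> = (ennreal (p / (p - 1)) * ennreal (f x)) * ennreal (f x powr (p - 1))"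
      using p nn[of x] nn_integral_powr_Ioo[of "p - 1" "f x"] by (subst nn_integral_cmult) auto
    also have "\<dots> = ennreal (p / (p - 1)) * ennreal (f x powr p)"
    proof -
      have "f x * f x powr (p - 1) = f x powr p"
        using nn[of x] powr_mult_base[of "f x" "p - 1"] by simp
      then show ?thesis using p nn[of x] by (simp add: ennreal_mult[symmetric] mult.assoc)
    qed
    finally show "(\<integral>\<^sup>+l. ennreal (p * l powr (p - 2)) * (ennreal (f x) * (indicator {0<..} l * indicator {z. fst z < snd z} (l, f x))) \<partial>lborel)
      = ennreal (p / (p - 1)) * ennreal (f x powr p)" .
  qed
  also have "\<dots> < \<infinity>"
    using fin by (simp add: nn_integral_cmult ennreal_mult_less_top)
  finally have \<Phi>fin: "(\<integral>\<^sup>+x. \<Phi> (?M x) \<partial>lborel) < \<infinity>" .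
  have \<Phi>m[measurable]: "(\<lambda>x. \<Phi> (?M x)) \<in> borel_measurable borel"
    unfolding \<Phi>_def by measurable
  have \<Phi>ge: "ennreal ((m / ?c) powr p) \<le> \<Phi> M" if "0 \<le> m" "ennreal m \<le> M" for m M
  proof -
    have "ennreal ((m / ?c) powr p) = (\<integral>\<^sup>+l. ennreal (p * l powr (p - 1)) * indicator {0<..<m / ?c} l \<partial>lborel)"
      using p that by (subst nn_integral_powr_Ioo) auto
    also have "\<dots> \<le> \<Phi> M" unfolding \<Phi>_def
    proof (intro nn_integral_mono mult_left_mono)
      fix l
      have "ennreal (?c * l) < M" if "0 < l" "l < m / ?c"
      proof -
        have "?c * l < m" using that(2) c by (simp add: field_simps)
        then have "ennreal (?c * l) < ennreal m" using that c by (subst ennreal_less_iff) auto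
        then show ?thesis using \<open>ennreal m \<le> M\<close> by (rule order.strict_trans2)
      qed
      then show "indicator {0<..<m / ?c} l \<le> (indicator {0<..} l * indicator {z. ennreal (?c * fst z) < snd z} (l, M) :: ennreal)"
        by (auto split: split_indicator)
    qed simp
    finally show ?thesis .
  qed
  have "AE x in lborel. \<Phi> (?M x) \<noteq> \<infinity>"
    using \<Phi>fin by (intro nn_integral_noteq_infinite) auto
  then show "AE x in lborel. ?M x < \<infinity>"
  proof (rule eventually_mono)
    fix x assume x: "\<Phi> (?M x) \<noteq> \<infinity>"
    show "?M x < \<infinity>"
    proof (rule ccontr)
      assume "\<not> ?M x < \<infinity>"
      then have inf: "?M x = \<infinity>" by (simp add: less_top[symmetric])
      obtain B where B: "\<Phi> (?M x) = ennreal B" "0 \<le> B" using x by (cases "\<Phi> (?M x)") auto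
      \<comment> \<open>With an infinite maximal value every finite \<open>m\<close> is admissible
        in \<open>\<Phi>ge\<close>; this one makes the lower bound B + 1.\<close>
      have "ennreal (B + 1) = ennreal ((?c * (B + 1) powr (1 / p) / ?c) powr p)"
        using p B c by (simp add: powr_powr)
      also have "\<dots> \<le> \<Phi> (?M x)" using B c inf by (intro \<Phi>ge) auto
      finally show False using B by (simp del: ennreal_plus add: ennreal_le_iff)
    qed
  qed
  have "(\<integral>\<^sup>+x. ennreal (enn2real (?M x) powr p) \<partial>lborel) \<le> (\<integral>\<^sup>+x. ennreal (?c powr p) * \<Phi> (?M x) \<partial>lborel)"
  proof (intro nn_integral_mono)
    fix x
    show "ennreal (enn2real (?M x) powr p) \<le> ennreal (?c powr p) * \<Phi> (?M x)"
    proof (cases "?M x")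
      case (real m)
      have "ennreal (m powr p) = ennreal (?c powr p) * ennreal ((m / ?c) powr p)"
        using real c by (simp add: powr_divide powr_mult ennreal_mult[symmetric])
      also have "\<dots> \<le> ennreal (?c powr p) * \<Phi> (?M x)"
        using real by (intro mult_left_mono \<Phi>ge) auto
      finally show ?thesis using real by simp
    qed (use p in simp)
  qed
  also have "\<dots> < \<infinity>"
    using \<Phi>fin by (simp add: nn_integral_cmult ennreal_mult_less_top)
  finally show "(\<integral>\<^sup>+x. ennreal (enn2real (?M x) powr p) \<partial>lborel) < \<infinity>" .
qed

section \<open>Sums along partitions of the line\<close>

text \<open>The indexed sum of \<open>total_variation\<close> in a form suited to list induction.
  The general cost covers variation, truncated variation and its two signed parts.\<close>

fun chain_sum :: "('a \<Rightarrow> 'a \<Rightarrow> real) \<Rightarrow> 'a list \<Rightarrow> real" where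
  "chain_sum c (x # y # zs) = c x y + chain_sum c (y # zs)"
| "chain_sum c _ = 0"

lemma chain_sum_Cons: "chain_sum c (x # xs) = (if xs = [] then 0 else c x (hd xs) + chain_sum c xs)"
  by (cases xs) auto

lemma chain_sum_nth: "chain_sum c xs = (\<Sum>i<length xs - 1. c (xs ! i) (xs ! (i + 1)))"
proof (induction c xs rule: chain_sum.induct)
  case (1 c x y zs)
  have "(\<Sum>i<length (x # y # zs) - 1. c ((x # y # zs) ! i) ((x # y # zs) ! (i + 1)))
    = c x y + (\<Sum>i<length zs. c ((y # zs) ! i) (zs ! i))"
    by (simp add: sum.lessThan_Suc_shift del: sum.lessThan_Suc)
  then show ?case using 1 by simp
qed auto

lemma chain_sum_map: "chain_sum c (map g xs) = chain_sum (\<lambda>x y. c (g x) (g y)) xs"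
  by (induction xs) (auto simp: chain_sum_Cons hd_map)

lemma chain_sum_snoc: "chain_sum c (xs @ [a, b]) = chain_sum c (xs @ [a]) + c a b"
  by (induction xs) (auto simp: chain_sum_Cons hd_append)

lemma chain_sum_rev: "chain_sum c (rev xs) = chain_sum (\<lambda>x y. c y x) xs"
proof (induction "\<lambda>x y. c y x" xs rule: chain_sum.induct)
  case (1 x y zs)
  then show ?case using chain_sum_snoc[of c "rev zs" y x] by simp
qed auto

lemma chain_sum_add: "chain_sum (\<lambda>x y. c x y + d x y) xs = chain_sum c xs + chain_sum d xs"
  by (induction c xs rule: chain_sum.induct) auto

lemma chain_sum_cong:
  assumes "sorted_wrt (<) xs" "\<And>x y. x < y \<Longrightarrow> c x y = d x y"
  shows "chain_sum c xs = chain_sum d xs"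
  using assms by (induction c xs rule: chain_sum.induct) auto

lemma chain_sum_mono:
  assumes "sorted_wrt (<) xs" "\<And>x y. x < y \<Longrightarrow> c x y \<le> d x y"
  shows "chain_sum c xs \<le> chain_sum d xs"
  using assms by (induction c xs rule: chain_sum.induct) (auto intro: add_mono)

lemma chain_sum_nonneg:
  assumes "\<And>x y. 0 \<le> c x y"
  shows "0 \<le> chain_sum c xs"
  using assms by (induction c xs rule: chain_sum.induct) auto

lemma chain_sum_refine:
  fixes xs :: "'a::linorder list"
  assumes nn: "\<And>x y. 0 \<le> c x y" and tri: "\<And>x y z. x < y \<Longrightarrow> y < z \<Longrightarrow> c x z \<le> c x y + c y z"
  shows "sorted_wrt (<) xs \<Longrightarrow> sorted_wrt (<) zs \<Longrightarrow> set xs \<subseteq> set zs \<Longrightarrow> chain_sum c xs \<le> chain_sum c zs"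
proof (induction zs arbitrary: xs)
  case (Cons z zs)
  have grow: "chain_sum c zs \<le> chain_sum c (z # zs)" using nn by (simp add: chain_sum_Cons)
  show ?case
  proof (cases xs)
    case xs: (Cons x xs')
    show ?thesis
    proof (cases "x = z")
      case False
      have "set xs \<subseteq> set zs" using Cons.prems xs False by fastforce
      then have "chain_sum c xs \<le> chain_sum c zs" using Cons by simp
      then show ?thesis using grow by simp
    next
      case True
      have sub: "set xs' \<subseteq> set zs" using Cons.prems xs True by fastforce
      show ?thesis
      proof (cases xs')
        case Nil
        then show ?thesis using xs nn by (simp add: chain_sum_nonneg)
      next
        case xs': (Cons x' xs'')
        then obtain z' zs' where zs: "zs = z' # zs'" using sub by (cases zs) auto
        have s': "sorted_wrt (<) xs'" "sorted_wrt (<) zs" using Cons.prems xs by auto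
        show ?thesis
        proof (cases "z' = x'")
          case True
          have "chain_sum c xs' \<le> chain_sum c zs" by (rule Cons.IH[OF s' sub])
          then show ?thesis using xs xs' zs True \<open>x = z\<close> by simp
        next
          case False
          \<comment> \<open>The next point of \<open>zs\<close> is missing from \<open>xs\<close>:
            the triangle inequality inserts it, and the induction hypothesis applies to the enlarged
            list.\<close>
          have lt: "z' < x'" using sub zs xs' s'(2) False by auto
          have "sorted_wrt (<) (z' # xs')" using s'(1) xs' lt by auto
          moreover have "set (z' # xs') \<subseteq> set zs" using sub zs by auto
          ultimately have "chain_sum c (z' # xs') \<le> chain_sum c zs" using s'(2) by (intro Cons.IH)
          moreover have "c z x' \<le> c z z' + c z' x'"
            using Cons.prems(2) zs lt by (intro tri) auto
          ultimately show ?thesis using xs xs' zs \<open>x = z\<close> by simp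
        qed
      qed
    qed
  qed (simp add: chain_sum_nonneg nn)
qed simp

text \<open>Passing from \<open>V\<close> to \<open>F\<close> on a partition: a local maximum of \<open>V\<close> over three
  consecutive points is nearly attained by \<open>F\<close> in between, and \<open>F \<le> V\<close> at the local minima.\<close>

lemma positive_variation_transfer:
  fixes F V :: "real \<Rightarrow> real"
  assumes le: "\<And>x. F x \<le> V x"
    and mid: "\<And>a x b c. a < x \<Longrightarrow> x < b \<Longrightarrow> V a \<le> c \<Longrightarrow> V b \<le> c \<Longrightarrow> (\<And>y. a \<le> y \<Longrightarrow> y \<le> b \<Longrightarrow> F y \<le> c) \<Longrightarrow> V x \<le> c"
    and right: "\<And>a x c. a < x \<Longrightarrow> V a \<le> c \<Longrightarrow> (\<And>y. a \<le> y \<Longrightarrow> F y \<le> c) \<Longrightarrow> V x \<le> c"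
    and e: "0 < e"
  shows "sorted_wrt (<) xs \<Longrightarrow> \<exists>ys. sorted_wrt (<) ys \<and> (\<forall>y\<in>set ys. \<forall>x\<in>set xs. hd xs \<le> y) \<and>
    chain_sum (\<lambda>x y. max 0 (V y - V x)) xs \<le> chain_sum (\<lambda>x y. max 0 (F y - F x)) ys + e * real (length xs)"
proof (induction xs rule: length_induct)
  case (1 xs)
  let ?p = "chain_sum (\<lambda>x y. max 0 (V y - V x))" and ?q = "chain_sum (\<lambda>x y. max 0 (F y - F x))"
  have IH: "\<exists>zs. sorted_wrt (<) zs \<and> (\<forall>y\<in>set zs. hd ys \<le> y) \<and> ?p ys \<le> ?q zs + e * real (length ys)"
    if ysA: "length ys < length xs" "sorted_wrt (<) ys" "ys \<noteq> []" for ys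
  proof -
    obtain zs where "sorted_wrt (<) zs" "\<forall>y\<in>set zs. \<forall>x\<in>set ys. hd ys \<le> y" "?p ys \<le> ?q zs + e * real (length ys)"
      using 1(1) ysA by blast
    then show ?thesis using hd_in_set[OF ysA(3)] by blast
  qed
  consider "xs = []" | a where "xs = [a]" | a x r where "xs = a # x # r" by (metis neq_Nil_conv)
  then show ?case
  proof cases
    case 3
    have sx: "a < x" "sorted_wrt (<) (x # r)" using 1(2) 3 by auto
    show ?thesis
    proof (cases "V x \<le> V a")
      \<comment> \<open>A first step that does not rise costs nothing and is dropped.\<close>
      case True
      obtain ys where ys: "sorted_wrt (<) ys" "\<forall>y\<in>set ys. x \<le> y" "?p (x # r) \<le> ?q ys + e * real (length (x # r))"
        using IH[of "x # r"] sx 3 by auto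
      then show ?thesis using 3 True sx e by (intro exI[of _ ys]) (auto simp: distrib_left)
    next
      case up: False
      show ?thesis
      proof (cases r)
        case Nil
        \<comment> \<open>A level at least \<open>V a\<close> and just below \<open>V x\<close>. If
          \<open>F\<close> stayed under it on the whole half-line, so would
          \<open>V\<close>.\<close>
        define c where "c = max (V a) (V x - e)"
        have "\<not> V x \<le> c" using up e by (auto simp: c_def)
        then obtain y where y: "a \<le> y" "c < F y" using right[OF sx(1), of c] by (force simp: c_def not_le)
        then have "a \<noteq> y" using le[of a] by (auto simp: c_def)
        then show ?thesis using y 3 Nil up le[of a] e
          by (intro exI[of _ "[a, y]"]) (auto simp: c_def)
      next
        case r: (Cons z r')
        have sz: "x < z" "sorted_wrt (<) (z # r')" "sorted_wrt (<) (a # z # r')" using 1(2) 3 r by auto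
        show ?thesis
        proof (cases "V x \<le> V z")
          \<comment> \<open>The ascent continues through \<open>x\<close>, so omitting
            \<open>x\<close> leaves the sum unchanged.\<close>
          case True
          obtain ys where ys: "sorted_wrt (<) ys" "\<forall>y\<in>set ys. a \<le> y" "?p (a # z # r') \<le> ?q ys + e * real (length (a # z # r'))"
            using IH[of "a # z # r'"] sz 3 r by auto
          then show ?thesis using 3 r True up e by (intro exI[of _ ys]) (auto simp: distrib_left)
        next
          case False
          \<comment> \<open>A peak at \<open>x\<close>: the level dominates both neighbours and
            loses at most \<open>e\<close>. A point where \<open>F\<close> exceeds it differs from
            \<open>a\<close> and \<open>z\<close>, because \<open>F \<le> V\<close> there.\<close>
          define c where "c = max (max (V a) (V z)) (V x - e)"
          have "\<not> V x \<le> c" using up False e by (auto simp: c_def)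
          then obtain y where y: "a \<le> y" "y \<le> z" "c < F y"
            using mid[OF sx(1) sz(1), of c] by (force simp: c_def not_le)
          have ne: "a \<noteq> y" "y \<noteq> z" using le[of a] le[of z] y by (auto simp: c_def)
          obtain ys where ys: "sorted_wrt (<) ys" "\<forall>y\<in>set ys. z \<le> y" "?p (z # r') \<le> ?q ys + e * real (length (z # r'))"
            using IH[of "z # r'"] sz 3 r by auto
          have "?p xs = (V x - V a) + ?p (z # r')" using 3 r up False by auto
          also have "\<dots> \<le> (F y - F a + e) + (?q ys + e * real (length (z # r')))"
            using ys(3) y le[of a] by (intro add_mono) (auto simp: c_def)
          also have "\<dots> \<le> ?q (a # y # ys) + e * real (length xs)"
            using 3 r e by (auto simp: chain_sum_Cons distrib_left)
          finally have "?p xs \<le> ?q (a # y # ys) + e * real (length xs)" .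
          moreover have "sorted_wrt (<) (a # y # ys)" using y ne ys by force
          moreover have "\<forall>w\<in>set (a # y # ys). a \<le> w" using y ys sx sz by fastforce
          ultimately show ?thesis using 3 by (intro exI[of _ "a # y # ys"]) auto
        qed
      qed
    qed
  qed (auto intro!: exI[of _ "[]"] simp: e less_imp_le)
qed

section \<open>A maximum principle on the line\<close>

definition heatr :: "real \<Rightarrow> ('a::euclidean_space \<Rightarrow> real) \<Rightarrow> 'a \<Rightarrow> real" where
  "heatr t f x = enn2real (heat t (\<lambda>y. ennreal (f y)) x)"

lemma borel_measurable_heatr [measurable]:
  "f \<in> borel_measurable borel \<Longrightarrow> heatr t f \<in> borel_measurable borel"
  unfolding heatr_def[abs_def] by measurable

lemma heatr_nonneg: "0 \<le> heatr t f x"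
  by (simp add: heatr_def)

lemma heat_eq_heatr: "heat t (\<lambda>y. ennreal (f y)) x < \<infinity> \<Longrightarrow> heat t (\<lambda>y. ennreal (f y)) x = ennreal (heatr t f x)"
  by (simp add: heatr_def)

lemma heatr_integral:
  fixes f :: "'a::euclidean_space \<Rightarrow> real"
  assumes [measurable]: "f \<in> borel_measurable borel" and nn: "\<And>x. 0 \<le> f x"
    and fin: "heat t (\<lambda>y. ennreal (f y)) x < \<infinity>"
  shows "integrable (heat_measure t) (\<lambda>y. f (x - y))"
    and "heatr t f x = (\<integral>y. f (x - y) \<partial>heat_measure t)"
proof -
  show "integrable (heat_measure t) (\<lambda>y. f (x - y))"
    using fin nn by (intro integrableI_nonneg) (auto simp: heat_def)
  show "heatr t f x = (\<integral>y. f (x - y) \<partial>heat_measure t)"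
    unfolding heatr_def heat_def using nn by (subst integral_eq_nn_integral) auto
qed

lemma heat_bounded:
  assumes "0 < t" "\<And>x. f x \<le> B"
  shows "heat t (\<lambda>y. ennreal (f y)) x \<le> ennreal B"
proof -
  have "heat t (\<lambda>y. ennreal (f y)) x \<le> heat t (\<lambda>_. ennreal B) x"
    by (intro heat_mono ennreal_leI assms)
  then show ?thesis using heat_const[OF assms(1)] by metis
qed

text \<open>Boundedness gives continuity of the flow at positive times and controls the kernel tails
  in the maximum principle. Data in L^p are brought into this form by letting the flow run for a
  short time.\<close>

locale bounded_datum =
  fixes f :: "real \<Rightarrow> real" and B :: real
  assumes f_meas [measurable]: "f \<in> borel_measurable borel"
    and f_nonneg: "\<And>x. 0 \<le> f x" and f_le: "\<And>x. f x \<le> B"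
begin

lemma B_nonneg: "0 \<le> B" using f_nonneg f_le order_trans by blast

lemma heat_finite: "0 < t \<Longrightarrow> heat t (\<lambda>y. ennreal (f y)) x < \<infinity>"
  using heat_bounded[of t f B x] f_le by (metis ennreal_less_top infinity_ennreal_def order.strict_trans1)

lemma heatr_le: "0 < t \<Longrightarrow> heatr t f x \<le> B"
  using heat_bounded[of t f B x] f_le B_nonneg unfolding heatr_def
  by (metis enn2real_mono enn2real_ennreal ennreal_less_top)

lemma heatr_heatr:
  assumes "0 < s" "0 < t"
  shows "heatr (s + t) f x = (\<integral>y. heatr t f (x - y) \<partial>heat_measure s)"
proof -
  have e: "(\<lambda>y. heat t (\<lambda>y. ennreal (f y)) y) = (\<lambda>y. ennreal (heatr t f y))"
    using heat_eq_heatr[OF heat_finite[OF assms(2)]] by blast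
  have "heat (s + t) (\<lambda>y. ennreal (f y)) x = heat s (\<lambda>y. ennreal (heatr t f y)) x"
    using heat_heat[of "\<lambda>y. ennreal (f y)" s t x] assms e by simp
  moreover have "heat s (\<lambda>y. ennreal (heatr t f y)) x < \<infinity>"
    using heat_bounded[of s "heatr t f" B x] assms heatr_le
    by (metis ennreal_less_top infinity_ennreal_def order.strict_trans1)
  ultimately show ?thesis
    using heatr_integral(2)[of "heatr t f" s x] by (simp add: heatr_def)
qed

lemma heatr_complement:
  assumes "0 < t"
  shows "heatr t (\<lambda>x. B - f x) x = B - heatr t f x"
proof -
  interpret P: prob_space "heat_measure t :: real measure" by (rule prob_space_heat_measure[OF assms])
  have g: "heat t (\<lambda>y. ennreal (B - f y)) x < \<infinity>"
    using heat_bounded[of t "\<lambda>x. B - f x" B x] assms f_nonneg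
    by (metis diff_left_mono diff_zero ennreal_less_top infinity_ennreal_def order.strict_trans1)
  have "heatr t (\<lambda>x. B - f x) x = (\<integral>y. B - f (x - y) \<partial>heat_measure t)"
    using f_le g by (intro heatr_integral) auto
  also have "\<dots> = B - (\<integral>y. f (x - y) \<partial>heat_measure t)"
    using heatr_integral(1)[OF f_meas f_nonneg heat_finite[OF assms], of x] P.prob_space by simp
  also have "\<dots> = B - heatr t f x"
    using heatr_integral(2)[OF f_meas f_nonneg heat_finite[OF assms], of x] by simp
  finally show ?thesis .
qed

text \<open>Fatou's lemma for \<open>f\<close> and for \<open>B - f\<close>.\<close>

lemma heatr_continuous:
  assumes t: "0 < t" and lim: "r \<longlonglongrightarrow> t" "X \<longlonglongrightarrow> x" and pos: "\<And>n. 0 < r n"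
  shows "(\<lambda>n. heatr (r n) f (X n)) \<longlonglongrightarrow> heatr t f x"
proof -
  have low: "\<forall>\<^sub>F n in sequentially. c < heatr (r n) g (X n)"
    if g: "bounded_datum g B" and c: "c < heatr t g x" for c g
  proof (cases "c < 0")
    case True
    then show ?thesis using heatr_nonneg[of _ g] by (intro always_eventually allI) (rule order.strict_trans2)
  next
    case False
    interpret g: bounded_datum g B by fact
    have "ennreal c < heat t (\<lambda>y. ennreal (g y)) x"
      using c False by (simp add: heat_eq_heatr[OF g.heat_finite[OF t]] ennreal_less_iff)
    also have "\<dots> \<le> liminf (\<lambda>n. heat (r n) (\<lambda>y. ennreal (g y)) (X n))"
      by (rule heat_lower_semicontinuous[OF _ t lim]) simp
    finally have "\<forall>\<^sub>F n in sequentially. ennreal c < heat (r n) (\<lambda>y. ennreal (g y)) (X n)"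
      by (simp add: less_LiminfD)
    then show ?thesis
      by (rule eventually_mono) (use False in \<open>simp add: heat_eq_heatr[OF g.heat_finite[OF pos]] ennreal_less_iff\<close>)
  qed
  show ?thesis
  proof (rule order_tendstoI)
    fix c assume "c < heatr t f x"
    then show "\<forall>\<^sub>F n in sequentially. c < heatr (r n) f (X n)" using low[OF bounded_datum_axioms] by blast
  next
    fix c assume c: "heatr t f x < c"
    have "bounded_datum (\<lambda>x. B - f x) B"
      by unfold_locales (auto simp: f_le f_nonneg)
    then have "\<forall>\<^sub>F n in sequentially. B - c < heatr (r n) (\<lambda>x. B - f x) (X n)"
      using c by (intro low) (auto simp: heatr_complement[OF t])
    then show "\<forall>\<^sub>F n in sequentially. heatr (r n) f (X n) < c"
      by (rule eventually_mono) (simp add: heatr_complement[OF pos])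
  qed
qed

text \<open>At an interior maximum \<open>(t\<^sub>0, x\<^sub>0)\<close> of the difference to the barrier, the reproducing
  identity \<open>P\<^sub>d w(t\<^sub>0 - d) = w(t\<^sub>0)\<close> is violated to first order in \<open>d\<close>: the second moment
  of the kernel gives \<open>- 2 e d\<close>, the fourth moment bounds the error by \<open>O(d\<^sup>2)\<close>.\<close>

lemma heat_comparison:
  assumes s: "0 < s" and ab: "a < b"
    and lat: "\<And>t. s \<le> t \<Longrightarrow> heatr t f a \<le> c + l * a" "\<And>t. s \<le> t \<Longrightarrow> heatr t f b \<le> c + l * b"
    and init: "\<And>y. a \<le> y \<Longrightarrow> y \<le> b \<Longrightarrow> heatr s f y \<le> c + l * y"
    and t: "s \<le> t" and x: "a \<le> x" "x \<le> b"
  shows "heatr t f x \<le> c + l * x"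
proof (rule ccontr)
  assume "\<not> ?thesis"
  then have gt: "0 < heatr t f x - (c + l * x)" by simp
  \<comment> \<open>The barrier vanishes at the lateral boundary, is nonpositive between, and has
    second derivative 2.\<close>
  define q where "q z = (z - a) * (z - b)" for z
  have q_le: "q z \<le> 0" if "a \<le> z" "z \<le> b" for z
    unfolding q_def using that by (intro mult_nonneg_nonpos) auto
  \<comment> \<open>Small enough that adding \<open>e * q x\<close> leaves part of the violation at
    \<open>(t, x)\<close>, so that the maximum of \<open>H\<close> stays positive.\<close>
  define e where "e = (heatr t f x - (c + l * x)) / (2 * (1 + \<bar>q x\<bar>))"
  have e: "0 < e" unfolding e_def using gt by (intro divide_pos_pos) auto
  have eq: "e * \<bar>q x\<bar> < heatr t f x - (c + l * x)"
  proof -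
    have "e * (2 * (1 + \<bar>q x\<bar>)) = heatr t f x - (c + l * x)" by (simp add: e_def)
    moreover have "e * (2 * (1 + \<bar>q x\<bar>)) = 2 * e + 2 * (e * \<bar>q x\<bar>)" by (simp add: algebra_simps)
    moreover have "0 \<le> e * \<bar>q x\<bar>" using e by simp
    ultimately show ?thesis using e by linarith
  qed
  define H where "H p = heatr (fst p) f (snd p) - (c + l * snd p) + e * q (snd p)" for p
  let ?Q = "{s..t} \<times> {a..b}"
  have "continuous_on ?Q H"
    unfolding continuous_on_sequentially
  proof (intro allI ballI impI)
    fix p :: "nat \<Rightarrow> real \<times> real" and z assume z: "z \<in> ?Q" and p: "(\<forall>n. p n \<in> ?Q) \<and> p \<longlonglongrightarrow> z"
    have l1: "(\<lambda>n. fst (p n)) \<longlonglongrightarrow> fst z" "(\<lambda>n. snd (p n)) \<longlonglongrightarrow> snd z"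
      using p by (auto intro: tendsto_intros)
    have pos: "0 < fst (p n)" for n
    proof -
      have "p n \<in> ?Q" using p by blast
      then show ?thesis using s by auto
    qed
    have "(\<lambda>n. heatr (fst (p n)) f (snd (p n))) \<longlonglongrightarrow> heatr (fst z) f (snd z)"
      by (rule heatr_continuous[OF _ l1 pos]) (use z s in auto)
    then show "(H \<circ> p) \<longlonglongrightarrow> H z"
      unfolding H_def q_def o_def by (intro tendsto_intros l1)
  qed
  moreover have "compact ?Q" by (intro compact_Times) auto
  moreover have "?Q \<noteq> {}" using t x by auto
  ultimately obtain p where p: "p \<in> ?Q" "\<And>z. z \<in> ?Q \<Longrightarrow> H z \<le> H p"
    using continuous_attains_sup[of ?Q H] by blast
  define t0 x0 M where "t0 = fst p" and "x0 = snd p" and "M = H p"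
  have Mmax: "heatr r f y \<le> M + (c + l * y) - e * q y" if "s \<le> r" "r \<le> t" "a \<le> y" "y \<le> b" for r y
    using p(2)[of "(r, y)"] that by (simp add: H_def M_def)
  have Meq: "heatr t0 f x0 = M + (c + l * x0) - e * q x0"
    by (simp add: H_def M_def t0_def x0_def)
  have "0 < M"
  proof -
    have "e * (- \<bar>q x\<bar>) \<le> e * q x" using e by (intro mult_left_mono) auto
    then have "0 < H (t, x)" using eq by (simp add: H_def)
    also have "\<dots> \<le> M" unfolding M_def using t x by (intro p(2)) auto
    finally show ?thesis .
  qed
  have t0: "s \<le> t0" "t0 \<le> t" and x0: "a \<le> x0" "x0 \<le> b" using p(1) by (auto simp: t0_def x0_def)
  have "x0 \<noteq> a" using lat(1)[OF t0(1)] Meq \<open>0 < M\<close> by (auto simp: q_def)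
  moreover have "x0 \<noteq> b" using lat(2)[OF t0(1)] Meq \<open>0 < M\<close> by (auto simp: q_def)
  ultimately have x0': "a < x0" "x0 < b" using x0 by auto
  have "t0 \<noteq> s"
  proof
    assume "t0 = s"
    then have "M + (c + l * x0) - e * q x0 \<le> c + l * x0" using init[OF x0] Meq by simp
    moreover have "e * q x0 \<le> 0" using e q_le[OF x0] by (simp add: mult_nonneg_nonpos)
    ultimately show False using \<open>0 < M\<close> by linarith
  qed
  then have t0': "s < t0" using t0 by simp
  \<comment> \<open>Expansion of the majorant about \<open>x0\<close>; it is exact, since the
    majorant is a quadratic polynomial.\<close>
  define \<alpha> where "\<alpha> = - l + e * (2 * x0 - a - b)"
  define A0 where "A0 = M + (c + l * x0) - e * q x0"
  have expand: "M + (c + l * (x0 - y)) - e * q (x0 - y) = A0 + \<alpha> * y - e * y\<^sup>2" for y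
    by (simp add: A0_def \<alpha>_def q_def algebra_simps power2_eq_square)
  define r where "r = min (x0 - a) (b - x0)"
  have r: "0 < r" using x0' by (simp add: r_def)
  \<comment> \<open>Outside \<open>[a, b]\<close> only the bound \<open>B\<close> for the flow is
    available. Each summand of \<open>C\<close> lets the quartic term absorb one of constant, linear
    and quadratic term once \<open>r \<le> \<bar>y\<bar>\<close>.\<close>
  define C where "C = (\<bar>A0\<bar> + B) / r ^ 4 + \<bar>\<alpha>\<bar> / r ^ 3 + e / r\<^sup>2"
  have C: "0 < C" unfolding C_def using r e B_nonneg by (intro add_nonneg_pos add_nonneg_nonneg) auto
  have far: "B \<le> A0 + \<alpha> * y - e * y\<^sup>2 + C * y ^ 4" if y: "r \<le> \<bar>y\<bar>" for y
  proof -
    have y0: "0 < \<bar>y\<bar>" using r y by linarith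
    define Y where "Y = \<bar>y\<bar>"
    have Y: "r \<le> Y" "0 < Y" using y r by (auto simp: Y_def)
    have pw: "1 \<le> Y ^ n / r ^ n" for n
      using power_mono[OF Y(1), of n] r by (simp add: le_divide_eq_1_pos)
    have p1: "(\<bar>A0\<bar> + B) * 1 \<le> (\<bar>A0\<bar> + B) * (Y ^ 4 / r ^ 4)"
      using B_nonneg by (intro mult_left_mono pw) auto
    have p2: "\<bar>\<alpha>\<bar> * Y * 1 \<le> \<bar>\<alpha>\<bar> * Y * (Y ^ 3 / r ^ 3)"
      using Y by (intro mult_left_mono pw) auto
    have p3: "e * Y\<^sup>2 * 1 \<le> e * Y\<^sup>2 * (Y\<^sup>2 / r\<^sup>2)"
      using e by (intro mult_left_mono pw) auto
    have p4: "C * Y ^ 4 = (\<bar>A0\<bar> + B) * (Y ^ 4 / r ^ 4) + \<bar>\<alpha>\<bar> * Y * (Y ^ 3 / r ^ 3) + e * Y\<^sup>2 * (Y\<^sup>2 / r\<^sup>2)"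
      by (simp add: C_def power4_eq_xxxx power3_eq_cube power2_eq_square algebra_simps add_divide_distrib)
    have "(\<bar>A0\<bar> + B) + \<bar>\<alpha>\<bar> * Y + e * Y\<^sup>2 \<le> C * Y ^ 4"
      unfolding p4 using add_mono[OF add_mono[OF p1 p2] p3] by (simp only: mult_1_right)
    then have "(\<bar>A0\<bar> + B) + \<bar>\<alpha>\<bar> * \<bar>y\<bar> + e * \<bar>y\<bar>\<^sup>2 \<le> C * \<bar>y\<bar> ^ 4" unfolding Y_def .
    moreover have "\<bar>y\<bar> ^ 4 = y ^ 4" "\<bar>y\<bar>\<^sup>2 = y\<^sup>2" by (simp_all add: power_even_abs)
    moreover have "- (\<bar>\<alpha>\<bar> * \<bar>y\<bar>) \<le> \<alpha> * y" using abs_ge_minus_self[of "\<alpha> * y"] by (simp add: abs_mult)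
    moreover have "B \<le> A0 + p1 - p2 + p3" if "\<bar>A0\<bar> + B + p4 + p2 \<le> p3" "- p4 \<le> p1" for p1 p2 p3 p4
      using that by linarith
    ultimately show ?thesis by metis
  qed
  have bound: "2 * e * d \<le> 12 * C * d\<^sup>2" if d: "0 < d" "d \<le> t0 - s" "d < t0" for d
  proof -
    interpret P: prob_space "heat_measure d :: real measure" by (rule prob_space_heat_measure[OF d(1)])
    have pw: "heatr (t0 - d) f (x0 - y) \<le> A0 + \<alpha> * y - e * y\<^sup>2 + C * y ^ 4" for y
    proof (cases "a \<le> x0 - y \<and> x0 - y \<le> b")
      case True
      have "heatr (t0 - d) f (x0 - y) \<le> M + (c + l * (x0 - y)) - e * q (x0 - y)"
        using True d t0 by (intro Mmax) auto
      also have "\<dots> \<le> A0 + \<alpha> * y - e * y\<^sup>2 + C * y ^ 4"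
        unfolding expand using C by simp
      finally show ?thesis .
    next
      case False
      then have "r \<le> \<bar>y\<bar>" by (auto simp: r_def)
      have "heatr (t0 - d) f (x0 - y) \<le> B" using d t0 s by (intro heatr_le) auto
      also note far[OF \<open>r \<le> \<bar>y\<bar>\<close>]
      finally show ?thesis .
    qed
    have m0: "has_bochner_integral (heat_measure d) (\<lambda>y::real. A0) A0"
      using P.prob_space by (simp add: has_bochner_integral_iff)
    have m1: "has_bochner_integral (heat_measure d) (\<lambda>y::real. y) 0" using heat_measure_moment_odd[OF d(1), of 0] by simp
    have m2: "has_bochner_integral (heat_measure d) (\<lambda>y::real. y\<^sup>2) (2 * d)"
      using heat_measure_moment_even[OF d(1), of 1] by (simp add: fact_numeral)
    have m4: "has_bochner_integral (heat_measure d) (\<lambda>y::real. y ^ 4) (12 * d\<^sup>2)"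
      using heat_measure_moment_even[OF d(1), of 2] by (simp add: fact_numeral)
    have m: "has_bochner_integral (heat_measure d) (\<lambda>y::real. A0 + \<alpha> * y - e * y\<^sup>2 + C * y ^ 4)
        (A0 + \<alpha> * 0 - e * (2 * d) + C * (12 * d\<^sup>2))"
      by (intro has_bochner_integral_add has_bochner_integral_diff has_bochner_integral_mult_right m0 m1 m2 m4)
    have bd: "integrable (heat_measure d) (\<lambda>y. heatr (t0 - d) f (x0 - y))"
    proof (rule P.integrable_const_bound[of _ B])
      have "0 < t0 - d" using d by simp
      then show "AE y in heat_measure d. norm (heatr (t0 - d) f (x0 - y)) \<le> B"
        using heatr_le[of "t0 - d"] by (simp add: heatr_nonneg)
    qed simp
    have "heatr t0 f x0 = (\<integral>y. heatr (t0 - d) f (x0 - y) \<partial>heat_measure d)"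
      using heatr_heatr[of d "t0 - d" x0] d by simp
    also have "\<dots> \<le> (\<integral>y. A0 + \<alpha> * y - e * y\<^sup>2 + C * y ^ 4 \<partial>heat_measure d)"
      by (rule integral_mono[OF bd _ pw]) (use m in \<open>simp add: has_bochner_integral_iff\<close>)
    also have "\<dots> = A0 - e * (2 * d) + C * (12 * d\<^sup>2)" using m by (simp add: has_bochner_integral_iff)
    finally show ?thesis using Meq by (simp add: A0_def)
  qed
  \<comment> \<open>Below e / (12 C) the gain 2 e d can no longer be offset by the error 12 C d^2;
    the other two entries keep \<open>t0 - d\<close> positive and not before
    \<open>s\<close>.\<close>
  define d where "d = min (min (t0 - s) (t0 / 2)) (e / (12 * C))"
  have d: "0 < d" "d \<le> t0 - s" "d < t0" "d \<le> e / (12 * C)"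
    using t0' s e C by (auto simp: d_def min_def)
  have "2 * e \<le> 12 * C * d"
    using bound[OF d(1-3)] d(1) by (simp add: power2_eq_square)
  also have "\<dots> \<le> 12 * C * (e / (12 * C))" using d(4) C by (intro mult_left_mono) auto
  also have "\<dots> = e" using C by simp
  finally show False using e by simp
qed

text \<open>Starting at a positive time leaves a continuous function as initial value for the
  maximum principle; the full maximal function is recovered as the starting time tends to 0.\<close>

definition sup_from :: "real \<Rightarrow> real \<Rightarrow> real" where
  "sup_from s x = (SUP t\<in>{s..}. heatr t f x)"

lemma sup_from_bdd: "0 < s \<Longrightarrow> bdd_above ((\<lambda>t. heatr t f x) ` {s..})"
  using heatr_le by (intro bdd_aboveI2[of _ _ B]) auto

lemma sup_from_upper: "0 < s \<Longrightarrow> s \<le> t \<Longrightarrow> heatr t f x \<le> sup_from s x"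
  unfolding sup_from_def by (intro cSUP_upper sup_from_bdd) auto

lemma sup_from_least: "(\<And>t. s \<le> t \<Longrightarrow> heatr t f x \<le> c) \<Longrightarrow> sup_from s x \<le> c"
  unfolding sup_from_def by (intro cSUP_least) auto

text \<open>Affine functions are stationary for the heat flow, so after subtracting
  \<open>l * x\<close> from both functions the comparison principle still holds and plain positive
  variation is transferred.\<close>

lemma sup_from_positive_variation:
  assumes s: "0 < s" and l: "0 \<le> l" and e: "0 < e" and xs: "sorted_wrt (<) xs"
  obtains ys where "sorted_wrt (<) ys"
    "chain_sum (\<lambda>x y. max 0 (sup_from s y - sup_from s x - l * (y - x))) xs
      \<le> chain_sum (\<lambda>x y. max 0 (heatr s f y - heatr s f x - l * (y - x))) ys + e"
proof -
  let ?V = "\<lambda>x. sup_from s x - l * x" and ?F = "\<lambda>x. heatr s f x - l * x"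
  have 1: "?F x \<le> ?V x" for x using sup_from_upper[OF s order_refl] by simp
  have 2: "?V x \<le> c" if "a < x" "x < b" "?V a \<le> c" "?V b \<le> c" "\<And>y. a \<le> y \<Longrightarrow> y \<le> b \<Longrightarrow> ?F y \<le> c" for a x b c
  proof -
    have "heatr t f x \<le> c + l * x" if t: "s \<le> t" for t
    proof (rule heat_comparison[OF s, of a b])
      show "heatr r f a \<le> c + l * a" "heatr r f b \<le> c + l * b" if "s \<le> r" for r
        using sup_from_upper[OF s that, of a] sup_from_upper[OF s that, of b] \<open>?V a \<le> c\<close> \<open>?V b \<le> c\<close> by linarith+
      show "heatr s f y \<le> c + l * y" if "a \<le> y" "y \<le> b" for y
        using \<open>\<And>y. a \<le> y \<Longrightarrow> y \<le> b \<Longrightarrow> ?F y \<le> c\<close>[OF that] by linarith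
    qed (use \<open>a < x\<close> \<open>x < b\<close> t in auto)
    then have "sup_from s x \<le> c + l * x" by (rule sup_from_least)
    then show ?thesis by simp
  qed
  have 3: "?V x \<le> c" if ax: "a < x" and Va: "?V a \<le> c" and F: "\<And>y. a \<le> y \<Longrightarrow> ?F y \<le> c" for a x c
  proof (rule field_le_epsilon)
    fix d :: real assume d: "0 < d"
    \<comment> \<open>On a half-line no bound is given at the far end. The majorant is tilted by a
      small slope \<open>k\<close>, which costs \<open>d\<close> at \<open>x\<close>, and
      \<open>b\<close> is taken so far out that the tilted line exceeds the bound \<open>B\<close>
      of the flow.\<close>
    define k where "k = d / (x - a)"
    have k: "0 < k" using d ax by (simp add: k_def)
    define b where "b = max (x + 1) (a + (B + \<bar>c + l * a\<bar>) / k)"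
    have b: "x < b" "a + (B + \<bar>c + l * a\<bar>) / k \<le> b" by (auto simp: b_def)
    have "(B + \<bar>c + l * a\<bar>) / k \<le> b - a" using b by simp
    then have kb: "B + \<bar>c + l * a\<bar> \<le> k * (b - a)" using k by (simp add: field_simps)
    have "heatr t f x \<le> (c - k * a) + (l + k) * x" if t: "s \<le> t" for t
    proof (rule heat_comparison[OF s, of a b])
      show "heatr r f a \<le> (c - k * a) + (l + k) * a" if "s \<le> r" for r
        using sup_from_upper[OF s that, of a] Va by (simp add: algebra_simps)
      show "heatr r f b \<le> (c - k * a) + (l + k) * b" if "s \<le> r" for r
      proof -
        have "heatr r f b \<le> B" using that s by (intro heatr_le) auto
        moreover have "(c - k * a) + (l + k) * b = (c + l * a) + l * (b - a) + k * (b - a)" by (simp add: algebra_simps)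
        moreover have "0 \<le> l * (b - a)" using l b ax by simp
        ultimately show ?thesis using kb by linarith
      qed
      show "heatr s f y \<le> (c - k * a) + (l + k) * y" if "a \<le> y" for y
      proof -
        have "0 \<le> k * (y - a)" using k that by simp
        then show ?thesis using F[OF that] by (simp add: algebra_simps)
      qed
    qed (use ax b t in auto)
    then have "sup_from s x \<le> (c - k * a) + (l + k) * x" by (rule sup_from_least)
    moreover have "k * (x - a) = d" using ax by (simp add: k_def)
    ultimately show "?V x \<le> c + d" by (simp add: algebra_simps)
  qed
  have cost: "max 0 (?V y - ?V x) = max 0 (sup_from s y - sup_from s x - l * (y - x))"
    "max 0 (?F y - ?F x) = max 0 (heatr s f y - heatr s f x - l * (y - x))" for x y
    by (simp_all add: algebra_simps)
  define e' where "e' = e / (real (length xs) + 1)"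
  have e': "0 < e'" using e by (simp add: e'_def add_pos_nonneg)
  have "e' * real (length xs) \<le> e" using e by (simp add: e'_def field_simps)
  obtain ys where ys: "sorted_wrt (<) ys"
    "chain_sum (\<lambda>x y. max 0 (?V y - ?V x)) xs \<le> chain_sum (\<lambda>x y. max 0 (?F y - ?F x)) ys + e' * real (length xs)"
      proof -
    have "\<exists>ys. sorted_wrt (<) ys \<and> (\<forall>y\<in>set ys. \<forall>x\<in>set xs. hd xs \<le> y) \<and>
      chain_sum (\<lambda>x y. max 0 (?V y - ?V x)) xs \<le> chain_sum (\<lambda>x y. max 0 (?F y - ?F x)) ys + e' * real (length xs)"
    proof (rule positive_variation_transfer[where F="?F" and V="?V", OF 1 _ _ e' xs], goal_cases)
      case (1 a x b c)
      show ?case by (rule 2[OF 1(1-4)]) (rule 1(5))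
    next
      case (2 a x c)
      show ?case by (rule 3[OF 2(1,2)]) (rule 2(3))
    qed
    then show thesis using that by blast
  qed
  show ?thesis
  proof (rule that[OF ys(1)])
    show "chain_sum (\<lambda>x y. max 0 (sup_from s y - sup_from s x - l * (y - x))) xs
      \<le> chain_sum (\<lambda>x y. max 0 (heatr s f y - heatr s f x - l * (y - x))) ys + e"
      using ys(2) \<open>e' * real (length xs) \<le> e\<close> unfolding cost by linarith
  qed
qed

end

section \<open>Variation of the maximal function on the line\<close>

text \<open>The sign selects increments (1) or decrements (-1). The transfer to the supremum treats
  one sign at a time, and each sign obtains its own partition.\<close>

definition excess :: "real \<Rightarrow> real \<Rightarrow> (real \<Rightarrow> real) \<Rightarrow> real \<Rightarrow> real \<Rightarrow> real" where
  "excess \<sigma> l f x y = max 0 (\<sigma> * (f y - f x) - l * (y - x))"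

text \<open>A substitute without derivatives for the integral of (|f'| - l)_+. Upper bounds for it
  survive pointwise limits, and for l > 0 it can be finite although the total variation is
  infinite.\<close>

definition var_excess :: "real \<Rightarrow> (real \<Rightarrow> real) \<Rightarrow> ennreal" where
  "var_excess l f = (SUP xs\<in>{xs. sorted_wrt (<) xs}.
    ennreal (chain_sum (\<lambda>x y. max 0 (\<bar>f y - f x\<bar> - l * (y - x))) xs))"

lemma total_variation_eq_var_excess: "total_variation f = var_excess 0 f"
  unfolding total_variation_def var_excess_def chain_sum_nth by simp

lemma excess_nonneg: "0 \<le> excess \<sigma> l f x y"
  by (simp add: excess_def)

lemma excess_triangle: "excess \<sigma> l f x z \<le> excess \<sigma> l f x y + excess \<sigma> l f y z"
  by (simp add: excess_def max_def algebra_simps)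

lemma excess_split:
  assumes "0 \<le> l" "x < y"
  shows "max 0 (\<bar>f y - f x\<bar> - l * (y - x)) = excess 1 l f x y + excess (-1) l f x y"
proof -
  have "0 \<le> l * (y - x)" using assms by simp
  then show ?thesis unfolding excess_def by (simp add: abs_if max_def)
qed

lemma chain_sum_excess_split:
  assumes "0 \<le> l" "sorted_wrt (<) xs"
  shows "chain_sum (\<lambda>x y. max 0 (\<bar>f y - f x\<bar> - l * (y - x))) xs
    = chain_sum (excess 1 l f) xs + chain_sum (excess (-1) l f) xs"
  unfolding chain_sum_add[symmetric]
  by (rule chain_sum_cong[OF assms(2)]) (rule excess_split[OF assms(1)])

text \<open>Both signed parts grow under refinement, so they may be evaluated on different
  partitions and are compared on the common refinement \<open>ws\<close>.\<close>

lemma chain_sum_excess_le_var_excess: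
  assumes l: "0 \<le> l" and ys: "sorted_wrt (<) ys" and zs: "sorted_wrt (<) zs"
  shows "ennreal (chain_sum (excess 1 l f) ys + chain_sum (excess (-1) l f) zs) \<le> var_excess l f"
proof -
  define ws where "ws = sorted_list_of_set (set ys \<union> set zs)"
  have ws: "sorted_wrt (<) ws" "set ws = set ys \<union> set zs" unfolding ws_def by auto
  have "chain_sum (excess 1 l f) ys \<le> chain_sum (excess 1 l f) ws"
    by (rule chain_sum_refine) (use ys ws excess_nonneg excess_triangle in auto)
  moreover have "chain_sum (excess (-1) l f) zs \<le> chain_sum (excess (-1) l f) ws"
    by (rule chain_sum_refine) (use zs ws excess_nonneg excess_triangle in auto)
  ultimately have "chain_sum (excess 1 l f) ys + chain_sum (excess (-1) l f) zs
      \<le> chain_sum (\<lambda>x y. max 0 (\<bar>f y - f x\<bar> - l * (y - x))) ws"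
    unfolding chain_sum_excess_split[OF l ws(1)] by (rule add_mono)
  then have "ennreal (chain_sum (excess 1 l f) ys + chain_sum (excess (-1) l f) zs)
      \<le> ennreal (chain_sum (\<lambda>x y. max 0 (\<bar>f y - f x\<bar> - l * (y - x))) ws)"
    by (rule ennreal_leI)
  also have "\<dots> \<le> var_excess l f" unfolding var_excess_def by (rule SUP_upper) (use ws in simp)
  finally show ?thesis .
qed

text \<open>Jensen's inequality for the convex truncation: the flow averages translates of
  \<open>u\<close>, and translating \<open>u\<close> amounts to translating the partition.\<close>

lemma chain_sum_excess_heatr:
  fixes u :: "real \<Rightarrow> real"
  assumes [measurable]: "u \<in> borel_measurable borel" and nn: "\<And>x. 0 \<le> u x" and t: "0 < t"
    and fin: "\<And>x. heat t (\<lambda>y. ennreal (u y)) x < \<infinity>"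
  shows "integrable (heat_measure t) (\<lambda>y. chain_sum (excess \<sigma> l u) (map (\<lambda>z. z - y) xs)) \<and>
    chain_sum (excess \<sigma> l (heatr t u)) xs \<le> (\<integral>y. chain_sum (excess \<sigma> l u) (map (\<lambda>z. z - y) xs) \<partial>heat_measure t)"
  unfolding chain_sum_map
proof (induction "excess \<sigma> l u" xs rule: chain_sum.induct)
  case (1 a b zs)
  interpret P: prob_space "heat_measure t :: real measure" by (rule prob_space_heat_measure[OF t])
  have i: "integrable (heat_measure t) (\<lambda>y. u (z - y))" for z
    by (rule heatr_integral(1)[OF _ nn fin]) simp
  have id: "integrable (heat_measure t) (\<lambda>y. \<sigma> * (u (b - y) - u (a - y)) - l * (b - a))"
    using i by simp
  have ie: "integrable (heat_measure t) (\<lambda>y. excess \<sigma> l u (a - y) (b - y))"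
    unfolding excess_def using integrable_max[OF integrable_zero id] by simp
  have "\<sigma> * (heatr t u b - heatr t u a) - l * (b - a) = (\<integral>y. \<sigma> * (u (b - y) - u (a - y)) - l * (b - a) \<partial>heat_measure t)"
    using i P.prob_space by (simp add: heatr_integral(2)[OF assms(1) nn fin])
  also have "\<dots> \<le> (\<integral>y. excess \<sigma> l u (a - y) (b - y) \<partial>heat_measure t)"
    by (rule integral_mono[OF id ie]) (simp add: excess_def)
  finally have "excess \<sigma> l (heatr t u) a b \<le> (\<integral>y. excess \<sigma> l u (a - y) (b - y) \<partial>heat_measure t)"
    using Bochner_Integration.integral_nonneg[of "heat_measure t" "\<lambda>y. excess \<sigma> l u (a - y) (b - y)"] excess_nonneg
    by (auto simp: excess_def[of \<sigma> l "heatr t u"])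
  then show ?case using 1 ie by simp
qed auto

lemma heatr_var_excess:
  fixes u :: "real \<Rightarrow> real"
  assumes u: "u \<in> borel_measurable borel" "\<And>x. 0 \<le> u x" and t: "0 < t"
    and fin: "\<And>x. heat t (\<lambda>y. ennreal (u y)) x < \<infinity>"
    and l: "0 \<le> l" and ys: "sorted_wrt (<) ys" and zs: "sorted_wrt (<) zs"
    and A: "0 \<le> A" "var_excess l u \<le> ennreal A"
  shows "chain_sum (excess 1 l (heatr t u)) ys + chain_sum (excess (-1) l (heatr t u)) zs \<le> A"
proof -
  interpret P: prob_space "heat_measure t :: real measure" by (rule prob_space_heat_measure[OF t])
  note J = chain_sum_excess_heatr[OF u t fin, of _ l]
  have sh: "sorted_wrt (<) (map (\<lambda>z. z - y) ys)" "sorted_wrt (<) (map (\<lambda>z. z - y) zs)" for y :: real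
    using ys zs by (auto simp: sorted_wrt_map)
  have le: "chain_sum (excess 1 l u) (map (\<lambda>z. z - y) ys) + chain_sum (excess (-1) l u) (map (\<lambda>z. z - y) zs) \<le> A" for y
    using order_trans[OF chain_sum_excess_le_var_excess[OF l sh] A(2)] A(1) by (simp add: ennreal_le_iff)
  have "chain_sum (excess 1 l (heatr t u)) ys + chain_sum (excess (-1) l (heatr t u)) zs
    \<le> (\<integral>y. chain_sum (excess 1 l u) (map (\<lambda>z. z - y) ys) \<partial>heat_measure t)
      + (\<integral>y. chain_sum (excess (-1) l u) (map (\<lambda>z. z - y) zs) \<partial>heat_measure t)"
    using J[of 1 ys] J[of "-1" zs] by (intro add_mono) auto
  also have "\<dots> = (\<integral>y. chain_sum (excess 1 l u) (map (\<lambda>z. z - y) ys) + chain_sum (excess (-1) l u) (map (\<lambda>z. z - y) zs) \<partial>heat_measure t)"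
    using J[of 1 ys] J[of "-1" zs] by (subst Bochner_Integration.integral_add) auto
  also have "\<dots> \<le> (\<integral>y. A \<partial>(heat_measure t :: real measure))"
    using J[of 1 ys] J[of "-1" zs] le by (intro integral_mono Bochner_Integration.integrable_add) auto
  also have "\<dots> = A" using P.prob_space by simp
  finally show ?thesis .
qed

text \<open>Reflecting the line turns decrements into increments, so the one-sided transfer suffices
  for both signs.\<close>

lemma excess_reflect:
  "chain_sum (excess (-1) l f) xs = chain_sum (excess 1 l (\<lambda>x. f (- x))) (rev (map uminus xs))"
proof -
  have "excess (-1) l f = (\<lambda>x y. excess 1 l (\<lambda>x. f (- x)) (- y) (- x))"
    by (intro ext) (simp add: excess_def algebra_simps)
  then show ?thesis unfolding chain_sum_rev chain_sum_map by simp
qed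

lemma sorted_wrt_reflect: "sorted_wrt (<) xs \<Longrightarrow> sorted_wrt (<) (rev (map uminus (xs :: real list)))"
  by (simp add: sorted_wrt_rev sorted_wrt_map)

context bounded_datum
begin

lemma bounded_datum_reflect: "bounded_datum (\<lambda>x. f (- x)) B"
  by unfold_locales (auto simp: f_nonneg f_le)

lemma heatr_reflect: "heatr t (\<lambda>x. f (- x)) x = heatr t f (- x)"
proof -
  have "heat t (\<lambda>y. ennreal (f (- y))) x = heat t (\<lambda>y. ennreal (f y)) (- x)"
    using heat_eq_plus[of "\<lambda>y. ennreal (f y)" t "- x"] by (simp add: heat_def)
  then show ?thesis by (simp add: heatr_def)
qed

lemma sup_from_excess:
  assumes s: "0 < s" and l: "0 \<le> l" and xs: "sorted_wrt (<) xs"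
    and A: "\<And>ys zs. sorted_wrt (<) ys \<Longrightarrow> sorted_wrt (<) zs \<Longrightarrow>
      chain_sum (excess 1 l (heatr s f)) ys + chain_sum (excess (-1) l (heatr s f)) zs \<le> A"
  shows "chain_sum (excess 1 l (sup_from s)) xs + chain_sum (excess (-1) l (sup_from s)) xs \<le> A"
proof (rule field_le_epsilon)
  fix e :: real assume "0 < e"
  then have e: "0 < e / 2" by simp
  interpret R: bounded_datum "\<lambda>x. f (- x)" B by (rule bounded_datum_reflect)
  have Rs: "R.sup_from s x = sup_from s (- x)" for x
    unfolding R.sup_from_def sup_from_def heatr_reflect ..
  obtain ys where ys: "sorted_wrt (<) ys"
    "chain_sum (excess 1 l (sup_from s)) xs \<le> chain_sum (excess 1 l (heatr s f)) ys + e / 2"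
    using sup_from_positive_variation[OF s l e xs] unfolding excess_def by auto
  obtain zs where zs: "sorted_wrt (<) zs"
    "chain_sum (excess 1 l (\<lambda>x. sup_from s (- x))) (rev (map uminus xs)) \<le> chain_sum (excess 1 l (\<lambda>x. heatr s f (- x))) zs + e / 2"
    using R.sup_from_positive_variation[OF s l e sorted_wrt_reflect[OF xs]]
    unfolding excess_def Rs heatr_reflect by auto
  have "chain_sum (excess (-1) l (heatr s f)) (rev (map uminus zs)) = chain_sum (excess 1 l (\<lambda>x. heatr s f (- x))) zs"
    unfolding excess_reflect by (simp add: rev_map o_def)
  with zs(2) have "chain_sum (excess (-1) l (sup_from s)) xs \<le> chain_sum (excess (-1) l (heatr s f)) (rev (map uminus zs)) + e / 2"
    unfolding excess_reflect[of l "sup_from s"] by simp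
  then show "chain_sum (excess 1 l (sup_from s)) xs + chain_sum (excess (-1) l (sup_from s)) xs \<le> A + e"
    using ys A[OF ys(1) sorted_wrt_reflect[OF zs(1)]] by linarith
qed

end

text \<open>A datum in L^p may be unbounded, but its flow is bounded at each positive time; this is
  all that the passage to the limit of small starting times requires.\<close>

locale heat_datum =
  fixes u :: "real \<Rightarrow> real"
  assumes u_meas [measurable]: "u \<in> borel_measurable borel" and u_nonneg: "\<And>x. 0 \<le> u x"
    and heat_bd: "\<And>s. 0 < s \<Longrightarrow> \<exists>B. \<forall>x. heat s (\<lambda>y. ennreal (u y)) x \<le> ennreal B"
begin

lemma heat_fin: "0 < s \<Longrightarrow> heat s (\<lambda>y. ennreal (u y)) x < \<infinity>"
  using heat_bd[of s] by (metis ennreal_less_top infinity_ennreal_def order.strict_trans1)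

definition usup :: "real \<Rightarrow> real \<Rightarrow> real" where
  "usup s x = (SUP t\<in>{s..}. heatr t u x)"

lemma
  assumes s: "0 < s"
  shows usup_upper: "\<And>t. s \<le> t \<Longrightarrow> heatr t u x \<le> usup s x"
    and usup_excess: "\<And>xs l A. 0 \<le> l \<Longrightarrow> sorted_wrt (<) xs \<Longrightarrow> 0 \<le> A \<Longrightarrow> var_excess l u \<le> ennreal A \<Longrightarrow>
      chain_sum (excess 1 l (usup s)) xs + chain_sum (excess (-1) l (usup s)) xs \<le> A"
proof -
  \<comment> \<open>The first half of the waiting time makes the datum bounded; the second half is
    the positive starting time required by \<open>sup_from\<close>.\<close>
  have s2: "0 < s / 2" using s by simp
  obtain B0 where B0: "\<And>x. heat (s / 2) (\<lambda>y. ennreal (u y)) x \<le> ennreal B0" using heat_bd[OF s2] by blast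
  define f where "f = heatr (s / 2) u"
  have fe: "(\<lambda>y. ennreal (f y)) = heat (s / 2) (\<lambda>y. ennreal (u y))"
    unfolding f_def using heat_eq_heatr[OF heat_fin[OF s2]] by auto
  interpret D: bounded_datum f "max 0 B0"
  proof
    show "f x \<le> max 0 B0" for x
      unfolding f_def heatr_def using B0[of x]
      by (metis enn2real_ennreal enn2real_mono ennreal_less_top ennreal_max_0 max.cobounded1)
  qed (auto simp: f_def heatr_nonneg)
  have hf: "heatr t f = heatr (t + s / 2) u" if "0 < t" for t
    unfolding heatr_def using heat_heat[OF _ that s2, of "\<lambda>y. ennreal (u y)"] by (simp add: fe fun_eq_iff)
  have img: "(\<lambda>t. heatr t u x) ` {s..} = (\<lambda>t. heatr t f x) ` {s / 2..}" for x
  proof -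
    have "{s..} = (\<lambda>t. t + s / 2) ` {s / 2..}"
    proof (intro set_eqI iffI)
      fix z assume "z \<in> {s..}"
      then have "z = (z - s / 2) + s / 2" "z - s / 2 \<in> {s / 2..}" by auto
      then show "z \<in> (\<lambda>t. t + s / 2) ` {s / 2..}" by blast
    qed auto
    moreover have "(\<lambda>t. heatr (t + s / 2) u x) ` {s / 2..} = (\<lambda>t. heatr t f x) ` {s / 2..}"
      using hf s2 by (intro image_cong) auto
    ultimately show ?thesis by (simp add: image_image)
  qed
  have us: "usup s = D.sup_from (s / 2)"
    unfolding usup_def D.sup_from_def img ..
  have bdd: "bdd_above ((\<lambda>t. heatr t u x) ` {s..})" unfolding img by (rule D.sup_from_bdd[OF s2])
  show "heatr t u x \<le> usup s x" if "s \<le> t" for t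
    unfolding usup_def by (rule cSUP_upper[OF _ bdd]) (use that in simp)
  show "chain_sum (excess 1 l (usup s)) xs + chain_sum (excess (-1) l (usup s)) xs \<le> A"
    if l: "0 \<le> l" and xs: "sorted_wrt (<) (xs :: real list)" and A: "0 \<le> A" "var_excess l u \<le> ennreal A" for xs l A
  proof -
    have h2: "heatr (s / 2) f = heatr s u" using hf[OF s2] by simp
    show ?thesis
      unfolding us
      by (rule D.sup_from_excess[OF s2 l xs], unfold h2, rule heatr_var_excess[OF u_meas u_nonneg s heat_fin[OF s] l _ _ A])
  qed
qed

lemma ennreal_usup_le: "0 < s \<Longrightarrow> ennreal (usup s x) \<le> heat_sup (\<lambda>y. ennreal (u y)) x"
proof -
  assume s: "0 < s"
  let ?M = "heat_sup (\<lambda>y. ennreal (u y)) x"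
  have h: "ennreal (heatr t u x) \<le> ?M" if "0 < t" for t
    unfolding heat_sup_def heat_eq_heatr[OF heat_fin[OF that], symmetric] using that by (intro SUP_upper) auto
  show ?thesis
  proof (cases ?M)
    case (real m)
    have "usup s x \<le> m" unfolding usup_def
      using h s real by (intro cSUP_least) (auto simp: ennreal_le_iff)
    then show ?thesis using real by (simp add: ennreal_leI)
  qed simp
qed

lemma usup_tendsto:
  assumes fin: "heat_sup (\<lambda>y. ennreal (u y)) x < \<infinity>"
  shows "(\<lambda>n. usup (1 / real (Suc n)) x) \<longlonglongrightarrow> enn2real (heat_sup (\<lambda>y. ennreal (u y)) x)"
proof -
  obtain m where m: "heat_sup (\<lambda>y. ennreal (u y)) x = ennreal m" "0 \<le> m"
    using fin by (cases "heat_sup (\<lambda>y. ennreal (u y)) x") auto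
  have "(\<lambda>n. usup (1 / real (Suc n)) x) \<longlonglongrightarrow> m"
  proof (rule order_tendstoI)
    fix c assume c: "m < c"
    have "usup (1 / real (Suc n)) x \<le> m" for n
      using ennreal_usup_le[of "1 / real (Suc n)" x] m by (simp add: ennreal_le_iff)
    then show "\<forall>\<^sub>F n in sequentially. usup (1 / real (Suc n)) x < c"
      by (intro always_eventually allI order.strict_trans1[OF _ c])
  next
    fix c assume c: "c < m"
    have "ennreal (max 0 c) < heat_sup (\<lambda>y. ennreal (u y)) x \<or> c < 0"
      unfolding m(1) using c by (auto simp: ennreal_less_iff max_def)
    then obtain t where t: "0 < t" "c < heatr t u x"
    proof
      assume "ennreal (max 0 c) < heat_sup (\<lambda>y. ennreal (u y)) x"
      then obtain t where t: "0 < t" "ennreal (max 0 c) < heat t (\<lambda>y. ennreal (u y)) x"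
        by (auto simp: heat_sup_def less_SUP_iff)
      then have "max 0 c < heatr t u x" by (simp add: heat_eq_heatr[OF heat_fin[OF t(1)]] ennreal_less_iff)
      then show thesis using that t(1) by auto
    next
      assume "c < 0"
      then show thesis using that[of 1] heatr_nonneg[of 1 u x] by auto
    qed
    obtain N where N: "1 / real (Suc N) < t" using t(1) nat_approx_posE by blast
    show "\<forall>\<^sub>F n in sequentially. c < usup (1 / real (Suc n)) x"
      unfolding eventually_sequentially
    proof (intro exI[of _ N] allI impI)
      fix n assume "N \<le> n"
      then have "1 / real (Suc n) \<le> 1 / real (Suc N)" by (intro divide_left_mono) auto
      then have "1 / real (Suc n) \<le> t" using N by linarith
      then have "heatr t u x \<le> usup (1 / real (Suc n)) x"
        by (intro usup_upper) auto
      then show "c < usup (1 / real (Suc n)) x" using t(2) by linarith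
    qed
  qed
  then show ?thesis using m by simp
qed

lemma chain_sum_excess_tendsto:
  assumes "\<And>x. (\<lambda>n. V n x) \<longlonglongrightarrow> W x"
  shows "(\<lambda>n. chain_sum (excess \<sigma> l (V n)) xs) \<longlonglongrightarrow> chain_sum (excess \<sigma> l W) xs"
proof (induction "excess \<sigma> l W" xs rule: chain_sum.induct)
  case (1 x y zs)
  have "(\<lambda>n. excess \<sigma> l (V n) x y) \<longlonglongrightarrow> excess \<sigma> l W x y"
    unfolding excess_def by (intro tendsto_intros assms)
  with 1 show ?case by (auto intro: tendsto_add)
qed auto

text \<open>A partition has finitely many points, so the bounds for the suprema over
  \<open>t \<ge> s\<close> pass to the pointwise limit as s tends to 0.\<close>

theorem var_excess_heat_sup:
  assumes fin: "\<And>x. heat_sup (\<lambda>y. ennreal (u y)) x < \<infinity>" and l: "0 \<le> l"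
  shows "var_excess l (\<lambda>x. enn2real (heat_sup (\<lambda>y. ennreal (u y)) x)) \<le> var_excess l u"
proof (cases "var_excess l u")
  case (real A)
  let ?W = "\<lambda>x. enn2real (heat_sup (\<lambda>y. ennreal (u y)) x)"
  show ?thesis
    unfolding var_excess_def[of l ?W]
  proof (rule SUP_least)
    fix xs :: "real list" assume "xs \<in> {xs. sorted_wrt (<) xs}"
    then have xs: "sorted_wrt (<) xs" by simp
    have "chain_sum (excess 1 l ?W) xs + chain_sum (excess (-1) l ?W) xs \<le> A"
    proof (rule LIMSEQ_le_const2)
      show "(\<lambda>n. chain_sum (excess 1 l (usup (1 / real (Suc n)))) xs + chain_sum (excess (-1) l (usup (1 / real (Suc n)))) xs)
        \<longlonglongrightarrow> chain_sum (excess 1 l ?W) xs + chain_sum (excess (-1) l ?W) xs"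
        by (intro tendsto_add chain_sum_excess_tendsto usup_tendsto fin)
      have "chain_sum (excess 1 l (usup (1 / real (Suc n)))) xs + chain_sum (excess (-1) l (usup (1 / real (Suc n)))) xs \<le> A" for n
        by (rule usup_excess) (use l xs real in auto)
      then show "\<exists>N. \<forall>n\<ge>N. chain_sum (excess 1 l (usup (1 / real (Suc n)))) xs + chain_sum (excess (-1) l (usup (1 / real (Suc n)))) xs \<le> A"
        by blast
    qed
    then show "ennreal (chain_sum (\<lambda>x y. max 0 (\<bar>?W y - ?W x\<bar> - l * (y - x))) xs) \<le> var_excess l u"
      unfolding real chain_sum_excess_split[OF l xs] by (rule ennreal_leI)
  qed
qed simp

text \<open>Finiteness at one point propagates: all \<^term>\<open>usup s\<close> have the same modulus of growth.\<close>

lemma heat_sup_finite: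
  assumes x0: "heat_sup (\<lambda>y. ennreal (u y)) x0 < \<infinity>" and l: "0 \<le> l" and A: "var_excess l u < \<infinity>"
  shows "heat_sup (\<lambda>y. ennreal (u y)) x < \<infinity>"
proof -
  obtain m where m: "heat_sup (\<lambda>y. ennreal (u y)) x0 = ennreal m" "0 \<le> m"
    using x0 by (cases "heat_sup (\<lambda>y. ennreal (u y)) x0") auto
  obtain a where a: "var_excess l u = ennreal a" "0 \<le> a" using A by (cases "var_excess l u") auto
  define C where "C = m + a + l * \<bar>x - x0\<bar>"
  have "heat t (\<lambda>y. ennreal (u y)) x \<le> ennreal C" if t: "0 < t" for t
  proof -
    have h: "heatr t u x \<le> usup t x" by (rule usup_upper[OF t order_refl])
    have m': "usup t x0 \<le> m" using ennreal_usup_le[OF t, of x0] m by (simp add: ennreal_le_iff)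
    have v: "chain_sum (excess 1 l (usup t)) xs + chain_sum (excess (-1) l (usup t)) xs \<le> a" if "sorted_wrt (<) xs" for xs
      by (rule usup_excess[OF t l that]) (use a in auto)
    have "usup t x - usup t x0 \<le> a + l * \<bar>x - x0\<bar>"
    proof (cases x x0 rule: linorder_cases)
      case less
      then have "excess 1 l (usup t) x x0 + excess (-1) l (usup t) x x0 \<le> a" using v[of "[x, x0]"] by simp
      then show ?thesis using less by (simp add: excess_def)
    next
      case greater
      then have "excess 1 l (usup t) x0 x + excess (-1) l (usup t) x0 x \<le> a" using v[of "[x0, x]"] by simp
      then show ?thesis using greater by (simp add: excess_def)
    qed (use a in simp)
    then have "heatr t u x \<le> C" using h m' by (simp add: C_def)
    then show ?thesis unfolding heat_eq_heatr[OF heat_fin[OF t]] by (rule ennreal_leI)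
  qed
  then have "heat_sup (\<lambda>y. ennreal (u y)) x \<le> ennreal C"
    unfolding heat_sup_def by (intro SUP_least) auto
  then show ?thesis by (rule order.strict_trans1) simp
qed

end

section \<open>Admissible data on the line and difference quotients\<close>

lemma heat_datum_bounded:
  assumes "u \<in> borel_measurable borel" "\<And>x. 0 \<le> u x" "\<And>x. u x \<le> B"
  shows "heat_datum u"
proof
  fix s :: real assume "0 < s"
  then show "\<exists>B. \<forall>x. heat s (\<lambda>y. ennreal (u y)) x \<le> ennreal B"
    using heat_bounded[of s u B] assms(3) by blast
qed (use assms in auto)

text \<open>In place of Hoelder's inequality, |u| \<le> 1 + |u|^p: the flow preserves the constant,
  and the second term is integrated against a kernel bounded by its value at 0.\<close>

lemma heat_Lp_bounded:
  fixes u :: "'a::euclidean_space \<Rightarrow> real"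
  assumes u[measurable]: "u \<in> borel_measurable borel" and p: "1 \<le> p" and s: "0 < s"
    and fin: "(\<integral>\<^sup>+x. ennreal (\<bar>u x\<bar> powr p) \<partial>lborel) < \<infinity>"
  shows "\<exists>B. \<forall>x. heat s (\<lambda>y. ennreal \<bar>u y\<bar>) x \<le> ennreal B"
proof -
  obtain I where I: "(\<integral>\<^sup>+x. ennreal (\<bar>u x\<bar> powr p) \<partial>lborel) = ennreal I" "0 \<le> I"
    using fin by (cases "\<integral>\<^sup>+x. ennreal (\<bar>u x\<bar> powr p) \<partial>lborel") auto
  let ?K = "(4 * pi * s) powr (- real DIM('a) / 2)"
  have K: "heat_kernel s y \<le> ?K" for y :: 'a
    using s by (simp add: heat_kernel_def mult_left_le)
  have "heat s (\<lambda>y. ennreal \<bar>u y\<bar>) x \<le> ennreal (1 + ?K * I)" for x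
  proof -
    have "heat s (\<lambda>y. ennreal \<bar>u y\<bar>) x \<le> heat s (\<lambda>y. 1 + ennreal (\<bar>u y\<bar> powr p)) x"
    proof (rule heat_mono)
      fix y
      have "\<bar>u y\<bar> \<le> 1 + \<bar>u y\<bar> powr p"
      proof (cases "\<bar>u y\<bar> \<le> 1")
        case False
        then have "\<bar>u y\<bar> powr 1 \<le> \<bar>u y\<bar> powr p" using p by (intro powr_mono) auto
        then show ?thesis using False by simp
      qed (simp add: add_increasing2)
      then have "ennreal \<bar>u y\<bar> \<le> ennreal (1 + \<bar>u y\<bar> powr p)" by (rule ennreal_leI)
      then show "ennreal \<bar>u y\<bar> \<le> 1 + ennreal (\<bar>u y\<bar> powr p)" by simp
    qed
    also have "\<dots> = 1 + heat s (\<lambda>y. ennreal (\<bar>u y\<bar> powr p)) x"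
      using s by (subst heat_add) (auto simp: heat_const)
    also have "heat s (\<lambda>y. ennreal (\<bar>u y\<bar> powr p)) x \<le> (\<integral>\<^sup>+y. ennreal ?K * ennreal (\<bar>u y\<bar> powr p) \<partial>lborel)"
      by (subst heat_eq, measurable) (intro nn_integral_mono mult_right_mono ennreal_leI K, simp)
    also have "\<dots> = ennreal (?K * I)"
      using I by (simp add: nn_integral_cmult ennreal_mult)
    finally show ?thesis using I by (simp add: add_left_mono)
  qed
  then show ?thesis by blast
qed

lemma heat_datum_Lp:
  assumes u: "u \<in> borel_measurable borel" and p: "1 \<le> p"
    and fin: "(\<integral>\<^sup>+x. ennreal (\<bar>u x\<bar> powr p) \<partial>lborel) < \<infinity>"
  shows "heat_datum (\<lambda>x. \<bar>u x\<bar>)"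
  by unfold_locales (use u heat_Lp_bounded[OF u p _ fin] in auto)

text \<open>Folding the line onto [0, h): for each x there, the points x + k h form a partition of
  step \<open>h\<close>, whose truncated variation is the sum of the integrand over these points, up
  to the factor \<open>h\<close>. Integrating over x costs the length \<open>h\<close>, which
  cancels.\<close>

lemma var_excess_difference_quotient:
  fixes v :: "real \<Rightarrow> real"
  assumes v[measurable]: "v \<in> borel_measurable borel" and h: "0 < h"
  shows "(\<integral>\<^sup>+x. ennreal (norm ((v (x + h) - v x) / h) - l) \<partial>lborel) \<le> var_excess l v"
proof -
  define \<phi> where "\<phi> x = ennreal (\<bar>v (x + h) - v x\<bar> - l * h)" for x
  have [measurable]: "\<phi> \<in> borel_measurable borel" unfolding \<phi>_def[abs_def] by measurable
  \<comment> \<open>For k \<le> 2 N these are the multiples of \<open>h\<close> from -N h to N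
    h.\<close>
  let ?a = "\<lambda>N k. (real k - real N) * h"
  have N: "(\<integral>\<^sup>+x. \<phi> x * indicator {- real N * h..<real N * h} x \<partial>lborel) \<le> ennreal h * var_excess l v" for N
  proof -
    have ind: "indicator {- real N * h..<real N * h} x = (\<Sum>k<2 * N. indicator {?a N k..<?a N (Suc k)} x :: ennreal)" for x
    proof -
      have "indicator {?a N 0..<?a N m} x = (\<Sum>k<m. indicator {?a N k..<?a N (Suc k)} x :: ennreal)" for m
      proof (induction m)
        case (Suc m)
        have "?a N 0 \<le> ?a N m" by (rule mult_right_mono) (use h in auto)
        moreover have "?a N m \<le> ?a N (Suc m)" by (rule mult_right_mono) (use h in auto)
        ultimately have "indicator {?a N 0..<?a N (Suc m)} x = (indicator {?a N 0..<?a N m} x + indicator {?a N m..<?a N (Suc m)} x :: ennreal)"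
          by (auto split: split_indicator)
        then show ?case using Suc by simp
      qed simp
      from this[of "2 * N"] show ?thesis by (simp add: algebra_simps)
    qed
    have "(\<integral>\<^sup>+x. \<phi> x * indicator {- real N * h..<real N * h} x \<partial>lborel)
      = (\<Sum>k<2 * N. \<integral>\<^sup>+x. \<phi> x * indicator {?a N k..<?a N (Suc k)} x \<partial>lborel)"
      unfolding ind sum_distrib_left by (rule nn_integral_sum) measurable
    also have "\<dots> = (\<Sum>k<2 * N. \<integral>\<^sup>+x. \<phi> (x + ?a N k) * indicator {0..<h} x \<partial>lborel)"
    proof (rule sum.cong[OF refl])
      fix k
      have "(\<integral>\<^sup>+x. \<phi> x * indicator {?a N k..<?a N (Suc k)} x \<partial>lborel)
        = (\<integral>\<^sup>+x. \<phi> (x + ?a N k) * indicator {?a N k..<?a N (Suc k)} (x + ?a N k) \<partial>lborel)"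
        by (rule nn_integral_lborel_translate[symmetric, where f="\<lambda>x. \<phi> x * indicator {?a N k..<?a N (Suc k)} x"]) measurable
      also have "\<dots> = (\<integral>\<^sup>+x. \<phi> (x + ?a N k) * indicator {0..<h} x \<partial>lborel)"
        by (intro nn_integral_cong arg_cong2[where f="(*)"] refl) (auto split: split_indicator simp: algebra_simps)
      finally show "(\<integral>\<^sup>+x. \<phi> x * indicator {?a N k..<?a N (Suc k)} x \<partial>lborel) = (\<integral>\<^sup>+x. \<phi> (x + ?a N k) * indicator {0..<h} x \<partial>lborel)" .
    qed
    also have "\<dots> = (\<integral>\<^sup>+x. (\<Sum>k<2 * N. \<phi> (x + ?a N k)) * indicator {0..<h} x \<partial>lborel)"
      unfolding sum_distrib_right by (rule nn_integral_sum[symmetric]) measurable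
    also have "\<dots> \<le> (\<integral>\<^sup>+x. var_excess l v * indicator {0..<h} x \<partial>lborel)"
    proof (intro nn_integral_mono mult_right_mono)
      fix x
      let ?xs = "map (\<lambda>k. x + ?a N k) [0..<Suc (2 * N)]"
      have "sorted_wrt (<) ?xs" using h by (simp add: sorted_wrt_map sorted_wrt_upt sorted_wrt_iff_nth_less del: upt_Suc)
      then have "ennreal (chain_sum (\<lambda>x y. max 0 (\<bar>v y - v x\<bar> - l * (y - x))) ?xs) \<le> var_excess l v"
        unfolding var_excess_def by (intro SUP_upper) simp
      moreover have "chain_sum (\<lambda>x y. max 0 (\<bar>v y - v x\<bar> - l * (y - x))) ?xs
          = (\<Sum>k<2 * N. max 0 (\<bar>v ((x + ?a N k) + h) - v (x + ?a N k)\<bar> - l * h))"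
        unfolding chain_sum_nth
        by (rule sum.cong) (auto simp del: upt_Suc simp: algebra_simps)
      moreover have "ennreal (\<Sum>k<2 * N. max 0 (\<bar>v ((x + ?a N k) + h) - v (x + ?a N k)\<bar> - l * h)) = (\<Sum>k<2 * N. \<phi> (x + ?a N k))"
        unfolding \<phi>_def by (subst sum_ennreal[symmetric]) (simp_all add: ennreal_max_0)
      ultimately show "(\<Sum>k<2 * N. \<phi> (x + ?a N k)) \<le> var_excess l v" by simp
    qed simp
    also have "\<dots> = ennreal h * var_excess l v" using h by (simp add: nn_integral_cmult_indicator mult.commute)
    finally show ?thesis .
  qed
  have "(\<integral>\<^sup>+x. \<phi> x \<partial>lborel) = (\<integral>\<^sup>+x. (SUP N. \<phi> x * indicator {- real N * h..<real N * h} x) \<partial>lborel)"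
  proof (intro nn_integral_cong antisym)
    fix x
    obtain N :: nat where "\<bar>x\<bar> / h < real N" using reals_Archimedean2 by blast
    then have "\<bar>x\<bar> < real N * h" using h by (simp add: field_simps)
    then have "\<phi> x \<le> \<phi> x * indicator {- real N * h..<real N * h} x" by (auto split: split_indicator)
    then show "\<phi> x \<le> (SUP N. \<phi> x * indicator {- real N * h..<real N * h} x)" by (rule SUP_upper2[rotated]) simp
    show "(SUP N. \<phi> x * indicator {- real N * h..<real N * h} x) \<le> \<phi> x"
      by (intro SUP_least) (auto split: split_indicator)
  qed
  also have "\<dots> = (SUP N. \<integral>\<^sup>+x. \<phi> x * indicator {- real N * h..<real N * h} x \<partial>lborel)"
  proof (rule nn_integral_monotone_convergence_SUP)
    show "incseq (\<lambda>N x. \<phi> x * indicator {- real N * h..<real N * h} x)"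
    proof (intro incseq_SucI le_funI mult_left_mono)
      fix N x
      have "real N * h \<le> real (Suc N) * h" "- real (Suc N) * h \<le> - real N * h"
        using h by (intro mult_right_mono; simp)+
      then show "indicator {- real N * h..<real N * h} x \<le> (indicator {- real (Suc N) * h..<real (Suc N) * h} x :: ennreal)"
        by (auto split: split_indicator simp del: of_nat_Suc)
    qed simp
  qed measurable
  also have "\<dots> \<le> ennreal h * var_excess l v" by (intro SUP_least N)
  finally have "ennreal (1 / h) * (\<integral>\<^sup>+x. \<phi> x \<partial>lborel) \<le> ennreal (1 / h) * (ennreal h * var_excess l v)"
    by (rule mult_left_mono) simp
  also have "\<dots> = var_excess l v"
    using h by (simp add: mult.assoc[symmetric] ennreal_mult[symmetric])
  finally have "ennreal (1 / h) * (\<integral>\<^sup>+x. \<phi> x \<partial>lborel) \<le> var_excess l v" .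
  moreover have "ennreal (1 / h) * (\<integral>\<^sup>+x. \<phi> x \<partial>lborel) = (\<integral>\<^sup>+x. ennreal (norm ((v (x + h) - v x) / h) - l) \<partial>lborel)"
    unfolding \<phi>_def using h
    by (subst nn_integral_cmult[symmetric]) (auto intro!: nn_integral_cong simp: ennreal_mult'[symmetric] field_simps)
  ultimately show ?thesis by simp
qed

section \<open>Absolutely continuous representatives\<close>

text \<open>The difference of \<open>u\<close> and a primitive of \<open>g\<close> is, for each
  shift, almost everywhere invariant. By Fubini a single base point serves almost all shifts, so the
  difference is constant almost everywhere.\<close>

lemma weak_grad_representative:
  fixes u g :: "real \<Rightarrow> real"
  assumes wg: "weak_grad u g"
  obtains U where "U \<in> borel_measurable borel" "AE x in lborel. u x = U x"
    "\<And>a b. a \<le> b \<Longrightarrow> ennreal \<bar>U b - U a\<bar> \<le> (\<integral>\<^sup>+x. ennreal \<bar>g x\<bar> * indicator {a<..b} x \<partial>lborel)"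
proof -
  have u: "loc_int u" and g: "loc_int g" using wg by (auto simp: weak_grad_def)
  note [measurable] = loc_int_measurable[OF u] loc_int_measurable[OF g]
  have gi: "integrable lborel (\<lambda>x. g x * indicator {a<..b} x)" for a b
    using loc_int_set_integrable[OF g, of "{a<..b}"] by (simp add: set_integrable_def mult.commute)
  define G where "G x = (\<integral>y. g y * indicator {0<..x} y \<partial>lborel) - (\<integral>y. g y * indicator {x<..0} y \<partial>lborel)" for x
  have Gdiff: "G b - G a = (\<integral>y. g y * indicator {a<..b} y \<partial>lborel)" if "a \<le> b" for a b
  proof -
    have "G b - G a = (\<integral>y. g y * indicator {0<..b} y - g y * indicator {b<..0} y - (g y * indicator {0<..a} y - g y * indicator {a<..0} y) \<partial>lborel)"
      unfolding G_def using gi by simp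
    also have "\<dots> = (\<integral>y. g y * indicator {a<..b} y \<partial>lborel)"
      using that by (intro Bochner_Integration.integral_cong) (auto split: split_indicator)
    finally show ?thesis .
  qed
  have Gb: "ennreal \<bar>G b - G a\<bar> \<le> (\<integral>\<^sup>+x. ennreal \<bar>g x\<bar> * indicator {a<..b} x \<partial>lborel)" if "a \<le> b" for a b
  proof -
    have "ennreal \<bar>G b - G a\<bar> \<le> (\<integral>\<^sup>+x. norm (g x * indicator {a<..b} x) \<partial>lborel)"
      unfolding Gdiff[OF that] real_norm_def[symmetric] by (rule norm_integral_le_nn_integral)
    also have "\<dots> = (\<integral>\<^sup>+x. ennreal \<bar>g x\<bar> * indicator {a<..b} x \<partial>lborel)"
      by (intro nn_integral_cong) (auto split: split_indicator)
    finally show ?thesis .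
  qed
  have [measurable]: "G \<in> borel_measurable borel"
  proof -
    have "G = (\<lambda>x. (\<integral>y. g y * indicator {z. 0 < snd z \<and> snd z \<le> fst z} (x, y) \<partial>lborel) - (\<integral>y. g y * indicator {z. fst z < snd z \<and> snd z \<le> 0} (x, y) \<partial>lborel))"
      unfolding G_def by (intro ext arg_cong2[where f="(-)"] Bochner_Integration.integral_cong refl) (auto split: split_indicator)
    moreover have "{z \<in> space (borel \<Otimes>\<^sub>M borel). 0 < (snd z :: real) \<and> snd z \<le> fst z} \<in> sets (borel \<Otimes>\<^sub>M borel)"
      "{z \<in> space (borel \<Otimes>\<^sub>M borel). (fst z :: real) < snd z \<and> snd z \<le> 0} \<in> sets (borel \<Otimes>\<^sub>M borel)" by measurable
    ultimately show ?thesis by (simp add: space_pair_measure)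
  qed
  define w where "w x = u x - G x" for x
  have [measurable]: "w \<in> borel_measurable borel" unfolding w_def by measurable
  have wpos: "AE x in lborel. w (x + h) = w x" if h: "0 < h" for h
    using weak_grad_difference[OF wg, of h]
  proof (rule eventually_mono)
    fix x assume x: "u (x + h) - u x = (\<integral>\<tau>. g (x + \<tau> *\<^sub>R h) \<bullet> h \<partial>unit_measure)"
    have "(\<integral>\<tau>. g (x + \<tau> *\<^sub>R h) \<bullet> h \<partial>unit_measure) = (\<integral>\<tau>. indicator {0..1} \<tau> *\<^sub>R (g (x + \<tau> * h) * h) \<partial>lborel)"
      unfolding unit_measure_def by (subst integral_density) auto
    also have "\<dots> = h * (\<integral>\<tau>. g (x + h * \<tau>) * indicator {x..x + h} (x + h * \<tau>) \<partial>lborel)"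
    proof -
      have "indicator {x..x + h} (x + h * \<tau>) = (indicator {0..1} \<tau> :: real)" for \<tau>
        using h by (auto split: split_indicator simp: zero_le_mult_iff)
      then show ?thesis
        by (subst integral_mult_right_zero[symmetric], intro Bochner_Integration.integral_cong refl)
          (simp add: mult_ac)
    qed
    also have "\<dots> = (\<integral>y. g y * indicator {x..x + h} y \<partial>lborel)"
      using h by (subst lborel_integral_real_affine[of h _ x]) auto
    also have "\<dots> = (\<integral>y. g y * indicator {x<..x + h} y \<partial>lborel)"
      by (rule integral_cong_AE, measurable, rule eventually_mono[OF AE_lborel_singleton[of x]])
        (auto split: split_indicator)
    also have "\<dots> = G (x + h) - G x" using h by (simp add: Gdiff)
    finally show "w (x + h) = w x" using x by (simp add: w_def)
  qed
  have wall: "AE x in lborel. w (x + h) = w x" for h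
  proof (cases h "0 :: real" rule: linorder_cases)
    case less
    have "AE x in lborel. w ((x + h) + (- h)) = w (x + h)"
      using AE_lborel_translate[OF wpos[of "- h"], of h] less by simp
    then show ?thesis by (rule eventually_mono) simp
  next
    case greater
    then show ?thesis by (rule wpos)
  qed simp
  have "AE h in lborel. AE x in lborel. w (x + h) = w x" using wall by simp
  then have "AE x in lborel. AE h in lborel. w (x + h) = w x"
  proof (subst lborel_pair.AE_commute)
    show "{x \<in> space (lborel \<Otimes>\<^sub>M lborel). w (fst x + snd x) = w (fst x)} \<in> sets (lborel \<Otimes>\<^sub>M lborel)"
      by measurable
  qed
  then obtain x0 where x0: "AE h in lborel. w (x0 + h) = w x0"
    using eventually_happens'[of "ae_filter (lborel :: real measure)"] by (auto simp: ae_filter_eq_bot_iff)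
  then have "AE y in lborel. w (x0 + (y + (- x0))) = w x0"
    by (rule AE_lborel_translate[where P="\<lambda>h. w (x0 + h) = w x0"])
  then have wc: "AE y in lborel. u y = w x0 + G y" by (rule eventually_mono) (simp add: w_def)
  show ?thesis
    by (rule that[of "\<lambda>y. w x0 + G y"]) (use wc Gb in auto)
qed

lemma var_excess_le_nn_integral:
  fixes U g :: "real \<Rightarrow> real"
  assumes [measurable]: "g \<in> borel_measurable borel" and l: "0 \<le> l"
    and U: "\<And>a b. a \<le> b \<Longrightarrow> ennreal \<bar>U b - U a\<bar> \<le> (\<integral>\<^sup>+x. ennreal \<bar>g x\<bar> * indicator {a<..b} x \<partial>lborel)"
  shows "var_excess l U \<le> (\<integral>\<^sup>+x. ennreal (\<bar>g x\<bar> - l) \<partial>lborel)"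
proof -
  have step: "ennreal (max 0 (\<bar>U b - U a\<bar> - l * (b - a))) \<le> (\<integral>\<^sup>+x. ennreal (\<bar>g x\<bar> - l) * indicator {a<..b} x \<partial>lborel)"
    if ab: "a < b" for a b
  proof -
    have "ennreal \<bar>U b - U a\<bar> \<le> (\<integral>\<^sup>+x. ennreal \<bar>g x\<bar> * indicator {a<..b} x \<partial>lborel)" using ab by (intro U) simp
    also have "\<dots> \<le> (\<integral>\<^sup>+x. ennreal l * indicator {a<..b} x + ennreal (\<bar>g x\<bar> - l) * indicator {a<..b} x \<partial>lborel)"
      using ennreal_le_add_excess[OF l] by (intro nn_integral_mono) (auto split: split_indicator)
    also have "\<dots> = ennreal (l * (b - a)) + (\<integral>\<^sup>+x. ennreal (\<bar>g x\<bar> - l) * indicator {a<..b} x \<partial>lborel)"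
      using ab l by (subst nn_integral_add) (auto simp: nn_integral_cmult_indicator ennreal_mult)
    finally have le: "ennreal \<bar>U b - U a\<bar> \<le> ennreal (l * (b - a)) + (\<integral>\<^sup>+x. ennreal (\<bar>g x\<bar> - l) * indicator {a<..b} x \<partial>lborel)" .
    show ?thesis
    proof (cases "\<integral>\<^sup>+x. ennreal (\<bar>g x\<bar> - l) * indicator {a<..b} x \<partial>lborel")
      case (real r)
      have "0 \<le> l * (b - a)" using l ab by simp
      then have "\<bar>U b - U a\<bar> \<le> l * (b - a) + r"
        using le real by (simp flip: ennreal_plus add: ennreal_le_iff)
      then show ?thesis using real by (auto intro: ennreal_leI)
    qed simp
  qed
  \<comment> \<open>The induction needs the integral to the right of the first point only, so that
    the interval added in front is disjoint from it; the condition \<open>xs \<noteq> []\<close>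
    guards \<open>hd\<close>.\<close>
  have "sorted_wrt (<) xs \<Longrightarrow> ennreal (chain_sum (\<lambda>x y. max 0 (\<bar>U y - U x\<bar> - l * (y - x))) xs)
      \<le> (\<integral>\<^sup>+x. ennreal (\<bar>g x\<bar> - l) * indicator {z. xs \<noteq> [] \<and> hd xs < z} x \<partial>lborel)" for xs
  proof (induction "\<lambda>x y. max 0 (\<bar>U y - U x\<bar> - l * (y - x))" xs rule: chain_sum.induct)
    case (1 a b zs)
    let ?c = "\<lambda>x y. max 0 (\<bar>U y - U x\<bar> - l * (y - x))"
    have ab: "a < b" using 1 by auto
    have "ennreal (chain_sum ?c (a # b # zs)) = ennreal (?c a b) + ennreal (chain_sum ?c (b # zs))"
      by (simp add: ennreal_plus chain_sum_nonneg)
    also have "\<dots> \<le> (\<integral>\<^sup>+x. ennreal (\<bar>g x\<bar> - l) * indicator {a<..b} x \<partial>lborel) + (\<integral>\<^sup>+x. ennreal (\<bar>g x\<bar> - l) * indicator {b<..} x \<partial>lborel)"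
      using 1 by (intro add_mono step[OF ab]) (auto simp: greaterThan_def)
    also have "\<dots> = (\<integral>\<^sup>+x. ennreal (\<bar>g x\<bar> - l) * indicator {a<..} x \<partial>lborel)"
      using ab by (subst nn_integral_add[symmetric]) (auto intro!: nn_integral_cong split: split_indicator)
    finally show ?case by (simp add: greaterThan_def)
  qed auto
  then have "ennreal (chain_sum (\<lambda>x y. max 0 (\<bar>U y - U x\<bar> - l * (y - x))) xs) \<le> (\<integral>\<^sup>+x. ennreal (\<bar>g x\<bar> - l) \<partial>lborel)"
    if "sorted_wrt (<) xs" for xs
    by (rule order_trans[OF _ nn_integral_mono]) (use that in \<open>auto split: split_indicator\<close>)
  then show ?thesis unfolding var_excess_def by (intro SUP_least) auto
qed

lemma var_excess_abs_le: "var_excess l (\<lambda>x. \<bar>f x\<bar>) \<le> var_excess l f"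
  unfolding var_excess_def
proof (rule SUP_mono)
  fix xs :: "real list" assume xs: "xs \<in> {xs. sorted_wrt (<) xs}"
  then have "chain_sum (\<lambda>x y. max 0 (\<bar>\<bar>f y\<bar> - \<bar>f x\<bar>\<bar> - l * (y - x))) xs \<le> chain_sum (\<lambda>x y. max 0 (\<bar>f y - f x\<bar> - l * (y - x))) xs"
    by (intro chain_sum_mono) auto
  then show "\<exists>ys\<in>{xs. sorted_wrt (<) xs}. ennreal (chain_sum (\<lambda>x y. max 0 (\<bar>\<bar>f y\<bar> - \<bar>f x\<bar>\<bar> - l * (y - x))) xs)
    \<le> ennreal (chain_sum (\<lambda>x y. max 0 (\<bar>f y - f x\<bar> - l * (y - x))) ys)"
    using xs ennreal_leI by blast
qed

section \<open>Functions of bounded variation\<close>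

lemma bounded_variation_bounded:
  assumes "bounded_variation f"
  obtains B where "\<And>x. \<bar>f x\<bar> \<le> B"
proof -
  obtain a where a: "total_variation f = ennreal a" "0 \<le> a"
    using assms by (cases "total_variation f") (auto simp: bounded_variation_def)
  have d: "\<bar>f y - f x\<bar> \<le> a" if "x < y" for x y
  proof -
    have "ennreal (chain_sum (\<lambda>x y. max 0 (\<bar>f y - f x\<bar> - 0 * (y - x))) [x, y]) \<le> var_excess 0 f"
      unfolding var_excess_def by (rule SUP_upper) (use that in simp)
    then show ?thesis using a by (simp add: total_variation_eq_var_excess ennreal_le_iff)
  qed
  have "\<bar>f x\<bar> \<le> \<bar>f 0\<bar> + a" for x
    using d[of x 0] d[of 0 x] a by (cases x "0 :: real" rule: linorder_cases) auto
  then show ?thesis by (rule that)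
qed

text \<open>\<open>T x\<close> is the variation to the right of \<open>x\<close>; both \<open>T\<close> and \<open>T + f\<close> are antitone.\<close>

lemma bounded_variation_borel_measurable:
  assumes bv: "bounded_variation f"
  shows "f \<in> borel_measurable borel"
proof -
  let ?c = "\<lambda>x y. \<bar>f y - f x\<bar>"
  obtain a where a: "total_variation f = ennreal a" "0 \<le> a"
    using bv by (cases "total_variation f") (auto simp: bounded_variation_def)
  have le_a: "chain_sum ?c xs \<le> a" if "sorted_wrt (<) xs" for xs
  proof -
    have "ennreal (chain_sum (\<lambda>x y. max 0 (\<bar>f y - f x\<bar> - 0 * (y - x))) xs) \<le> var_excess 0 f"
      unfolding var_excess_def by (rule SUP_upper) (use that in simp)
    then show ?thesis using a by (simp add: total_variation_eq_var_excess ennreal_le_iff)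
  qed
  define S where "S x = {xs. sorted_wrt (<) xs \<and> (\<forall>z\<in>set xs. x \<le> z)}" for x :: real
  define T where "T x = (SUP xs\<in>S x. chain_sum ?c xs)" for x
  have bdd: "bdd_above (chain_sum ?c ` S x)" for x
    by (rule bdd_aboveI2[of _ _ a]) (auto simp: S_def le_a)
  have T: "T y + \<bar>f y - f x\<bar> \<le> T x" if xy: "x < y" for x y
  proof -
    have "T y \<le> T x - \<bar>f y - f x\<bar>"
      unfolding T_def[of y]
    proof (rule cSUP_least)
      show "S y \<noteq> {}" by (auto simp: S_def intro: exI[of _ "[]"])
      fix xs assume xs: "xs \<in> S y"
      define zs where "zs = sorted_list_of_set (insert y (set xs))"
      have zs: "sorted_wrt (<) zs" "set zs = insert y (set xs)"
        unfolding zs_def by (simp_all only: set_sorted_list_of_set finite_insert finite_set strict_sorted_list_of_set)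
      have ge: "\<forall>z\<in>set zs. y \<le> z" using xs zs by (auto simp: S_def)
      have ne: "zs \<noteq> []" using zs(2) by auto
      have hd: "hd zs = y"
      proof (rule antisym)
        show "y \<le> hd zs" using ge ne by simp
        have "y \<in> set zs" using zs by simp
        then show "hd zs \<le> y" using zs(1) ne by (cases zs) auto
      qed
      have "chain_sum ?c xs \<le> chain_sum ?c zs"
        by (rule chain_sum_refine) (use xs zs in \<open>auto simp: S_def\<close>)
      moreover have "chain_sum ?c (x # zs) = \<bar>f y - f x\<bar> + chain_sum ?c zs" using ne hd by (simp add: chain_sum_Cons)
      moreover have "x # zs \<in> S x" using zs ge xy by (force simp: S_def)
      then have "chain_sum ?c (x # zs) \<le> T x" unfolding T_def by (intro cSUP_upper bdd)
      ultimately show "chain_sum ?c xs \<le> T x - \<bar>f y - f x\<bar>" by linarith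
    qed
    then show ?thesis by simp
  qed
  have m: "mono (\<lambda>x. - T x)" "mono (\<lambda>x. - (T x + f x))"
  proof -
    have anti: "T y \<le> T x \<and> T y + f y \<le> T x + f x" if "x \<le> y" for x y
      using T[of x y] that by (cases "x = y") auto
    show "mono (\<lambda>x. - T x)" using anti by (simp add: mono_def)
    show "mono (\<lambda>x. - (T x + f x))" using anti by (intro monoI) (simp only: neg_le_iff_le)
  qed
  have "(\<lambda>x. - T x - - (T x + f x)) \<in> borel_measurable borel"
    by (rule borel_measurable_diff[OF m[THEN borel_measurable_mono]])
  then show ?thesis by simp
qed

section \<open>Bounds for differences\<close>

text \<open>Nonnegativity of the variance; when the square is not integrable, the right-hand side is
  infinite.\<close>

lemma (in prob_space) square_integral_le:
  fixes f :: "'a \<Rightarrow> real"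
  assumes [measurable]: "f \<in> borel_measurable M"
  shows "ennreal ((\<integral>x. f x \<partial>M)\<^sup>2) \<le> (\<integral>\<^sup>+x. ennreal ((f x)\<^sup>2) \<partial>M)"
proof (cases "integrable M (\<lambda>x. (f x)\<^sup>2)")
  case True
  have i: "integrable M f"
  proof (rule Bochner_Integration.integrable_bound[of M "\<lambda>x. 1 + (f x)\<^sup>2"])
    have "\<bar>a\<bar> \<le> 1 + a\<^sup>2" for a :: real
    proof -
      have "2 * \<bar>a\<bar> \<le> 1 + a\<^sup>2" using sum_squares_bound[of "\<bar>a\<bar>" 1] by simp
      then show ?thesis by linarith
    qed
    then show "AE x in M. norm (f x) \<le> norm (1 + (f x)\<^sup>2)" by (intro AE_I2) simp
  qed (use True in simp_all)
  have "0 \<le> (\<integral>x. (f x - (\<integral>x. f x \<partial>M))\<^sup>2 \<partial>M)" by simp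
  also have "\<dots> = (\<integral>x. (f x)\<^sup>2 \<partial>M) - (\<integral>x. f x \<partial>M)\<^sup>2"
    by (rule variance_eq[OF i True])
  finally have "(\<integral>x. f x \<partial>M)\<^sup>2 \<le> (\<integral>x. (f x)\<^sup>2 \<partial>M)" by simp
  then show ?thesis using True by (subst nn_integral_eq_integral) (auto intro: ennreal_leI)
next
  case False
  have "(\<integral>\<^sup>+x. ennreal ((f x)\<^sup>2) \<partial>M) = \<infinity>"
  proof (rule ccontr)
    assume "(\<integral>\<^sup>+x. ennreal ((f x)\<^sup>2) \<partial>M) \<noteq> \<infinity>"
    then have "integrable M (\<lambda>x. (f x)\<^sup>2)" by (intro integrableI_nonneg) (auto simp: less_top)
    with False show False by simp
  qed
  then show ?thesis by simp
qed

text \<open>The directional form is kept: averaging the square of \<open>h \<bullet> g x\<close>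
  over the Gaussian gives exactly 2 s times the squared norm of \<open>g x\<close>, whereas bounding
  it by norms first would lose a factor d.\<close>

lemma weak_grad_difference_L2:
  fixes u :: "'a::euclidean_space \<Rightarrow> real"
  assumes wg: "weak_grad u g"
  shows "(\<integral>\<^sup>+x. ennreal ((u (x + h) - u x)\<^sup>2) \<partial>lborel) \<le> (\<integral>\<^sup>+x. ennreal ((h \<bullet> g x)\<^sup>2) \<partial>lborel)"
proof -
  interpret U: prob_space unit_measure by (rule prob_space_unit_measure)
  interpret P: pair_sigma_finite lborel unit_measure ..
  have [measurable]: "u \<in> borel_measurable borel" "g \<in> borel_measurable borel"
    using wg by (auto simp: weak_grad_def dest: loc_int_measurable)
  have "(\<integral>\<^sup>+x. ennreal ((u (x + h) - u x)\<^sup>2) \<partial>lborel) = (\<integral>\<^sup>+x. ennreal ((\<integral>\<tau>. g (x + \<tau> *\<^sub>R h) \<bullet> h \<partial>unit_measure)\<^sup>2) \<partial>lborel)"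
    by (rule nn_integral_cong_AE, rule eventually_mono[OF weak_grad_difference[OF wg, of h]]) simp
  also have "\<dots> \<le> (\<integral>\<^sup>+x. \<integral>\<^sup>+\<tau>. ennreal ((g (x + \<tau> *\<^sub>R h) \<bullet> h)\<^sup>2) \<partial>unit_measure \<partial>lborel)"
    by (rule nn_integral_mono, rule U.square_integral_le) measurable
  also have "\<dots> = (\<integral>\<^sup>+\<tau>. \<integral>\<^sup>+x. ennreal ((g (x + \<tau> *\<^sub>R h) \<bullet> h)\<^sup>2) \<partial>lborel \<partial>unit_measure)"
    by (rule P.Fubini'[symmetric]) measurable
  also have "\<dots> = (\<integral>\<^sup>+\<tau>. \<integral>\<^sup>+x. ennreal ((h \<bullet> g x)\<^sup>2) \<partial>lborel \<partial>unit_measure)"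
  proof (rule nn_integral_cong)
    fix \<tau> :: real
    show "(\<integral>\<^sup>+x. ennreal ((g (x + \<tau> *\<^sub>R h) \<bullet> h)\<^sup>2) \<partial>lborel) = (\<integral>\<^sup>+x. ennreal ((h \<bullet> g x)\<^sup>2) \<partial>lborel)"
      using nn_integral_lborel_translate[of "\<lambda>x. ennreal ((g x \<bullet> h)\<^sup>2)" "\<tau> *\<^sub>R h"] by (simp add: inner_commute)
  qed
  also have "\<dots> = (\<integral>\<^sup>+x. ennreal ((h \<bullet> g x)\<^sup>2) \<partial>lborel)" using U.emeasure_space_1 by simp
  finally show ?thesis .
qed

lemma weak_grad_difference_bounded:
  fixes u :: "'a::euclidean_space \<Rightarrow> real"
  assumes wg: "weak_grad u g" and L: "0 \<le> L" "AE x in lborel. norm (g x) \<le> L"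
  shows "AE x in lborel. \<bar>u (x + h) - u x\<bar> \<le> L * norm h"
proof -
  interpret U: prob_space unit_measure by (rule prob_space_unit_measure)
  interpret P: pair_sigma_finite lborel unit_measure ..
  have [measurable]: "g \<in> borel_measurable borel"
    using wg by (auto simp: weak_grad_def dest: loc_int_measurable)
  have "AE \<tau> in unit_measure. AE x in lborel. norm (g (x + \<tau> *\<^sub>R h)) \<le> L"
    using AE_lborel_translate[OF L(2)] by simp
  moreover have "{x \<in> space (lborel \<Otimes>\<^sub>M unit_measure). norm (g (fst x + snd x *\<^sub>R h)) \<le> L} \<in> sets (lborel \<Otimes>\<^sub>M unit_measure)"
    by measurable
  ultimately have "AE x in lborel. AE \<tau> in unit_measure. norm (g (x + \<tau> *\<^sub>R h)) \<le> L"
    using P.AE_commute[of "\<lambda>x \<tau>. norm (g (x + \<tau> *\<^sub>R h)) \<le> L"] by blast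
  with weak_grad_difference[OF wg, of h] show ?thesis
  proof eventually_elim
    case (elim x)
    have "ennreal \<bar>u (x + h) - u x\<bar> \<le> (\<integral>\<^sup>+\<tau>. norm (g (x + \<tau> *\<^sub>R h) \<bullet> h) \<partial>unit_measure)"
      unfolding elim(1) real_norm_def[symmetric] by (rule norm_integral_le_nn_integral)
    also have "\<dots> \<le> (\<integral>\<^sup>+\<tau>. ennreal (L * norm h) \<partial>unit_measure)"
    proof (rule nn_integral_mono_AE, rule eventually_mono[OF elim(2)])
      fix \<tau> assume "norm (g (x + \<tau> *\<^sub>R h)) \<le> L"
      then have "norm (g (x + \<tau> *\<^sub>R h)) * norm h \<le> L * norm h" by (intro mult_right_mono) auto
      then show "ennreal (norm (g (x + \<tau> *\<^sub>R h) \<bullet> h)) \<le> ennreal (L * norm h)"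
        using Cauchy_Schwarz_ineq2[of "g (x + \<tau> *\<^sub>R h)" h] by (intro ennreal_leI) simp
    qed
    also have "\<dots> = ennreal (L * norm h)" using U.emeasure_space_1 by simp
    finally show ?case using L(1) by (simp add: ennreal_le_iff)
  qed
qed

section \<open>Gradients at scale \<open>s\<close>\<close>

text \<open>This is the gradient of \<^term>\<open>heat s V\<close>, written without derivatives.\<close>

definition heat_grad :: "real \<Rightarrow> ('a::euclidean_space \<Rightarrow> real) \<Rightarrow> 'a \<Rightarrow> 'a" where
  "heat_grad s V x = (\<Sum>i\<in>Basis. ((\<integral>h. (V (x + h) - V x) * (h \<bullet> i) \<partial>heat_measure s) / (2 * s)) *\<^sub>R i)"

lemma heat_grad_inner:
  "i \<in> Basis \<Longrightarrow> heat_grad s V x \<bullet> i = (\<integral>h. (V (x + h) - V x) * (h \<bullet> i) \<partial>heat_measure s) / (2 * s)"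
  unfolding heat_grad_def by (simp add: inner_sum_left inner_Basis if_distrib sum.delta cong: if_cong)

lemma borel_measurable_heat_grad [measurable]:
  fixes V :: "'a::euclidean_space \<Rightarrow> real"
  assumes [measurable]: "V \<in> borel_measurable borel"
  shows "heat_grad s V \<in> borel_measurable borel"
proof -
  interpret sigma_finite_measure "heat_measure s :: 'a measure" by (rule sigma_finite_heat_measure)
  show ?thesis unfolding heat_grad_def[abs_def] by measurable
qed

lemma heat_grad_direction:
  fixes V :: "'a::euclidean_space \<Rightarrow> real"
  assumes i: "\<And>i. i \<in> Basis \<Longrightarrow> integrable (heat_measure s) (\<lambda>h. (V (x + h) - V x) * (h \<bullet> i))"
  shows "heat_grad s V x \<bullet> e = (\<integral>h. (V (x + h) - V x) * (h \<bullet> e) \<partial>heat_measure s) / (2 * s)"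
    and "integrable (heat_measure s) (\<lambda>h. (V (x + h) - V x) * (h \<bullet> e))"
proof -
  have eq: "(\<lambda>h. (V (x + h) - V x) * (h \<bullet> e)) = (\<lambda>h. \<Sum>i\<in>Basis. (e \<bullet> i) * ((V (x + h) - V x) * (h \<bullet> i)))"
    by (rule ext, subst euclidean_inner) (simp add: sum_distrib_left mult_ac)
  show "integrable (heat_measure s) (\<lambda>h. (V (x + h) - V x) * (h \<bullet> e))"
    unfolding eq using i by (intro Bochner_Integration.integrable_sum integrable_mult_right) auto
  have "(\<integral>h. (V (x + h) - V x) * (h \<bullet> e) \<partial>heat_measure s) = (\<Sum>i\<in>Basis. (e \<bullet> i) * (\<integral>h. (V (x + h) - V x) * (h \<bullet> i) \<partial>heat_measure s))"
    unfolding eq using i by (subst Bochner_Integration.integral_sum) auto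
  then show "heat_grad s V x \<bullet> e = (\<integral>h. (V (x + h) - V x) * (h \<bullet> e) \<partial>heat_measure s) / (2 * s)"
    by (subst euclidean_inner) (simp add: heat_grad_inner sum_divide_distrib mult_ac)
qed

text \<open>The vector is paired with itself; by the arithmetic-geometric mean inequality and the
  covariance 2 s, half of its square is absorbed. This keeps the sharp constant.\<close>

lemma heat_grad_norm_le:
  fixes V :: "'a::euclidean_space \<Rightarrow> real"
  assumes [measurable]: "V \<in> borel_measurable borel" and s: "0 < s"
  shows "ennreal ((norm (heat_grad s V x))\<^sup>2) \<le> ennreal (1 / (2 * s)) * (\<integral>\<^sup>+h. ennreal ((V (x + h) - V x)\<^sup>2) \<partial>heat_measure s)"
proof (cases "integrable (heat_measure s) (\<lambda>h. (V (x + h) - V x)\<^sup>2)")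
  case True
  let ?D = "\<lambda>h. V (x + h) - V x" and ?G = "heat_grad s V x"
  have prod: "integrable (heat_measure s) (\<lambda>h. ?D h * (h \<bullet> e))" for e
  proof (rule Bochner_Integration.integrable_bound[of _ "\<lambda>h. (?D h)\<^sup>2 + (h \<bullet> e) * (h \<bullet> e)"])
    show "integrable (heat_measure s) (\<lambda>h. (?D h)\<^sup>2 + (h \<bullet> e) * (h \<bullet> e))"
      using True heat_measure_inner_inner[OF s, of e e] by (auto simp: has_bochner_integral_iff)
    have "\<bar>a * b\<bar> \<le> a\<^sup>2 + b * b" for a b :: real
    proof -
      have "2 * \<bar>a * b\<bar> \<le> a\<^sup>2 + b * b"
        using sum_squares_bound[of "\<bar>a\<bar>" "\<bar>b\<bar>"] by (simp add: abs_mult power2_eq_square mult.assoc)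
      then show ?thesis by linarith
    qed
    then show "AE h in heat_measure s. norm (?D h * (h \<bullet> e)) \<le> norm ((?D h)\<^sup>2 + (h \<bullet> e) * (h \<bullet> e))"
      by (intro AE_I2) (simp add: abs_of_nonneg add_nonneg_nonneg)
  qed simp
  have "(norm ?G)\<^sup>2 = ?G \<bullet> ?G" by (rule power2_norm_eq_inner)
  also have "\<dots> = (\<integral>h. ?D h * (h \<bullet> ?G) \<partial>heat_measure s) / (2 * s)"
    by (rule heat_grad_direction(1)) (rule prod)
  also have "\<dots> \<le> (\<integral>h. (?D h)\<^sup>2 / 2 + (h \<bullet> ?G) * (h \<bullet> ?G) / 2 \<partial>heat_measure s) / (2 * s)"
  proof (intro divide_right_mono integral_mono prod)
    show "integrable (heat_measure s) (\<lambda>h. (?D h)\<^sup>2 / 2 + (h \<bullet> ?G) * (h \<bullet> ?G) / 2)"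
      using True heat_measure_inner_inner[OF s, of ?G ?G] by (auto simp: has_bochner_integral_iff)
    have "a * b \<le> a\<^sup>2 / 2 + b * b / 2" for a b :: real
      using sum_squares_bound[of a b] by (simp add: power2_eq_square)
    then show "?D h * (h \<bullet> ?G) \<le> (?D h)\<^sup>2 / 2 + (h \<bullet> ?G) * (h \<bullet> ?G) / 2" for h .
  qed (use s in simp)
  also have "\<dots> = ((\<integral>h. (?D h)\<^sup>2 \<partial>heat_measure s) / 2 + (2 * s * (?G \<bullet> ?G)) / 2) / (2 * s)"
    using True heat_measure_inner_inner[OF s, of ?G ?G] by (simp add: has_bochner_integral_iff)
  also have "\<dots> = (\<integral>h. (?D h)\<^sup>2 \<partial>heat_measure s) / (4 * s) + (norm ?G)\<^sup>2 / 2"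
    using s by (simp add: power2_norm_eq_inner field_simps)
  finally have "(norm ?G)\<^sup>2 \<le> 1 / (2 * s) * (\<integral>h. (?D h)\<^sup>2 \<partial>heat_measure s)"
    using s by (simp add: field_simps)
  then have "ennreal ((norm ?G)\<^sup>2) \<le> ennreal (1 / (2 * s) * (\<integral>h. (?D h)\<^sup>2 \<partial>heat_measure s))"
    by (rule ennreal_leI)
  then show ?thesis
    using True s by (subst nn_integral_eq_integral) (auto simp: ennreal_mult'[symmetric])
next
  case False
  have "(\<integral>\<^sup>+h. ennreal ((V (x + h) - V x)\<^sup>2) \<partial>heat_measure s) = \<infinity>"
  proof (rule ccontr)
    assume "\<not> ?thesis"
    then have "integrable (heat_measure s) (\<lambda>h. (V (x + h) - V x)\<^sup>2)" by (intro integrableI_nonneg) (auto simp: less_top)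
    with False show False by simp
  qed
  then show ?thesis using s by (simp add: ennreal_mult_top)
qed

lemma heat_measure_norm2:
  assumes s: "0 < s"
  shows "has_bochner_integral (heat_measure s) (\<lambda>x::'a::euclidean_space. (norm x)\<^sup>2) (2 * s * real DIM('a))"
proof -
  have "has_bochner_integral (heat_measure s) (\<lambda>x::'a. \<Sum>b\<in>Basis. (x \<bullet> b) * (x \<bullet> b)) (\<Sum>b\<in>(Basis::'a set). 2 * s * (b \<bullet> b))"
    by (intro has_bochner_integral_sum heat_measure_inner_inner s)
  moreover have "(\<lambda>x::'a. \<Sum>b\<in>Basis. (x \<bullet> b) * (x \<bullet> b)) = (\<lambda>x. (norm x)\<^sup>2)"
    by (rule ext, subst power2_norm_eq_inner, subst (3) euclidean_inner) simp
  ultimately show ?thesis by (simp add: mult.commute)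
qed

text \<open>The third power is interpolated between second and fourth with weight
  \<open>sqrt s\<close>, which balances the two. The constant is 2 + 12, from the second and the
  fourth moment.\<close>

lemma heat_measure_norm3:
  assumes s: "0 < s"
  shows "(\<integral>\<^sup>+x. ennreal (norm (x::'a::euclidean_space) ^ 3) \<partial>heat_measure s) \<le> ennreal (14 * (real DIM('a))\<^sup>2 * (s * sqrt s))"
proof -
  obtain C where C: "C = 12 * (real DIM('a))\<^sup>2" "integrable (heat_measure s) (\<lambda>x::'a. norm x ^ 4)"
    "(\<integral>x. norm (x::'a) ^ 4 \<partial>heat_measure s) \<le> C * s\<^sup>2"
    using heat_measure_norm4[OF s, where 'a='a] by metis
  have r: "0 < sqrt s" using s by simp
  have "(\<integral>\<^sup>+x. ennreal (norm (x::'a) ^ 3) \<partial>heat_measure s) \<le> (\<integral>\<^sup>+x. ennreal (sqrt s * (norm (x::'a))\<^sup>2 + norm x ^ 4 / sqrt s) \<partial>heat_measure s)"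
  proof (intro nn_integral_mono ennreal_leI)
    fix x :: 'a
    have "n ^ 3 \<le> w * n\<^sup>2 + n ^ 4 / w" if w: "0 < w" and n: "0 \<le> n" for w n :: real
    proof -
      have "2 * (w * n) \<le> w\<^sup>2 + n\<^sup>2" using sum_squares_bound[of w n] by simp
      moreover have "0 \<le> w * n" using w n by simp
      ultimately have "w * n \<le> w\<^sup>2 + n\<^sup>2" by linarith
      then have "n\<^sup>2 * (w * n) \<le> n\<^sup>2 * (w\<^sup>2 + n\<^sup>2)" by (rule mult_left_mono) simp
      then have "n ^ 3 * w \<le> (w * n\<^sup>2 + n ^ 4 / w) * w"
        using w by (simp add: power2_eq_square power3_eq_cube power4_eq_xxxx algebra_simps)
      then show ?thesis using w by (rule mult_right_le_imp_le)
    qed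
    from this[OF r norm_ge_zero] show "norm x ^ 3 \<le> sqrt s * (norm x)\<^sup>2 + norm x ^ 4 / sqrt s" .
  qed
  also have "\<dots> = ennreal (\<integral>x. sqrt s * (norm (x::'a))\<^sup>2 + norm x ^ 4 / sqrt s \<partial>heat_measure s)"
    using heat_measure_norm2[OF s, where 'a='a] C s
    by (intro nn_integral_eq_integral) (auto simp: has_bochner_integral_iff)
  also have "\<dots> \<le> ennreal (14 * (real DIM('a))\<^sup>2 * (s * sqrt s))"
  proof (rule ennreal_leI)
    have "(\<integral>x. sqrt s * (norm (x::'a))\<^sup>2 + norm x ^ 4 / sqrt s \<partial>heat_measure s)
      = sqrt s * (2 * s * real DIM('a)) + (\<integral>x. norm (x::'a) ^ 4 \<partial>heat_measure s) / sqrt s"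
      using heat_measure_norm2[OF s, where 'a='a] C by (simp add: has_bochner_integral_iff)
    also have "\<dots> \<le> sqrt s * (2 * s * (real DIM('a))\<^sup>2) + (C * s\<^sup>2) / sqrt s"
    proof (intro add_mono mult_left_mono divide_right_mono C)
      have "1 \<le> real DIM('a)" using DIM_positive[where 'a='a] by linarith
      then show "real DIM('a) \<le> (real DIM('a))\<^sup>2" by (simp add: power2_eq_square)
    qed (use s in auto)
    also have "(C * s\<^sup>2) / sqrt s = C * (s * sqrt s)"
      using s r by (simp add: field_simps power2_eq_square)
    finally show "(\<integral>x. sqrt s * (norm (x::'a))\<^sup>2 + norm x ^ 4 / sqrt s \<partial>heat_measure s) \<le> 14 * (real DIM('a))\<^sup>2 * (s * sqrt s)"
      by (simp add: C(1) algebra_simps)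
  qed
  finally show ?thesis .
qed

section \<open>Pairing approximate gradients with test functions\<close>

lemma test_function_partial:
  fixes \<phi> :: "'a::euclidean_space \<Rightarrow> real"
  assumes \<phi>: "\<phi> \<in> test_functions" and i: "i \<in> Basis"
  shows "(\<lambda>x. frechet_derivative \<phi> (at x) i) \<in> test_functions"
proof -
  obtain R where R: "\<And>x h. norm x > R \<Longrightarrow> frechet_derivative \<phi> (at x) h = 0"
    using test_function_facts[OF \<phi>] by metis
  have "{x. frechet_derivative \<phi> (at x) i \<noteq> 0} \<subseteq> cball 0 R" using R by (auto simp: not_less[symmetric])
  then have "bounded {x. frechet_derivative \<phi> (at x) i \<noteq> 0}" by (rule bounded_subset[OF bounded_cball])
  moreover have "C_k k (\<lambda>x. frechet_derivative \<phi> (at x) i)" for k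
  proof -
    have "C_k (Suc k) \<phi>" using \<phi> by (simp only: test_functions_def mem_Collect_eq)
    then show ?thesis using i by simp
  qed
  ultimately show ?thesis by (simp add: test_functions_def)
qed

lemma test_function_taylor:
  fixes \<phi> :: "'a::euclidean_space \<Rightarrow> real"
  assumes \<phi>: "\<phi> \<in> test_functions"
  obtains K where "0 \<le> K" "\<And>x h. \<bar>\<phi> (x - h) - \<phi> x + frechet_derivative \<phi> (at x) h\<bar> \<le> K * (norm h)\<^sup>2"
proof -
  define D where "D x = frechet_derivative \<phi> (at x)" for x
  have d: "(\<phi> has_derivative D x) (at x)" for x unfolding D_def using test_function_facts[OF \<phi>] by metis
  have "\<exists>B\<ge>0. \<forall>x y. \<bar>D x i - D y i\<bar> \<le> B * norm (x - y)" if "i \<in> Basis" for i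
    unfolding D_def using test_function_facts[OF test_function_partial[OF \<phi> that]] by metis
  then obtain B where B: "\<And>i. i \<in> Basis \<Longrightarrow> 0 \<le> B i" "\<And>i x y. i \<in> Basis \<Longrightarrow> \<bar>D x i - D y i\<bar> \<le> B i * norm (x - y)"
    by metis
  define K where "K = (\<Sum>i\<in>Basis. B i)"
  have K: "0 \<le> K" unfolding K_def using B by (intro sum_nonneg) auto
  have Dlip: "\<bar>D x h - D y h\<bar> \<le> K * norm (x - y) * norm h" for x y h
  proof -
    have "D x h - D y h = (\<Sum>i\<in>Basis. (h \<bullet> i) * (D x i - D y i))"
      unfolding D_def
      by (subst (1 2) test_function_derivative_sum[OF \<phi>, of _ h]) (simp add: sum_subtractf right_diff_distrib)
    also have "\<bar>\<dots>\<bar> \<le> (\<Sum>i\<in>Basis. \<bar>h \<bullet> i\<bar> * \<bar>D x i - D y i\<bar>)"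
      by (rule order_trans[OF sum_abs]) (simp add: abs_mult)
    also have "\<dots> \<le> (\<Sum>i\<in>Basis. norm h * (B i * norm (x - y)))"
      by (intro sum_mono mult_mono B) (auto simp: Basis_le_norm)
    also have "\<dots> = K * norm (x - y) * norm h"
      by (simp add: K_def sum_distrib_left sum_distrib_right mult_ac)
    finally show ?thesis .
  qed
  show ?thesis
  proof (rule that[OF K])
    fix x h :: 'a
    have lin: "linear (D x)" using d has_derivative_linear by blast
    \<comment> \<open>After subtraction of the linear part the derivative is a difference of
      derivatives of \<open>\<phi>\<close>, of size \<open>K * norm h\<close> on the ball, and the
      mean value inequality gives the square.\<close>
    let ?f = "\<lambda>z. \<phi> z - D x z"
    have "norm (?f (x - h) - ?f x) \<le> (K * norm h) * norm ((x - h) - x)"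
    proof (rule differentiable_bound[of "cball x (norm h)" ?f "\<lambda>z v. D z v - D x v"])
      show "(?f has_derivative (\<lambda>v. D z v - D x v)) (at z within cball x (norm h))" for z
        by (intro has_derivative_diff has_derivative_at_withinI[OF d] linear_imp_has_derivative lin)
      show "onorm (\<lambda>v. D z v - D x v) \<le> K * norm h" if "z \<in> cball x (norm h)" for z
      proof (rule onorm_bound)
        fix v :: 'a
        have "norm (z - x) \<le> norm h" using that by (simp add: dist_norm norm_minus_commute)
        then have "K * norm (z - x) * norm v \<le> K * norm h * norm v" using K by (intro mult_right_mono mult_left_mono) auto
        then show "norm (D z v - D x v) \<le> K * norm h * norm v" using Dlip[of z v x] by simp
      qed (use K in simp)
    qed (auto simp: dist_norm)
    moreover have "?f (x - h) - ?f x = \<phi> (x - h) - \<phi> x + D x h"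
      by (simp add: linear_diff[OF lin])
    ultimately show "\<bar>\<phi> (x - h) - \<phi> x + frechet_derivative \<phi> (at x) h\<bar> \<le> K * (norm h)\<^sup>2"
      by (simp add: D_def[symmetric] power2_eq_square mult.assoc)
  qed
qed

text \<open>The bound is uniform in the centre: Gaussian shifts carry the support of a test function
  arbitrarily far, where local integrability alone gives no control of the mass met.\<close>

definition ball_mean :: "real \<Rightarrow> ('a::euclidean_space \<Rightarrow> real) \<Rightarrow> real \<Rightarrow> bool" where
  "ball_mean R V c \<longleftrightarrow> (\<forall>z. (\<integral>\<^sup>+x. ennreal \<bar>V x\<bar> * indicator (cball z R) x \<partial>lborel) \<le> ennreal c)"

lemma test_function_difference_mass:
  fixes \<phi> :: "'a::euclidean_space \<Rightarrow> real"
  assumes \<phi>: "\<phi> \<in> test_functions"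
  obtains R C where "0 \<le> C"
    "\<And>V c h. V \<in> borel_measurable borel \<Longrightarrow> 0 \<le> c \<Longrightarrow> ball_mean R V c \<Longrightarrow>
      (\<integral>\<^sup>+x. ennreal \<bar>V x * (\<phi> (x - h) - \<phi> x)\<bar> \<partial>lborel) \<le> ennreal (C * c * norm h)"
    "\<And>V c h. V \<in> borel_measurable borel \<Longrightarrow> 0 \<le> c \<Longrightarrow> ball_mean R V c \<Longrightarrow>
      (\<integral>\<^sup>+x. ennreal \<bar>V x * (\<phi> (x - h) - \<phi> x + frechet_derivative \<phi> (at x) h)\<bar> \<partial>lborel) \<le> ennreal (C * c * (norm h)\<^sup>2)"
proof -
  obtain R B where RB: "0 < R" "0 \<le> B" "\<And>x h. \<bar>frechet_derivative \<phi> (at x) h\<bar> \<le> B * norm h" "\<And>x. \<bar>\<phi> x\<bar> \<le> B"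
    "\<And>x y. \<bar>\<phi> x - \<phi> y\<bar> \<le> B * norm (x - y)"
    "\<And>x. norm x > R \<Longrightarrow> \<phi> x = 0" "\<And>x h. norm x > R \<Longrightarrow> frechet_derivative \<phi> (at x) h = 0"
    using test_function_facts[OF \<phi>] by metis
  obtain K where K: "0 \<le> K" "\<And>x h. \<bar>\<phi> (x - h) - \<phi> x + frechet_derivative \<phi> (at x) h\<bar> \<le> K * (norm h)\<^sup>2"
    using test_function_taylor[OF \<phi>] by blast
  \<comment> \<open>\<open>K\<close> covers the second-order bound for shifts of length at most 1,
    whose supports stay in one ball of radius \<open>R + 1\<close>. For longer shifts there are at
    most three terms, each bounded by \<open>B\<close> times a power of
    \<open>norm h\<close>.\<close>
  define C where "C = K + 3 * B"
  have C: "0 \<le> C" using K RB by (simp add: C_def)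
  have mass: "(\<integral>\<^sup>+x. ennreal \<bar>V x * q x\<bar> \<partial>lborel) \<le> ennreal ((a + b) * c)"
    if [measurable]: "V \<in> borel_measurable borel" and c: "0 \<le> c" and bm: "ball_mean (R + 1) V c"
      and ab: "0 \<le> a" "0 \<le> b"
      and q: "\<And>x. \<bar>q x\<bar> \<le> a * indicator (cball 0 (R + 1)) x + b * indicator (cball z (R + 1)) x" for V c a b q z
  proof -
    have "(\<integral>\<^sup>+x. ennreal \<bar>V x * q x\<bar> \<partial>lborel)
      \<le> (\<integral>\<^sup>+x. ennreal a * (ennreal \<bar>V x\<bar> * indicator (cball 0 (R + 1)) x) + ennreal b * (ennreal \<bar>V x\<bar> * indicator (cball z (R + 1)) x) \<partial>lborel)"
    proof (intro nn_integral_mono)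
      fix x
      have "\<bar>V x * q x\<bar> \<le> \<bar>V x\<bar> * (a * indicator (cball 0 (R + 1)) x + b * indicator (cball z (R + 1)) x)"
        unfolding abs_mult by (intro mult_left_mono q) auto
      then have "ennreal \<bar>V x * q x\<bar> \<le> ennreal (a * (\<bar>V x\<bar> * indicator (cball 0 (R + 1)) x) + b * (\<bar>V x\<bar> * indicator (cball z (R + 1)) x))"
        by (intro ennreal_leI) (simp add: algebra_simps)
      also have "\<dots> = ennreal a * (ennreal \<bar>V x\<bar> * indicator (cball 0 (R + 1)) x) + ennreal b * (ennreal \<bar>V x\<bar> * indicator (cball z (R + 1)) x)"
        using ab by (simp add: ennreal_mult ennreal_indicator)
      finally show "ennreal \<bar>V x * q x\<bar> \<le> ennreal a * (ennreal \<bar>V x\<bar> * indicator (cball 0 (R + 1)) x) + ennreal b * (ennreal \<bar>V x\<bar> * indicator (cball z (R + 1)) x)" .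
    qed
    also have "\<dots> = ennreal a * (\<integral>\<^sup>+x. ennreal \<bar>V x\<bar> * indicator (cball 0 (R + 1)) x \<partial>lborel) + ennreal b * (\<integral>\<^sup>+x. ennreal \<bar>V x\<bar> * indicator (cball z (R + 1)) x \<partial>lborel)"
      by (simp add: nn_integral_add nn_integral_cmult)
    also have "\<dots> \<le> ennreal a * ennreal c + ennreal b * ennreal c"
      using bm unfolding ball_mean_def by (intro add_mono mult_left_mono) auto
    also have "\<dots> = ennreal ((a + b) * c)" using ab c by (simp add: ennreal_mult distrib_right)
    finally show ?thesis .
  qed
  show ?thesis
  proof (rule that[of C "R + 1"])
    fix V :: "'a \<Rightarrow> real" and c h assume V: "V \<in> borel_measurable borel" "0 \<le> c" "ball_mean (R + 1) V c"
    have d1: "\<bar>\<phi> (x - h) - \<phi> x\<bar> \<le> B * norm h" for x using RB(5)[of "x - h" x] by simp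
    have d2: "\<bar>\<phi> (x - h) - \<phi> x\<bar> \<le> B * indicator (cball 0 (R + 1)) x + B * indicator (cball h (R + 1)) x" for x
    proof -
      have "\<bar>\<phi> x\<bar> \<le> B * indicator (cball 0 (R + 1)) x" using RB(4)[of x] RB(6)[of x] by (cases "norm x > R") (auto simp: RB(2))
      moreover have "\<bar>\<phi> (x - h)\<bar> \<le> B * indicator (cball h (R + 1)) x"
        using RB(4)[of "x - h"] RB(6)[of "x - h"] RB(2) by (cases "norm (x - h) > R") (auto simp: dist_norm norm_minus_commute)
      ultimately show ?thesis by linarith
    qed
    have near: "\<phi> (x - h) = 0 \<and> \<phi> x = 0 \<and> frechet_derivative \<phi> (at x) h = 0" if "norm h \<le> 1" "x \<notin> cball 0 (R + 1)" for x
    proof -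
      have "R < norm x" "R < norm (x - h)" using that norm_triangle_ineq2[of x h] by auto
      then show ?thesis using RB(6,7) by auto
    qed
    have cases': "norm h \<le> 1 \<or> 1 \<le> norm h" by linarith
    show "(\<integral>\<^sup>+x. ennreal \<bar>V x * (\<phi> (x - h) - \<phi> x)\<bar> \<partial>lborel) \<le> ennreal (C * c * norm h)"
      using cases'
    proof
      assume h: "norm h \<le> 1"
      have "(\<integral>\<^sup>+x. ennreal \<bar>V x * (\<phi> (x - h) - \<phi> x)\<bar> \<partial>lborel) \<le> ennreal ((B * norm h + 0) * c)"
        by (rule mass[where ?z1=0, OF V]) (use RB(2) d1 near[OF h] in \<open>auto split: split_indicator\<close>)
      also have "\<dots> \<le> ennreal (C * c * norm h)"
      proof (rule ennreal_leI)
        have "B * (norm h * c) \<le> C * (norm h * c)" using K RB V by (intro mult_right_mono) (auto simp: C_def)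
        then show "(B * norm h + 0) * c \<le> C * c * norm h" by (simp add: mult_ac)
      qed
      finally show ?thesis .
    next
      assume h: "1 \<le> norm h"
      have "(\<integral>\<^sup>+x. ennreal \<bar>V x * (\<phi> (x - h) - \<phi> x)\<bar> \<partial>lborel) \<le> ennreal ((B + B) * c)"
        by (rule mass[where ?z1=h, OF V]) (use RB(2) d2 in auto)
      also have "\<dots> \<le> ennreal (C * c * norm h)"
      proof (rule ennreal_leI)
        have "((B + B) * c) * 1 \<le> (C * c) * norm h" using K RB V h by (intro mult_mono mult_right_mono) (auto simp: C_def)
        then show "(B + B) * c \<le> C * c * norm h" by simp
      qed
      finally show ?thesis .
    qed
    show "(\<integral>\<^sup>+x. ennreal \<bar>V x * (\<phi> (x - h) - \<phi> x + frechet_derivative \<phi> (at x) h)\<bar> \<partial>lborel) \<le> ennreal (C * c * (norm h)\<^sup>2)"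
      using cases'
    proof
      assume h: "norm h \<le> 1"
      have "(\<integral>\<^sup>+x. ennreal \<bar>V x * (\<phi> (x - h) - \<phi> x + frechet_derivative \<phi> (at x) h)\<bar> \<partial>lborel) \<le> ennreal ((K * (norm h)\<^sup>2 + 0) * c)"
        by (rule mass[where ?z1=0, OF V]) (use K near[OF h] in \<open>auto split: split_indicator\<close>)
      also have "\<dots> \<le> ennreal (C * c * (norm h)\<^sup>2)"
      proof (rule ennreal_leI)
        have "K * ((norm h)\<^sup>2 * c) \<le> C * ((norm h)\<^sup>2 * c)" using K RB V by (intro mult_right_mono) (auto simp: C_def)
        then show "(K * (norm h)\<^sup>2 + 0) * c \<le> C * c * (norm h)\<^sup>2" by (simp add: mult_ac)
      qed
      finally show ?thesis .
    next
      assume h: "1 \<le> norm h"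
      have "(\<integral>\<^sup>+x. ennreal \<bar>V x * (\<phi> (x - h) - \<phi> x + frechet_derivative \<phi> (at x) h)\<bar> \<partial>lborel) \<le> ennreal (((B + B * norm h) + B) * c)"
      proof (rule mass[where ?z1=h, OF V])
        fix x
        have "\<bar>frechet_derivative \<phi> (at x) h\<bar> \<le> B * norm h * indicator (cball 0 (R + 1)) x"
          using RB(3)[of x h] RB(7)[of x h] RB(2) by (cases "norm x > R") auto
        then show "\<bar>\<phi> (x - h) - \<phi> x + frechet_derivative \<phi> (at x) h\<bar> \<le> (B + B * norm h) * indicator (cball 0 (R + 1)) x + B * indicator (cball h (R + 1)) x"
          using d2[of x] by (simp add: distrib_right)
      qed (use RB(2) in auto)
      also have "\<dots> \<le> ennreal (C * c * (norm h)\<^sup>2)"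
      proof (rule ennreal_leI)
        have "norm h * 1 \<le> norm h * norm h" using h by (rule mult_left_mono) simp
        then have h2: "norm h \<le> (norm h)\<^sup>2" "1 \<le> (norm h)\<^sup>2" using h by (simp_all add: power2_eq_square)
        have "(B + B * norm h) + B \<le> (B * (norm h)\<^sup>2 + B * (norm h)\<^sup>2) + B * (norm h)\<^sup>2"
          using RB(2) h2 by (intro add_mono mult_left_mono) (auto simp: mult_left_le mult_le_cancel_left1)
        also have "\<dots> \<le> C * (norm h)\<^sup>2" using K by (simp add: C_def algebra_simps)
        finally have "((B + B * norm h) + B) * c \<le> (C * (norm h)\<^sup>2) * c" using V(2) by (rule mult_right_mono)
        then show "((B + B * norm h) + B) * c \<le> C * c * (norm h)\<^sup>2" by (simp add: mult_ac)
      qed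
      finally show ?thesis .
    qed
  qed (rule C)
qed

lemma ball_mean_translate:
  assumes "ball_mean R V c" and [measurable]: "V \<in> borel_measurable borel"
  shows "(\<integral>\<^sup>+x. ennreal \<bar>V (x + h)\<bar> * indicator (cball 0 R) x \<partial>lborel) \<le> ennreal c"
proof -
  have "(\<integral>\<^sup>+x. ennreal \<bar>V (x + h)\<bar> * indicator (cball 0 R) x \<partial>lborel)
    = (\<integral>\<^sup>+x. ennreal \<bar>V (x + h)\<bar> * indicator (cball h R) (x + h) \<partial>lborel)"
    by (intro nn_integral_cong) (auto split: split_indicator simp: dist_norm)
  also have "\<dots> = (\<integral>\<^sup>+x. ennreal \<bar>V x\<bar> * indicator (cball h R) x \<partial>lborel)"
    by (rule nn_integral_lborel_translate[where f="\<lambda>x. ennreal \<bar>V x\<bar> * indicator (cball h R) x"]) measurable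
  also have "\<dots> \<le> ennreal c" using assms(1) by (simp add: ball_mean_def)
  finally show ?thesis .
qed

lemma ball_mean_loc_int:
  assumes [measurable]: "V \<in> borel_measurable borel" and b: "\<And>R. \<exists>c. ball_mean R V c"
  shows "loc_int V"
proof (rule loc_intI)
  fix R
  obtain c where "ball_mean R V c" using b by blast
  then have "(\<integral>\<^sup>+x. ennreal \<bar>V x\<bar> * indicator (cball 0 R) x \<partial>lborel) \<le> ennreal c" by (simp add: ball_mean_def)
  also have "\<dots> < \<infinity>" by simp
  also have "(\<integral>\<^sup>+x. ennreal \<bar>V x\<bar> * indicator (cball 0 R) x \<partial>lborel) = (\<integral>\<^sup>+x. ennreal (norm (V x) * indicator (cball 0 R) x) \<partial>lborel)"
    by (intro nn_integral_cong) (auto split: split_indicator)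
  finally show "(\<integral>\<^sup>+x. ennreal (norm (V x) * indicator (cball 0 R) x) \<partial>lborel) < \<infinity>" .
qed simp

lemma test_function_shift_integrable:
  fixes V :: "'a::euclidean_space \<Rightarrow> real"
  assumes V: "loc_int V" and \<phi>: "\<phi> \<in> test_functions"
  shows "integrable lborel (\<lambda>x. V x * \<phi> (x - h))"
proof -
  have [measurable]: "V \<in> borel_measurable borel" "\<phi> \<in> borel_measurable borel"
    using V \<phi> loc_int_measurable borel_measurable_test_function by auto
  have "integrable lborel (\<lambda>x. V (x + h) * \<phi> x)"
    by (rule loc_int_test_function(1)[OF loc_int_translate[OF V] \<phi>])
  then have "integrable (distr lborel borel (\<lambda>x. x + h)) (\<lambda>x. V x * \<phi> (x - h))"
    by (subst integrable_distr_eq) auto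
  then show ?thesis by (simp add: distr_lborel_translate)
qed

text \<open>Discrete integration by parts: translating the variable moves the difference from
  \<open>V\<close>, which has no regularity, to the test function.\<close>

lemma heat_grad_pairing:
  fixes V :: "'a::euclidean_space \<Rightarrow> real"
  assumes V[measurable]: "V \<in> borel_measurable borel" and b: "\<And>R. \<exists>c. ball_mean R V c"
    and \<phi>: "\<phi> \<in> test_functions" and s: "0 < s" and i: "i \<in> Basis"
  shows "(\<integral>x. (heat_grad s V x \<bullet> i) * \<phi> x \<partial>lborel) =
      (\<integral>h. (h \<bullet> i) * (\<integral>x. V x * (\<phi> (x - h) - \<phi> x) \<partial>lborel) \<partial>heat_measure s) / (2 * s)"
proof -
  interpret H: prob_space "heat_measure s :: 'a measure" by (rule prob_space_heat_measure[OF s])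
  interpret P: pair_sigma_finite lborel "heat_measure s :: 'a measure" ..
  have [measurable]: "\<phi> \<in> borel_measurable borel" using \<phi> by (rule borel_measurable_test_function)
  have loc: "loc_int V" by (rule ball_mean_loc_int[OF V b])
  obtain R B where RB: "0 \<le> B" "\<And>x. \<bar>\<phi> x\<bar> \<le> B" "\<And>x. norm x > R \<Longrightarrow> \<phi> x = 0"
    using test_function_facts[OF \<phi>] by metis
  obtain c0 where c0: "ball_mean R V c0" using b by blast
  define c where "c = max 0 c0"
  have c: "0 \<le> c" "ball_mean R V c"
    using c0 by (auto simp: ball_mean_def c_def intro: order_trans[OF _ ennreal_leI])
  have int: "integrable (lborel \<Otimes>\<^sub>M heat_measure s) (\<lambda>(x, h). ((V (x + h) - V x) * (h \<bullet> i)) * \<phi> x)"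
  proof -
    have m: "(\<lambda>(x, h). ((V (x + h) - V x) * (h \<bullet> i)) * \<phi> x) \<in> borel_measurable (lborel \<Otimes>\<^sub>M heat_measure s)" by measurable
    have "(\<integral>\<^sup>+x. \<integral>\<^sup>+h. norm (((V (x + h) - V x) * (h \<bullet> i)) * \<phi> x) \<partial>heat_measure s \<partial>lborel)
      = (\<integral>\<^sup>+h. \<integral>\<^sup>+x. norm (((V (x + h) - V x) * (h \<bullet> i)) * \<phi> x) \<partial>lborel \<partial>heat_measure s)"
      by (rule P.Fubini'[symmetric]) measurable
    also have "\<dots> \<le> (\<integral>\<^sup>+h. ennreal ((1 + (norm h)\<^sup>2) * (2 * B * c)) \<partial>(heat_measure s :: 'a measure))"
    proof (rule nn_integral_mono)
      fix h :: 'a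
      have n1: "norm h \<le> 1 + (norm h)\<^sup>2"
      proof -
        have "2 * norm h \<le> 1 + (norm h)\<^sup>2" using sum_squares_bound[of "norm h" 1] by simp
        then show ?thesis using norm_ge_zero[of h] by linarith
      qed
      have "(\<integral>\<^sup>+x. norm (((V (x + h) - V x) * (h \<bullet> i)) * \<phi> x) \<partial>lborel)
        \<le> (\<integral>\<^sup>+x. ennreal (norm h * B) * (ennreal \<bar>V (x + h)\<bar> * indicator (cball 0 R) x + ennreal \<bar>V x\<bar> * indicator (cball 0 R) x) \<partial>lborel)"
      proof (rule nn_integral_mono)
        fix x
        have "norm (((V (x + h) - V x) * (h \<bullet> i)) * \<phi> x) \<le> (norm h * B) * (\<bar>V (x + h)\<bar> * indicator (cball 0 R) x + \<bar>V x\<bar> * indicator (cball 0 R) x)"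
        proof (cases "norm x > R")
          case False
          have "norm (((V (x + h) - V x) * (h \<bullet> i)) * \<phi> x) \<le> ((\<bar>V (x + h)\<bar> + \<bar>V x\<bar>) * norm h) * B"
            unfolding real_norm_def abs_mult
            using Basis_le_norm[OF i, of h] RB(1,2) by (intro mult_mono abs_triangle_ineq4) auto
          then show ?thesis using False by (simp add: mult_ac)
        qed (use RB in simp)
        then have "ennreal (norm (((V (x + h) - V x) * (h \<bullet> i)) * \<phi> x)) \<le> ennreal ((norm h * B) * (\<bar>V (x + h)\<bar> * indicator (cball 0 R) x + \<bar>V x\<bar> * indicator (cball 0 R) x))"
          by (rule ennreal_leI)
        also have "\<dots> = ennreal (norm h * B) * (ennreal \<bar>V (x + h)\<bar> * indicator (cball 0 R) x + ennreal \<bar>V x\<bar> * indicator (cball 0 R) x)"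
          using RB(1) by (simp add: ennreal_mult ennreal_indicator)
        finally show "ennreal (norm (((V (x + h) - V x) * (h \<bullet> i)) * \<phi> x))
          \<le> ennreal (norm h * B) * (ennreal \<bar>V (x + h)\<bar> * indicator (cball 0 R) x + ennreal \<bar>V x\<bar> * indicator (cball 0 R) x)" .
      qed
      also have "\<dots> = ennreal (norm h * B) * ((\<integral>\<^sup>+x. ennreal \<bar>V (x + h)\<bar> * indicator (cball 0 R) x \<partial>lborel) + (\<integral>\<^sup>+x. ennreal \<bar>V x\<bar> * indicator (cball 0 R) x \<partial>lborel))"
        by (simp add: nn_integral_cmult nn_integral_add)
      also have "\<dots> \<le> ennreal (norm h * B) * (ennreal c + ennreal c)"
        using c(2) by (intro mult_left_mono add_mono ball_mean_translate) (auto simp: ball_mean_def)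
      also have "\<dots> = ennreal (norm h * (2 * B * c))"
        using RB(1) c(1) by (simp add: ennreal_mult[symmetric] ennreal_plus[symmetric] mult_ac del: ennreal_plus)
      also have "\<dots> \<le> ennreal ((1 + (norm h)\<^sup>2) * (2 * B * c))"
        using n1 RB(1) c(1) by (intro ennreal_leI mult_right_mono) auto
      finally show "(\<integral>\<^sup>+x. norm (((V (x + h) - V x) * (h \<bullet> i)) * \<phi> x) \<partial>lborel) \<le> ennreal ((1 + (norm h)\<^sup>2) * (2 * B * c))" .
    qed
    also have "\<dots> < \<infinity>"
    proof -
      have "integrable (heat_measure s) (\<lambda>h::'a. (1 + (norm h)\<^sup>2) * (2 * B * c))"
        using heat_measure_norm2[OF s, where 'a='a] by (simp add: has_bochner_integral_iff)
      then show ?thesis using RB(1) c(1) by (subst nn_integral_eq_integral) auto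
    qed
    finally show ?thesis
      using m by (simp add: integrable_iff_bounded H.nn_integral_fst[symmetric] case_prod_beta')
  qed
  have "(\<integral>x. (heat_grad s V x \<bullet> i) * \<phi> x \<partial>lborel) = (\<integral>x. (\<integral>h. ((V (x + h) - V x) * (h \<bullet> i)) * \<phi> x \<partial>heat_measure s) \<partial>lborel) / (2 * s)"
    unfolding heat_grad_inner[OF i] by simp
  also have "(\<integral>x. (\<integral>h. ((V (x + h) - V x) * (h \<bullet> i)) * \<phi> x \<partial>heat_measure s) \<partial>lborel)
      = (\<integral>h. (\<integral>x. ((V (x + h) - V x) * (h \<bullet> i)) * \<phi> x \<partial>lborel) \<partial>heat_measure s)"
    using P.Fubini_integral[OF int] by simp
  also have "\<dots> = (\<integral>h. (h \<bullet> i) * (\<integral>x. V x * (\<phi> (x - h) - \<phi> x) \<partial>lborel) \<partial>heat_measure s)"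
  proof (rule Bochner_Integration.integral_cong[OF refl])
    fix h
    have I: "integrable lborel (\<lambda>x. V (x + h) * \<phi> x)" "integrable lborel (\<lambda>x. V x * \<phi> x)" "integrable lborel (\<lambda>x. V x * \<phi> (x - h))"
      using loc_int_test_function(1)[OF loc_int_translate[OF loc] \<phi>] loc_int_test_function(1)[OF loc \<phi>]
        test_function_shift_integrable[OF loc \<phi>] by auto
    have "(\<integral>x. ((V (x + h) - V x) * (h \<bullet> i)) * \<phi> x \<partial>lborel) = (\<integral>x. (h \<bullet> i) * (V (x + h) * \<phi> x - V x * \<phi> x) \<partial>lborel)"
      by (intro Bochner_Integration.integral_cong refl) (simp add: algebra_simps)
    also have "\<dots> = (h \<bullet> i) * ((\<integral>x. V (x + h) * \<phi> x \<partial>lborel) - (\<integral>x. V x * \<phi> x \<partial>lborel))" using I by simp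
    also have "(\<integral>x. V (x + h) * \<phi> x \<partial>lborel) = (\<integral>x. V x * \<phi> (x - h) \<partial>lborel)"
      using integral_lborel_translate[of "\<lambda>x. V x * \<phi> (x - h)" h] by simp
    also have "(\<integral>x. V x * \<phi> (x - h) \<partial>lborel) - (\<integral>x. V x * \<phi> x \<partial>lborel) = (\<integral>x. V x * (\<phi> (x - h) - \<phi> x) \<partial>lborel)"
      using I by (simp add: right_diff_distrib)
    finally show "(\<integral>x. ((V (x + h) - V x) * (h \<bullet> i)) * \<phi> x \<partial>lborel) = (h \<bullet> i) * (\<integral>x. V x * (\<phi> (x - h) - \<phi> x) \<partial>lborel)" .
  qed
  finally show ?thesis .
qed

text \<open>Two errors are separated. For the fixed \<open>V\<close> the Taylor remainder meets the
  third moment, of order s^(3/2), so division by s leaves \<open>sqrt s\<close>. For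
  \<open>Vn n - V\<close> the first-order bound meets the second moment, whose order s cancels the
  division. No relation between the rates of \<open>s\<close> and \<open>Vn\<close> is therefore
  required.\<close>

lemma heat_grad_tendsto:
  fixes V :: "'a::euclidean_space \<Rightarrow> real" and Vn :: "nat \<Rightarrow> 'a \<Rightarrow> real"
  assumes V[measurable]: "V \<in> borel_measurable borel" and b: "\<And>R. \<exists>c. ball_mean R V c"
    and Vn[measurable]: "\<And>n. Vn n \<in> borel_measurable borel"
    and lim: "\<And>R e. 0 < e \<Longrightarrow> \<exists>N. \<forall>n\<ge>N. ball_mean R (\<lambda>x. Vn n x - V x) e"
    and bn: "\<And>n R. \<exists>c. ball_mean R (Vn n) c"
    and s: "\<And>n. 0 < s n" "s \<longlonglongrightarrow> 0"
    and \<phi>: "\<phi> \<in> test_functions" and i: "i \<in> Basis"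
  shows "(\<lambda>n. \<integral>x. (heat_grad (s n) (Vn n) x \<bullet> i) * \<phi> x \<partial>lborel) \<longlonglongrightarrow> - (\<integral>x. V x * frechet_derivative \<phi> (at x) i \<partial>lborel)"
proof -
  have [measurable]: "\<phi> \<in> borel_measurable borel" using \<phi> by (rule borel_measurable_test_function)
  define D where "D x = frechet_derivative \<phi> (at x)" for x
  have Dm[measurable]: "(\<lambda>x. D x h) \<in> borel_measurable borel" for h unfolding D_def by (rule borel_measurable_test_function_derivative[OF \<phi>])
  have loc: "loc_int V" "loc_int (Vn n)" for n by (rule ball_mean_loc_int; (rule V Vn b bn))+
  define A where "A h = (\<integral>x. V x * D x h \<partial>lborel)" for h
  obtain R C where C: "0 \<le> C"
    and m1: "\<And>V c h. V \<in> borel_measurable borel \<Longrightarrow> 0 \<le> c \<Longrightarrow> ball_mean R V c \<Longrightarrow>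
      (\<integral>\<^sup>+x. ennreal \<bar>V x * (\<phi> (x - h) - \<phi> x)\<bar> \<partial>lborel) \<le> ennreal (C * c * norm h)"
    and m2: "\<And>V c h. V \<in> borel_measurable borel \<Longrightarrow> 0 \<le> c \<Longrightarrow> ball_mean R V c \<Longrightarrow>
      (\<integral>\<^sup>+x. ennreal \<bar>V x * (\<phi> (x - h) - \<phi> x + D x h)\<bar> \<partial>lborel) \<le> ennreal (C * c * (norm h)\<^sup>2)"
  proof (rule test_function_difference_mass[OF \<phi>], goal_cases)
    case (1 R C)
    show ?case by (rule 1(1)[OF 1(2)]) (rule 1(3) 1(4)[folded D_def]; assumption)+
  qed
  obtain c0 where c0: "ball_mean R V c0" using b by blast
  define c where "c = max 0 c0"
  have c: "0 \<le> c" "ball_mean R V c"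
    using c0 by (auto simp: ball_mean_def c_def intro: order_trans[OF _ ennreal_leI])
  have Ah: "A h = (\<Sum>j\<in>Basis. (h \<bullet> j) * A j)" for h
  proof -
    have "A h = (\<integral>x. (\<Sum>j\<in>Basis. (h \<bullet> j) * (V x * D x j)) \<partial>lborel)"
      unfolding A_def D_def by (subst test_function_derivative_sum[OF \<phi>, of _ h]) (simp add: sum_distrib_left mult_ac)
    also have "\<dots> = (\<Sum>j\<in>Basis. (h \<bullet> j) * A j)"
      unfolding A_def D_def using loc_int_test_function(2)[OF loc(1) \<phi>]
      by (subst Bochner_Integration.integral_sum) auto
    finally show ?thesis .
  qed
  define F where "F W h = (\<integral>x. W x * (\<phi> (x - h) - \<phi> x) \<partial>lborel)" for W :: "'a \<Rightarrow> real" and h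
  have Fm[measurable]: "F W \<in> borel_measurable borel" if [measurable]: "W \<in> borel_measurable borel" for W
    unfolding F_def[abs_def] by measurable
  have FI: "integrable lborel (\<lambda>x. W x * (\<phi> (x - h) - \<phi> x))" if "loc_int W" for W h
    using test_function_shift_integrable[OF that \<phi>, of h] loc_int_test_function(1)[OF that \<phi>] by (simp add: right_diff_distrib)
  have F1: "\<bar>F W h\<bar> \<le> C * c * norm h" if "W \<in> borel_measurable borel" "0 \<le> c" "ball_mean R W c" for W c h
  proof -
    have "ennreal \<bar>F W h\<bar> \<le> (\<integral>\<^sup>+x. ennreal \<bar>W x * (\<phi> (x - h) - \<phi> x)\<bar> \<partial>lborel)"
      unfolding F_def real_norm_def[symmetric] by (rule norm_integral_le_nn_integral)
    also have "\<dots> \<le> ennreal (C * c * norm h)" by (rule m1[OF that])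
    finally show ?thesis using C that by (subst (asm) ennreal_le_iff) auto
  qed
  have F2: "\<bar>F V h + A h\<bar> \<le> C * c * (norm h)\<^sup>2" for h
  proof -
    have "F V h + A h = (\<integral>x. V x * (\<phi> (x - h) - \<phi> x + D x h) \<partial>lborel)"
      unfolding F_def A_def
      using FI[OF loc(1)] loc_int_test_function(2)[OF loc(1) \<phi>, folded D_def]
      by (subst Bochner_Integration.integral_add[symmetric]) (auto simp: distrib_left)
    then have "ennreal \<bar>F V h + A h\<bar> \<le> (\<integral>\<^sup>+x. ennreal \<bar>V x * (\<phi> (x - h) - \<phi> x + D x h)\<bar> \<partial>lborel)"
      using norm_integral_le_nn_integral[of lborel "\<lambda>x. V x * (\<phi> (x - h) - \<phi> x + D x h)"] by simp
    also have "\<dots> \<le> ennreal (C * c * (norm h)\<^sup>2)" by (rule m2[OF V c])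
    finally show ?thesis using C c by (subst (asm) ennreal_le_iff) auto
  qed
  let ?d = "real DIM('a)"
  have hF: "integrable (heat_measure t) (\<lambda>h. (h \<bullet> i) * F W h)" "\<bar>\<integral>h. (h \<bullet> i) * F W h \<partial>heat_measure t\<bar> \<le> C * c * (2 * t * ?d)"
    if W: "W \<in> borel_measurable borel" "0 \<le> c" "ball_mean R W c" and t: "0 < t" for W c t
  proof -
    have n2: "integrable (heat_measure t) (\<lambda>h::'a. C * c * (norm h)\<^sup>2)" "(\<integral>h. C * c * (norm (h::'a))\<^sup>2 \<partial>heat_measure t) = C * c * (2 * t * ?d)"
      using heat_measure_norm2[OF t, where 'a='a] by (auto simp: has_bochner_integral_iff)
    have pw: "\<bar>(h \<bullet> i) * F W h\<bar> \<le> C * c * (norm h)\<^sup>2" for h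
    proof -
      have "\<bar>h \<bullet> i\<bar> * \<bar>F W h\<bar> \<le> norm h * (C * c * norm h)" by (intro mult_mono F1 W Basis_le_norm i) auto
      then show ?thesis by (simp add: abs_mult power2_eq_square mult_ac)
    qed
    note [measurable] = Fm[OF W(1)]
    show I: "integrable (heat_measure t) (\<lambda>h. (h \<bullet> i) * F W h)"
      by (rule Bochner_Integration.integrable_bound[OF n2(1)]) (use pw in \<open>auto intro!: AE_I2 order_trans[OF pw]\<close>)
    have "\<bar>\<integral>h. (h \<bullet> i) * F W h \<partial>heat_measure t\<bar> \<le> (\<integral>h. \<bar>(h \<bullet> i) * F W h\<bar> \<partial>heat_measure t)" by (rule integral_abs_bound)
    also have "\<dots> \<le> (\<integral>h. C * c * (norm (h::'a))\<^sup>2 \<partial>heat_measure t)" using I n2(1) pw by (intro integral_mono) auto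
    finally show "\<bar>\<integral>h. (h \<bullet> i) * F W h \<partial>heat_measure t\<bar> \<le> C * c * (2 * t * ?d)" unfolding n2(2) .
  qed
  have main: "\<bar>(\<integral>h. (h \<bullet> i) * F V h \<partial>heat_measure t) / (2 * t) + A i\<bar> \<le> C * c * (14 * ?d\<^sup>2 * sqrt t)" if t: "0 < t" for t
  proof -
    have hA: "has_bochner_integral (heat_measure t) (\<lambda>h. (h \<bullet> i) * A h) (2 * t * A i)"
    proof -
      have "has_bochner_integral (heat_measure t) (\<lambda>h. \<Sum>j\<in>Basis. ((h \<bullet> i) * (h \<bullet> j)) * A j) (\<Sum>j\<in>Basis. (2 * t * (i \<bullet> j)) * A j)"
        by (intro has_bochner_integral_sum has_bochner_integral_mult_left heat_measure_inner_inner t)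
      moreover have "(\<lambda>h. \<Sum>j\<in>Basis. ((h \<bullet> i) * (h \<bullet> j)) * A j) = (\<lambda>h. (h \<bullet> i) * A h)"
        by (rule ext, subst Ah) (simp add: sum_distrib_left mult_ac)
      moreover have "(\<Sum>j\<in>Basis. (2 * t * (i \<bullet> j)) * A j) = 2 * t * A i"
      proof -
        have "(\<Sum>j\<in>Basis. (2 * t * (i \<bullet> j)) * A j) = (\<Sum>j\<in>Basis. if i = j then 2 * t * A j else 0)"
          using i by (intro sum.cong) (auto simp: inner_Basis)
        then show ?thesis using i by simp
      qed
      ultimately show ?thesis by simp
    qed
    have "(\<integral>h. (h \<bullet> i) * F V h \<partial>heat_measure t) + 2 * t * A i = (\<integral>h. (h \<bullet> i) * (F V h + A h) \<partial>heat_measure t)"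
      using hF(1)[OF V c t] hA by (simp add: distrib_left has_bochner_integral_iff)
    then have "ennreal \<bar>(\<integral>h. (h \<bullet> i) * F V h \<partial>heat_measure t) + 2 * t * A i\<bar> \<le> (\<integral>\<^sup>+h. norm ((h \<bullet> i) * (F V h + A h)) \<partial>heat_measure t)"
      using norm_integral_le_nn_integral[of "heat_measure t" "\<lambda>h. (h \<bullet> i) * (F V h + A h)"] by simp
    also have "\<dots> \<le> (\<integral>\<^sup>+h. ennreal (C * c) * ennreal (norm (h::'a) ^ 3) \<partial>heat_measure t)"
    proof (rule nn_integral_mono)
      fix h :: 'a
      have "\<bar>h \<bullet> i\<bar> * \<bar>F V h + A h\<bar> \<le> norm h * (C * c * (norm h)\<^sup>2)" by (intro mult_mono F2 Basis_le_norm i) auto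
      then show "ennreal (norm ((h \<bullet> i) * (F V h + A h))) \<le> ennreal (C * c) * ennreal (norm h ^ 3)"
        using C c by (simp add: ennreal_mult[symmetric] abs_mult power2_eq_square power3_eq_cube mult_ac ennreal_leI)
    qed
    also have "\<dots> \<le> ennreal (C * c) * ennreal (14 * ?d\<^sup>2 * (t * sqrt t))"
      by (subst nn_integral_cmult) (auto intro!: mult_left_mono heat_measure_norm3 t)
    also have "\<dots> = ennreal (C * c * (14 * ?d\<^sup>2 * (t * sqrt t)))" using C c t by (simp add: ennreal_mult[symmetric])
    finally have le: "\<bar>(\<integral>h. (h \<bullet> i) * F V h \<partial>heat_measure t) + 2 * t * A i\<bar> \<le> C * c * (14 * ?d\<^sup>2 * (t * sqrt t))"
      using C c t by (subst (asm) ennreal_le_iff) auto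
    have "(\<integral>h. (h \<bullet> i) * F V h \<partial>heat_measure t) / (2 * t) + A i = ((\<integral>h. (h \<bullet> i) * F V h \<partial>heat_measure t) + 2 * t * A i) / (2 * t)"
      using t by (simp add: field_simps)
    then have "\<bar>(\<integral>h. (h \<bullet> i) * F V h \<partial>heat_measure t) / (2 * t) + A i\<bar> = \<bar>(\<integral>h. (h \<bullet> i) * F V h \<partial>heat_measure t) + 2 * t * A i\<bar> / (2 * t)"
      using t by (simp add: abs_divide)
    also have "\<dots> \<le> C * c * (14 * ?d\<^sup>2 * (t * sqrt t)) / (2 * t)" using le t by (intro divide_right_mono) auto
    also have "\<dots> = C * c * (14 * ?d\<^sup>2 * sqrt t) / 2" using t by simp
    also have "\<dots> \<le> C * c * (14 * ?d\<^sup>2 * sqrt t)"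
    proof -
      have "0 \<le> C * c * (14 * ?d\<^sup>2 * sqrt t)" using C c t by simp
      then show ?thesis by linarith
    qed
    finally show ?thesis .
  qed
  have T: "(\<integral>x. (heat_grad (s n) (Vn n) x \<bullet> i) * \<phi> x \<partial>lborel) = (\<integral>h. (h \<bullet> i) * F (Vn n) h \<partial>heat_measure (s n)) / (2 * s n)" for n
    unfolding F_def by (rule heat_grad_pairing[OF Vn bn \<phi> s(1) i])
  show ?thesis
  proof (rule LIMSEQ_I)
    fix e :: real assume e: "0 < e"
    define \<eta> where "\<eta> = e / (2 * (C * ?d + 1))"
    have Cd: "0 < C * ?d + 1" using C by (simp add: add_nonneg_pos)
    have \<eta>: "0 < \<eta>" unfolding \<eta>_def using e Cd by (intro divide_pos_pos) auto
    obtain N1 where N1: "\<And>n. N1 \<le> n \<Longrightarrow> ball_mean R (\<lambda>x. Vn n x - V x) \<eta>" using lim[OF \<eta>] by blast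
    have "(\<lambda>n. C * c * (14 * ?d\<^sup>2 * sqrt (s n))) \<longlonglongrightarrow> C * c * (14 * ?d\<^sup>2 * sqrt 0)"
      by (intro tendsto_intros s(2))
    then have "(\<lambda>n. C * c * (14 * ?d\<^sup>2 * sqrt (s n))) \<longlonglongrightarrow> 0" by simp
    then obtain N2 where N2: "\<And>n. N2 \<le> n \<Longrightarrow> C * c * (14 * ?d\<^sup>2 * sqrt (s n)) < e / 2"
      using e order_tendstoD(2)[of _ 0 sequentially "e / 2"] unfolding eventually_sequentially by (metis half_gt_zero)
    show "\<exists>no. \<forall>n\<ge>no. norm ((\<integral>x. (heat_grad (s n) (Vn n) x \<bullet> i) * \<phi> x \<partial>lborel) - - (\<integral>x. V x * frechet_derivative \<phi> (at x) i \<partial>lborel)) < e"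
    proof (intro exI[of _ "max N1 N2"] allI impI)
      fix n assume n: "max N1 N2 \<le> n"
      let ?W = "\<lambda>x. Vn n x - V x"
      have bm: "ball_mean R ?W \<eta>" using N1 n by simp
      have Wm: "?W \<in> borel_measurable borel" by simp
      have "F (Vn n) h = F V h + F ?W h" for h
        unfolding F_def using FI[OF loc(1), of h] FI[OF loc_int_diff[OF loc(2)[of n] loc(1)], of h]
        by (subst Bochner_Integration.integral_add[symmetric]) (auto simp: algebra_simps)
      then have "(\<integral>h. (h \<bullet> i) * F (Vn n) h \<partial>heat_measure (s n)) = (\<integral>h. (h \<bullet> i) * F V h \<partial>heat_measure (s n)) + (\<integral>h. (h \<bullet> i) * F ?W h \<partial>heat_measure (s n))"
        using hF(1)[OF V c s(1)[of n]] hF(1)[OF Wm less_imp_le[OF \<eta>] bm s(1)[of n]] by (simp add: distrib_left)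
      then have "(\<integral>x. (heat_grad (s n) (Vn n) x \<bullet> i) * \<phi> x \<partial>lborel) + A i
        = ((\<integral>h. (h \<bullet> i) * F V h \<partial>heat_measure (s n)) / (2 * s n) + A i) + (\<integral>h. (h \<bullet> i) * F ?W h \<partial>heat_measure (s n)) / (2 * s n)"
        unfolding T by (simp add: add_divide_distrib)
      note eq = this
      have "\<bar>(\<integral>x. (heat_grad (s n) (Vn n) x \<bullet> i) * \<phi> x \<partial>lborel) + A i\<bar>
        \<le> C * c * (14 * ?d\<^sup>2 * sqrt (s n)) + \<bar>\<integral>h. (h \<bullet> i) * F ?W h \<partial>heat_measure (s n)\<bar> / (2 * s n)"
      proof -
        have "\<bar>a + b\<bar> \<le> c1 + \<bar>b1\<bar> / d" if "\<bar>a\<bar> \<le> c1" "b = b1 / d" "0 < d" for a b b1 c1 d :: real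
          using that abs_triangle_ineq[of a b] by (simp add: abs_divide)
        from this[OF main[OF s(1)[of n]] refl] s(1)[of n] show ?thesis unfolding eq by simp
      qed
      also have "\<dots> \<le> C * c * (14 * ?d\<^sup>2 * sqrt (s n)) + C * \<eta> * (2 * s n * ?d) / (2 * s n)"
        using hF(2)[OF Wm less_imp_le[OF \<eta>] bm s(1)[of n]] s(1)[of n] by (intro add_left_mono divide_right_mono) auto
      also have "C * \<eta> * (2 * s n * ?d) / (2 * s n) = C * ?d * \<eta>" using s(1)[of n] by simp
      also have "C * ?d * \<eta> \<le> (C * ?d + 1) * \<eta>" using \<eta> by (intro mult_right_mono) auto
      also have "(C * ?d + 1) * \<eta> = e / 2" using Cd unfolding \<eta>_def by (auto simp: nonzero_divide_eq_eq)
      also have "C * c * (14 * ?d\<^sup>2 * sqrt (s n)) + e / 2 < e" using N2[of n] n by simp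
      finally show "norm ((\<integral>x. (heat_grad (s n) (Vn n) x \<bullet> i) * \<phi> x \<partial>lborel) - - (\<integral>x. V x * frechet_derivative \<phi> (at x) i \<partial>lborel)) < e"
        by (simp add: A_def D_def)
    qed
  qed
qed

section \<open>Bounded Lipschitz functions\<close>

text \<open>Uses only \<open>exp z \<ge> 1 + z\<close> for the quotient of two translates of the kernel.\<close>

lemma heat_grad_Lipschitz:
  fixes W :: "'a::euclidean_space \<Rightarrow> real"
  assumes [measurable]: "W \<in> borel_measurable borel" and W: "\<And>x. 0 \<le> W x" "\<And>x. W x \<le> B"
    and L: "0 \<le> L" "\<And>x y. \<bar>W x - W y\<bar> \<le> L * norm (x - y)" and s: "0 < s"
  shows "norm (heat_grad s W x) \<le> L"
proof -
  interpret H: prob_space "heat_measure s :: 'a measure" by (rule prob_space_heat_measure[OF s])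
  have B: "0 \<le> B" using W order_trans by blast
  have lin: "integrable (heat_measure s) (\<lambda>h. h \<bullet> e)" for e :: 'a
  proof (rule Bochner_Integration.integrable_bound[of _ "\<lambda>h. 1 + (h \<bullet> e) * (h \<bullet> e)"])
    show "integrable (heat_measure s) (\<lambda>h. 1 + (h \<bullet> e) * (h \<bullet> e))"
      using heat_measure_inner_inner[OF s, of e e] by (simp add: has_bochner_integral_iff)
    have "\<bar>a\<bar> \<le> 1 + a * a" for a :: real
    proof -
      have "2 * \<bar>a\<bar> \<le> 1 + a * a" using sum_squares_bound[of "\<bar>a\<bar>" 1] by (simp add: power2_eq_square)
      then show ?thesis by linarith
    qed
    then show "AE h in heat_measure s. norm (h \<bullet> e) \<le> norm (1 + (h \<bullet> e) * (h \<bullet> e))"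
      by (intro AE_I2) (simp add: abs_of_nonneg add_nonneg_nonneg)
  qed simp
  have lin0: "(\<integral>h. h \<bullet> e \<partial>heat_measure s) = 0" for e :: 'a
    using integral_heat_measure_uminus[of "\<lambda>h. h \<bullet> e" s] by simp
  have Wl: "integrable (heat_measure s) (\<lambda>h. W (x + h) * (h \<bullet> e))" for e
    by (rule Bochner_Integration.integrable_bound[OF integrable_mult_right[OF lin[of e], of B]])
      (use W B in \<open>auto intro!: AE_I2 mult_right_mono simp: abs_mult\<close>)
  have Wi: "integrable (heat_measure s) (\<lambda>h. W (x + h))" for x
    by (rule H.integrable_const_bound[of _ B]) (use W in \<open>auto intro!: AE_I2\<close>)
  have DI: "integrable (heat_measure s) (\<lambda>h. (W (x + h) - W x) * (h \<bullet> e))" for e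
    using Wl[of e] lin[of e] by (simp add: left_diff_distrib)
  have G: "heat_grad s W x \<bullet> e = (\<integral>h. W (x + h) * (h \<bullet> e) \<partial>heat_measure s) / (2 * s)" for e
    using heat_grad_direction(1)[OF DI, of e] Wl[of e] lin[of e] lin0[of e] by (simp add: left_diff_distrib)
  have dir: "heat_grad s W x \<bullet> e \<le> L" if e: "norm e = 1" for e
  proof (rule field_le_epsilon)
    fix \<epsilon> :: real assume \<epsilon>: "0 < \<epsilon>"
    \<comment> \<open>The quadratic error of the kernel expansion, divided by the step
      \<open>\<eta>\<close>, is then at most \<open>\<epsilon>\<close>.\<close>
    define \<eta> where "\<eta> = 4 * s * \<epsilon> / (B + 1)"
    have \<eta>: "0 < \<eta>" using \<epsilon> s B by (simp add: \<eta>_def)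
    have lower: "heat_kernel s y * (1 + (2 * \<eta> * (y \<bullet> e) - \<eta>\<^sup>2) / (4 * s)) \<le> heat_kernel s (y - \<eta> *\<^sub>R e)" for y :: 'a
    proof -
      let ?z = "(2 * \<eta> * (y \<bullet> e) - \<eta>\<^sup>2) / (4 * s)"
      have n: "(norm (y - \<eta> *\<^sub>R e))\<^sup>2 = (norm y)\<^sup>2 - (2 * \<eta> * (y \<bullet> e) - \<eta>\<^sup>2)"
        using e unfolding norm_eq_1 by (simp add: power2_norm_eq_inner inner_diff_left inner_diff_right inner_commute power2_eq_square[of \<eta>])
      have "- (norm (y - \<eta> *\<^sub>R e))\<^sup>2 / (4 * s) = - (norm y)\<^sup>2 / (4 * s) + ?z"
        unfolding n by (simp add: diff_divide_distrib add_divide_distrib)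
      then have "heat_kernel s (y - \<eta> *\<^sub>R e) = heat_kernel s y * exp ?z"
        unfolding heat_kernel_def by (simp only: exp_add mult.assoc)
      then show ?thesis using exp_ge_add_one_self[of ?z] by (simp add: mult_left_mono)
    qed
    have "(\<integral>h. W (x + h) * (1 + (2 * \<eta> * (h \<bullet> e) - \<eta>\<^sup>2) / (4 * s)) \<partial>heat_measure s) \<le> (\<integral>h. W ((x + \<eta> *\<^sub>R e) + h) \<partial>heat_measure s)"
    proof -
      let ?q = "\<lambda>h. W (x + h) * (1 + (2 * \<eta> * (h \<bullet> e) - \<eta>\<^sup>2) / (4 * s))"
      have eq: "?q = (\<lambda>h. (1 - \<eta>\<^sup>2 / (4 * s)) * W (x + h) + (2 * \<eta> / (4 * s)) * (W (x + h) * (h \<bullet> e)))"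
        by (rule ext) (simp add: diff_divide_distrib algebra_simps)
      have qi: "integrable (heat_measure s) ?q" unfolding eq using Wi Wl by simp
      have ri: "integrable lborel (\<lambda>h. heat_kernel s (h - \<eta> *\<^sub>R e) * W (x + h))"
      proof -
        have "integrable lborel (\<lambda>h. heat_kernel s h * W ((x + \<eta> *\<^sub>R e) + h))"
          using Wi[of "x + \<eta> *\<^sub>R e"] by (simp add: integrable_heat_measure)
        then have "integrable (distr lborel borel (\<lambda>h. h + \<eta> *\<^sub>R e)) (\<lambda>h. heat_kernel s (h - \<eta> *\<^sub>R e) * W (x + h))"
          by (subst integrable_distr_eq) (auto simp: add_ac)
        then show ?thesis by (simp add: distr_lborel_translate)
      qed
      have "(\<integral>h. ?q h \<partial>heat_measure s) = (\<integral>h. heat_kernel s h * ?q h \<partial>lborel)"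
        by (subst integral_heat_measure) auto
      also have "\<dots> \<le> (\<integral>h. heat_kernel s (h - \<eta> *\<^sub>R e) * W (x + h) \<partial>lborel)"
      proof (rule integral_mono[OF _ ri])
        show "integrable lborel (\<lambda>h. heat_kernel s h * ?q h)" using qi by (simp add: integrable_heat_measure)
        show "heat_kernel s h * ?q h \<le> heat_kernel s (h - \<eta> *\<^sub>R e) * W (x + h)" for h
          using mult_right_mono[OF lower[of h] W(1)[of "x + h"]] by (simp add: mult_ac)
      qed
      also have "\<dots> = (\<integral>h. heat_kernel s h * W ((x + \<eta> *\<^sub>R e) + h) \<partial>lborel)"
        using integral_lborel_translate[of "\<lambda>h. heat_kernel s (h - \<eta> *\<^sub>R e) * W (x + h)" "\<eta> *\<^sub>R e"] by (simp add: add_ac)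
      also have "\<dots> = (\<integral>h. W ((x + \<eta> *\<^sub>R e) + h) \<partial>heat_measure s)"
        by (subst integral_heat_measure) auto
      finally show ?thesis .
    qed
    also have "(\<integral>h. W (x + h) * (1 + (2 * \<eta> * (h \<bullet> e) - \<eta>\<^sup>2) / (4 * s)) \<partial>heat_measure s)
      = (\<integral>h. W (x + h) \<partial>heat_measure s) + \<eta> * (heat_grad s W x \<bullet> e) - \<eta>\<^sup>2 / (4 * s) * (\<integral>h. W (x + h) \<partial>heat_measure s)"
    proof -
      have "(\<integral>h. W (x + h) * (1 + (2 * \<eta> * (h \<bullet> e) - \<eta>\<^sup>2) / (4 * s)) \<partial>heat_measure s)
        = (\<integral>h. (1 - \<eta>\<^sup>2 / (4 * s)) * W (x + h) + (2 * \<eta> / (4 * s)) * (W (x + h) * (h \<bullet> e)) \<partial>heat_measure s)"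
        by (intro Bochner_Integration.integral_cong refl) (simp add: diff_divide_distrib algebra_simps)
      also have "\<dots> = (1 - \<eta>\<^sup>2 / (4 * s)) * (\<integral>h. W (x + h) \<partial>heat_measure s) + (2 * \<eta> / (4 * s)) * (\<integral>h. W (x + h) * (h \<bullet> e) \<partial>heat_measure s)"
        using Wi Wl by simp
      finally have eq: "(\<integral>h. W (x + h) * (1 + (2 * \<eta> * (h \<bullet> e) - \<eta>\<^sup>2) / (4 * s)) \<partial>heat_measure s)
        = (1 - \<eta>\<^sup>2 / (4 * s)) * (\<integral>h. W (x + h) \<partial>heat_measure s) + (2 * \<eta> / (4 * s)) * (\<integral>h. W (x + h) * (h \<bullet> e) \<partial>heat_measure s)" .
      have "(1 - \<eta>\<^sup>2 / (4 * s)) * a + (2 * \<eta> / (4 * s)) * b = a + \<eta> * (b / (2 * s)) - \<eta>\<^sup>2 / (4 * s) * a" for a b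
        by (simp add: left_diff_distrib)
      then show ?thesis unfolding G eq by simp
    qed
    finally have "\<eta> * (heat_grad s W x \<bullet> e) \<le> ((\<integral>h. W ((x + \<eta> *\<^sub>R e) + h) \<partial>heat_measure s) - (\<integral>h. W (x + h) \<partial>heat_measure s))
        + \<eta>\<^sup>2 / (4 * s) * (\<integral>h. W (x + h) \<partial>heat_measure s)" by linarith
    also have "\<dots> \<le> L * \<eta> + \<eta>\<^sup>2 / (4 * s) * B"
    proof (intro add_mono mult_left_mono)
      have "(\<integral>h. W ((x + \<eta> *\<^sub>R e) + h) \<partial>heat_measure s) - (\<integral>h. W (x + h) \<partial>heat_measure s) = (\<integral>h. W ((x + \<eta> *\<^sub>R e) + h) - W (x + h) \<partial>heat_measure s)"
        using Wi by simp
      also have "\<dots> \<le> (\<integral>h. L * \<eta> \<partial>(heat_measure s :: 'a measure))"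
      proof (rule integral_mono)
        show "W ((x + \<eta> *\<^sub>R e) + h) - W (x + h) \<le> L * \<eta>" for h
          using L(2)[of "(x + \<eta> *\<^sub>R e) + h" "x + h"] e \<eta> by simp
      qed (use Wi in auto)
      also have "\<dots> = L * \<eta>" using H.prob_space by simp
      finally show "(\<integral>h. W ((x + \<eta> *\<^sub>R e) + h) \<partial>heat_measure s) - (\<integral>h. W (x + h) \<partial>heat_measure s) \<le> L * \<eta>" .
      have "(\<integral>h. W (x + h) \<partial>heat_measure s) \<le> (\<integral>h. B \<partial>(heat_measure s :: 'a measure))"
        using Wi W by (intro integral_mono) auto
      then show "(\<integral>h. W (x + h) \<partial>heat_measure s) \<le> B" using H.prob_space by simp
    qed (use s in simp)
    finally have "\<eta> * (heat_grad s W x \<bullet> e) \<le> L * \<eta> + \<eta>\<^sup>2 / (4 * s) * B" .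
    also have "\<dots> = \<eta> * (L + \<eta> / (4 * s) * B)" by (simp add: algebra_simps power2_eq_square)
    finally have "heat_grad s W x \<bullet> e \<le> L + \<eta> / (4 * s) * B" using \<eta> by simp
    also have "\<eta> / (4 * s) * B \<le> \<epsilon>"
    proof -
      have "\<eta> / (4 * s) * B = \<epsilon> * (B / (B + 1))" using s B by (simp add: \<eta>_def)
      also have "\<dots> \<le> \<epsilon> * 1" using \<epsilon> B by (intro mult_left_mono) auto
      finally show ?thesis by simp
    qed
    finally show "heat_grad s W x \<bullet> e \<le> L + \<epsilon>" by simp
  qed
  show ?thesis
  proof (cases "heat_grad s W x = 0")
    case False
    have "heat_grad s W x \<bullet> sgn (heat_grad s W x) \<le> L" using False by (intro dir) (simp add: norm_sgn)
    moreover have "heat_grad s W x \<bullet> sgn (heat_grad s W x) = norm (heat_grad s W x)"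
      using False by (simp add: sgn_div_norm power2_norm_eq_inner[symmetric] power2_eq_square)
    ultimately show ?thesis by simp
  qed (use L in simp)
qed

lemma ball_mean_bounded:
  fixes W :: "'a::euclidean_space \<Rightarrow> real"
  assumes W: "\<And>x. \<bar>W x\<bar> \<le> B"
  shows "\<exists>c. ball_mean R W c"
proof -
  define c where "c = enn2real (emeasure lborel (cball (0::'a) R))"
  have c0: "0 \<le> c" by (simp add: c_def)
  have B: "0 \<le> B" using W[of 0] by linarith
  have em: "emeasure lborel (cball z R) = ennreal c" for z :: 'a
  proof -
    have "emeasure lborel (cball z R) = (\<integral>\<^sup>+x. indicator (cball z R) (x + z) \<partial>lborel)"
      by (subst nn_integral_lborel_translate[of "indicator (cball z R)"]) auto
    also have "\<dots> = (\<integral>\<^sup>+x. indicator (cball (0::'a) R) x \<partial>lborel)"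
      by (rule nn_integral_cong) (auto split: split_indicator simp: dist_norm)
    also have "\<dots> = ennreal c"
      unfolding c_def using emeasure_lborel_cball_finite[of "0::'a" R] by (simp add: less_top)
    finally show ?thesis .
  qed
  have "ball_mean R W (B * c)"
    unfolding ball_mean_def
  proof
    fix z
    have "(\<integral>\<^sup>+x. ennreal \<bar>W x\<bar> * indicator (cball z R) x \<partial>lborel) \<le> (\<integral>\<^sup>+x. ennreal B * indicator (cball z R) x \<partial>lborel)"
      by (intro nn_integral_mono mult_right_mono ennreal_leI W) simp
    also have "\<dots> = ennreal (B * c)" using B c0 by (simp add: nn_integral_cmult_indicator em ennreal_mult)
    finally show "(\<integral>\<^sup>+x. ennreal \<bar>W x\<bar> * indicator (cball z R) x \<partial>lborel) \<le> ennreal (B * c)" .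
  qed
  then show ?thesis by blast
qed

text \<open>A weak form of Rademacher's theorem. The approximate gradients are bounded by
  \<open>L\<close> pointwise, so uniform integrability is immediate, and the bound passes to
  midpoints and limits.\<close>

theorem weak_grad_Lipschitz:
  fixes W :: "'a::euclidean_space \<Rightarrow> real"
  assumes Wm[measurable]: "W \<in> borel_measurable borel" and W: "\<And>x. 0 \<le> W x" "\<And>x. W x \<le> B"
    and L: "0 \<le> L" "\<And>x y. \<bar>W x - W y\<bar> \<le> L * norm (x - y)"
  obtains g where "weak_grad W g" "AE x in lborel. norm (g x) \<le> L"
proof -
  let ?G = "\<lambda>n. heat_grad (1 / real (Suc n)) W"
  have Wabs: "\<bar>W x\<bar> \<le> B" for x using W by simp
  have bm: "\<exists>c. ball_mean R W c" for R by (rule ball_mean_bounded[OF Wabs])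
  have GL: "norm (?G n x) \<le> L" for n x by (rule heat_grad_Lipschitz[OF Wm W L]) simp
  obtain \<gamma> g where g: "weak_grad W g" "\<And>k. midconv ?G k (\<gamma> k)" "AE x in lborel. (\<lambda>k. \<gamma> k x) \<longlonglongrightarrow> g x"
  proof (rule weak_grad_compactness[of W ?G])
    show "loc_int W" by (rule ball_mean_loc_int[OF Wm bm])
    show "?G n \<in> borel_measurable borel" for n by measurable
    show "\<exists>K\<ge>0. \<forall>n. (\<integral>\<^sup>+x. ennreal (norm (?G n x) - K) \<partial>heat_measure 1) \<le> ennreal e" for e
      using GL L by (intro exI[of _ L]) (simp add: ennreal_neg)
    show "(\<lambda>n. \<integral>x. (?G n x \<bullet> i) * \<phi> x \<partial>lborel) \<longlonglongrightarrow> - (\<integral>x. W x * frechet_derivative \<phi> (at x) i \<partial>lborel)"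
      if "\<phi> \<in> test_functions" "i \<in> Basis" for \<phi> i
    proof (rule heat_grad_tendsto[where Vn="\<lambda>_. W"])
      show "\<exists>N. \<forall>n\<ge>N. ball_mean R (\<lambda>x. W x - W x) e" for R e by (simp add: ball_mean_def)
      show "(\<lambda>n. 1 / real (Suc n)) \<longlonglongrightarrow> 0" using LIMSEQ_inverse_real_of_nat by (simp add: inverse_eq_divide)
    qed (use that bm in auto)
  qed blast
  have mc: "norm (f x) \<le> L" if "midconv ?G k f" for f k x
    using that
  proof induction
    case (mid f g)
    then show ?case using norm_triangle_ineq[of "f x" "g x"] by simp
  qed (rule GL)
  have "AE x in lborel. norm (g x) \<le> L"
  proof (rule eventually_mono[OF g(3)])
    fix x assume "(\<lambda>k. \<gamma> k x) \<longlonglongrightarrow> g x"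
    then show "norm (g x) \<le> L"
      by (rule Lim_norm_ubound[OF sequentially_bot]) (intro always_eventually allI mc[OF g(2)])
  qed
  with g(1) show ?thesis by (rule that)
qed

text \<open>For each shift the Lipschitz bound for \<open>f\<close> holds off a null set depending
  on the shift. The flow ignores null sets, so the maximal function is Lipschitz at every pair of
  points.\<close>

theorem heat_sup_W1_infinity:
  fixes f :: "'a::euclidean_space \<Rightarrow> real"
  assumes [measurable]: "f \<in> borel_measurable borel" and B: "0 \<le> B" "AE x in lborel. \<bar>f x\<bar> \<le> B"
    and wg: "weak_grad f g" and L: "0 \<le> L" "AE x in lborel. norm (g x) \<le> L"
  defines "M \<equiv> heat_sup (\<lambda>x. ennreal \<bar>f x\<bar>)"
  obtains g' where "\<And>x. M x \<le> ennreal B" "weak_grad (\<lambda>x. enn2real (M x)) g'" "AE x in lborel. norm (g' x) \<le> L"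
proof -
  have [measurable]: "M \<in> borel_measurable borel" unfolding M_def by measurable
  have MB: "M x \<le> ennreal B" for x
    unfolding M_def heat_sup_def
  proof (rule SUP_least)
    fix t :: real assume "t \<in> {0<..}"
    then have t: "0 < t" by simp
    have "heat t (\<lambda>y. ennreal \<bar>f y\<bar>) x \<le> heat t (\<lambda>_. ennreal B) x"
      by (rule heat_AE_mono[OF _ t]) (use B(2) in \<open>auto elim: eventually_mono intro: ennreal_leI\<close>)
    then show "heat t (\<lambda>y. ennreal \<bar>f y\<bar>) x \<le> ennreal B" by (simp add: heat_const[OF t])
  qed
  have lip: "M (x + h) \<le> M x + ennreal (L * norm h)" for x h
    unfolding M_def heat_sup_def
  proof (rule SUP_least)
    fix t :: real assume t': "t \<in> {0<..}"
    then have t: "0 < t" by simp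
    have "heat t (\<lambda>y. ennreal \<bar>f y\<bar>) (x + h) = heat t (\<lambda>y. ennreal \<bar>f (y + h)\<bar>) x"
      by (simp add: heat_def algebra_simps)
    also have "\<dots> \<le> heat t (\<lambda>y. ennreal \<bar>f y\<bar> + ennreal (L * norm h)) x"
    proof (rule heat_AE_mono[OF _ t], rule eventually_mono[OF weak_grad_difference_bounded[OF wg L, of h]])
      fix y assume "\<bar>f (y + h) - f y\<bar> \<le> L * norm h"
      then have "\<bar>f (y + h)\<bar> \<le> \<bar>f y\<bar> + L * norm h" by linarith
      then show "ennreal \<bar>f (y + h)\<bar> \<le> ennreal \<bar>f y\<bar> + ennreal (L * norm h)"
        using L(1) by (subst ennreal_plus[symmetric]) (auto simp del: ennreal_plus intro: ennreal_leI)
    qed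
    also have "\<dots> = heat t (\<lambda>y. ennreal \<bar>f y\<bar>) x + ennreal (L * norm h)"
      using t by (subst heat_add) (auto simp: heat_const)
    also have "\<dots> \<le> (SUP t\<in>{0<..}. heat t (\<lambda>y. ennreal \<bar>f y\<bar>) x) + ennreal (L * norm h)"
      using t' by (intro add_right_mono SUP_upper)
    finally show "heat t (\<lambda>y. ennreal \<bar>f y\<bar>) (x + h) \<le> (SUP t\<in>{0<..}. heat t (\<lambda>y. ennreal \<bar>f y\<bar>) x) + ennreal (L * norm h)" .
  qed
  let ?W = "\<lambda>x. enn2real (M x)"
  have Mr: "M x = ennreal (?W x)" for x
    using MB[of x] by (metis ennreal_enn2real ennreal_less_top order.strict_trans1)
  have WB: "?W x \<le> B" for x using MB[of x] Mr[of x] B(1) by (metis enn2real_leI)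
  have Wd: "?W y - ?W x \<le> L * norm (y - x)" for x y
  proof -
    have "ennreal (?W y) \<le> ennreal (?W x) + ennreal (L * norm (y - x))"
      using lip[of x "y - x"] unfolding Mr[symmetric] by simp
    then have "ennreal (?W y) \<le> ennreal (?W x + L * norm (y - x))" using L(1) by (simp add: ennreal_plus)
    then have "?W y \<le> ?W x + L * norm (y - x)" using L(1) by (subst (asm) ennreal_le_iff) auto
    then show ?thesis by simp
  qed
  have Wlip: "\<bar>?W x - ?W y\<bar> \<le> L * norm (x - y)" for x y
    using Wd[of x y] Wd[of y x] by (simp add: norm_minus_commute abs_le_iff)
  obtain g' where "weak_grad ?W g'" "AE x in lborel. norm (g' x) \<le> L"
    using weak_grad_Lipschitz[of ?W B L] WB L(1) Wlip by auto
  then show ?thesis using MB by (intro that)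
qed

section \<open>Bounds for weak limits\<close>

lemma nn_integral_heat_measure_le_lborel:
  fixes f :: "'a::euclidean_space \<Rightarrow> ennreal"
  assumes [measurable]: "f \<in> borel_measurable borel"
  shows "(\<integral>\<^sup>+x. f x \<partial>heat_measure 1) \<le> (\<integral>\<^sup>+x. f x \<partial>lborel)"
proof -
  have "heat_kernel 1 x \<le> 1" for x :: 'a
  proof -
    have "(4 * pi) powr (- real DIM('a) / 2) \<le> (4 * pi) powr 0"
      using pi_gt3 by (intro powr_mono) auto
    then have "(4 * pi * 1) powr (- real DIM('a) / 2) * exp (- (norm x)\<^sup>2 / (4 * 1)) \<le> 1 * 1"
      using pi_gt3 by (intro mult_mono) auto
    then show ?thesis by (simp add: heat_kernel_def)
  qed
  then have "ennreal (heat_kernel 1 x) * f x \<le> 1 * f x" for x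
    by (intro mult_right_mono) auto
  then show ?thesis by (simp add: nn_integral_heat_measure nn_integral_mono)
qed

lemma midconv_limit_nn_integral_le:
  fixes G :: "nat \<Rightarrow> 'a \<Rightarrow> 'b::euclidean_space" and \<Phi> :: "'b \<Rightarrow> ennreal"
  assumes \<gamma>: "\<And>k. midconv G k (\<gamma> k)" and lim: "AE x in M. (\<lambda>k. \<gamma> k x) \<longlonglongrightarrow> g x"
    and G: "\<And>n. G n \<in> borel_measurable M" and cont: "continuous_on UNIV \<Phi>"
    and conv: "\<And>a b. \<Phi> ((1 / 2) *\<^sub>R (a + b)) \<le> (\<Phi> a + \<Phi> b) / 2"
    and le: "\<And>n. (\<integral>\<^sup>+x. \<Phi> (G n x) \<partial>M) \<le> c"
  shows "(\<integral>\<^sup>+x. \<Phi> (g x) \<partial>M) \<le> c"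
proof -
  have [measurable]: "\<Phi> \<in> borel_measurable borel" using cont by (rule borel_measurable_continuous_onI)
  have [measurable]: "\<gamma> k \<in> borel_measurable M" for k by (rule midconv_measurable[OF \<gamma> G])
  have "(\<integral>\<^sup>+x. \<Phi> (g x) \<partial>M) = (\<integral>\<^sup>+x. liminf (\<lambda>k. \<Phi> (\<gamma> k x)) \<partial>M)"
  proof (rule nn_integral_cong_AE, rule eventually_mono[OF lim])
    fix x assume "(\<lambda>k. \<gamma> k x) \<longlonglongrightarrow> g x"
    then have "(\<lambda>k. \<Phi> (\<gamma> k x)) \<longlonglongrightarrow> \<Phi> (g x)"
      using cont by (rule_tac continuous_on_tendsto_compose) auto
    then show "\<Phi> (g x) = liminf (\<lambda>k. \<Phi> (\<gamma> k x))"
      using lim_imp_Liminf[OF sequentially_bot] by metis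
  qed
  also have "\<dots> \<le> liminf (\<lambda>k. \<integral>\<^sup>+x. \<Phi> (\<gamma> k x) \<partial>M)" by (rule nn_integral_liminf) measurable
  also have "\<dots> \<le> liminf (\<lambda>k. c)"
    by (intro Liminf_mono always_eventually allI midconv_nn_integral_le[OF \<gamma> G _ conv le]) measurable
  finally show ?thesis by (simp add: Liminf_const)
qed

section \<open>Dirichlet energy at scale \<open>s\<close>\<close>

text \<open>Not normalised: after division by \<open>2 * s\<close> it is the difference analogue of
  the squared L^2 norm of the gradient. It is one integral over the product space because the
  symmetry argument acts there.\<close>

definition energy :: "real \<Rightarrow> ('a::euclidean_space \<Rightarrow> real) \<Rightarrow> ennreal" where
  "energy s w = (\<integral>\<^sup>+(x, h). ennreal ((w (x + h) - w x)\<^sup>2) \<partial>(lborel \<Otimes>\<^sub>M heat_measure s))"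

lemma energy_fst:
  assumes s: "0 < s" and [measurable]: "w \<in> borel_measurable borel"
  shows "energy s w = (\<integral>\<^sup>+x. \<integral>\<^sup>+h. ennreal ((w (x + h) - w x)\<^sup>2) \<partial>heat_measure s \<partial>lborel)"
proof -
  interpret H: prob_space "heat_measure s :: 'a measure" by (rule prob_space_heat_measure[OF s])
  show ?thesis unfolding energy_def by (subst H.nn_integral_fst[symmetric]) auto
qed

lemma energy_snd:
  fixes w :: "'a::euclidean_space \<Rightarrow> real"
  assumes s: "0 < s" and [measurable]: "w \<in> borel_measurable borel"
  shows "energy s w = (\<integral>\<^sup>+h. \<integral>\<^sup>+x. ennreal ((w (x + h) - w x)\<^sup>2) \<partial>lborel \<partial>heat_measure s)"
proof -
  interpret H: prob_space "heat_measure s :: 'a measure" by (rule prob_space_heat_measure[OF s])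
  interpret P: pair_sigma_finite lborel "heat_measure s :: 'a measure" ..
  show ?thesis unfolding energy_def by (subst P.nn_integral_snd[symmetric]) auto
qed

text \<open>Reversibility of the random walk with Gaussian steps: exchanging start and end point
  preserves the measure.\<close>

lemma distr_heat_flip:
  assumes s: "0 < s"
  shows "distr (lborel \<Otimes>\<^sub>M heat_measure s) (lborel \<Otimes>\<^sub>M heat_measure s) (\<lambda>(x::'a::euclidean_space, h). (x + h, - h))
    = lborel \<Otimes>\<^sub>M heat_measure s" (is "distr ?M ?M ?T = ?M")
proof (rule measure_eqI)
  interpret H: prob_space "heat_measure s :: 'a measure" by (rule prob_space_heat_measure[OF s])
  interpret P: pair_sigma_finite lborel "heat_measure s :: 'a measure" ..
  fix A assume "A \<in> sets (distr ?M ?M ?T)"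
  then have A[measurable]: "A \<in> sets ?M" by simp
  have [measurable]: "?T \<in> measurable ?M ?M" by measurable
  have "emeasure (distr ?M ?M ?T) A = (\<integral>\<^sup>+z. indicator A z \<partial>distr ?M ?M ?T)"
    using A by (intro nn_integral_indicator[symmetric]) simp
  also have "\<dots> = (\<integral>\<^sup>+z. indicator A (?T z) \<partial>?M)" by (rule nn_integral_distr) measurable
  also have "\<dots> = (\<integral>\<^sup>+h. \<integral>\<^sup>+x. indicator A (x + h, - h) \<partial>lborel \<partial>heat_measure s)"
    by (subst P.nn_integral_snd[symmetric]) (auto simp: case_prod_beta')
  also have "\<dots> = (\<integral>\<^sup>+h. \<integral>\<^sup>+x. indicator A (x, - h) \<partial>lborel \<partial>heat_measure s)"
    by (intro nn_integral_cong nn_integral_lborel_translate[where f="\<lambda>x. indicator A (x, - _)"]) measurable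
  also have "\<dots> = (\<integral>\<^sup>+h. \<integral>\<^sup>+x. indicator A (x, h) \<partial>lborel \<partial>heat_measure s)"
    by (rule nn_integral_heat_measure_uminus[where f="\<lambda>h. \<integral>\<^sup>+x. indicator A (x, h) \<partial>lborel"]) measurable
  also have "\<dots> = emeasure ?M A"
    by (subst P.nn_integral_snd) (auto intro: nn_integral_indicator[OF A])
  finally show "emeasure (distr ?M ?M ?T) A = emeasure ?M A" .
qed simp

text \<open>With \<open>d = F - V\<close>, \<open>energy F - energy V\<close> dominates twice the bilinear form of \<open>V\<close> and \<open>d\<close>,
  which by the symmetry \<open>(x, h) \<mapsto> (x + h, - h)\<close> is the integral of \<open>2 d (V - P V)\<close>; both factors
  are nonpositive where \<open>d \<noteq> 0\<close>.\<close>

lemma energy_obstacle_le: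
  fixes V F :: "'a::euclidean_space \<Rightarrow> real"
  assumes s: "0 < s" and [measurable]: "V \<in> borel_measurable borel" "F \<in> borel_measurable borel"
    and V2: "(\<integral>\<^sup>+x. ennreal ((V x)\<^sup>2) \<partial>lborel) < \<infinity>"
    and FV: "AE x in lborel. 0 \<le> F x \<and> F x \<le> V x"
    and obst: "AE x in lborel. V x \<le> max (F x) (\<integral>h. V (x + h) \<partial>heat_measure s)"
  shows "energy s V \<le> energy s F"
proof -
  let ?H = "heat_measure s :: 'a measure"
  let ?M = "lborel \<Otimes>\<^sub>M ?H"
  let ?T = "\<lambda>(x::'a, h::'a). (x + h, - h)"
  interpret H: prob_space ?H by (rule prob_space_heat_measure[OF s])
  interpret P: pair_sigma_finite lborel ?H ..
  have [measurable]: "?T \<in> measurable ?M ?M" by measurable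
  have flip: "integrable ?M (\<lambda>z. G (?T z))" "(\<integral>z. G (?T z) \<partial>?M) = (\<integral>z. G z \<partial>?M)"
    if G: "integrable ?M G" for G :: "'a \<times> 'a \<Rightarrow> real"
  proof -
    have Gd: "integrable (distr ?M ?M ?T) G" using G by (simp add: distr_heat_flip[OF s])
    then show "integrable ?M (\<lambda>z. G (?T z))" using G by (subst (asm) integrable_distr_eq) auto
    show "(\<integral>z. G (?T z) \<partial>?M) = (\<integral>z. G z \<partial>?M)"
      using integral_distr[of ?T ?M ?M G] G by (simp add: distr_heat_flip[OF s] borel_measurable_integrable)
  qed
  have F2: "(\<integral>\<^sup>+x. ennreal ((F x)\<^sup>2) \<partial>lborel) < \<infinity>"
  proof -
    have "(\<integral>\<^sup>+x. ennreal ((F x)\<^sup>2) \<partial>lborel) \<le> (\<integral>\<^sup>+x. ennreal ((V x)\<^sup>2) \<partial>lborel)"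
      by (rule nn_integral_mono_AE, rule eventually_mono[OF FV]) (auto intro!: ennreal_leI power_mono)
    then show ?thesis using V2 by (rule order.strict_trans1)
  qed
  have sq1: "integrable ?M (\<lambda>(x, h). (w x)\<^sup>2)" and sq2: "integrable ?M (\<lambda>(x, h). (w (x + h))\<^sup>2)"
    if [measurable]: "w \<in> borel_measurable borel" and w2: "(\<integral>\<^sup>+x. ennreal ((w x)\<^sup>2) \<partial>lborel) < \<infinity>" for w :: "'a \<Rightarrow> real"
  proof -
    have "(\<integral>\<^sup>+z. ennreal (norm (case z of (x, h) \<Rightarrow> (w x)\<^sup>2)) \<partial>?M) = (\<integral>\<^sup>+x. \<integral>\<^sup>+h. ennreal ((w x)\<^sup>2) \<partial>?H \<partial>lborel)"
      by (subst H.nn_integral_fst[symmetric]) auto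
    also have "\<dots> = (\<integral>\<^sup>+x. ennreal ((w x)\<^sup>2) \<partial>lborel)" by (simp add: H.emeasure_space_1[simplified])
    finally show 1: "integrable ?M (\<lambda>(x, h). (w x)\<^sup>2)" using w2 by (intro integrableI_bounded) auto
    show "integrable ?M (\<lambda>(x, h). (w (x + h))\<^sup>2)" using flip(1)[OF 1] by (simp add: case_prod_beta')
  qed
  have prod: "integrable ?M (\<lambda>z. a z * b z)"
    if [measurable]: "a \<in> borel_measurable ?M" "b \<in> borel_measurable ?M"
      and "integrable ?M (\<lambda>z. (a z)\<^sup>2)" "integrable ?M (\<lambda>z. (b z)\<^sup>2)" for a b :: "'a \<times> 'a \<Rightarrow> real"
  proof (rule Bochner_Integration.integrable_bound[OF Bochner_Integration.integrable_add[OF that(3,4)]])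
    show "AE z in ?M. norm (a z * b z) \<le> norm ((a z)\<^sup>2 + (b z)\<^sup>2)"
    proof (rule AE_I2)
      fix z
      have "2 * \<bar>a z * b z\<bar> \<le> (a z)\<^sup>2 + (b z)\<^sup>2"
        using sum_squares_bound[of "\<bar>a z\<bar>" "\<bar>b z\<bar>"] by (simp add: abs_mult)
      then show "norm (a z * b z) \<le> norm ((a z)\<^sup>2 + (b z)\<^sup>2)" by simp
    qed
  qed measurable
  have sum2: "integrable ?M (\<lambda>z. (a z - b z)\<^sup>2)"
    if [measurable]: "a \<in> borel_measurable ?M" "b \<in> borel_measurable ?M"
      and "integrable ?M (\<lambda>z. (a z)\<^sup>2)" "integrable ?M (\<lambda>z. (b z)\<^sup>2)" for a b :: "'a \<times> 'a \<Rightarrow> real"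
    using prod[OF that] that(3,4) by (simp add: power2_diff mult.assoc)
  define d where "d x = F x - V x" for x
  have [measurable]: "d \<in> borel_measurable borel" unfolding d_def[abs_def] by measurable
  define V1 V0 F1 F0 d0 where "V1 = (\<lambda>(x, h). V (x + h))" "V0 = (\<lambda>(x, h::'a). V x)"
    "F1 = (\<lambda>(x, h). F (x + h))" "F0 = (\<lambda>(x, h::'a). F x)" "d0 = (\<lambda>(x, h::'a). d x)"
  note defs = V1_V0_F1_F0_d0_def
  have [measurable]: "V1 \<in> borel_measurable ?M" "V0 \<in> borel_measurable ?M" "F1 \<in> borel_measurable ?M"
    "F0 \<in> borel_measurable ?M" "d0 \<in> borel_measurable ?M"
    unfolding defs by measurable
  have i: "integrable ?M (\<lambda>z. (V0 z)\<^sup>2)" "integrable ?M (\<lambda>z. (V1 z)\<^sup>2)" "integrable ?M (\<lambda>z. (F0 z)\<^sup>2)" "integrable ?M (\<lambda>z. (F1 z)\<^sup>2)"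
    using sq1[OF _ V2] sq2[OF _ V2] sq1[OF _ F2] sq2[OF _ F2] by (simp_all add: defs case_prod_beta')
  have Vd: "integrable ?M (\<lambda>z. (V1 z - V0 z)\<^sup>2)" and Fd: "integrable ?M (\<lambda>z. (F1 z - F0 z)\<^sup>2)"
    using i by (auto intro!: sum2)
  have d0': "d0 = (\<lambda>z. F0 z - V0 z)" by (auto simp: defs d_def)
  have "integrable ?M (\<lambda>z. (d0 z)\<^sup>2)" unfolding d0' using i by (auto intro!: sum2)
  moreover have "integrable ?M (\<lambda>z. (V0 z - V1 z)\<^sup>2)" using i by (auto intro!: sum2)
  ultimately have G: "integrable ?M (\<lambda>z. (V0 z - V1 z) * d0 z)" by (intro prod) auto
  have pos: "0 \<le> (\<integral>z. (V0 z - V1 z) * d0 z \<partial>?M)"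
  proof -
    have "(\<integral>z. (V0 z - V1 z) * d0 z \<partial>?M) = (\<integral>x. \<integral>h. (V x - V (x + h)) * d x \<partial>?H \<partial>lborel)"
      using P.integral_fst'[OF G] by (simp add: defs)
    also have "\<dots> \<ge> 0"
    proof (rule integral_nonneg_AE)
      show "AE x in lborel. 0 \<le> (\<integral>h. (V x - V (x + h)) * d x \<partial>?H)"
        using FV obst
      proof eventually_elim
        case (elim x)
        have I: "integrable ?H (\<lambda>h. V (x + h))"
        proof -
          have "\<exists>B. \<forall>x. heat s (\<lambda>y. ennreal \<bar>V y\<bar>) x \<le> ennreal B"
            by (rule heat_Lp_bounded[of V 2]) (use s V2 in auto)
          then have "heat s (\<lambda>y. ennreal \<bar>V y\<bar>) x < \<infinity>" by (metis ennreal_less_top infinity_ennreal_def order.strict_trans1)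
          then show ?thesis by (intro integrableI_bounded) (auto simp: heat_eq_plus)
        qed
        have "(\<integral>h. (V x - V (x + h)) * d x \<partial>?H) = (V x - (\<integral>h. V (x + h) \<partial>?H)) * d x"
          using Bochner_Integration.integral_diff[OF H.integrable_const[of "V x"] I] H.prob_space by simp
        moreover have "0 \<le> (V x - (\<integral>h. V (x + h) \<partial>?H)) * d x"
        proof (cases "V x \<le> (\<integral>h. V (x + h) \<partial>?H)")
          case True
          then show ?thesis using elim by (intro mult_nonpos_nonpos) (auto simp: d_def)
        next
          case False
          then show ?thesis using elim by (auto simp: d_def)
        qed
        ultimately show ?case by (simp only:)
      qed
    qed
    finally show ?thesis .
  qed
  let ?G = "\<lambda>z. (V0 z - V1 z) * d0 z"
  have G2: "integrable ?M (\<lambda>z. ?G (?T z))" "(\<integral>z. ?G (?T z) \<partial>?M) = (\<integral>z. ?G z \<partial>?M)" using flip[OF G] by auto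
  have "(\<integral>z. (V1 z - V0 z)\<^sup>2 \<partial>?M) \<le> (\<integral>z. (V1 z - V0 z)\<^sup>2 + 2 * (?G z + ?G (?T z)) \<partial>?M)"
    using Vd G G2 pos by simp
  also have "\<dots> \<le> (\<integral>z. (F1 z - F0 z)\<^sup>2 \<partial>?M)"
  proof (rule integral_mono)
    show "integrable ?M (\<lambda>z. (V1 z - V0 z)\<^sup>2 + 2 * (?G z + ?G (?T z)))" using Vd G G2 by simp
    fix z :: "'a \<times> 'a"
    obtain x h where z: "z = (x, h)" by (cases z)
    \<comment> \<open>The expansion of the energy of \<open>V + d\<close>; the square that is
      dropped is the energy density of \<open>d\<close>.\<close>
    have "(a - b)\<^sup>2 + 2 * ((b - a) * (q - b) + (a - b) * (p - a)) \<le> (p - q)\<^sup>2" for a b p q :: real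
    proof -
      have "(p - q)\<^sup>2 - ((a - b)\<^sup>2 + 2 * ((b - a) * (q - b) + (a - b) * (p - a))) = ((p - a) - (q - b))\<^sup>2"
        by (simp add: power2_eq_square algebra_simps)
      then show ?thesis using zero_le_power2[of "(p - a) - (q - b)"] by linarith
    qed
    from this[of "V (x + h)" "V x" "F x" "F (x + h)"]
    show "(V1 z - V0 z)\<^sup>2 + 2 * (?G z + ?G (?T z)) \<le> (F1 z - F0 z)\<^sup>2"
      by (simp add: z defs d_def)
  qed (rule Fd)
  finally have "ennreal (\<integral>z. (V1 z - V0 z)\<^sup>2 \<partial>?M) \<le> ennreal (\<integral>z. (F1 z - F0 z)\<^sup>2 \<partial>?M)" by (rule ennreal_leI)
  moreover have "energy s V = ennreal (\<integral>z. (V1 z - V0 z)\<^sup>2 \<partial>?M)"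
    unfolding energy_def using Vd by (subst nn_integral_eq_integral[symmetric]) (auto simp: defs case_prod_beta')
  moreover have "energy s F = ennreal (\<integral>z. (F1 z - F0 z)\<^sup>2 \<partial>?M)"
    unfolding energy_def using Fd by (subst nn_integral_eq_integral[symmetric]) (auto simp: defs case_prod_beta')
  ultimately show ?thesis by simp
qed

text \<open>Jensen's inequality for the averaged difference at fixed shift, followed by translation
  invariance of Lebesgue measure.\<close>

lemma energy_heatr_le:
  fixes f :: "'a::euclidean_space \<Rightarrow> real"
  assumes s: "0 < s" and t: "0 < t" and [measurable]: "f \<in> borel_measurable borel" and nn: "\<And>x. 0 \<le> f x"
    and fin: "\<And>x. heat t (\<lambda>y. ennreal (f y)) x < \<infinity>"
  shows "energy s (heatr t f) \<le> energy s f"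
proof -
  let ?H = "heat_measure t :: 'a measure"
  interpret H: prob_space ?H by (rule prob_space_heat_measure[OF t])
  interpret P: pair_sigma_finite lborel ?H ..
  show ?thesis
    unfolding energy_snd[OF s borel_measurable_heatr[OF \<open>f \<in> _\<close>]] energy_snd[OF s \<open>f \<in> _\<close>]
  proof (rule nn_integral_mono)
    fix h :: 'a
    have "(\<integral>\<^sup>+x. ennreal ((heatr t f (x + h) - heatr t f x)\<^sup>2) \<partial>lborel)
      \<le> (\<integral>\<^sup>+x. \<integral>\<^sup>+y. ennreal ((f (x + h - y) - f (x - y))\<^sup>2) \<partial>?H \<partial>lborel)"
    proof (rule nn_integral_mono)
      fix x
      have "heatr t f (x + h) - heatr t f x = (\<integral>y. f (x + h - y) - f (x - y) \<partial>?H)"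
        using heatr_integral[OF \<open>f \<in> _\<close> nn fin] by simp
      then show "ennreal ((heatr t f (x + h) - heatr t f x)\<^sup>2) \<le> (\<integral>\<^sup>+y. ennreal ((f (x + h - y) - f (x - y))\<^sup>2) \<partial>?H)"
        using H.square_integral_le[of "\<lambda>y. f (x + h - y) - f (x - y)"] by simp
    qed
    also have "\<dots> = (\<integral>\<^sup>+y. \<integral>\<^sup>+x. ennreal ((f (x + h - y) - f (x - y))\<^sup>2) \<partial>lborel \<partial>?H)"
      by (rule P.Fubini'[symmetric]) measurable
    also have "\<dots> = (\<integral>\<^sup>+y. \<integral>\<^sup>+x. ennreal ((f (x + h) - f x)\<^sup>2) \<partial>lborel \<partial>?H)"
    proof (rule nn_integral_cong)
      fix y
      show "(\<integral>\<^sup>+x. ennreal ((f (x + h - y) - f (x - y))\<^sup>2) \<partial>lborel) = (\<integral>\<^sup>+x. ennreal ((f (x + h) - f x)\<^sup>2) \<partial>lborel)"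
        using nn_integral_lborel_translate[of "\<lambda>x. ennreal ((f (x + h) - f x)\<^sup>2)" "- y"] by (simp add: algebra_simps)
    qed
    also have "\<dots> = (\<integral>\<^sup>+x. ennreal ((f (x + h) - f x)\<^sup>2) \<partial>lborel)" by (simp add: H.emeasure_space_1[simplified])
    finally show "(\<integral>\<^sup>+x. ennreal ((heatr t f (x + h) - heatr t f x)\<^sup>2) \<partial>lborel) \<le> (\<integral>\<^sup>+x. ennreal ((f (x + h) - f x)\<^sup>2) \<partial>lborel)" .
  qed
qed

lemma energy_weak_grad_le:
  fixes u :: "'a::euclidean_space \<Rightarrow> real"
  assumes s: "0 < s" and wg: "weak_grad u g"
  shows "energy s (\<lambda>x. \<bar>u x\<bar>) \<le> ennreal (2 * s) * (\<integral>\<^sup>+x. ennreal ((norm (g x))\<^sup>2) \<partial>lborel)"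
proof -
  let ?H = "heat_measure s :: 'a measure"
  interpret H: prob_space ?H by (rule prob_space_heat_measure[OF s])
  interpret P: pair_sigma_finite lborel ?H ..
  have [measurable]: "u \<in> borel_measurable borel" "g \<in> borel_measurable borel"
    using wg by (auto simp: weak_grad_def dest: loc_int_measurable)
  have "energy s (\<lambda>x. \<bar>u x\<bar>) \<le> (\<integral>\<^sup>+h. \<integral>\<^sup>+x. ennreal ((h \<bullet> g x)\<^sup>2) \<partial>lborel \<partial>?H)"
    unfolding energy_snd[OF s borel_measurable_abs[OF \<open>u \<in> _\<close>]]
  proof (rule nn_integral_mono)
    fix h :: 'a
    have "(\<integral>\<^sup>+x. ennreal ((\<bar>u (x + h)\<bar> - \<bar>u x\<bar>)\<^sup>2) \<partial>lborel) \<le> (\<integral>\<^sup>+x. ennreal ((u (x + h) - u x)\<^sup>2) \<partial>lborel)"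
    proof (intro nn_integral_mono ennreal_leI)
      fix x show "(\<bar>u (x + h)\<bar> - \<bar>u x\<bar>)\<^sup>2 \<le> (u (x + h) - u x)\<^sup>2"
        by (rule abs_le_square_iff[THEN iffD1]) (rule abs_triangle_ineq3)
    qed
    also note weak_grad_difference_L2[OF wg]
    finally show "(\<integral>\<^sup>+x. ennreal ((\<bar>u (x + h)\<bar> - \<bar>u x\<bar>)\<^sup>2) \<partial>lborel) \<le> (\<integral>\<^sup>+x. ennreal ((h \<bullet> g x)\<^sup>2) \<partial>lborel)" .
  qed
  also have "\<dots> = (\<integral>\<^sup>+x. \<integral>\<^sup>+h. ennreal ((h \<bullet> g x)\<^sup>2) \<partial>?H \<partial>lborel)" by (rule P.Fubini') measurable
  also have "\<dots> = (\<integral>\<^sup>+x. ennreal (2 * s) * ennreal ((norm (g x))\<^sup>2) \<partial>lborel)"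
  proof (rule nn_integral_cong)
    fix x
    have "has_bochner_integral ?H (\<lambda>h. (h \<bullet> g x)\<^sup>2) (2 * s * (norm (g x))\<^sup>2)"
      using heat_measure_inner_inner[OF s, of "g x" "g x"] by (simp add: power2_eq_square power2_norm_eq_inner[symmetric])
    then show "(\<integral>\<^sup>+h. ennreal ((h \<bullet> g x)\<^sup>2) \<partial>?H) = ennreal (2 * s) * ennreal ((norm (g x))\<^sup>2)"
      using s by (subst nn_integral_eq_integral) (auto simp: has_bochner_integral_iff ennreal_mult)
  qed
  also have "\<dots> = ennreal (2 * s) * (\<integral>\<^sup>+x. ennreal ((norm (g x))\<^sup>2) \<partial>lborel)" by (rule nn_integral_cmult) measurable
  finally show ?thesis .
qed

lemma heat_grad_energy_le:
  fixes V :: "'a::euclidean_space \<Rightarrow> real"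
  assumes s: "0 < s" and [measurable]: "V \<in> borel_measurable borel" and E: "energy s V \<le> ennreal (2 * s) * D"
  shows "(\<integral>\<^sup>+x. ennreal ((norm (heat_grad s V x))\<^sup>2) \<partial>lborel) \<le> D"
proof -
  interpret H: prob_space "heat_measure s :: 'a measure" by (rule prob_space_heat_measure[OF s])
  have "(\<integral>\<^sup>+x. ennreal ((norm (heat_grad s V x))\<^sup>2) \<partial>lborel)
    \<le> (\<integral>\<^sup>+x. ennreal (1 / (2 * s)) * (\<integral>\<^sup>+h. ennreal ((V (x + h) - V x)\<^sup>2) \<partial>heat_measure s) \<partial>lborel)"
    by (intro nn_integral_mono heat_grad_norm_le s) measurable
  also have "\<dots> = ennreal (1 / (2 * s)) * energy s V"
    by (subst nn_integral_cmult) (auto simp: energy_fst[OF s])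
  also have "\<dots> \<le> ennreal (1 / (2 * s)) * (ennreal (2 * s) * D)" using E by (rule mult_left_mono) simp
  also have "\<dots> = D" using s by (simp add: mult.assoc[symmetric] ennreal_mult'[symmetric])
  finally show ?thesis .
qed

lemma energy_heat_sup_dyadic_le:
  fixes f :: "'a::euclidean_space \<Rightarrow> real" and k :: nat
  defines "S \<equiv> heat_sup_dyadic k (\<lambda>x. ennreal (f x))" and "s \<equiv> 1 / 2 ^ k"
  assumes [measurable]: "f \<in> borel_measurable borel" and nn: "\<And>x. 0 \<le> f x"
    and f2: "(\<integral>\<^sup>+x. ennreal ((f x)\<^sup>2) \<partial>lborel) < \<infinity>"
    and S: "AE x in lborel. S x < \<infinity>" "(\<integral>\<^sup>+x. ennreal ((enn2real (S x))\<^sup>2) \<partial>lborel) < \<infinity>"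
  shows "energy s (\<lambda>x. enn2real (S x)) \<le> energy s f"
proof -
  let ?V = "\<lambda>x. enn2real (S x)"
  have s: "0 < s" by (simp add: s_def)
  have [measurable]: "S \<in> borel_measurable borel" unfolding S_def by measurable
  have fin: "heat s (\<lambda>y. ennreal \<bar>w y\<bar>) x < \<infinity>" if "w \<in> borel_measurable borel" "(\<integral>\<^sup>+x. ennreal ((w x)\<^sup>2) \<partial>lborel) < \<infinity>"
    for w :: "'a \<Rightarrow> real" and x
  proof -
    have "\<exists>B. \<forall>x. heat s (\<lambda>y. ennreal \<bar>w y\<bar>) x \<le> ennreal B"
      by (rule heat_Lp_bounded[of w 2]) (use s that in auto)
    then show ?thesis by (metis ennreal_less_top infinity_ennreal_def order.strict_trans1)
  qed
  have ffin: "heat s (\<lambda>y. ennreal (f y)) x < \<infinity>" for x using fin[of f x] f2 nn by simp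
  have "heat s (\<lambda>y. ennreal (f y)) x \<le> S x" for x
    unfolding S_def heat_sup_dyadic_def s_def by (rule SUP_upper2[of 0]) auto
  then have F: "ennreal (heatr s f x) \<le> S x" for x using heat_eq_heatr[OF ffin] by simp
  have HS: "heat s S x = ennreal (\<integral>h. ?V (x + h) \<partial>heat_measure s)" for x
  proof -
    have "heat s S x = heat s (\<lambda>y. ennreal (?V y)) x"
      by (rule heat_AE_cong[OF _ s], rule eventually_mono[OF S(1)]) simp
    moreover have "heat s (\<lambda>y. ennreal (?V y)) x < \<infinity>" using fin[of ?V x] S(2) by simp
    ultimately show ?thesis
      by (simp add: heat_eq_plus) (subst nn_integral_eq_integral, auto intro!: integrableI_nonneg)
  qed
  have "S x \<le> max (ennreal (heatr s f x)) (heat s S x)" for x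
    unfolding S_def heat_sup_dyadic_def
  proof (rule SUP_least)
    fix n
    show "heat (real (Suc n) / 2 ^ k) (\<lambda>x. ennreal (f x)) x
      \<le> max (ennreal (heatr s f x)) (heat s (\<lambda>x. SUP n. heat (real (Suc n) / 2 ^ k) (\<lambda>x. ennreal (f x)) x) x)"
    \<comment> \<open>The first time gives the obstacle \<open>heatr s f\<close>; each later time is
      one step \<open>s\<close> after a time at which \<open>S\<close> is already an upper
      bound.\<close>
    proof (cases n)
      case 0
      then show ?thesis unfolding heat_eq_heatr[OF ffin, symmetric] by (simp add: s_def)
    next
      case (Suc m)
      have e: "real (Suc n) / 2 ^ k = s + real (Suc m) / 2 ^ k" by (simp add: Suc s_def add_divide_distrib)
      have "heat (real (Suc n) / 2 ^ k) (\<lambda>x. ennreal (f x)) x = heat s (heat (real (Suc m) / 2 ^ k) (\<lambda>x. ennreal (f x))) x"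
        unfolding e using s by (subst heat_heat) auto
      also have "\<dots> \<le> heat s (\<lambda>x. SUP n. heat (real (Suc n) / 2 ^ k) (\<lambda>x. ennreal (f x)) x) x"
        by (intro heat_mono SUP_upper) auto
      finally show ?thesis by (simp add: le_max_iff_disj)
    qed
  qed
  then have max: "S x \<le> max (ennreal (heatr s f x)) (ennreal (\<integral>h. ?V (x + h) \<partial>heat_measure s))" for x
    unfolding HS .
  have "energy s ?V \<le> energy s (heatr s f)"
  proof (rule energy_obstacle_le[OF s])
    show "AE x in lborel. 0 \<le> heatr s f x \<and> heatr s f x \<le> ?V x"
    proof (rule eventually_mono[OF S(1)])
      fix x assume "S x < \<infinity>"
      then show "0 \<le> heatr s f x \<and> heatr s f x \<le> ?V x"
        using enn2real_mono[OF F[of x]] by (simp add: heatr_nonneg)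
    qed
    show "AE x in lborel. ?V x \<le> max (heatr s f x) (\<integral>h. ?V (x + h) \<partial>heat_measure s)"
    proof (rule AE_I2)
      fix x
      have "0 \<le> (\<integral>h. ?V (x + h) \<partial>heat_measure s)" by simp
      moreover have "S x \<le> ennreal (max (heatr s f x) (\<integral>h. ?V (x + h) \<partial>heat_measure s))"
        using max[of x] by (simp add: max_def ennreal_le_iff heatr_nonneg split: if_splits)
      ultimately show "?V x \<le> max (heatr s f x) (\<integral>h. ?V (x + h) \<partial>heat_measure s)"
        by (intro enn2real_leI) (auto simp: le_max_iff_disj heatr_nonneg)
    qed
  qed (use S(2) in auto)
  also have "\<dots> \<le> energy s f" by (rule energy_heatr_le[OF s s _ nn ffin]) measurable
  finally show ?thesis .
qed

text \<open>The weight \<open>\<eta>\<close> decouples volume and square: a small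
  \<open>\<eta>\<close> and then a still smaller \<open>A\<close> make the whole bound small, so
  convergence in mean square implies convergence in \<open>ball_mean\<close>.\<close>

lemma ball_mean_square:
  fixes V :: "'a::euclidean_space \<Rightarrow> real"
  assumes [measurable]: "V \<in> borel_measurable borel" and A: "(\<integral>\<^sup>+x. ennreal ((V x)\<^sup>2) \<partial>lborel) \<le> ennreal A" "0 \<le> A" and \<eta>: "0 < \<eta>"
  shows "ball_mean R V (\<eta> * (unit_ball_vol (real DIM('a)) * \<bar>R\<bar> ^ DIM('a)) + A / \<eta>)"
  unfolding ball_mean_def
proof
  fix z :: 'a
  let ?v = "unit_ball_vol (real DIM('a)) * \<bar>R\<bar> ^ DIM('a)"
  have v: "0 \<le> ?v" by simp
  have em: "emeasure lborel (cball z R) \<le> ennreal ?v"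
    by (cases "0 \<le> R") (auto simp: emeasure_cball)
  have "(\<integral>\<^sup>+x. ennreal \<bar>V x\<bar> * indicator (cball z R) x \<partial>lborel)
    \<le> (\<integral>\<^sup>+x. ennreal \<eta> * indicator (cball z R) x + ennreal (1 / \<eta>) * ennreal ((V x)\<^sup>2) \<partial>lborel)"
  proof (rule nn_integral_mono)
    fix x
    have "\<bar>V x\<bar> \<le> \<eta> + 1 / \<eta> * (V x)\<^sup>2"
    proof -
      have "2 * (\<eta> * \<bar>V x\<bar>) \<le> \<eta>\<^sup>2 + (V x)\<^sup>2" using sum_squares_bound[of \<eta> "\<bar>V x\<bar>"] by (simp add: mult.assoc)
      moreover have "0 \<le> \<eta> * \<bar>V x\<bar>" using \<eta> by simp
      ultimately have "\<eta> * \<bar>V x\<bar> \<le> \<eta>\<^sup>2 + (V x)\<^sup>2" by linarith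
      also have "\<dots> = \<eta> * (\<eta> + 1 / \<eta> * (V x)\<^sup>2)" using \<eta> by (simp add: distrib_left power2_eq_square)
      finally show ?thesis using \<eta> by simp
    qed
    then have "ennreal \<bar>V x\<bar> \<le> ennreal \<eta> + ennreal (1 / \<eta>) * ennreal ((V x)\<^sup>2)"
      using \<eta> by (subst ennreal_mult[symmetric], simp, simp, subst ennreal_plus[symmetric]) (auto simp del: ennreal_plus intro: ennreal_leI)
    then show "ennreal \<bar>V x\<bar> * indicator (cball z R) x \<le> ennreal \<eta> * indicator (cball z R) x + ennreal (1 / \<eta>) * ennreal ((V x)\<^sup>2)"
      by (auto split: split_indicator)
  qed
  also have "\<dots> = ennreal \<eta> * emeasure lborel (cball z R) + ennreal (1 / \<eta>) * (\<integral>\<^sup>+x. ennreal ((V x)\<^sup>2) \<partial>lborel)"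
    by (subst nn_integral_add) (auto simp: nn_integral_cmult)
  also have "\<dots> \<le> ennreal \<eta> * ennreal ?v + ennreal (1 / \<eta>) * ennreal A"
    using em A by (intro add_mono mult_left_mono) auto
  also have "\<dots> = ennreal (\<eta> * ?v + A / \<eta>)"
    using \<eta> A v by (simp add: ennreal_mult'[symmetric] ennreal_plus[symmetric] del: ennreal_plus)
  finally show "(\<integral>\<^sup>+x. ennreal \<bar>V x\<bar> * indicator (cball z R) x \<partial>lborel) \<le> ennreal (\<eta> * ?v + A / \<eta>)" .
qed

text \<open>The maximal inequality supplies a square integrable majorant \<open>W\<close> of the
  increasing functions \<open>V k\<close>, hence convergence in mean square. Their energies are
  taken at the scale of their own mesh, so the scale shrinks together with the
  approximation.\<close>

theorem heat_sup_W1_2: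
  fixes u :: "'a::euclidean_space \<Rightarrow> real"
  assumes wg: "weak_grad u g" and u2: "(\<integral>\<^sup>+x. ennreal ((u x)\<^sup>2) \<partial>lborel) < \<infinity>"
    and g2: "(\<integral>\<^sup>+x. ennreal ((norm (g x))\<^sup>2) \<partial>lborel) < \<infinity>"
  obtains g' where "weak_grad (\<lambda>x. enn2real (heat_sup (\<lambda>x. ennreal \<bar>u x\<bar>) x)) g'"
    "(\<integral>\<^sup>+x. ennreal ((norm (g' x))\<^sup>2) \<partial>lborel) \<le> (\<integral>\<^sup>+x. ennreal ((norm (g x))\<^sup>2) \<partial>lborel)"
proof -
  let ?f = "\<lambda>x. ennreal \<bar>u x\<bar>"
  have [measurable]: "u \<in> borel_measurable borel" "g \<in> borel_measurable borel"
    using wg by (auto simp: weak_grad_def dest: loc_int_measurable)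
  define D where "D = enn2real (\<integral>\<^sup>+x. ennreal ((norm (g x))\<^sup>2) \<partial>lborel)"
  have D: "(\<integral>\<^sup>+x. ennreal ((norm (g x))\<^sup>2) \<partial>lborel) = ennreal D" "0 \<le> D" using g2 by (simp_all add: D_def)
  define S where "S k = heat_sup_dyadic k ?f" for k
  define M where "M = heat_sup ?f"
  define V where "V k x = enn2real (S k x)" for k x
  define W where "W x = enn2real (M x)" for x
  have [measurable]: "S k \<in> borel_measurable borel" "M \<in> borel_measurable borel" for k unfolding S_def M_def by measurable
  have [measurable]: "V k \<in> borel_measurable borel" "W \<in> borel_measurable borel" for k unfolding V_def[abs_def] W_def[abs_def] by measurable
  have Mfin: "AE x in lborel. M x < \<infinity>" and W2: "(\<integral>\<^sup>+x. ennreal ((W x)\<^sup>2) \<partial>lborel) < \<infinity>"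
    using heat_sup_Lp[of "\<lambda>x. \<bar>u x\<bar>" 2] u2 by (simp_all add: M_def W_def)
  have inc: "incseq (\<lambda>k. S k x)" for x unfolding S_def by (intro incseq_SucI heat_sup_dyadic_incseq)
  have MS: "M x = (SUP k. S k x)" for x unfolding M_def S_def by (rule heat_sup_eq_dyadic) measurable
  have VW: "V k x \<le> W x" if "M x < \<infinity>" for k x
    unfolding V_def W_def using that MS[of x] by (intro enn2real_mono) (auto intro: SUP_upper)
  have lim: "(\<lambda>k. V k x) \<longlonglongrightarrow> W x" if "M x < \<infinity>" for x
    unfolding V_def W_def using LIMSEQ_SUP[OF inc[of x]] that MS[of x] by (intro tendsto_enn2real) auto
  have V0: "0 \<le> V k x" for k x by (simp add: V_def)
  have V2: "(\<integral>\<^sup>+x. ennreal ((V k x)\<^sup>2) \<partial>lborel) \<le> (\<integral>\<^sup>+x. ennreal ((W x)\<^sup>2) \<partial>lborel)" for k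
    by (rule nn_integral_mono_AE, rule eventually_mono[OF Mfin]) (auto intro!: ennreal_leI power_mono VW V0)
  have Sfin: "AE x in lborel. S k x < \<infinity>" for k
    by (rule eventually_mono[OF Mfin]) (metis MS SUP_upper UNIV_I order.strict_trans1)
  define A where "A = enn2real (\<integral>\<^sup>+x. ennreal ((W x)\<^sup>2) \<partial>lborel)"
  have A: "(\<integral>\<^sup>+x. ennreal ((W x)\<^sup>2) \<partial>lborel) = ennreal A" "0 \<le> A" using W2 by (simp_all add: A_def)
  have bmW: "\<exists>c. ball_mean R W c" for R using ball_mean_square[of W A 1 R] A by auto
  have bmV: "\<exists>c. ball_mean R (V k) c" for R k using ball_mean_square[of "V k" A 1 R] V2[of k] A by auto
  let ?G = "\<lambda>k. heat_grad (1 / 2 ^ k) (V k)"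
  have G2: "(\<integral>\<^sup>+x. ennreal ((norm (?G k x))\<^sup>2) \<partial>lborel) \<le> ennreal D" for k
  proof (rule heat_grad_energy_le)
    have "energy (1 / 2 ^ k) (V k) \<le> energy (1 / 2 ^ k) (\<lambda>x. \<bar>u x\<bar>)"
      using energy_heat_sup_dyadic_le[of "\<lambda>x. \<bar>u x\<bar>" k] u2 Sfin[of k] V2[of k] W2
      unfolding V_def S_def by simp
    also have "\<dots> \<le> ennreal (2 * (1 / 2 ^ k)) * ennreal D"
      unfolding D(1)[symmetric] by (rule energy_weak_grad_le[OF _ wg]) simp
    finally show "energy (1 / 2 ^ k) (V k) \<le> ennreal (2 * (1 / 2 ^ k)) * ennreal D" .
  qed simp_all
  obtain \<gamma> g' where g': "weak_grad W g'" "\<And>k. midconv ?G k (\<gamma> k)" "AE x in lborel. (\<lambda>k. \<gamma> k x) \<longlonglongrightarrow> g' x"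
  proof (rule weak_grad_compactness[of W ?G])
    show "loc_int W" by (rule ball_mean_loc_int[OF _ bmW]) simp
    show "?G k \<in> borel_measurable borel" for k by measurable
    fix e :: real assume e: "0 < e"
    \<comment> \<open>The excess over \<open>K\<close> is at most the square divided by
      \<open>K\<close>, so its integral is at most D / K; the summand 1 keeps \<open>K\<close>
      positive.\<close>
    define K where "K = (D + 1) / e"
    have K: "0 < K" using e D(2) by (simp add: K_def)
    show "\<exists>K\<ge>0. \<forall>k. (\<integral>\<^sup>+x. ennreal (norm (?G k x) - K) \<partial>heat_measure 1) \<le> ennreal e"
    proof (intro exI[of _ K] conjI allI)
      fix k
      have "(\<integral>\<^sup>+x. ennreal (norm (?G k x) - K) \<partial>heat_measure 1) \<le> (\<integral>\<^sup>+x. ennreal (norm (?G k x) - K) \<partial>lborel)"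
        by (rule nn_integral_heat_measure_le_lborel) measurable
      also have "\<dots> \<le> (\<integral>\<^sup>+x. ennreal (1 / K) * ennreal ((norm (?G k x))\<^sup>2) \<partial>lborel)"
      proof (rule nn_integral_mono)
        fix x
        have "a - K \<le> 1 / K * a\<^sup>2" if "0 \<le> a" for a
        proof -
          have "K * (a - K) \<le> a\<^sup>2"
            using sum_squares_bound[of a K] K that by (smt (verit) mult_nonneg_nonneg power2_eq_square right_diff_distrib mult.commute zero_le_power2)
          then show ?thesis using K by (simp add: pos_le_divide_eq mult.commute)
        qed
        then show "ennreal (norm (?G k x) - K) \<le> ennreal (1 / K) * ennreal ((norm (?G k x))\<^sup>2)"
          using K by (subst ennreal_mult[symmetric]) (auto intro!: ennreal_leI)
      qed
      also have "\<dots> \<le> ennreal (1 / K) * ennreal D" by (subst nn_integral_cmult) (auto intro: mult_left_mono G2)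
      also have "\<dots> = ennreal (D / K)" using K D(2) by (simp add: ennreal_mult[symmetric])
      also have "\<dots> \<le> ennreal e"
        using e D(2) by (intro ennreal_leI) (simp add: K_def divide_le_eq add_nonneg_pos)
      finally show "(\<integral>\<^sup>+x. ennreal (norm (?G k x) - K) \<partial>heat_measure 1) \<le> ennreal e" .
    qed (use K in simp)
  next
    fix \<phi> :: "'a \<Rightarrow> real" and i :: 'a assume \<phi>: "\<phi> \<in> test_functions" and i: "i \<in> Basis"
    show "(\<lambda>n. \<integral>x. (?G n x \<bullet> i) * \<phi> x \<partial>lborel) \<longlonglongrightarrow> - (\<integral>x. W x * frechet_derivative \<phi> (at x) i \<partial>lborel)"
    proof (rule heat_grad_tendsto[OF _ bmW _ _ bmV _ _ \<phi> i])
      fix R e :: real assume e: "0 < e"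
      define v where "v = unit_ball_vol (real DIM('a)) * \<bar>R\<bar> ^ DIM('a)"
      have v: "0 \<le> v" by (simp add: v_def)
      \<comment> \<open>The volume term is then at most e / 2, and a squared distance below
        \<open>\<eta> * e / 2\<close> contributes the other half.\<close>
      define \<eta> where "\<eta> = e / (2 * (v + 1))"
      have \<eta>: "0 < \<eta>" using e v by (simp add: \<eta>_def)
      have "(\<lambda>k. \<integral>\<^sup>+x. ennreal ((V k x - W x)\<^sup>2) \<partial>lborel) \<longlonglongrightarrow> (\<integral>\<^sup>+x. 0 \<partial>(lborel :: 'a measure))"
      proof (rule nn_integral_dominated_convergence[where w="\<lambda>x. ennreal ((W x)\<^sup>2)"])
        show "AE x in lborel. ennreal ((V k x - W x)\<^sup>2) \<le> ennreal ((W x)\<^sup>2)" for k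
        proof (rule eventually_mono[OF Mfin])
          fix x assume "M x < \<infinity>"
          then have "\<bar>V k x - W x\<bar> \<le> \<bar>W x\<bar>" using VW[of x k] V0[of k x] by linarith
          then show "ennreal ((V k x - W x)\<^sup>2) \<le> ennreal ((W x)\<^sup>2)" by (intro ennreal_leI) (simp add: abs_le_square_iff)
        qed
        show "AE x in lborel. (\<lambda>k. ennreal ((V k x - W x)\<^sup>2)) \<longlonglongrightarrow> 0"
        proof (rule eventually_mono[OF Mfin])
          fix x assume "M x < \<infinity>"
          then have "(\<lambda>k. ennreal ((V k x - W x)\<^sup>2)) \<longlonglongrightarrow> ennreal ((W x - W x)\<^sup>2)" by (intro tendsto_intros lim tendsto_ennrealI)
          then show "(\<lambda>k. ennreal ((V k x - W x)\<^sup>2)) \<longlonglongrightarrow> 0" by simp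
        qed
      qed (use W2 in auto)
      then have "eventually (\<lambda>k. (\<integral>\<^sup>+x. ennreal ((V k x - W x)\<^sup>2) \<partial>lborel) < ennreal (\<eta> * e / 2)) sequentially"
        using \<eta> e by (intro order_tendstoD(2)) auto
      then obtain N where N: "\<And>k. k \<ge> N \<Longrightarrow> (\<integral>\<^sup>+x. ennreal ((V k x - W x)\<^sup>2) \<partial>lborel) < ennreal (\<eta> * e / 2)"
        by (auto simp: eventually_sequentially)
      have "\<eta> * v + (\<eta> * e / 2) / \<eta> \<le> e"
      proof -
        have "\<eta> * v \<le> \<eta> * (v + 1)" using \<eta> by simp
        also have "\<dots> = e / 2" using v by (auto simp: \<eta>_def nonzero_divide_eq_eq)
        finally show ?thesis using \<eta> by simp
      qed
      then have "ball_mean R (\<lambda>x. V k x - W x) e" if "k \<ge> N" for k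
        using ball_mean_square[of "\<lambda>x. V k x - W x" "\<eta> * e / 2" \<eta> R] N[OF that] \<eta> e
        unfolding ball_mean_def v_def[symmetric] by (auto intro: order_trans[OF _ ennreal_leI] less_imp_le)
      then show "\<exists>N. \<forall>n\<ge>N. ball_mean R (\<lambda>x. V n x - W x) e" by blast
    next
      show "(\<lambda>k. 1 / 2 ^ k :: real) \<longlonglongrightarrow> 0" using LIMSEQ_realpow_zero[of "1 / 2"] by (simp add: power_one_over)
    qed simp_all
  qed blast
  have "(\<integral>\<^sup>+x. ennreal ((norm (g' x))\<^sup>2) \<partial>lborel) \<le> ennreal D"
  proof (rule midconv_limit_nn_integral_le[OF g'(2,3), where \<Phi>="\<lambda>a. ennreal ((norm a)\<^sup>2)"])
    show "continuous_on UNIV (\<lambda>a::'a. ennreal ((norm a)\<^sup>2))" by (intro continuous_on_ennreal continuous_intros)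
    fix a b :: 'a
    have "(norm ((1 / 2) *\<^sub>R (a + b)))\<^sup>2 \<le> ((norm a + norm b) / 2)\<^sup>2"
      using norm_triangle_ineq[of a b] by (intro power_mono) auto
    also have "\<dots> \<le> ((norm a)\<^sup>2 + (norm b)\<^sup>2) / 2"
      using sum_squares_bound[of "norm a" "norm b"] by (simp add: power2_eq_square field_simps)
    finally have "ennreal ((norm ((1 / 2) *\<^sub>R (a + b)))\<^sup>2) \<le> ennreal (((norm a)\<^sup>2 + (norm b)\<^sup>2) / 2)" by (rule ennreal_leI)
    also have "\<dots> = (ennreal ((norm a)\<^sup>2) + ennreal ((norm b)\<^sup>2)) / 2"
      by (subst ennreal_plus[symmetric]) (auto simp: divide_ennreal[of _ 2, simplified, symmetric] simp del: ennreal_plus)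
    finally show "ennreal ((norm ((1 / 2) *\<^sub>R (a + b)))\<^sup>2) \<le> (ennreal ((norm a)\<^sup>2) + ennreal ((norm b)\<^sup>2)) / 2" .
  qed (use G2 in auto)
  then show ?thesis using g'(1) D(1) unfolding W_def M_def by (intro that[of g']) simp_all
qed

section \<open>Sobolev functions on the line\<close>

text \<open>The layer cake formula for the second derivative of \<open>t\<^sup>p\<close>: an inequality between all
  integrals of excesses \<open>(t - l)\<^sub>+\<close> yields one between \<open>L\<^sup>p\<close> norms.\<close>

lemma nn_integral_powr_excess:
  fixes p t :: real
  assumes p: "1 < p" and t: "0 \<le> t"
  shows "(\<integral>\<^sup>+l. ennreal (p * (p - 1) * l powr (p - 2)) * indicator {0<..} l * ennreal (t - l) \<partial>lborel) = ennreal (t powr p)"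
proof -
  let ?w = "\<lambda>l. ennreal (p * (p - 1) * l powr (p - 2))"
  let ?J = "\<lambda>r l :: real. if 0 < l \<and> l < r \<and> r < t then ?w l else 0"
  have "ennreal (t powr p) = (\<integral>\<^sup>+r. ennreal (p * r powr (p - 1)) * indicator {0<..<t} r \<partial>lborel)"
    using nn_integral_powr_Ioo[of p t] p t by simp
  also have "\<dots> = (\<integral>\<^sup>+r. \<integral>\<^sup>+l. ?J r l \<partial>lborel \<partial>lborel)"
  proof (rule nn_integral_cong)
    fix r :: real
    show "ennreal (p * r powr (p - 1)) * indicator {0<..<t} r = (\<integral>\<^sup>+l. ?J r l \<partial>lborel)"
    proof (cases "0 < r \<and> r < t")
      case True
      have "ennreal (p * r powr (p - 1)) = ennreal p * (\<integral>\<^sup>+l. ennreal ((p - 1) * l powr (p - 1 - 1)) * indicator {0<..<r} l \<partial>lborel)"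
        using nn_integral_powr_Ioo[of "p - 1" r] p True by (simp add: ennreal_mult)
      also have "\<dots> = (\<integral>\<^sup>+l. ennreal p * (ennreal ((p - 1) * l powr (p - 1 - 1)) * indicator {0<..<r} l) \<partial>lborel)"
        by (rule nn_integral_cmult[symmetric]) measurable
      also have "\<dots> = (\<integral>\<^sup>+l. ?J r l \<partial>lborel)"
        using True p by (intro nn_integral_cong) (auto simp: ennreal_mult[symmetric] mult.assoc split: split_indicator)
      finally show ?thesis using True by simp
    next
      case False
      then have "?J r l = 0" for l by auto
      then show ?thesis using False by (auto split: split_indicator)
    qed
  qed
  also have "\<dots> = (\<integral>\<^sup>+l. \<integral>\<^sup>+r. ?J r l \<partial>lborel \<partial>lborel)"
    by (rule lborel_pair.Fubini'[symmetric]) measurable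
  also have "\<dots> = (\<integral>\<^sup>+l. ?w l * indicator {0<..} l * ennreal (t - l) \<partial>lborel)"
  proof (rule nn_integral_cong)
    fix l :: real
    have "(\<integral>\<^sup>+r. ?J r l \<partial>lborel) = (\<integral>\<^sup>+r. (?w l * indicator {0<..} l) * indicator {l<..<t} r \<partial>lborel)"
      by (rule nn_integral_cong) (auto split: split_indicator)
    also have "\<dots> = ?w l * indicator {0<..} l * ennreal (t - l)"
      by (subst nn_integral_cmult_indicator) (auto simp: ennreal_neg, cases "l \<le> t", auto simp: ennreal_neg)
    finally show "(\<integral>\<^sup>+r. ?J r l \<partial>lborel) = ?w l * indicator {0<..} l * ennreal (t - l)" .
  qed
  finally show ?thesis by simp
qed

lemma nn_integral_powr_le_excess:
  fixes g \<gamma> :: "'a::euclidean_space \<Rightarrow> real"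
  assumes [measurable]: "g \<in> borel_measurable borel" "\<gamma> \<in> borel_measurable borel" and p: "1 \<le> p"
    and ex: "\<And>l. 0 \<le> l \<Longrightarrow> (\<integral>\<^sup>+x. ennreal (\<bar>\<gamma> x\<bar> - l) \<partial>lborel) \<le> (\<integral>\<^sup>+x. ennreal (\<bar>g x\<bar> - l) \<partial>lborel)"
  shows "(\<integral>\<^sup>+x. ennreal (\<bar>\<gamma> x\<bar> powr p) \<partial>lborel) \<le> (\<integral>\<^sup>+x. ennreal (\<bar>g x\<bar> powr p) \<partial>lborel)"
proof (cases "p = 1")
  \<comment> \<open>For p = 1 the weight \<open>p * (p - 1)\<close> of the layer cake formula
    vanishes; the excess at level 0 is already the integrand.\<close>
  case True
  then show ?thesis using ex[of 0] by simp
next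
  case False
  then have p: "1 < p" using p by simp
  let ?w = "\<lambda>l. ennreal (p * (p - 1) * l powr (p - 2)) * indicator {0<..} l"
  have eq: "(\<integral>\<^sup>+x. ennreal (\<bar>h x\<bar> powr p) \<partial>lborel) = (\<integral>\<^sup>+l. ?w l * (\<integral>\<^sup>+x. ennreal (\<bar>h x\<bar> - l) \<partial>lborel) \<partial>lborel)"
    if [measurable]: "h \<in> borel_measurable borel" for h :: "'a \<Rightarrow> real"
  proof -
    have "(\<integral>\<^sup>+x. ennreal (\<bar>h x\<bar> powr p) \<partial>lborel) = (\<integral>\<^sup>+x. \<integral>\<^sup>+l. ?w l * ennreal (\<bar>h x\<bar> - l) \<partial>lborel \<partial>lborel)"
      by (rule nn_integral_cong, rule nn_integral_powr_excess[OF p, symmetric]) simp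
    also have "\<dots> = (\<integral>\<^sup>+l. \<integral>\<^sup>+x. ?w l * ennreal (\<bar>h x\<bar> - l) \<partial>lborel \<partial>lborel)"
      by (rule lborel_pair.Fubini') measurable
    finally show ?thesis by (simp add: nn_integral_cmult)
  qed
  show ?thesis unfolding eq[OF \<open>g \<in> _\<close>] eq[OF \<open>\<gamma> \<in> _\<close>]
  proof (rule nn_integral_mono)
    fix l show "?w l * (\<integral>\<^sup>+x. ennreal (\<bar>\<gamma> x\<bar> - l) \<partial>lborel) \<le> ?w l * (\<integral>\<^sup>+x. ennreal (\<bar>g x\<bar> - l) \<partial>lborel)"
      using ex[of l] by (cases "0 < l") (auto intro: mult_left_mono)
  qed
qed

section \<open>Weak derivatives from truncated variation\<close>

lemma excess_le_var_excess:
  assumes "a < b"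
  shows "ennreal (\<bar>W b - W a\<bar> - l * (b - a)) \<le> var_excess l W"
proof -
  have "ennreal (\<bar>W b - W a\<bar> - l * (b - a)) \<le> ennreal (chain_sum (\<lambda>x y. max 0 (\<bar>W y - W x\<bar> - l * (y - x))) [a, b])"
    by (intro ennreal_leI) (simp add: chain_sum_Cons)
  also have "\<dots> \<le> var_excess l W" unfolding var_excess_def using assms by (intro SUP_upper) simp
  finally show ?thesis .
qed

lemma nn_integral_excess_tendsto_0:
  fixes g :: "'a \<Rightarrow> real"
  assumes [measurable]: "g \<in> borel_measurable M" and fin: "(\<integral>\<^sup>+x. ennreal (\<bar>g x\<bar> - l) \<partial>M) < \<infinity>"
  shows "(\<lambda>n. \<integral>\<^sup>+x. ennreal (\<bar>g x\<bar> - (l + real n)) \<partial>M) \<longlonglongrightarrow> 0"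
proof -
  have "(\<lambda>n. \<integral>\<^sup>+x. ennreal (\<bar>g x\<bar> - (l + real n)) \<partial>M) \<longlonglongrightarrow> (\<integral>\<^sup>+x. 0 \<partial>M)"
  proof (rule nn_integral_dominated_convergence[where w="\<lambda>x. ennreal (\<bar>g x\<bar> - l)"])
    show "AE x in M. (\<lambda>n. ennreal (\<bar>g x\<bar> - (l + real n))) \<longlonglongrightarrow> 0"
    proof (rule AE_I2, rule tendsto_eventually)
      fix x
      obtain N :: nat where "\<bar>g x\<bar> - l \<le> real N" using real_arch_simple by blast
      then show "eventually (\<lambda>n. ennreal (\<bar>g x\<bar> - (l + real n)) = 0) sequentially"
        unfolding eventually_sequentially by (intro exI[of _ N]) (auto intro!: ennreal_neg)
    qed
  qed (use fin in \<open>auto intro!: ennreal_leI\<close>)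
  then show ?thesis by simp
qed

text \<open>All difference quotients of \<open>W\<close> inherit the excess bounds of
  \<open>g\<close>. The bounds at large levels are uniform integrability, and those at every level
  survive the limit by convexity and Fatou's lemma. No regularity of \<open>W\<close> is
  presupposed, and p = 1 needs no separate treatment.\<close>

theorem weak_grad_var_excess:
  fixes W g :: "real \<Rightarrow> real"
  assumes W[measurable]: "W \<in> borel_measurable borel" and g[measurable]: "g \<in> borel_measurable borel"
    and ex: "\<And>l. 0 \<le> l \<Longrightarrow> var_excess l W \<le> (\<integral>\<^sup>+x. ennreal (\<bar>g x\<bar> - l) \<partial>lborel)"
    and fin: "(\<integral>\<^sup>+x. ennreal (\<bar>g x\<bar> - 1) \<partial>lborel) < \<infinity>"
  obtains \<gamma> where "weak_grad W \<gamma>"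
    "\<And>l. 0 \<le> l \<Longrightarrow> (\<integral>\<^sup>+x. ennreal (\<bar>\<gamma> x\<bar> - l) \<partial>lborel) \<le> (\<integral>\<^sup>+x. ennreal (\<bar>g x\<bar> - l) \<partial>lborel)"
proof -
  define h where "h n = 1 / real (Suc n)" for n
  have h: "0 < h n" "h n \<le> 1" for n by (auto simp: h_def)
  define G where "G n x = (W (x + h n) - W x) / h n" for n x
  have Gm[measurable]: "G n \<in> borel_measurable borel" for n unfolding G_def[abs_def] by measurable
  have Gex: "(\<integral>\<^sup>+x. ennreal (norm (G n x) - l) \<partial>lborel) \<le> (\<integral>\<^sup>+x. ennreal (\<bar>g x\<bar> - l) \<partial>lborel)" if "0 \<le> l" for n l
    unfolding G_def by (rule order_trans[OF var_excess_difference_quotient[OF W h(1)] ex[OF that]])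
  have loc: "loc_int W"
  proof (rule loc_intI)
    fix R :: real
    \<comment> \<open>Level 1 instead of 0, since the total variation may be infinite; the growth of
      \<open>W\<close> is then at most linear.\<close>
    obtain A where A: "0 \<le> A" "var_excess 1 W = ennreal A"
      using ex[of 1] fin by (cases "var_excess 1 W") (auto simp: top_unique)
    have bd: "\<bar>W b - W a\<bar> \<le> (b - a) + A" if "a < b" for a b
    proof -
      have "ennreal (\<bar>W b - W a\<bar> - 1 * (b - a)) \<le> ennreal A" using excess_le_var_excess[OF that, of W 1] A by simp
      then show ?thesis using A(1) by (simp add: ennreal_le_iff)
    qed
    have Wb: "\<bar>W x\<bar> \<le> \<bar>W 0\<bar> + \<bar>x\<bar> + A" for x
      using bd[of 0 x] bd[of x 0] A(1) by (cases x "0::real" rule: linorder_cases) auto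
    have "(\<integral>\<^sup>+x. ennreal (norm (W x)) * indicator (cball 0 R) x \<partial>lborel) \<le> (\<integral>\<^sup>+x. ennreal (\<bar>W 0\<bar> + \<bar>R\<bar> + A) * indicator (cball (0::real) R) x \<partial>lborel)"
    proof (rule nn_integral_mono)
      fix x
      show "ennreal (norm (W x)) * indicator (cball 0 R) x \<le> ennreal (\<bar>W 0\<bar> + \<bar>R\<bar> + A) * indicator (cball 0 R) x"
        using Wb[of x] by (auto split: split_indicator intro!: ennreal_leI simp del: ennreal_plus)
    qed
    also have "\<dots> < \<infinity>"
      using emeasure_lborel_cball_finite[of "0::real" R]
      by (subst nn_integral_cmult_indicator) (auto simp: ennreal_mult_less_top simp del: ennreal_plus)
    finally show "(\<integral>\<^sup>+x. ennreal (norm (W x) * indicator (cball 0 R) x) \<partial>lborel) < \<infinity>"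
      by (simp add: ennreal_mult ennreal_indicator)
  qed simp
  obtain \<gamma>' \<gamma> where \<gamma>: "weak_grad W \<gamma>" "\<And>k. midconv G k (\<gamma>' k)" "AE x in lborel. (\<lambda>k. \<gamma>' k x) \<longlonglongrightarrow> \<gamma> x"
  proof (rule weak_grad_compactness[OF loc Gm])
    fix e :: real assume e: "0 < e"
    have "eventually (\<lambda>n. (\<integral>\<^sup>+x. ennreal (\<bar>g x\<bar> - (1 + real n)) \<partial>lborel) < ennreal e) sequentially"
      using nn_integral_excess_tendsto_0[of g lborel 1] fin e by (intro order_tendstoD(2)) auto
    then obtain N :: nat where N: "(\<integral>\<^sup>+x. ennreal (\<bar>g x\<bar> - (1 + real N)) \<partial>lborel) < ennreal e"
      by (auto simp: eventually_sequentially)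
    show "\<exists>K\<ge>0. \<forall>n. (\<integral>\<^sup>+x. ennreal (norm (G n x) - K) \<partial>heat_measure 1) \<le> ennreal e"
    proof (intro exI[of _ "1 + real N"] conjI allI)
      fix n
      have "(\<integral>\<^sup>+x. ennreal (norm (G n x) - (1 + real N)) \<partial>heat_measure 1) \<le> (\<integral>\<^sup>+x. ennreal (norm (G n x) - (1 + real N)) \<partial>lborel)"
        by (rule nn_integral_heat_measure_le_lborel) measurable
      also have "\<dots> \<le> (\<integral>\<^sup>+x. ennreal (\<bar>g x\<bar> - (1 + real N)) \<partial>lborel)" by (rule Gex) simp
      finally show "(\<integral>\<^sup>+x. ennreal (norm (G n x) - (1 + real N)) \<partial>heat_measure 1) \<le> ennreal e" using N by simp
    qed simp
  next
    fix \<phi> :: "real \<Rightarrow> real" and i :: real assume \<phi>: "\<phi> \<in> test_functions" and "i \<in> Basis"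
    then have i: "i = 1" by simp
    obtain R B where RB: "0 < R" "0 \<le> B" "\<And>x. (\<phi> has_derivative frechet_derivative \<phi> (at x)) (at x)"
      "\<And>x y. \<bar>\<phi> x - \<phi> y\<bar> \<le> B * norm (x - y)" "\<And>x. norm x > R \<Longrightarrow> \<phi> x = 0"
      by (rule test_function_facts[OF \<phi>]) blast
    have [measurable]: "\<phi> \<in> borel_measurable borel" "(\<lambda>x. frechet_derivative \<phi> (at x) 1) \<in> borel_measurable borel"
      using borel_measurable_test_function[OF \<phi>] borel_measurable_test_function_derivative[OF \<phi>] by auto
    have eq: "(\<integral>x. (G n x \<bullet> i) * \<phi> x \<partial>lborel) = (\<integral>x. W x * ((\<phi> (x - h n) - \<phi> x) / h n) \<partial>lborel)" for n
    proof -
      have I: "integrable lborel (\<lambda>x. W (x + h n) * \<phi> x)" "integrable lborel (\<lambda>x. W x * \<phi> x)" "integrable lborel (\<lambda>x. W x * \<phi> (x - h n))"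
        using loc_int_test_function(1)[OF loc_int_translate[OF loc] \<phi>] loc_int_test_function(1)[OF loc \<phi>]
          test_function_shift_integrable[OF loc \<phi>] by auto
      have "(\<integral>x. (G n x \<bullet> i) * \<phi> x \<partial>lborel) = (\<integral>x. (W (x + h n) * \<phi> x - W x * \<phi> x) / h n \<partial>lborel)"
        by (intro Bochner_Integration.integral_cong refl) (simp add: G_def i left_diff_distrib diff_divide_distrib)
      also have "\<dots> = ((\<integral>x. W (x + h n) * \<phi> x \<partial>lborel) - (\<integral>x. W x * \<phi> x \<partial>lborel)) / h n"
        using I by simp
      also have "(\<integral>x. W (x + h n) * \<phi> x \<partial>lborel) = (\<integral>x. W x * \<phi> (x - h n) \<partial>lborel)"
        using integral_lborel_translate[of "\<lambda>x. W x * \<phi> (x - h n)" "h n"] by simp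
      also have "((\<integral>x. W x * \<phi> (x - h n) \<partial>lborel) - (\<integral>x. W x * \<phi> x \<partial>lborel)) / h n = (\<integral>x. (W x * \<phi> (x - h n) - W x * \<phi> x) / h n \<partial>lborel)"
        using I by simp
      also have "\<dots> = (\<integral>x. W x * ((\<phi> (x - h n) - \<phi> x) / h n) \<partial>lborel)"
        by (intro Bochner_Integration.integral_cong refl) (simp add: right_diff_distrib diff_divide_distrib)
      finally show ?thesis .
    qed
    have "(\<lambda>n. \<integral>x. W x * ((\<phi> (x - h n) - \<phi> x) / h n) \<partial>lborel) \<longlonglongrightarrow> (\<integral>x. - (W x * frechet_derivative \<phi> (at x) 1) \<partial>lborel)"
    proof (rule integral_dominated_convergence[where w="\<lambda>x. B * norm (indicator (cball 0 (R + 1)) x *\<^sub>R W x)"])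
      have "set_integrable lborel (cball 0 (R + 1)) W" using loc by (simp add: loc_int_def)
      then show "integrable lborel (\<lambda>x. B * norm (indicator (cball 0 (R + 1)) x *\<^sub>R W x))"
        unfolding set_integrable_def by (intro integrable_mult_right integrable_norm)
      show "AE x in lborel. (\<lambda>n. W x * ((\<phi> (x - h n) - \<phi> x) / h n)) \<longlonglongrightarrow> - (W x * frechet_derivative \<phi> (at x) 1)"
      proof (rule AE_I2)
        fix x
        have "(\<phi> has_field_derivative frechet_derivative \<phi> (at x) 1) (at x)"
          using RB(3)[of x] has_derivative_bounded_linear[OF RB(3)[of x]]
          by (simp add: has_field_derivative_def) (metis (no_types, lifting) bounded_linear.linear linear_cmul mult.commute mult.right_neutral real_scaleR_def has_derivative_eq_rhs ext)
        then have d: "((\<lambda>t. (\<phi> (x + t) - \<phi> x) / t) \<longlongrightarrow> frechet_derivative \<phi> (at x) 1) (at 0)" by (simp add: DERIV_def)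
        have "(\<lambda>n. - h n) \<longlonglongrightarrow> - 0"
          unfolding h_def using LIMSEQ_inverse_real_of_nat by (intro tendsto_minus) (simp add: inverse_eq_divide)
        then have "filterlim (\<lambda>n. - h n) (at 0) sequentially"
          using h(1) by (intro filterlim_atI always_eventually) (auto simp: less_imp_neq[THEN not_sym])
        from filterlim_compose[OF d this]
        have "(\<lambda>n. (\<phi> (x + - h n) - \<phi> x) / - h n) \<longlonglongrightarrow> frechet_derivative \<phi> (at x) 1" .
        from tendsto_mult[OF tendsto_const[of "- W x"] this]
        show "(\<lambda>n. W x * ((\<phi> (x - h n) - \<phi> x) / h n)) \<longlonglongrightarrow> - (W x * frechet_derivative \<phi> (at x) 1)" by simp
      qed
      fix n
      show "AE x in lborel. norm (W x * ((\<phi> (x - h n) - \<phi> x) / h n)) \<le> B * norm (indicator (cball 0 (R + 1)) x *\<^sub>R W x)"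
      proof (rule AE_I2)
        fix x
        show "norm (W x * ((\<phi> (x - h n) - \<phi> x) / h n)) \<le> B * norm (indicator (cball 0 (R + 1)) x *\<^sub>R W x)"
        proof (cases "norm x \<le> R + 1")
          case True
          have "\<bar>\<phi> (x - h n) - \<phi> x\<bar> / h n \<le> B * h n / h n"
            using RB(4)[of "x - h n" x] h(1)[of n] by (intro divide_right_mono) auto
          then have "\<bar>W x\<bar> * (\<bar>\<phi> (x - h n) - \<phi> x\<bar> / h n) \<le> \<bar>W x\<bar> * B" using h(1)[of n] by (intro mult_left_mono) auto
          then show ?thesis using True h(1)[of n] by (simp add: abs_mult mult.commute)
        next
          case False
          then have "\<phi> x = 0" "\<phi> (x - h n) = 0" using RB(5)[of x] RB(5)[of "x - h n"] h[of n] by auto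
          then show ?thesis using RB(2) by simp
        qed
      qed
    qed measurable
    then show "(\<lambda>n. \<integral>x. (G n x \<bullet> i) * \<phi> x \<partial>lborel) \<longlonglongrightarrow> - (\<integral>x. W x * frechet_derivative \<phi> (at x) i \<partial>lborel)"
      unfolding eq by (simp add: i)
  qed blast
  have "(\<integral>\<^sup>+x. ennreal (norm (\<gamma> x) - l) \<partial>lborel) \<le> (\<integral>\<^sup>+x. ennreal (\<bar>g x\<bar> - l) \<partial>lborel)" if l: "0 \<le> l" for l
    by (rule midconv_limit_nn_integral_le[OF \<gamma>(2,3), where \<Phi>="\<lambda>a. ennreal (norm a - l)"])
      (simp, intro continuous_on_ennreal continuous_intros, rule norm_excess_midpoint, rule Gex[OF l])
  then show ?thesis using \<gamma>(1) by (intro that[of \<gamma>]) auto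
qed

lemma AE_lborel_ex:
  assumes "AE x in (lborel :: 'a::euclidean_space measure). P x"
  shows "\<exists>x. P x"
proof (rule ccontr)
  assume "\<not> (\<exists>x. P x)"
  then have "ae_filter (lborel :: 'a measure) = bot" using assms by (simp add: trivial_limit_def)
  then show False by (simp add: ae_filter_eq_bot_iff)
qed

text \<open>The datum is first replaced by its representative \<open>U\<close>, whose increments are
  bounded by integrals of |g|: truncated variation depends on values at single points, while the
  maximal function is unchanged.\<close>

theorem heat_sup_W1_line:
  fixes u g :: "real \<Rightarrow> real"
  assumes wg: "weak_grad u g" and p: "1 \<le> p"
    and up: "(\<integral>\<^sup>+x. ennreal (\<bar>u x\<bar> powr p) \<partial>lborel) < \<infinity>" and gp: "(\<integral>\<^sup>+x. ennreal (\<bar>g x\<bar> powr p) \<partial>lborel) < \<infinity>"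
  defines "M \<equiv> heat_sup (\<lambda>x. ennreal \<bar>u x\<bar>)"
  obtains \<gamma> where "\<And>x. M x < \<infinity>" "weak_grad (\<lambda>x. enn2real (M x)) \<gamma>"
    "(\<integral>\<^sup>+x. ennreal (\<bar>\<gamma> x\<bar> powr p) \<partial>lborel) \<le> (\<integral>\<^sup>+x. ennreal (\<bar>g x\<bar> powr p) \<partial>lborel)"
    "p = 1 \<Longrightarrow> \<exists>B. \<forall>x. M x \<le> ennreal B"
proof -
  have [measurable]: "u \<in> borel_measurable borel" "g \<in> borel_measurable borel"
    using wg by (auto simp: weak_grad_def dest: loc_int_measurable)
  obtain U where [measurable]: "U \<in> borel_measurable borel" and uU: "AE x in lborel. u x = U x"
    and U: "\<And>a b. a \<le> b \<Longrightarrow> ennreal \<bar>U b - U a\<bar> \<le> (\<integral>\<^sup>+x. ennreal \<bar>g x\<bar> * indicator {a<..b} x \<partial>lborel)"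
    using weak_grad_representative[OF wg] by blast
  have M: "M = heat_sup (\<lambda>x. ennreal \<bar>U x\<bar>)"
    unfolding M_def heat_sup_def
    by (intro ext SUP_cong refl heat_AE_cong eventually_mono[OF uU]) auto
  have Up: "(\<integral>\<^sup>+x. ennreal (\<bar>U x\<bar> powr p) \<partial>lborel) < \<infinity>"
    using up by (subst nn_integral_cong_AE[OF eventually_mono[OF uU], of _ "\<lambda>x. ennreal (\<bar>u x\<bar> powr p)"]) auto
  interpret heat_datum "\<lambda>x. \<bar>U x\<bar>" by (rule heat_datum_Lp[OF _ p Up]) simp
  have ex: "var_excess l (\<lambda>x. \<bar>U x\<bar>) \<le> (\<integral>\<^sup>+x. ennreal (\<bar>g x\<bar> - l) \<partial>lborel)" if "0 \<le> l" for l
    by (rule order_trans[OF var_excess_abs_le var_excess_le_nn_integral[OF _ that U]]) auto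
  have fin1: "(\<integral>\<^sup>+x. ennreal (\<bar>g x\<bar> - 1) \<partial>lborel) < \<infinity>"
  proof -
    have "(\<integral>\<^sup>+x. ennreal (\<bar>g x\<bar> - 1) \<partial>lborel) \<le> (\<integral>\<^sup>+x. ennreal (\<bar>g x\<bar> powr p) \<partial>lborel)"
    proof (intro nn_integral_mono ennreal_leI)
      fix x
      show "\<bar>g x\<bar> - 1 \<le> \<bar>g x\<bar> powr p"
      proof (cases "1 \<le> \<bar>g x\<bar>")
        case True
        then have "\<bar>g x\<bar> powr 1 \<le> \<bar>g x\<bar> powr p" using p by (intro powr_mono)
        then show ?thesis by simp
      next
        case False
        then show ?thesis using powr_ge_zero[of "\<bar>g x\<bar>" p] by linarith
      qed
    qed
    then show ?thesis using gp by (rule order.strict_trans1)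
  qed
  have bdd: "\<exists>B. \<forall>x. M x \<le> ennreal B" if "p = 1"
  proof -
    define A where "A = enn2real (\<integral>\<^sup>+x. ennreal \<bar>g x\<bar> \<partial>lborel)"
    have A: "(\<integral>\<^sup>+x. ennreal \<bar>g x\<bar> \<partial>lborel) = ennreal A" "0 \<le> A" using gp that by (simp_all add: A_def)
    have d: "\<bar>U b - U a\<bar> \<le> A" if "a \<le> b" for a b
    proof -
      have "ennreal \<bar>U b - U a\<bar> \<le> (\<integral>\<^sup>+x. ennreal \<bar>g x\<bar> * indicator {a<..b} x \<partial>lborel)" by (rule U[OF that])
      also have "\<dots> \<le> ennreal A" unfolding A(1)[symmetric] by (intro nn_integral_mono) (auto split: split_indicator)
      finally show ?thesis using A(2) by simp
    qed
    have "\<bar>U x\<bar> \<le> \<bar>U 0\<bar> + A" for x using d[of 0 x] d[of x 0] by linarith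
    then have "M x \<le> ennreal (\<bar>U 0\<bar> + A)" for x
      unfolding M heat_sup_def by (intro SUP_least heat_bounded) auto
    then show ?thesis by blast
  qed
  have fin: "M x < \<infinity>" for x
  proof (cases "p = 1")
    case True
    then show ?thesis using bdd by (metis ennreal_less_top infinity_ennreal_def order.strict_trans1)
  next
    case False
    then have "AE x in lborel. M x < \<infinity>"
      unfolding M using p Up by (intro heat_sup_Lp(1)[of _ p]) auto
    then obtain x0 where "M x0 < \<infinity>" using AE_lborel_ex by blast
    then show ?thesis unfolding M
      by (rule heat_sup_finite[of _ 1]) (use order.strict_trans1[OF ex[of 1] fin1] in auto)
  qed
  have [measurable]: "M \<in> borel_measurable borel" unfolding M_def by measurable
  obtain \<gamma> where \<gamma>: "weak_grad (\<lambda>x. enn2real (M x)) \<gamma>"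
    "\<And>l. 0 \<le> l \<Longrightarrow> (\<integral>\<^sup>+x. ennreal (\<bar>\<gamma> x\<bar> - l) \<partial>lborel) \<le> (\<integral>\<^sup>+x. ennreal (\<bar>g x\<bar> - l) \<partial>lborel)"
  proof (rule weak_grad_var_excess[of "\<lambda>x. enn2real (M x)" g])
    show "var_excess l (\<lambda>x. enn2real (M x)) \<le> (\<integral>\<^sup>+x. ennreal (\<bar>g x\<bar> - l) \<partial>lborel)" if "0 \<le> l" for l
      using order_trans[OF var_excess_heat_sup[OF fin[unfolded M] that] ex[OF that]] unfolding M .
  qed (use fin1 in auto)
  have [measurable]: "\<gamma> \<in> borel_measurable borel" using \<gamma>(1) by (auto simp: weak_grad_def dest: loc_int_measurable)
  show ?thesis by (rule that[OF fin \<gamma>(1) nn_integral_powr_le_excess[OF _ _ p \<gamma>(2)] bdd]) auto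
qed

theorem heat_sup_bounded_variation:
  fixes f :: "real \<Rightarrow> real"
  assumes bv: "bounded_variation f"
  defines "M \<equiv> heat_sup (\<lambda>x. ennreal \<bar>f x\<bar>)"
  shows "M x < \<infinity>" and "total_variation (\<lambda>x. enn2real (M x)) \<le> total_variation f"
proof -
  have [measurable]: "f \<in> borel_measurable borel" by (rule bounded_variation_borel_measurable[OF bv])
  obtain B where B: "\<And>x. \<bar>f x\<bar> \<le> B" using bounded_variation_bounded[OF bv] by blast
  interpret heat_datum "\<lambda>x. \<bar>f x\<bar>" by (rule heat_datum_bounded[of _ B]) (use B in auto)
  have fin: "M x < \<infinity>" for x
  proof -
    have "M x \<le> ennreal B" unfolding M_def heat_sup_def by (intro SUP_least heat_bounded B) auto
    then show ?thesis by (rule order.strict_trans1) simp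
  qed
  then show "M x < \<infinity>" .
  show "total_variation (\<lambda>x. enn2real (M x)) \<le> total_variation f"
    using order_trans[OF var_excess_heat_sup[OF fin[unfolded M_def], of 0] var_excess_abs_le]
    by (simp add: total_variation_eq_var_excess M_def)
qed

section \<open>Lebesgue and Sobolev spaces\<close>

lemma Lp_norm_finite_iff:
  assumes "p \<noteq> \<infinity>"
  shows "Lp_norm p f < \<infinity> \<longleftrightarrow> (\<integral>\<^sup>+x. ennreal (\<bar>f x\<bar> powr enn2real p) \<partial>lborel) < \<infinity>"
  using assms by (auto simp: Lp_norm_def Let_def nn_integral_completion top.not_eq_extremum)

lemma Lp_norm_integral_mono:
  assumes p: "p \<noteq> \<infinity>"
    and le: "(\<integral>\<^sup>+x. ennreal (\<bar>f x\<bar> powr enn2real p) \<partial>lborel) \<le> (\<integral>\<^sup>+x. ennreal (\<bar>g x\<bar> powr enn2real p) \<partial>lborel)"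
  shows "Lp_norm p f \<le> Lp_norm p g"
proof (cases "(\<integral>\<^sup>+x. ennreal (\<bar>g x\<bar> powr enn2real p) \<partial>lborel) = \<infinity>")
  case True
  then show ?thesis using p by (simp add: Lp_norm_def nn_integral_completion)
next
  case False
  then have "(\<integral>\<^sup>+x. ennreal (\<bar>f x\<bar> powr enn2real p) \<partial>lborel) \<noteq> \<infinity>"
    using le by (auto simp: top_unique)
  then show ?thesis
    using p False le
    by (auto simp: Lp_norm_def nn_integral_completion Let_def top.not_eq_extremum intro!: ennreal_leI powr_mono2 enn2real_mono)
qed

lemma Lp_norm_AE_mono:
  fixes f g :: "'a::euclidean_space \<Rightarrow> real"
  assumes f: "f \<in> borel_measurable lebesgue" and le: "AE x in lborel. \<bar>f x\<bar> \<le> \<bar>g x\<bar>"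
  shows "Lp_norm p f \<le> Lp_norm p g"
proof (cases "p = \<infinity>")
  case True
  have "AE x in lebesgue. ennreal \<bar>f x\<bar> \<le> ennreal \<bar>g x\<bar>"
    unfolding AE_completion_iff by (rule eventually_mono[OF le]) (rule ennreal_leI)
  then show ?thesis using f True by (simp add: Lp_norm_def esssup_AE_mono)
next
  case False
  show ?thesis
    by (rule Lp_norm_integral_mono[OF False], rule nn_integral_mono_AE, rule eventually_mono[OF le])
      (auto intro!: ennreal_leI powr_mono2)
qed

lemma Lp_norm_infinity_AE:
  assumes "Lp_norm \<infinity> f < \<infinity>"
  shows "AE x in lborel. \<bar>f x\<bar> \<le> enn2real (Lp_norm \<infinity> f)"
proof -
  have "AE x in lborel. ennreal \<bar>f x\<bar> \<le> Lp_norm \<infinity> f"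
    using esssup_AE[of "\<lambda>x. ennreal \<bar>f x\<bar>" lebesgue] by (simp add: Lp_norm_def AE_completion_iff)
  then show ?thesis
    by eventually_elim (use assms in \<open>auto dest: enn2real_mono\<close>)
qed

lemma Lp_norm_infinity_le:
  assumes "f \<in> borel_measurable lebesgue" "AE x in lborel. \<bar>f x\<bar> \<le> B"
  shows "Lp_norm \<infinity> f \<le> ennreal B"
proof -
  have "AE x in lebesgue. ennreal \<bar>f x\<bar> \<le> ennreal B"
    unfolding AE_completion_iff by (rule eventually_mono[OF assms(2)]) (rule ennreal_leI)
  then show ?thesis using assms(1) by (auto simp: Lp_norm_def)
qed

text \<open>\<open>Sobolev_W1\<close> speaks about components, the norm inequality about the length
  of the gradient. For finite exponents the largest component bounds the length up to the factor
  d.\<close>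

lemma Lp_norm_norm_finite:
  fixes g :: "'a::euclidean_space \<Rightarrow> 'a"
  assumes [measurable]: "g \<in> borel_measurable borel" and fin: "\<And>i. i \<in> Basis \<Longrightarrow> Lp_norm p (\<lambda>x. g x \<bullet> i) < \<infinity>"
  shows "Lp_norm p (\<lambda>x. norm (g x)) < \<infinity>"
proof (cases "p = \<infinity>")
  case True
  have "AE x in lborel. \<forall>i\<in>Basis. \<bar>g x \<bullet> i\<bar> \<le> enn2real (Lp_norm \<infinity> (\<lambda>x. g x \<bullet> i))"
    using fin True by (intro AE_finite_allI finite_Basis Lp_norm_infinity_AE) auto
  then have "AE x in lborel. \<bar>norm (g x)\<bar> \<le> (\<Sum>i\<in>Basis. enn2real (Lp_norm \<infinity> (\<lambda>x. g x \<bullet> i)))"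
    by eventually_elim (auto intro!: order_trans[OF norm_le_l1] sum_mono)
  then have "Lp_norm p (\<lambda>x. norm (g x)) \<le> ennreal (\<Sum>i\<in>Basis. enn2real (Lp_norm \<infinity> (\<lambda>x. g x \<bullet> i)))"
    unfolding True by (intro Lp_norm_infinity_le) (auto intro: measurable_completion)
  then show ?thesis by (rule order.strict_trans1) simp
next
  case False
  let ?q = "enn2real p" and ?d = "real DIM('a)"
  have "(\<integral>\<^sup>+x. ennreal (\<bar>norm (g x)\<bar> powr ?q) \<partial>lborel)
    \<le> (\<integral>\<^sup>+x. (\<Sum>i\<in>Basis. ennreal (?d powr ?q) * ennreal (\<bar>g x \<bullet> i\<bar> powr ?q)) \<partial>lborel)"
  proof (rule nn_integral_mono)
    fix x
    obtain j where j: "j \<in> Basis" "\<And>i. i \<in> Basis \<Longrightarrow> \<bar>g x \<bullet> i\<bar> \<le> \<bar>g x \<bullet> j\<bar>"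
    proof -
      have "Max ((\<lambda>i. \<bar>g x \<bullet> i\<bar>) ` Basis) \<in> (\<lambda>i. \<bar>g x \<bullet> i\<bar>) ` Basis" by (intro Max_in) auto
      then obtain j where "j \<in> Basis" "Max ((\<lambda>i. \<bar>g x \<bullet> i\<bar>) ` Basis) = \<bar>g x \<bullet> j\<bar>" by blast
      then show ?thesis using that[of j] Max_ge[of "(\<lambda>i. \<bar>g x \<bullet> i\<bar>) ` Basis"] by (metis finite_Basis finite_imageI imageI)
    qed
    have "norm (g x) \<le> ?d * \<bar>g x \<bullet> j\<bar>"
      using norm_le_l1[of "g x"] sum_bounded_above[of Basis "\<lambda>i. \<bar>g x \<bullet> i\<bar>" "\<bar>g x \<bullet> j\<bar>"] j by simp
    then have "\<bar>norm (g x)\<bar> powr ?q \<le> (?d * \<bar>g x \<bullet> j\<bar>) powr ?q" by (intro powr_mono2) auto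
    then have "ennreal (\<bar>norm (g x)\<bar> powr ?q) \<le> ennreal (?d powr ?q) * ennreal (\<bar>g x \<bullet> j\<bar> powr ?q)"
      by (simp add: powr_mult ennreal_mult[symmetric] ennreal_leI)
    also have "\<dots> \<le> (\<Sum>i\<in>Basis. ennreal (?d powr ?q) * ennreal (\<bar>g x \<bullet> i\<bar> powr ?q))"
      by (rule member_le_sum[OF j(1)]) auto
    finally show "ennreal (\<bar>norm (g x)\<bar> powr ?q) \<le> (\<Sum>i\<in>Basis. ennreal (?d powr ?q) * ennreal (\<bar>g x \<bullet> i\<bar> powr ?q))" .
  qed
  also have "\<dots> = (\<Sum>i\<in>Basis. ennreal (?d powr ?q) * (\<integral>\<^sup>+x. ennreal (\<bar>g x \<bullet> i\<bar> powr ?q) \<partial>lborel))"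
    by (subst nn_integral_sum) (auto simp: nn_integral_cmult)
  also have "\<dots> < \<infinity>"
    using fin[unfolded Lp_norm_finite_iff[OF False]] by (simp add: ennreal_mult_less_top)
  finally show ?thesis unfolding Lp_norm_finite_iff[OF False] .
qed

section \<open>Transfer to Sobolev functions and the chosen weak gradient\<close>

lemma heat_maximal_AE_eq:
  fixes u u' :: "'a::euclidean_space \<Rightarrow> real"
  assumes "AE x in lborel. u x = u' x" "u' \<in> borel_measurable borel"
  shows "heat_maximal u = heat_sup (\<lambda>x. ennreal \<bar>u' x\<bar>)"
proof (rule ext)
  fix x
  have "AE y in lborel. u (x - y) = u' (x - y)" by (rule AE_lborel_reflect[OF assms(1)])
  then have "heat_maximal u x = heat_maximal u' x"
    unfolding heat_maximal_def nn_convolution_def nn_integral_completion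
    by (intro SUP_cong refl nn_integral_cong_AE) (auto elim: eventually_mono)
  then show "heat_maximal u x = heat_sup (\<lambda>x. ennreal \<bar>u' x\<bar>) x"
    using heat_maximal_eq[OF assms(2), of x] by (simp add: heat_sup_def)
qed

lemma has_weak_gradient_weak_gradient: "has_weak_gradient u g \<Longrightarrow> has_weak_gradient u (weak_gradient u)"
  unfolding weak_gradient_def by (rule someI[where P="has_weak_gradient u"])

text \<open>The choice in \<open>weak_gradient\<close> is harmless: weak gradients are unique up to
  null sets, and \<open>Lp_norm\<close> does not see null sets.\<close>

lemma weak_grad_weak_gradient:
  fixes u :: "'a::euclidean_space \<Rightarrow> real"
  assumes wg: "weak_grad u g"
  shows "AE x in lborel. weak_gradient u x = g x" "weak_gradient u \<in> borel_measurable lebesgue"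
proof -
  have h: "has_weak_gradient u (weak_gradient u)"
    by (rule has_weak_gradient_weak_gradient[OF weak_grad_has_weak_gradient[OF wg]])
  then show "weak_gradient u \<in> borel_measurable lebesgue"
    by (auto simp: has_weak_gradient_def dest: locally_integrable_measurable)
  obtain g' where "AE x in lborel. weak_gradient u x = g' x" "weak_grad u g'"
  proof (rule has_weak_gradient_borel[OF h], goal_cases)
    case (1 g')
    show ?case using wg by (intro 1(1)[OF 1(3)] 1(4)) (auto simp: weak_grad_def dest: loc_int_measurable)
  qed
  then show "AE x in lborel. weak_gradient u x = g x"
    using weak_grad_unique[OF \<open>weak_grad u g'\<close> wg] by auto
qed

text \<open>Membership provides some gradient with components in L^p, while the norm to be compared
  belongs to the chosen one. Uniqueness identifies their Borel representatives.\<close>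

lemma Sobolev_W1_borel:
  fixes u :: "'a::euclidean_space \<Rightarrow> real"
  assumes u: "u \<in> Sobolev_W1 p"
  obtains u' g' where "AE x in lborel. u x = u' x" "weak_grad u' g'" "Lp_norm p u' < \<infinity>"
    "Lp_norm p (\<lambda>x. norm (g' x)) < \<infinity>" "Lp_norm p (\<lambda>x. norm (g' x)) \<le> Lp_norm p (\<lambda>x. norm (weak_gradient u x))"
proof -
  obtain g where g: "has_weak_gradient u g" "\<And>i. i \<in> Basis \<Longrightarrow> Lp_norm p (\<lambda>x. g x \<bullet> i) < \<infinity>"
    and um: "u \<in> borel_measurable lebesgue" and up: "Lp_norm p u < \<infinity>"
    using u by (auto simp: Sobolev_W1_def Lp_space_def)
  obtain u' where u': "u' \<in> borel_measurable borel" "AE x in lborel. u x = u' x"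
    using lebesgue_measurable_ex_borel[OF um] by blast
  obtain g1 where g1: "g1 \<in> borel_measurable borel" "AE x in lborel. g x = g1 x" "weak_grad u' g1"
  proof (rule has_weak_gradient_borel[OF g(1)], goal_cases)
    case (1 g')
    show ?case by (rule 1(1)[OF 1(2,3) 1(4)[OF u']])
  qed
  obtain g2 where g2: "g2 \<in> borel_measurable borel" "AE x in lborel. weak_gradient u x = g2 x" "weak_grad u' g2"
  proof (rule has_weak_gradient_borel[OF has_weak_gradient_weak_gradient[OF g(1)]], goal_cases)
    case (1 g')
    show ?case by (rule 1(1)[OF 1(2,3) 1(4)[OF u']])
  qed
  have g12: "AE x in lborel. g1 x = g2 x" by (rule weak_grad_unique[OF g1(3) g2(3)])
  have [measurable]: "g1 \<in> borel_measurable lebesgue" "u' \<in> borel_measurable lebesgue"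
    using g1(1) u'(1) by (auto intro: measurable_completion)
  have "Lp_norm p (\<lambda>x. g1 x \<bullet> i) \<le> Lp_norm p (\<lambda>x. g x \<bullet> i)" for i
    by (rule Lp_norm_AE_mono) (use g1(2) in \<open>auto elim!: eventually_mono\<close>)
  then have fin: "Lp_norm p (\<lambda>x. norm (g1 x)) < \<infinity>"
    using g(2) by (intro Lp_norm_norm_finite[OF g1(1)]) (auto intro: order.strict_trans1)
  have "Lp_norm p u' \<le> Lp_norm p u"
    by (rule Lp_norm_AE_mono) (use u'(2) in \<open>auto elim!: eventually_mono\<close>)
  then have u'p: "Lp_norm p u' < \<infinity>" using up by (rule order.strict_trans1)
  have "Lp_norm p (\<lambda>x. norm (g1 x)) \<le> Lp_norm p (\<lambda>x. norm (weak_gradient u x))"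
  proof (rule Lp_norm_AE_mono)
    show "AE x in lborel. \<bar>norm (g1 x)\<bar> \<le> \<bar>norm (weak_gradient u x)\<bar>" using g12 g2(2) by eventually_elim simp
  qed measurable
  then show ?thesis by (rule that[OF u'(2) g1(3) u'p fin])
qed

text \<open>Two exponents: \<open>p\<close> for the gradient and \<open>q\<close> for the maximal
  function itself. They differ only for p = 1 on the line, where the maximal function is bounded but
  not claimed to be integrable.\<close>

definition heat_sup_bound :: "ennreal \<Rightarrow> ennreal \<Rightarrow> ('a::euclidean_space \<Rightarrow> real) \<Rightarrow> ('a \<Rightarrow> 'a) \<Rightarrow> bool" where
  "heat_sup_bound p q u g \<longleftrightarrow> (let M = heat_sup (\<lambda>x. ennreal \<bar>u x\<bar>) in
    (AE x in lborel. M x < \<infinity>) \<and> Lp_norm q (enn2real \<circ> M) < \<infinity> \<and>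
    (\<exists>\<gamma>. weak_grad (enn2real \<circ> M) \<gamma> \<and> Lp_norm p (\<lambda>x. norm (\<gamma> x)) \<le> Lp_norm p (\<lambda>x. norm (g x))))"

text \<open>Every Sobolev case reduces to an estimate for Borel representatives, stated as the
  hypothesis \<open>step\<close>; representatives and choices of gradients are settled here
  once.\<close>

lemma heat_maximal_Sobolev_W1:
  fixes u :: "'a::euclidean_space \<Rightarrow> real"
  assumes u: "u \<in> Sobolev_W1 p"
    and step: "\<And>(u' :: 'a \<Rightarrow> real) g'. weak_grad u' g' \<Longrightarrow> Lp_norm p u' < \<infinity> \<Longrightarrow> Lp_norm p (\<lambda>x. norm (g' x)) < \<infinity> \<Longrightarrow>
      heat_sup_bound p q u' g'"
  shows "AE x in lebesgue. heat_maximal u x < \<infinity>"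
    and "enn2real \<circ> heat_maximal u \<in> Lp_space q"
    and "\<exists>g. has_weak_gradient (enn2real \<circ> heat_maximal u) g"
    and "Lp_norm p (\<lambda>x. norm (weak_gradient (enn2real \<circ> heat_maximal u) x)) \<le> Lp_norm p (\<lambda>x. norm (weak_gradient u x))"
    and "p = q \<Longrightarrow> enn2real \<circ> heat_maximal u \<in> Sobolev_W1 p"
proof -
  obtain u' g' where u': "AE x in lborel. u x = u' x" "weak_grad u' g'" "Lp_norm p u' < \<infinity>"
    "Lp_norm p (\<lambda>x. norm (g' x)) < \<infinity>" and le: "Lp_norm p (\<lambda>x. norm (g' x)) \<le> Lp_norm p (\<lambda>x. norm (weak_gradient u x))"
    using Sobolev_W1_borel[OF u] by blast
  have [measurable]: "u' \<in> borel_measurable borel" using u'(2) by (auto simp: weak_grad_def dest: loc_int_measurable)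
  let ?W = "enn2real \<circ> heat_maximal u"
  have M: "heat_maximal u = heat_sup (\<lambda>x. ennreal \<bar>u' x\<bar>)" by (rule heat_maximal_AE_eq[OF u'(1)]) simp
  obtain \<gamma> where fin: "AE x in lborel. heat_maximal u x < \<infinity>" and W: "Lp_norm q ?W < \<infinity>"
    and \<gamma>: "weak_grad ?W \<gamma>" "Lp_norm p (\<lambda>x. norm (\<gamma> x)) \<le> Lp_norm p (\<lambda>x. norm (g' x))"
    using step[OF u'(2-4)] unfolding heat_sup_bound_def Let_def M by blast
  show "AE x in lebesgue. heat_maximal u x < \<infinity>" using fin by (simp add: AE_completion_iff)
  have Wm: "?W \<in> borel_measurable lebesgue"
  proof (rule measurable_completion)
    show "?W \<in> borel_measurable lborel" using \<gamma>(1) by (simp add: weak_grad_def loc_int_measurable)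
  qed
  then show Wq: "?W \<in> Lp_space q" using W by (simp add: Lp_space_def)
  have h: "has_weak_gradient ?W \<gamma>" by (rule weak_grad_has_weak_gradient[OF \<gamma>(1)])
  then show "\<exists>g. has_weak_gradient ?W g" by blast
  note g = weak_grad_weak_gradient[OF \<gamma>(1)]
  have "Lp_norm p (\<lambda>x. norm (weak_gradient ?W x)) \<le> Lp_norm p (\<lambda>x. norm (\<gamma> x))"
  proof (rule Lp_norm_AE_mono)
    show "AE x in lborel. \<bar>norm (weak_gradient ?W x)\<bar> \<le> \<bar>norm (\<gamma> x)\<bar>" using g(1) by eventually_elim simp
  qed (use g(2) in measurable)
  also note \<gamma>(2)
  finally have le': "Lp_norm p (\<lambda>x. norm (weak_gradient ?W x)) \<le> Lp_norm p (\<lambda>x. norm (g' x))" .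
  then show "Lp_norm p (\<lambda>x. norm (weak_gradient ?W x)) \<le> Lp_norm p (\<lambda>x. norm (weak_gradient u x))"
    using le by (rule order_trans)
  have "(\<lambda>x. weak_gradient ?W x \<bullet> i) \<in> Lp_space p" if i: "i \<in> Basis" for i
  proof -
    have m: "(\<lambda>x. weak_gradient ?W x \<bullet> i) \<in> borel_measurable lebesgue" using g(2) by measurable
    have "Lp_norm p (\<lambda>x. weak_gradient ?W x \<bullet> i) \<le> Lp_norm p (\<lambda>x. norm (weak_gradient ?W x))"
      by (rule Lp_norm_AE_mono[OF m]) (auto intro!: Basis_le_norm i)
    also have "\<dots> < \<infinity>" using le' u'(4) by (rule order.strict_trans1)
    finally show ?thesis using m by (simp add: Lp_space_def)
  qed
  moreover assume "p = q"
  ultimately show "?W \<in> Sobolev_W1 p"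
    using Wq has_weak_gradient_weak_gradient[OF h] by (auto simp: Sobolev_W1_def)
qed

lemma heat_sup_bound_infinity:
  fixes u g :: "'a::euclidean_space \<Rightarrow> _"
  assumes wg: "weak_grad u g" and u: "Lp_norm \<infinity> u < \<infinity>" and g: "Lp_norm \<infinity> (\<lambda>x. norm (g x)) < \<infinity>"
  shows "heat_sup_bound \<infinity> \<infinity> u g"
proof -
  define M where "M = heat_sup (\<lambda>x. ennreal \<bar>u x\<bar>)"
  define B L where "B = enn2real (Lp_norm \<infinity> u)" and "L = enn2real (Lp_norm \<infinity> (\<lambda>x. norm (g x)))"
  have [measurable]: "u \<in> borel_measurable borel" using wg by (auto simp: weak_grad_def dest: loc_int_measurable)
  have B: "0 \<le> B" "AE x in lborel. \<bar>u x\<bar> \<le> B" unfolding B_def using Lp_norm_infinity_AE[OF u] by auto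
  have L: "0 \<le> L" "AE x in lborel. norm (g x) \<le> L" unfolding L_def using Lp_norm_infinity_AE[OF g] by auto
  obtain \<gamma> where M: "\<And>x. M x \<le> ennreal B" and \<gamma>: "weak_grad (\<lambda>x. enn2real (M x)) \<gamma>" "AE x in lborel. norm (\<gamma> x) \<le> L"
    unfolding M_def using heat_sup_W1_infinity[OF _ B wg L] by auto
  have m: "(\<lambda>x. norm (\<gamma> x)) \<in> borel_measurable lebesgue" "(\<lambda>x. enn2real (M x)) \<in> borel_measurable lebesgue"
    using \<gamma>(1) by (auto simp: weak_grad_def intro!: measurable_completion borel_measurable_norm dest: loc_int_measurable)
  have "Lp_norm \<infinity> (\<lambda>x. norm (\<gamma> x)) \<le> ennreal L" using Lp_norm_infinity_le[OF m(1), of L] \<gamma>(2) by simp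
  also have "ennreal L = Lp_norm \<infinity> (\<lambda>x. norm (g x))" using g by (simp add: L_def)
  finally have 1: "Lp_norm \<infinity> (\<lambda>x. norm (\<gamma> x)) \<le> Lp_norm \<infinity> (\<lambda>x. norm (g x))" .
  have "Lp_norm \<infinity> (\<lambda>x. enn2real (M x)) \<le> ennreal B"
    by (rule Lp_norm_infinity_le[OF m(2)]) (use M B(1) in \<open>auto intro: enn2real_leI\<close>)
  then have 2: "Lp_norm \<infinity> (\<lambda>x. enn2real (M x)) < \<infinity>" by (rule order.strict_trans1) simp
  have "M x < \<infinity>" for x using M[of x] by (rule order.strict_trans1) simp
  then show ?thesis using 1 2 \<gamma>(1) unfolding heat_sup_bound_def Let_def M_def[symmetric] comp_def by blast
qed

lemma heat_sup_bound_2: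
  fixes u g :: "'a::euclidean_space \<Rightarrow> _"
  assumes wg: "weak_grad u g" and u: "Lp_norm 2 u < \<infinity>" and g: "Lp_norm 2 (\<lambda>x. norm (g x)) < \<infinity>"
  shows "heat_sup_bound 2 2 u g"
proof -
  define M where "M = heat_sup (\<lambda>x. ennreal \<bar>u x\<bar>)"
  have [measurable]: "u \<in> borel_measurable borel" using wg by (auto simp: weak_grad_def dest: loc_int_measurable)
  have 2: "(2 :: ennreal) \<noteq> \<infinity>" "enn2real 2 = 2" by simp_all
  note fin = Lp_norm_finite_iff[OF 2(1), unfolded 2(2)] and mono = Lp_norm_integral_mono[OF 2(1), unfolded 2(2)]
  have up: "(\<integral>\<^sup>+x. ennreal (\<bar>u x\<bar> powr 2) \<partial>lborel) < \<infinity>" using u by (simp only: fin)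
  have M: "AE x in lborel. M x < \<infinity>" "Lp_norm 2 (enn2real \<circ> M) < \<infinity>"
    unfolding M_def fin using heat_sup_Lp[of "\<lambda>x. \<bar>u x\<bar>" 2] up by auto
  obtain \<gamma> where \<gamma>: "weak_grad (\<lambda>x. enn2real (M x)) \<gamma>"
    "(\<integral>\<^sup>+x. ennreal ((norm (\<gamma> x))\<^sup>2) \<partial>lborel) \<le> (\<integral>\<^sup>+x. ennreal ((norm (g x))\<^sup>2) \<partial>lborel)"
    unfolding M_def using heat_sup_W1_2[OF wg] up g[unfolded fin] by auto
  have "Lp_norm 2 (\<lambda>x. norm (\<gamma> x)) \<le> Lp_norm 2 (\<lambda>x. norm (g x))" by (rule mono) (use \<gamma>(2) in simp)
  then show ?thesis using M \<gamma>(1) unfolding heat_sup_bound_def Let_def M_def[symmetric] comp_def by blast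
qed

lemma heat_sup_bound_line:
  fixes u g :: "real \<Rightarrow> real"
  assumes wg: "weak_grad u g" and p: "1 \<le> p" and u: "Lp_norm p u < \<infinity>" and g: "Lp_norm p (\<lambda>x. norm (g x)) < \<infinity>"
  shows "heat_sup_bound p (if p = 1 then \<infinity> else p) u g"
proof (cases "p = \<infinity>")
  case True
  then show ?thesis using heat_sup_bound_infinity[OF wg] u g by simp
next
  case False
  define M where "M = heat_sup (\<lambda>x. ennreal \<bar>u x\<bar>)"
  define q where "q = (if p = 1 then \<infinity> else p)"
  have [measurable]: "u \<in> borel_measurable borel" using wg by (auto simp: weak_grad_def dest: loc_int_measurable)
  define r where "r = enn2real p"
  have pr: "p = ennreal r" using False by (simp add: r_def top.not_eq_extremum)
  have r: "1 \<le> r" using p unfolding pr by (metis ennreal_1 ennreal_le_iff2 not_one_le_zero)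
  note fin = Lp_norm_finite_iff[OF False, folded r_def] and mono = Lp_norm_integral_mono[OF False, folded r_def]
  have up: "(\<integral>\<^sup>+x. ennreal (\<bar>u x\<bar> powr r) \<partial>lborel) < \<infinity>" "(\<integral>\<^sup>+x. ennreal (\<bar>g x\<bar> powr r) \<partial>lborel) < \<infinity>"
    using u g unfolding fin by simp_all
  obtain \<gamma> where \<gamma>: "\<And>x. M x < \<infinity>" "weak_grad (\<lambda>x. enn2real (M x)) \<gamma>"
    "(\<integral>\<^sup>+x. ennreal (\<bar>\<gamma> x\<bar> powr r) \<partial>lborel) \<le> (\<integral>\<^sup>+x. ennreal (\<bar>g x\<bar> powr r) \<partial>lborel)"
    "r = 1 \<Longrightarrow> \<exists>B. \<forall>x. M x \<le> ennreal B"
    unfolding M_def using heat_sup_W1_line[OF wg r up] by auto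
  have "Lp_norm p (\<lambda>x. norm (\<gamma> x)) \<le> Lp_norm p (\<lambda>x. norm (g x))" by (rule mono) (use \<gamma>(3) in simp)
  moreover have "Lp_norm q (enn2real \<circ> M) < \<infinity>"
  proof (cases "p = 1")
    case True
    then have "r = 1" by (simp add: r_def)
    then obtain B where B: "\<And>x. M x \<le> ennreal B" using \<gamma>(4) by blast
    have "(\<lambda>x. enn2real (M x)) \<in> borel_measurable lebesgue"
      using \<gamma>(2) by (auto simp: weak_grad_def intro!: measurable_completion dest: loc_int_measurable)
    then have "Lp_norm \<infinity> (\<lambda>x. enn2real (M x)) \<le> ennreal (max B 0)"
      by (rule Lp_norm_infinity_le) (use B in \<open>auto intro!: enn2real_leI order_trans[OF B] ennreal_leI\<close>)
    then show ?thesis using True by (auto simp: q_def comp_def intro: order.strict_trans1)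
  next
    case p1: False
    then have "1 < r" using r pr by (cases "r = 1") auto
    then have "(\<integral>\<^sup>+x. ennreal (enn2real (M x) powr r) \<partial>lborel) < \<infinity>"
      unfolding M_def using up by (intro heat_sup_Lp(2)) auto
    then show ?thesis using p1 fin[of "enn2real \<circ> M"] by (simp add: q_def)
  qed
  ultimately show ?thesis using \<gamma>(1,2) unfolding heat_sup_bound_def Let_def M_def[symmetric] q_def[symmetric] comp_def by blast
qed

theorem theorem1:
  "(\<forall>(p::ennreal) (u\<^sub>0 :: real \<Rightarrow> real). 1 < p \<and> u\<^sub>0 \<in> Sobolev_W1 p \<longrightarrow>
      (AE x in lebesgue. heat_maximal u\<^sub>0 x < \<infinity>) \<and>
      enn2real \<circ> heat_maximal u\<^sub>0 \<in> Sobolev_W1 p \<and>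
      Lp_norm p (weak_gradient (enn2real \<circ> heat_maximal u\<^sub>0)) \<le> Lp_norm p (weak_gradient u\<^sub>0)) \<and>
   (\<forall>(u\<^sub>0 :: real \<Rightarrow> real). u\<^sub>0 \<in> Sobolev_W1 1 \<longrightarrow>
      (AE x in lebesgue. heat_maximal u\<^sub>0 x < \<infinity>) \<and>
      enn2real \<circ> heat_maximal u\<^sub>0 \<in> Lp_space \<infinity> \<and>
      (\<exists>g. has_weak_gradient (enn2real \<circ> heat_maximal u\<^sub>0) g) \<and>
      Lp_norm 1 (weak_gradient (enn2real \<circ> heat_maximal u\<^sub>0)) \<le> Lp_norm 1 (weak_gradient u\<^sub>0)) \<and>
   (\<forall>(u\<^sub>0 :: real \<Rightarrow> real). bounded_variation u\<^sub>0 \<longrightarrow>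
      (\<forall>x. heat_maximal u\<^sub>0 x < \<infinity>) \<and>
      bounded_variation (enn2real \<circ> heat_maximal u\<^sub>0) \<and>
      total_variation (enn2real \<circ> heat_maximal u\<^sub>0) \<le> total_variation u\<^sub>0) \<and>
   (\<forall>(p::ennreal) (u\<^sub>0 :: real ^ 'n \<Rightarrow> real).
      CARD('n) > 1 \<and> (p = 2 \<or> p = \<infinity>) \<and> u\<^sub>0 \<in> Sobolev_W1 p \<longrightarrow>
      (AE x in lebesgue. heat_maximal u\<^sub>0 x < \<infinity>) \<and>
      enn2real \<circ> heat_maximal u\<^sub>0 \<in> Sobolev_W1 p \<and>
      Lp_norm p (\<lambda>x. norm (weak_gradient (enn2real \<circ> heat_maximal u\<^sub>0) x))
        \<le> Lp_norm p (\<lambda>x. norm (weak_gradient u\<^sub>0 x)))"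
proof (intro conjI allI impI; (elim conjE)?)
  \<comment> \<open>On the line the gradient is a number and \<open>Lp_norm\<close> takes its
    absolute value anyway, which reconciles the two ways of writing the bound.\<close>
  have norm_real: "Lp_norm p (\<lambda>x. norm (f x)) = Lp_norm p f" for p and f :: "real \<Rightarrow> real"
    by (simp add: Lp_norm_def)
  {
    fix p :: ennreal and u :: "real \<Rightarrow> real"
    assume p: "1 < p" and u: "u \<in> Sobolev_W1 p"
    have step: "heat_sup_bound p p u' g'"
      if "weak_grad u' g'" "Lp_norm p u' < \<infinity>" "Lp_norm p (\<lambda>x. norm (g' x)) < \<infinity>" for u' g' :: "real \<Rightarrow> real"
      using heat_sup_bound_line[OF that(1) less_imp_le[OF p] that(2,3)] less_imp_neq[OF p] by simp
    note * = heat_maximal_Sobolev_W1[OF u step]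
    show "AE x in lebesgue. heat_maximal u x < \<infinity>" "enn2real \<circ> heat_maximal u \<in> Sobolev_W1 p"
      "Lp_norm p (weak_gradient (enn2real \<circ> heat_maximal u)) \<le> Lp_norm p (weak_gradient u)"
      using *(1,4) *(5)[OF _ _ _ refl] by (simp_all add: norm_real[unfolded real_norm_def])
  }
  {
    fix u :: "real \<Rightarrow> real"
    assume u: "u \<in> Sobolev_W1 1"
    have step: "heat_sup_bound 1 \<infinity> u' g'"
      if "weak_grad u' g'" "Lp_norm 1 u' < \<infinity>" "Lp_norm 1 (\<lambda>x. norm (g' x)) < \<infinity>" for u' g' :: "real \<Rightarrow> real"
      using heat_sup_bound_line[OF that(1) order_refl that(2,3)] by simp
    note * = heat_maximal_Sobolev_W1[OF u step]
    show "AE x in lebesgue. heat_maximal u x < \<infinity>" "enn2real \<circ> heat_maximal u \<in> Lp_space \<infinity>"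
      "\<exists>g. has_weak_gradient (enn2real \<circ> heat_maximal u) g"
      "Lp_norm 1 (weak_gradient (enn2real \<circ> heat_maximal u)) \<le> Lp_norm 1 (weak_gradient u)"
      using *(1-4) by (simp_all add: norm_real[unfolded real_norm_def])
  }
  {
    fix u :: "real \<Rightarrow> real" and x :: real
    assume bv: "bounded_variation u"
    have M: "heat_maximal u = heat_sup (\<lambda>x. ennreal \<bar>u x\<bar>)"
      by (rule heat_maximal_AE_eq) (use bounded_variation_borel_measurable[OF bv] in auto)
    show "heat_maximal u x < \<infinity>" unfolding M by (rule heat_sup_bounded_variation(1)[OF bv])
    show le: "total_variation (enn2real \<circ> heat_maximal u) \<le> total_variation u"
      unfolding M comp_def by (rule heat_sup_bounded_variation(2)[OF bv])
    show "bounded_variation (enn2real \<circ> heat_maximal u)"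
      using le bv unfolding bounded_variation_def by (rule order.strict_trans1)
  }
  {
    fix p :: ennreal and u :: "real ^ 'n \<Rightarrow> real"
    assume p: "p = 2 \<or> p = \<infinity>" and u: "u \<in> Sobolev_W1 p"
    have step: "heat_sup_bound p p u' g'"
      if "weak_grad u' g'" "Lp_norm p u' < \<infinity>" "Lp_norm p (\<lambda>x. norm (g' x)) < \<infinity>"
      for u' :: "real ^ 'n \<Rightarrow> real" and g' :: "real ^ 'n \<Rightarrow> real ^ 'n"
      using p heat_sup_bound_2[OF that(1)] heat_sup_bound_infinity[OF that(1)] that(2,3) by auto
    note * = heat_maximal_Sobolev_W1[OF u step]
    show "AE x in lebesgue. heat_maximal u x < \<infinity>" "enn2real \<circ> heat_maximal u \<in> Sobolev_W1 p"
      "Lp_norm p (\<lambda>x. norm (weak_gradient (enn2real \<circ> heat_maximal u) x)) \<le> Lp_norm p (\<lambda>x. norm (weak_gradient u x))"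
      using *(1,4) *(5)[OF _ _ _ refl] by simp_all
  }
qed

end
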